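(* Let $d\ge 1$ and $k\ge 1$ be integers, let $\Omega\subset\mathbb{R}^d$ be a bounded Lipschitz domain, and let $0<p\le 1$. Assume that either $$ s>k+\frac dp \quad\text{and}\quad 0<q\le\infty, $$ or $$ s=k+\frac dp \quad\text{and}\quad 0<q\le 1. $$ Then $B^s_{p,q}(\Omega)\hookrightarrow\mathcal{L}_1(\mathbb{D})$; that is, every $f\in B^s_{p,q}(\Omega)$ belongs to $\mathcal L_1(\mathbb D)$ and $\|f\|_{\mathcal L_1(\mathbb D)}\le C\|f\|_{B^s_{p,q}(\Omega)}$ with a constant $C$ independent of $f$.
   Context: All function spaces are real. Elements of the spaces below are identified as distributions in $\mathcal D'(\Omega)$. Dictionary and variation space. $\sigma_k(t):=\max\{t,0\}^k$, $\mathbb S^{d-1}:=\{\omega\in\mathbb R^d:|\omega|=1\}$, and $c>0$ is a fixed number with $-c<\inf_{x\in\Omega,\,\omega\in\mathbb S^{d-1}}\omega\cdot x<\sup_{x\in\Omega,\,\omega\in\mathbb S^{d-1}}\omega\cdot x<c$. The dictionary is the set of functions on $\Omega$ given by $\mathbb D:=\{\sigma_k(\omega\cdot x-b):\omega\in\mathbb S^{d-1},\ b\in[-c,c]\}$. Let $\mathcal K(\mathbb D)$ be the closure in $L^2(\Omega)$ of $\{\sum_{i=1}^N a_iv_i: N\ge 1,\ v_i\in\mathbb D,\ a_i\in\mathbb R,\ \sum_{i=1}^N|a_i|\le 1\}$. Then $\|f\|_{\mathcal L_1(\mathbb D)}:=\inf\{t>0:f\in t\mathcal K(\mathbb D)\}$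 and $\mathcal L_1(\mathbb D):=\{f\in L^2(\Omega):\|f\|_{\mathcal L_1(\mathbb D)}<\infty\}$. (Equivalently, $\|f\|_{\mathcal L_1(\mathbb D)}$ is the infimum of $\|\mu\|_{\mathrm{TV}}$ over finite signed Borel measures $\mu$ on $\mathbb S^{d-1}\times[-c,c]$ with $f(x)=\int\sigma_k(\omega\cdot x-b)\,\mathrm d\mu(\omega,b)$ on $\Omega$.) Besov spaces. Fix a radial, radially nonincreasing $\varphi_0\in C_c^\infty(\mathbb R^d)$ with $0\le\varphi_0\le1$, $\varphi_0(\xi)=1$ for $|\xi|\le1$, $\operatorname{supp}\varphi_0\subset\{|\xi|\le2\}$, and set $\varphi_j(\xi):=\varphi_0(2^{-j}\xi)-\varphi_0(2^{-j+1}\xi)$ for $j\ge1$. For $f\in\mathcal S'(\mathbb R^d)$ let $\Delta_jf:=(\varphi_j\widehat f)^\vee$. For $s>0$ and $0<p,q\le\infty$, $B^s_{p,q}(\mathbb R^d)$ consists of $f\in\mathcal S'(\mathbb R^d)$ with $\|f\|_{B^s_{p,q}(\mathbb R^d)}:=\big(\sum_{j\ge0}2^{jsq}\|\Delta_jf\|_{L^p(\mathbb R^d)}^q\big)^{1/q}<\infty$ (with $\sup_{j\ge0}2^{js}\|\Delta_jf\|_{L^p(\mathbb R^d)}$ if $q=\infty$). $B^s_{p,q}(\Omega)$ is the set of $f\in\mathcal D'(\Omega)$ with $f=f_e|_\Omega$ for some $f_e\in B^s_{p,q}(\mathbb R^d)$, with quasi-norm $\|f\|_{B^s_{p,q}(\Omega)}:=\inf\{\|f_e\|_{B^s_{p,q}(\mathbb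 R^d)}:f_e|_\Omega=f\}$. *)

theory Defs
  imports "HOL-Analysis.Analysis"
begin

section \<open>Smooth functions, test functions and Schwartz functions\<close>

definition partial_deriv ::
  "'n \<Rightarrow> (real^'n \<Rightarrow> 'b) \<Rightarrow> real^'n \<Rightarrow> 'b::real_normed_vector" where
  "partial_deriv i f x = frechet_derivative f (at x) (axis i 1)"

text \<open>Multi-indices are encoded as lists of coordinate directions; the order of differentiation
  does not matter for the smooth functions considered here.\<close>

definition iter_partial ::
  "'n list \<Rightarrow> (real^'n \<Rightarrow> 'b) \<Rightarrow> real^'n \<Rightarrow> 'b::real_normed_vector" where
  "iter_partial is f = foldr partial_deriv is f"

definition smooth :: "(real^'n \<Rightarrow> 'b::real_normed_vector) \<Rightarrow> bool" where
  "smooth f \<longleftrightarrow> (\<forall>is. iter_partial is f differentiable_on UNIV)"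

definition fun_support :: "(real^'n \<Rightarrow> 'b::zero) \<Rightarrow> (real^'n) set" where
  "fun_support f = closure {x. f x \<noteq> 0}"

definition test_functions :: "(real^'n) set \<Rightarrow> (real^'n \<Rightarrow> real) set" where
  "test_functions \<Omega> = {\<phi>. smooth \<phi> \<and> compact (fun_support \<phi>) \<and> fun_support \<phi> \<subseteq> \<Omega>}"

definition schwartz :: "(real^'n \<Rightarrow> 'b::real_normed_vector) set" where
  "schwartz = {\<phi>. smooth \<phi> \<and>
     (\<forall>N is. bounded (range (\<lambda>x. (1 + norm x) ^ N *\<^sub>R iter_partial is \<phi> x)))}"

definition schwartz_seminorm :: "nat \<Rightarrow> (real^'n \<Rightarrow> 'b::real_normed_vector) \<Rightarrow> real" where
  "schwartz_seminorm N \<phi> =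
     (\<Sum>is | length is \<le> N. SUP x. (1 + norm x) ^ N * norm (iter_partial is \<phi> x))"

definition CN_norm :: "nat \<Rightarrow> (real^'n \<Rightarrow> 'b::real_normed_vector) \<Rightarrow> real" where
  "CN_norm N \<phi> = (\<Sum>is | length is \<le> N. SUP x. norm (iter_partial is \<phi> x))"

section \<open>Real distributions\<close>

definition linear_functional_on ::
  "(real^'n \<Rightarrow> real) set \<Rightarrow> ((real^'n \<Rightarrow> real) \<Rightarrow> real) \<Rightarrow> bool" where
  "linear_functional_on V u \<longleftrightarrow>
     (\<forall>\<phi>\<in>V. \<forall>\<psi>\<in>V. \<forall>a b. u (\<lambda>x. a * \<phi> x + b * \<psi> x) = a * u \<phi> + b * u \<psi>)"

text \<open>Distributions are functionals on all functions that are \<open>undefined\<close> outside their space of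
  test functions, so that HOL equality is equality of distributions.\<close>

definition distributions :: "(real^'n) set \<Rightarrow> ((real^'n \<Rightarrow> real) \<Rightarrow> real) set" where
  "distributions \<Omega> = {u \<in> extensional (test_functions \<Omega>).
     linear_functional_on (test_functions \<Omega>) u \<and>
     (\<forall>K. compact K \<and> K \<subseteq> \<Omega> \<longrightarrow>
        (\<exists>C N. \<forall>\<phi>\<in>test_functions \<Omega>. fun_support \<phi> \<subseteq> K \<longrightarrow> \<bar>u \<phi>\<bar> \<le> C * CN_norm N \<phi>))}"

definition tempered_distributions :: "((real^'n \<Rightarrow> real) \<Rightarrow> real) set" where
  "tempered_distributions = {u \<in> extensional schwartz. linear_functional_on schwartz u \<and>
     (\<exists>C N. \<forall>\<phi>\<in>schwartz. \<bar>u \<phi>\<bar> \<le> C * schwartz_seminorm N \<phi>)}"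

definition restrict_distribution ::
  "(real^'n) set \<Rightarrow> ((real^'n \<Rightarrow> real) \<Rightarrow> real) \<Rightarrow> (real^'n \<Rightarrow> real) \<Rightarrow> real" where
  "restrict_distribution \<Omega> u = restrict u (test_functions \<Omega>)"

definition regular_distribution ::
  "(real^'n) set \<Rightarrow> (real^'n \<Rightarrow> real) \<Rightarrow> (real^'n \<Rightarrow> real) \<Rightarrow> real" where
  "regular_distribution \<Omega> g = restrict (\<lambda>\<phi>. LINT x:\<Omega>|lborel. g x * \<phi> x) (test_functions \<Omega>)"

section \<open>Fourier transform\<close>

definition fourier :: "(real^'n \<Rightarrow> complex) \<Rightarrow> real^'n \<Rightarrow> complex" where
  "fourier \<phi> \<xi> = (LINT x|lborel. cis (- (x \<bullet> \<xi>)) * \<phi> x)"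

definition inv_fourier :: "(real^'n \<Rightarrow> complex) \<Rightarrow> real^'n \<Rightarrow> complex" where
  "inv_fourier \<phi> x =
     complex_of_real (1 / (2 * pi) ^ CARD('n)) * (LINT \<xi>|lborel. cis (x \<bullet> \<xi>) * \<phi> \<xi>)"

text \<open>The Fourier transform of a real distribution is complex, so real distributions are first
  extended complex-linearly to complex-valued Schwartz functions.\<close>

definition complexify ::
  "((real^'n \<Rightarrow> real) \<Rightarrow> real) \<Rightarrow> (real^'n \<Rightarrow> complex) \<Rightarrow> complex" where
  "complexify u \<phi> = Complex (u (\<lambda>x. Re (\<phi> x))) (u (\<lambda>x. Im (\<phi> x)))"

definition fourier_dist ::
  "((real^'n \<Rightarrow> complex) \<Rightarrow> complex) \<Rightarrow> (real^'n \<Rightarrow> complex) \<Rightarrow> complex" where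
  "fourier_dist U \<phi> = U (fourier \<phi>)"

definition inv_fourier_dist ::
  "((real^'n \<Rightarrow> complex) \<Rightarrow> complex) \<Rightarrow> (real^'n \<Rightarrow> complex) \<Rightarrow> complex" where
  "inv_fourier_dist U \<phi> = U (inv_fourier \<phi>)"

definition mult_dist ::
  "(real^'n \<Rightarrow> real) \<Rightarrow> ((real^'n \<Rightarrow> complex) \<Rightarrow> complex) \<Rightarrow> (real^'n \<Rightarrow> complex) \<Rightarrow> complex" where
  "mult_dist m U \<phi> = U (\<lambda>\<xi>. complex_of_real (m \<xi>) * \<phi> \<xi>)"

section \<open>Besov spaces\<close>

definition LP_generator :: "(real^'n \<Rightarrow> real) \<Rightarrow> bool" where
  "LP_generator \<phi>0 \<longleftrightarrow>
     smooth \<phi>0 \<and> compact (fun_support \<phi>0) \<and> fun_support \<phi>0 \<subseteq> {\<xi>. norm \<xi> \<le> 2} \<and>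
     (\<forall>\<xi> \<eta>. norm \<xi> = norm \<eta> \<longrightarrow> \<phi>0 \<xi> = \<phi>0 \<eta>) \<and>
     (\<forall>\<xi> \<eta>. norm \<xi> \<le> norm \<eta> \<longrightarrow> \<phi>0 \<eta> \<le> \<phi>0 \<xi>) \<and>
     (\<forall>\<xi>. 0 \<le> \<phi>0 \<xi> \<and> \<phi>0 \<xi> \<le> 1) \<and>
     (\<forall>\<xi>. norm \<xi> \<le> 1 \<longrightarrow> \<phi>0 \<xi> = 1)"

definition LP_function :: "(real^'n \<Rightarrow> real) \<Rightarrow> nat \<Rightarrow> real^'n \<Rightarrow> real" where
  "LP_function \<phi>0 j \<xi> =
     (if j = 0 then \<phi>0 \<xi>
      else \<phi>0 ((2 powr (- real j)) *\<^sub>R \<xi>) - \<phi>0 ((2 powr (- real j + 1)) *\<^sub>R \<xi>))"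

definition LP_block ::
  "(real^'n \<Rightarrow> real) \<Rightarrow> nat \<Rightarrow> ((real^'n \<Rightarrow> real) \<Rightarrow> real) \<Rightarrow> (real^'n \<Rightarrow> complex) \<Rightarrow> complex" where
  "LP_block \<phi>0 j u =
     inv_fourier_dist (mult_dist (LP_function \<phi>0 j) (fourier_dist (complexify u)))"

text \<open>Powers of extended nonnegative numbers, intended for exponents \<open>r > 0\<close>.\<close>

definition ennreal_powr :: "ennreal \<Rightarrow> real \<Rightarrow> ennreal" where
  "ennreal_powr a r = (if a = \<infinity> then \<infinity> else ennreal (enn2real a powr r))"

definition Lp_norm :: "ennreal \<Rightarrow> (real^'n \<Rightarrow> complex) \<Rightarrow> ennreal" where
  "Lp_norm p g =
     (if p = \<infinity> then Inf {C. AE x in lborel. ennreal (norm (g x)) \<le> C}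
      else ennreal_powr (\<integral>\<^sup>+x. ennreal (norm (g x) powr enn2real p) \<partial>lborel) (1 / enn2real p))"

text \<open>The functional \<open>U\<close> is integration against \<open>g\<close>; such a \<open>g\<close> is unique almost everywhere.\<close>

definition represented_by ::
  "((real^'n \<Rightarrow> complex) \<Rightarrow> complex) \<Rightarrow> (real^'n \<Rightarrow> complex) \<Rightarrow> bool" where
  "represented_by U g \<longleftrightarrow> g \<in> borel_measurable lborel \<and>
     (\<forall>\<phi>\<in>schwartz. integrable lborel (\<lambda>x. g x * \<phi> x) \<and> U \<phi> = (LINT x|lborel. g x * \<phi> x))"

text \<open>The infimum only selects the representing function, and is \<open>\<infinity>\<close> if there is none.
  Littlewood-Paley blocks of tempered distributions always have one (Paley-Wiener-Schwartz).\<close>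

definition dist_Lp_norm :: "ennreal \<Rightarrow> ((real^'n \<Rightarrow> complex) \<Rightarrow> complex) \<Rightarrow> ennreal" where
  "dist_Lp_norm p U = (INF g\<in>{g. represented_by U g}. Lp_norm p g)"

definition besov_norm ::
  "(real^'n \<Rightarrow> real) \<Rightarrow> real \<Rightarrow> ennreal \<Rightarrow> ennreal \<Rightarrow> ((real^'n \<Rightarrow> real) \<Rightarrow> real) \<Rightarrow> ennreal" where
  "besov_norm \<phi>0 s p q f =
     (if q = \<infinity> then (SUP j. ennreal (2 powr (real j * s)) * dist_Lp_norm p (LP_block \<phi>0 j f))
      else ennreal_powr
        (\<Sum>j. ennreal (2 powr (real j * s * enn2real q)) *
              ennreal_powr (dist_Lp_norm p (LP_block \<phi>0 j f)) (enn2real q))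
        (1 / enn2real q))"

definition besov_space ::
  "(real^'n \<Rightarrow> real) \<Rightarrow> real \<Rightarrow> ennreal \<Rightarrow> ennreal \<Rightarrow> ((real^'n \<Rightarrow> real) \<Rightarrow> real) set" where
  "besov_space \<phi>0 s p q = {f \<in> tempered_distributions. besov_norm \<phi>0 s p q f < \<infinity>}"

definition besov_space_on ::
  "(real^'n \<Rightarrow> real) \<Rightarrow> real \<Rightarrow> ennreal \<Rightarrow> ennreal \<Rightarrow> (real^'n) set \<Rightarrow> ((real^'n \<Rightarrow> real) \<Rightarrow> real) set"
  where
  "besov_space_on \<phi>0 s p q \<Omega> =
     {f \<in> distributions \<Omega>. \<exists>fe\<in>besov_space \<phi>0 s p q. restrict_distribution \<Omega> fe = f}"

definition besov_norm_on ::
  "(real^'n \<Rightarrow> real) \<Rightarrow> real \<Rightarrow> ennreal \<Rightarrow> ennreal \<Rightarrow> (real^'n) set \<Rightarrow>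
     ((real^'n \<Rightarrow> real) \<Rightarrow> real) \<Rightarrow> ennreal" where
  "besov_norm_on \<phi>0 s p q \<Omega> f =
     (INF fe\<in>{fe \<in> besov_space \<phi>0 s p q. restrict_distribution \<Omega> fe = f}. besov_norm \<phi>0 s p q fe)"

section \<open>Lipschitz domains\<close>

text \<open>Near each boundary point, \<open>\<Omega>\<close> is the strict epigraph, in some unit direction \<open>\<nu>\<close>, of a
  Lipschitz function on the hyperplane orthogonal to \<open>\<nu>\<close>.\<close>

definition bounded_lipschitz_domain :: "(real^'n) set \<Rightarrow> bool" where
  "bounded_lipschitz_domain \<Omega> \<longleftrightarrow>
     open \<Omega> \<and> connected \<Omega> \<and> \<Omega> \<noteq> {} \<and> bounded \<Omega> \<and>
     (\<forall>x\<in>frontier \<Omega>. \<exists>r>0. \<exists>\<nu> \<gamma> L. norm \<nu> = 1 \<and> L-lipschitz_on {z. \<nu> \<bullet> z = 0} \<gamma> \<and>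
        \<Omega> \<inter> ball x r = {y \<in> ball x r. \<gamma> (y - (\<nu> \<bullet> y) *\<^sub>R \<nu>) < \<nu> \<bullet> y})"

section \<open>The ReLU dictionary and its variation space\<close>

definition relu_power :: "nat \<Rightarrow> real \<Rightarrow> real" where
  "relu_power k t = max t 0 ^ k"

definition dictionary :: "nat \<Rightarrow> real \<Rightarrow> (real^'n \<Rightarrow> real) set" where
  "dictionary k c = {\<lambda>x. relu_power k (\<omega> \<bullet> x - b) | \<omega> b. norm \<omega> = 1 \<and> b \<in> {-c..c}}"

text \<open>Elements of \<open>L2 \<Omega>\<close> are functions rather than almost-everywhere classes, and their values
  outside \<open>\<Omega>\<close> are irrelevant; the hull below is closed under almost-everywhere equality on \<open>\<Omega>\<close>.\<close>

definition L2 :: "(real^'n) set \<Rightarrow> (real^'n \<Rightarrow> real) set" where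
  "L2 \<Omega> = {g. set_borel_measurable lborel \<Omega> g \<and> set_integrable lborel \<Omega> (\<lambda>x. (g x)\<^sup>2)}"

definition L2_norm_on :: "(real^'n) set \<Rightarrow> (real^'n \<Rightarrow> real) \<Rightarrow> real" where
  "L2_norm_on \<Omega> g = sqrt (LINT x:\<Omega>|lborel. (g x)\<^sup>2)"

definition abs_convex_combinations :: "(real^'n \<Rightarrow> real) set \<Rightarrow> (real^'n \<Rightarrow> real) set" where
  "abs_convex_combinations D =
     {\<lambda>x. \<Sum>i=1..N. a i * v i x | N a v.
        N \<ge> (1::nat) \<and> (\<forall>i\<in>{1..N}. v i \<in> D) \<and> (\<Sum>i=1..N. \<bar>a i\<bar>) \<le> 1}"

definition closed_hull :: "(real^'n) set \<Rightarrow> (real^'n \<Rightarrow> real) set \<Rightarrow> (real^'n \<Rightarrow> real) set" where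
  "closed_hull \<Omega> D =
     {g \<in> L2 \<Omega>. \<forall>\<epsilon>>0. \<exists>h\<in>abs_convex_combinations D. L2_norm_on \<Omega> (\<lambda>x. g x - h x) < \<epsilon>}"

definition variation_norm ::
  "(real^'n) set \<Rightarrow> (real^'n \<Rightarrow> real) set \<Rightarrow> (real^'n \<Rightarrow> real) \<Rightarrow> ennreal" where
  "variation_norm \<Omega> D g =
     Inf {ennreal t | t. t > 0 \<and> g \<in> (\<lambda>h x. t * h x) ` closed_hull \<Omega> D}"

definition variation_space ::
  "(real^'n) set \<Rightarrow> (real^'n \<Rightarrow> real) set \<Rightarrow> (real^'n \<Rightarrow> real) set" where
  "variation_space \<Omega> D = {g \<in> L2 \<Omega>. variation_norm \<Omega> D g < \<infinity>}"

end

theory Submission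
  imports Defs "HOL-Probability.Probability" "HOL-Computational_Algebra.Polynomial"
begin

text \<open>The Littlewood--Paley blocks \<open>r\<^sub>j\<close> of a Besov distribution reproduce themselves under
  convolution with a Schwartz kernel \<open>K\<close> dilated to scale \<open>R = 2\<^sup>j\<^sup>+\<^sup>1\<close>. It therefore suffices to bound the
  variation norm of one translate \<open>K (R (x - y))\<close> by a multiple of \<open>R\<^sup>k\<close>: superposition over \<open>y\<close> costs
  \<open>R\<^sup>d\<^sup>+\<^sup>k\<close> times the \<open>L\<^sup>1\<close> norm of \<open>r\<^sub>j\<close>, and Nikolskii's inequality trades that norm for the \<open>L\<^sup>p\<close> norm at
  the price \<open>d/p - d\<close> in the smoothness, which leaves \<open>k + d/p\<close>.

  For the kernel bound, Fourier inversion is averaged over dilations \<open>r \<in> [1, 2]\<close> of the frequency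
  variable. Integrating by parts twice in \<open>r\<close> shows that the resulting ridge profiles and their
  derivatives decay like \<open>1 / (1 + t\<^sup>2)\<close>, so the derivative of order \<open>k + 1\<close> of a profile at frequency \<open>R\<close> has
  integral of size \<open>R\<^sup>k\<close>. Taylor's formula at \<open>-c\<close> with integral remainder writes the profile as a
  superposition of truncated powers plus a polynomial of degree \<open>k\<close>, and such a polynomial is a linear
  combination of \<open>k + 1\<close> truncated powers whose breakpoints lie to the left of the domain.\<close>

text \<open>A plane wave of frequency length \<kappa> has no decay, so its derivative of order
  \<open>k + 1\<close> costs \<kappa>^(k+1) on \<open>{-c..c}\<close>, one power too many for the
  endpoint s = k + d/p. Averaging over r concentrates the profile near a hyperplane at scale
  1/\<kappa>, and integrating across that layer wins the lost power back.

  The Nikolskii argument divides by a power of a supremum and is void while that supremum may be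
  infinite. A block is at first only a functional with a representing function in L^p, p \<le> 1;
  its polynomial growth has to be extracted from the mere integrability against every Schwartz
  function, and the supremum is then taken with a weight that is removed at the end.

  Superpositions are never treated as measures. They are uniform limits on \<Omega> of finite
  combinations with bounded coefficient sum (\<open>approx_hull\<close>), a notion stable under
  integrals and series; boundedness of \<Omega> turns it into closeness in L^2.\<close>

section \<open>Smooth functions and test functions\<close>

text \<open>Dividing a remainder of order two by \<open>norm h\<close> leaves
  \<open>B * norm h\<close>, which tends to 0. All derivatives of parameter integrals below are
  obtained in this quantitative form.\<close>

lemma has_derivative_quadratic:
  fixes f :: "'a::real_normed_vector \<Rightarrow> 'b::real_normed_vector"
  assumes L: "bounded_linear L"
    and bound: "\<And>h. norm h \<le> 1 \<Longrightarrow> norm (f (x + h) - f x - L h) \<le> B * (norm h)\<^sup>2"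
  shows "(f has_derivative L) (at x)"
  unfolding has_derivative_at
proof (intro conjI L)
  have "(\<lambda>h. norm (f (x + h) - f x - L h) / norm h) \<midarrow>0\<rightarrow> 0"
  proof (rule Lim_null_comparison)
    show "\<forall>\<^sub>F h in at 0. norm (norm (f (x + h) - f x - L h) / norm h) \<le> \<bar>B\<bar> * norm h"
    proof (rule eventually_mono)
      show "\<forall>\<^sub>F h in at 0. norm h \<le> (1::real)"
        unfolding eventually_at by (auto intro!: exI[of _ 1] simp: dist_norm)
      fix h :: 'a assume h: "norm h \<le> 1"
      show "norm (norm (f (x + h) - f x - L h) / norm h) \<le> \<bar>B\<bar> * norm h"
      proof (cases "h = 0")
        case False
        have "norm (f (x + h) - f x - L h) \<le> \<bar>B\<bar> * (norm h)\<^sup>2"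
          using bound[OF h] by (smt (verit) mult_right_mono zero_le_power2)
        then show ?thesis
          using False by (simp add: divide_simps power2_eq_square mult.assoc)
      qed simp
    qed
    show "(\<lambda>h. \<bar>B\<bar> * norm h) \<midarrow>0\<rightarrow> 0"
      by (auto intro!: tendsto_eq_intros)
  qed
  then show "(\<lambda>h. norm (f (x + h) - f x - L h) / norm h) \<midarrow>0\<rightarrow> 0" .
qed

lemma bounded_linear_coords: "bounded_linear (\<lambda>h::real^'n. \<Sum>i\<in>UNIV. h $ i * c i)"
  for c :: "'n::finite \<Rightarrow> real"
  by (intro bounded_linear_sum bounded_linear_mult_const bounded_linear_vec_nth)

text \<open>Differentiation under the integral sign by integrating the second-order remainder: its
  integrable factor \<open>b\<close> becomes the constant of
  \<open>has_derivative_quadratic\<close>. The measure is arbitrary because the lemma serves both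
  Lebesgue integrals and series, the latter as integrals over counting measure.\<close>

lemma has_derivative_integral_quadratic:
  fixes g :: "real^'n \<Rightarrow> 'a \<Rightarrow> real"
  assumes b: "integrable M b" and g: "\<And>y. integrable M (g y)" and g': "\<And>i. integrable M (g' i)"
    and bound: "\<And>h w. w \<in> space M \<Longrightarrow> norm h \<le> 1 \<Longrightarrow>
      \<bar>g (x + h) w - g x w - (\<Sum>i\<in>UNIV. h $ i * g' i w)\<bar> \<le> b w * (norm h)\<^sup>2"
  shows "((\<lambda>x. LINT w|M. g x w) has_derivative (\<lambda>h. \<Sum>i\<in>UNIV. h $ i * (LINT w|M. g' i w))) (at x)"
proof (rule has_derivative_quadratic[where B="LINT w|M. b w"])
  fix h :: "real^'n" assume h: "norm h \<le> 1"
  have i: "integrable M (\<lambda>w. g (x + h) w - g x w - (\<Sum>i\<in>UNIV. h $ i * g' i w))"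
    by (intro Bochner_Integration.integrable_diff Bochner_Integration.integrable_sum
        integrable_mult_right g g')
  have "(LINT w|M. g (x + h) w) - (LINT w|M. g x w) - (\<Sum>i\<in>UNIV. h $ i * (LINT w|M. g' i w))
      = (LINT w|M. g (x + h) w - g x w - (\<Sum>i\<in>UNIV. h $ i * g' i w))"
    using g g' by (simp add: Bochner_Integration.integral_diff Bochner_Integration.integral_sum)
  also have "norm \<dots> \<le> (LINT w|M. norm (g (x + h) w - g x w - (\<Sum>i\<in>UNIV. h $ i * g' i w)))"
    by (rule integral_norm_bound)
  also have "\<dots> \<le> (LINT w|M. b w * (norm h)\<^sup>2)"
    using bound h i b by (intro integral_mono) auto
  finally show "norm ((LINT w|M. g (x + h) w) - (LINT w|M. g x w) -
      (\<Sum>i\<in>UNIV. h $ i * (LINT w|M. g' i w))) \<le> (LINT w|M. b w) * (norm h)\<^sup>2"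
    by simp
qed (rule bounded_linear_coords)

lemma partial_deriv_has_derivative:
  "(f has_derivative D) (at x) \<Longrightarrow> partial_deriv i f x = D (axis i 1)"
  unfolding partial_deriv_def by (metis frechet_derivative_at)

lemma partial_deriv_coords:
  fixes c :: "'n::finite \<Rightarrow> real"
  assumes "(f has_derivative (\<lambda>h. \<Sum>i\<in>UNIV. h $ i * c i)) (at x)"
  shows "partial_deriv i f x = c i"
  using partial_deriv_has_derivative[OF assms, of i]
  by (simp add: axis_def if_distrib[of "\<lambda>x. x * _"] cong: if_cong)

lemma has_derivative_partials:
  fixes f :: "real^'n \<Rightarrow> real"
  assumes "f differentiable (at x)"
  shows "(f has_derivative (\<lambda>h. \<Sum>i\<in>UNIV. h $ i * partial_deriv i f x)) (at x)"
proof -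
  from assms have d: "(f has_derivative frechet_derivative f (at x)) (at x)"
    by (simp add: frechet_derivative_works)
  have "frechet_derivative f (at x) h = (\<Sum>i\<in>UNIV. h $ i * partial_deriv i f x)" for h
  proof -
    have l: "linear (frechet_derivative f (at x))"
      using d has_derivative_linear by blast
    have "h = (\<Sum>i\<in>UNIV. (h $ i) *\<^sub>R axis i 1)"
      by (simp add: vec_eq_iff axis_def if_distrib[of "\<lambda>x. _ * x"] cong: if_cong)
    then have "frechet_derivative f (at x) h = frechet_derivative f (at x) (\<Sum>i\<in>UNIV. (h $ i) *\<^sub>R axis i 1)"
      by simp
    also have "\<dots> = (\<Sum>i\<in>UNIV. h $ i * partial_deriv i f x)"
      by (simp add: linear_sum[OF l] linear_scale[OF l] partial_deriv_def)
    finally show ?thesis .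
  qed
  then have "frechet_derivative f (at x) = (\<lambda>h. \<Sum>i\<in>UNIV. h $ i * partial_deriv i f x)" by auto
  with d show ?thesis by simp
qed

lemma iter_partial_Nil [simp]: "iter_partial [] f = f"
  and iter_partial_Cons [simp]: "iter_partial (i # is) f = partial_deriv i (iter_partial is f)"
  by (simp_all add: iter_partial_def)

lemma iter_partial_append: "iter_partial (is @ js) f = iter_partial is (iter_partial js f)"
  by (simp add: iter_partial_def)

text \<open>Coinductive access to smoothness: \<open>A\<close> is an invariant under
  differentiation, so no formula for iterated derivatives has to be found.\<close>

lemma smooth_closedI:
  assumes "f \<in> A" and "\<And>g. g \<in> A \<Longrightarrow> g differentiable_on UNIV"
    and "\<And>g i. g \<in> A \<Longrightarrow> partial_deriv i g \<in> A"
  shows "smooth f"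
proof -
  have "iter_partial is f \<in> A" for "is"
    by (induction "is") (use assms in auto)
  then show ?thesis using assms(2) by (auto simp: smooth_def)
qed

lemma smooth_iter_partial: "smooth f \<Longrightarrow> smooth (iter_partial js f)"
  unfolding smooth_def by (metis iter_partial_append)

lemma smooth_partial_deriv: "smooth f \<Longrightarrow> smooth (partial_deriv i f)"
  using smooth_iter_partial[of f "[i]"] by simp

lemma smooth_differentiable: "smooth f \<Longrightarrow> f differentiable (at x)"
  unfolding smooth_def by (metis UNIV_I differentiable_on_def iter_partial_Nil)

lemma smooth_continuous: "smooth f \<Longrightarrow> continuous_on UNIV f"
  by (simp add: continuous_at_imp_continuous_on differentiable_imp_continuous_within smooth_differentiable)

lemmas smooth_has_derivative = has_derivative_partials[OF smooth_differentiable]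

lemma partial_deriv_scale_add:
  fixes f g :: "real^'n \<Rightarrow> real"
  assumes "f differentiable (at x)" "g differentiable (at x)"
  shows "partial_deriv i (\<lambda>x. a * f x + b * g x) x = a * partial_deriv i f x + b * partial_deriv i g x"
proof (rule partial_deriv_coords)
  show "((\<lambda>x. a * f x + b * g x) has_derivative
     (\<lambda>h. \<Sum>i\<in>UNIV. h $ i * (a * partial_deriv i f x + b * partial_deriv i g x))) (at x)"
    by (rule has_derivative_eq_rhs, (rule derivative_intros has_derivative_partials assms)+)
       (simp add: sum_distrib_left algebra_simps sum.distrib)
qed

lemma iter_partial_scale_add:
  fixes f g :: "real^'n \<Rightarrow> real"
  assumes "smooth f" "smooth g"
  shows "iter_partial is (\<lambda>x. a * f x + b * g x) = (\<lambda>x. a * iter_partial is f x + b * iter_partial is g x)"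
proof (induction "is")
  case (Cons i "is")
  show ?case
    by (auto simp: Cons fun_eq_iff intro!: partial_deriv_scale_add smooth_differentiable smooth_iter_partial assms)
qed simp

lemma smooth_scale_add:
  fixes f g :: "real^'n \<Rightarrow> real"
  assumes "smooth f" "smooth g"
  shows "smooth (\<lambda>x. a * f x + b * g x)"
  using assms unfolding smooth_def iter_partial_scale_add[OF assms]
  by (auto simp: differentiable_on_def intro!: derivative_intros)

lemma partial_deriv_affine:
  fixes f :: "real^'n \<Rightarrow> real"
  assumes "smooth f"
  shows "partial_deriv i (\<lambda>x. f (a + c *\<^sub>R x)) x = c * partial_deriv i f (a + c *\<^sub>R x)"
    and "(\<lambda>x. f (a + c *\<^sub>R x)) differentiable (at x)"
proof -
  have "((\<lambda>x. a + c *\<^sub>R x) has_derivative (\<lambda>h. c *\<^sub>R h)) (at x)"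
    by (auto intro!: derivative_eq_intros)
  from diff_chain_at[OF this smooth_has_derivative[OF assms]]
  have d: "((\<lambda>x. f (a + c *\<^sub>R x)) has_derivative (\<lambda>h. \<Sum>i\<in>UNIV. h $ i * (c * partial_deriv i f (a + c *\<^sub>R x)))) (at x)"
    by (simp add: o_def mult_ac)
  from partial_deriv_coords[OF this]
  show "partial_deriv i (\<lambda>x. f (a + c *\<^sub>R x)) x = c * partial_deriv i f (a + c *\<^sub>R x)" .
  from d show "(\<lambda>x. f (a + c *\<^sub>R x)) differentiable (at x)"
    by (auto simp: differentiable_def)
qed

lemma partial_deriv_cmult:
  fixes f :: "real^'n \<Rightarrow> real"
  assumes "f differentiable (at x)"
  shows "partial_deriv i (\<lambda>x. a * f x) x = a * partial_deriv i f x"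
  using partial_deriv_scale_add[OF assms assms, of i a 0] by simp

lemma iter_partial_affine:
  fixes f :: "real^'n \<Rightarrow> real"
  assumes "smooth f"
  shows "iter_partial is (\<lambda>x. f (a + c *\<^sub>R x)) = (\<lambda>x. c ^ length is * iter_partial is f (a + c *\<^sub>R x))"
proof (induction "is")
  case (Cons i "is")
  have s: "smooth (iter_partial is f)" by (simp add: assms smooth_iter_partial)
  show ?case
    by (simp add: Cons fun_eq_iff partial_deriv_cmult partial_deriv_affine[OF s] mult_ac)
qed simp

lemma smooth_affine:
  fixes f :: "real^'n \<Rightarrow> real"
  assumes "smooth f"
  shows "smooth (\<lambda>x. f (a + c *\<^sub>R x))"
  unfolding smooth_def iter_partial_affine[OF assms]
  by (auto simp: differentiable_on_def intro!: derivative_intros differentiable_at_withinI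
      partial_deriv_affine(2) smooth_iter_partial assms)

lemma smooth_zero: "smooth (\<lambda>x::real^'n. 0::real)"
  by (rule smooth_closedI[of _ "{\<lambda>x. 0}"]) (auto simp: partial_deriv_def)

lemma partial_deriv_coord_mult:
  fixes f :: "real^'n \<Rightarrow> real"
  assumes "f differentiable (at x)"
  shows "partial_deriv i (\<lambda>x. x $ j * f x) x = x $ j * partial_deriv i f x + (if i = j then f x else 0)"
proof -
  have "((\<lambda>x. x $ j * f x) has_derivative (\<lambda>h. x $ j * (\<Sum>i\<in>UNIV. h $ i * partial_deriv i f x) + h $ j * f x)) (at x)"
    by (rule derivative_intros has_derivative_partials assms bounded_linear_imp_has_derivative bounded_linear_vec_nth)+
  then have "((\<lambda>x. x $ j * f x) has_derivative (\<lambda>h. \<Sum>i\<in>UNIV. h $ i * (x $ j * partial_deriv i f x + (if i = j then f x else 0)))) (at x)"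
    by (rule has_derivative_eq_rhs)
       (simp add: fun_eq_iff distrib_left sum.distrib sum_distrib_left mult_ac if_distrib[of "\<lambda>x. _ * x"] cong: if_cong)
  from partial_deriv_coords[OF this] show ?thesis .
qed

text \<open>The functions \<open>x $ j * u x + v x\<close> form an invariant class: the product rule
  turns \<open>x $ j * u x\<close> into \<open>x $ j * partial_deriv i u x\<close> plus at most a
  copy of \<open>u\<close>, which the summand \<open>v\<close> absorbs.\<close>

lemma smooth_coord_mult:
  fixes f :: "real^'n \<Rightarrow> real"
  assumes "smooth f"
  shows "smooth (\<lambda>x. x $ j * f x)"
proof (rule smooth_closedI[where A="{\<lambda>x. x $ j * u x + v x | u v. smooth u \<and> smooth v}"])
  show "(\<lambda>x. x $ j * f x) \<in> {\<lambda>x. x $ j * u x + v x | u v. smooth u \<and> smooth v}"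
    using assms smooth_zero by (intro CollectI exI[of _ f] exI[of _ "\<lambda>x. 0"]) simp
next
  fix g :: "real^'n \<Rightarrow> real" and i
  assume "g \<in> {\<lambda>x. x $ j * u x + v x | u v. smooth u \<and> smooth v}"
  then obtain u v where g: "g = (\<lambda>x. x $ j * u x + v x)" and u: "smooth u" and v: "smooth v" by auto
  have d: "(\<lambda>x. x $ j * u x) differentiable (at x)" for x
    by (intro derivative_intros smooth_differentiable u bounded_linear_imp_differentiable bounded_linear_vec_nth)
  show "g differentiable_on UNIV"
    using differentiable_add[OF d smooth_differentiable[OF v]]
    by (simp add: g differentiable_on_def differentiable_at_withinI)
  have "partial_deriv i g = (\<lambda>x. x $ j * partial_deriv i u x + (1 * partial_deriv i v x + (if i = j then 1 else 0) * u x))"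
  proof
    fix x
    show "partial_deriv i g x = x $ j * partial_deriv i u x + (1 * partial_deriv i v x + (if i = j then 1 else 0) * u x)"
      using partial_deriv_scale_add[OF d smooth_differentiable[OF v], where a=1 and b=1 and i=i]
      by (simp add: g partial_deriv_coord_mult smooth_differentiable[OF u])
  qed
  moreover have "smooth (\<lambda>x. 1 * partial_deriv i v x + (if i = j then 1 else 0) * u x)"
    by (intro smooth_scale_add smooth_partial_deriv u v)
  ultimately show "partial_deriv i g \<in> {\<lambda>x. x $ j * u x + v x | u v. smooth u \<and> smooth v}"
    using smooth_partial_deriv[OF u, of i]
    by (intro CollectI exI[of _ "partial_deriv i u"]
        exI[of _ "\<lambda>x. 1 * partial_deriv i v x + (if i = j then 1 else 0) * u x"]) auto
qed

lemma abs_coord_sum_le: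
  fixes h :: "real^'n"
  assumes "\<And>i. \<bar>c i\<bar> \<le> B"
  shows "\<bar>\<Sum>i\<in>UNIV. h $ i * c i\<bar> \<le> real CARD('n) * B * norm h"
proof -
  have "\<bar>\<Sum>i\<in>UNIV. h $ i * c i\<bar> \<le> (\<Sum>i\<in>(UNIV::'n set). norm h * B)"
    by (intro order_trans[OF sum_abs] sum_mono) (auto simp: abs_mult intro!: mult_mono component_le_norm_cart assms)
  then show ?thesis by (simp add: mult_ac)
qed

lemma smooth_lipschitz:
  fixes f :: "real^'n \<Rightarrow> real"
  assumes f: "smooth f" and B: "\<And>i x. \<bar>partial_deriv i f x\<bar> \<le> B"
  shows "\<bar>f x - f y\<bar> \<le> real CARD('n) * B * norm (x - y)"
proof -
  have "norm (f x - f y) \<le> (real CARD('n) * B) * norm (x - y)"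
  proof (rule differentiable_bound[where S=UNIV])
    fix x :: "real^'n"
    show "(f has_derivative (\<lambda>h. \<Sum>i\<in>UNIV. h $ i * partial_deriv i f x)) (at x within UNIV)"
      using smooth_has_derivative[OF f] by simp
    show "onorm (\<lambda>h. \<Sum>i\<in>UNIV. h $ i * partial_deriv i f x) \<le> real CARD('n) * B"
      by (rule onorm_le) (simp add: abs_coord_sum_le[OF B])
  qed auto
  then show ?thesis by simp
qed

text \<open>Mean value inequality for \<open>f\<close> minus its linear part at \<open>x\<close>.
  The derivative of that difference is a difference of first partials, hence at most of order
  \<open>norm h\<close> on the ball of radius \<open>norm h\<close> by
  \<open>smooth_lipschitz\<close>.\<close>

lemma smooth_quadratic:
  fixes f :: "real^'n \<Rightarrow> real"
  assumes f: "smooth f" and B: "\<And>i j x. \<bar>partial_deriv j (partial_deriv i f) x\<bar> \<le> B"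
  shows "\<bar>f (x + h) - f x - (\<Sum>i\<in>UNIV. h $ i * partial_deriv i f x)\<bar> \<le> (real CARD('n))\<^sup>2 * B * (norm h)\<^sup>2"
proof -
  let ?c = "\<lambda>i. partial_deriv i f x"
  let ?g = "\<lambda>u. f u - (\<Sum>i\<in>UNIV. u $ i * ?c i)"
  have B0: "0 \<le> B" using B[of undefined undefined x] by linarith
  have "norm (?g (x + h) - ?g x) \<le> ((real CARD('n))\<^sup>2 * B * norm h) * norm (x + h - x)"
  proof (rule differentiable_bound[where S="cball x (norm h)"])
    fix u :: "real^'n" assume u: "u \<in> cball x (norm h)"
    show "(?g has_derivative (\<lambda>h. \<Sum>i\<in>UNIV. h $ i * (partial_deriv i f u - ?c i))) (at u within cball x (norm h))"
      by (rule has_derivative_eq_rhs, rule has_derivative_at_withinI, rule has_derivative_diff,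
          rule smooth_has_derivative[OF f], rule bounded_linear_imp_has_derivative,
          rule bounded_linear_coords) (simp add: right_diff_distrib sum_subtractf)
    have "\<bar>partial_deriv i f u - ?c i\<bar> \<le> real CARD('n) * B * norm h" for i
    proof -
      have "\<bar>partial_deriv i f u - ?c i\<bar> \<le> real CARD('n) * B * norm (u - x)"
        by (rule smooth_lipschitz[OF smooth_partial_deriv[OF f] B])
      also have "\<dots> \<le> real CARD('n) * B * norm h"
        using u B0 by (intro mult_left_mono) (auto simp: dist_norm norm_minus_commute)
      finally show ?thesis .
    qed
    then have "\<bar>\<Sum>i\<in>UNIV. v $ i * (partial_deriv i f u - ?c i)\<bar> \<le> real CARD('n) * (real CARD('n) * B * norm h) * norm v" for v
      by (rule abs_coord_sum_le)
    then show "onorm (\<lambda>h. \<Sum>i\<in>UNIV. h $ i * (partial_deriv i f u - ?c i)) \<le> (real CARD('n))\<^sup>2 * B * norm h"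
      by (intro onorm_le) (simp add: power2_eq_square mult_ac)
  qed (auto simp: dist_norm)
  moreover have "?g (x + h) - ?g x = f (x + h) - f x - (\<Sum>i\<in>UNIV. h $ i * partial_deriv i f x)"
    by (simp add: distrib_right sum.distrib)
  ultimately show ?thesis by (simp add: power2_eq_square mult_ac)
qed

section \<open>Test functions on the whole space\<close>

abbreviation test_fun :: "(real^'n \<Rightarrow> real) \<Rightarrow> bool" where
  "test_fun m \<equiv> m \<in> test_functions UNIV"

text \<open>An explicit radius beyond which the function vanishes is easier to carry through sums,
  products and affine changes of variable than compactness of the support.\<close>

lemma test_fun_iff: "test_fun m \<longleftrightarrow> smooth m \<and> (\<exists>R. \<forall>x. R < norm x \<longrightarrow> m x = 0)"
proof
  assume "test_fun m"
  then have m: "smooth m" "compact (fun_support m)" by (auto simp: test_functions_def)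
  from m(2) obtain R where R: "\<And>x. x \<in> fun_support m \<Longrightarrow> norm x \<le> R"
    by (meson bounded_iff compact_imp_bounded)
  have "m x = 0" if "R < norm x" for x
  proof (rule ccontr)
    assume "m x \<noteq> 0"
    then have "x \<in> fun_support m" unfolding fun_support_def by (intro closure_subset[THEN subsetD]) auto
    then show False using R that by fastforce
  qed
  then show "smooth m \<and> (\<exists>R. \<forall>x. R < norm x \<longrightarrow> m x = 0)" using m by blast
next
  assume "smooth m \<and> (\<exists>R. \<forall>x. R < norm x \<longrightarrow> m x = 0)"
  then obtain R where m: "smooth m" "\<And>x. R < norm x \<Longrightarrow> m x = 0" by blast
  have "{x. m x \<noteq> 0} \<subseteq> cball 0 R" using m(2) by (auto simp: not_less[symmetric])
  then have "bounded {x. m x \<noteq> 0}" using bounded_subset bounded_cball by blast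
  then have "compact (fun_support m)" unfolding fun_support_def by (simp add: compact_closure)
  then show "test_fun m" using m by (auto simp: test_functions_def)
qed

lemma test_fun_smooth: "test_fun m \<Longrightarrow> smooth m" by (simp add: test_fun_iff)

text \<open>The exterior of a closed ball is open, so \<open>m\<close> coincides with the zero
  function near \<open>x\<close>.\<close>

lemma partial_deriv_zero_outside:
  fixes m :: "real^'n \<Rightarrow> real"
  assumes m: "smooth m" "\<And>x. R < norm x \<Longrightarrow> m x = 0" and x: "R < norm x"
  shows "partial_deriv i m x = 0"
proof -
  have "open {x::real^'n. R < norm x}" by (intro open_Collect_less continuous_intros)
  then have "((\<lambda>x. 0) has_derivative (\<lambda>h. \<Sum>i\<in>UNIV. h $ i * partial_deriv i m x)) (at x)"
    by (rule has_derivative_transform_within_open[OF smooth_has_derivative[OF m(1)]]) (use x m in auto)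
  moreover have "((\<lambda>x. 0::real) has_derivative (\<lambda>h. 0)) (at x)" by simp
  ultimately have "(\<lambda>h. \<Sum>i\<in>UNIV. h $ i * partial_deriv i m x) = (\<lambda>h. 0)"
    by (rule has_derivative_unique)
  from fun_cong[OF this, of "axis i 1"] show ?thesis
    by (simp add: axis_def if_distrib[of "\<lambda>x. x * _"] cong: if_cong)
qed

lemma test_fun_partial:
  assumes "test_fun m" shows "test_fun (partial_deriv i m)"
proof -
  from assms obtain R where m: "smooth m" "\<And>x. R < norm x \<Longrightarrow> m x = 0" by (auto simp: test_fun_iff)
  have "partial_deriv i m x = 0" if "R < norm x" for x
    using that m by (intro partial_deriv_zero_outside[of m R])
  then show ?thesis
    using smooth_partial_deriv[OF m(1)] by (auto simp: test_fun_iff)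
qed

lemma test_fun_iter_partial: "test_fun m \<Longrightarrow> test_fun (iter_partial is m)"
  by (induction "is") (auto intro: test_fun_partial)

lemma test_fun_coord_mult: "test_fun m \<Longrightarrow> test_fun (\<lambda>x. x $ j * m x)"
  by (auto simp: test_fun_iff intro: smooth_coord_mult)

lemma test_fun_scale_add:
  assumes "test_fun m" "test_fun m'" shows "test_fun (\<lambda>x. a * m x + b * m' x)"
proof -
  from assms obtain R R' where "smooth m" "smooth m'" "\<And>x. R < norm x \<Longrightarrow> m x = 0" "\<And>x. R' < norm x \<Longrightarrow> m' x = 0"
    by (auto simp: test_fun_iff)
  then show ?thesis by (auto simp: test_fun_iff intro!: smooth_scale_add exI[of _ "max R R'"])
qed

lemma test_fun_affine:
  assumes "test_fun m" "c \<noteq> 0" shows "test_fun (\<lambda>x. m (a + c *\<^sub>R x))"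
proof -
  from assms obtain R where m: "smooth m" "\<And>x. R < norm x \<Longrightarrow> m x = 0" by (auto simp: test_fun_iff)
  have "m (a + c *\<^sub>R x) = 0" if "(\<bar>R\<bar> + norm a) / \<bar>c\<bar> < norm x" for x
  proof (rule m(2))
    from that assms have "\<bar>R\<bar> + norm a < norm (c *\<^sub>R x)" by (simp add: field_simps)
    then show "R < norm (a + c *\<^sub>R x)" using norm_diff_ineq[of "c *\<^sub>R x" a] by (simp add: add.commute)
  qed
  then show ?thesis using m smooth_affine by (auto simp: test_fun_iff)
qed

lemma test_fun_continuous: "test_fun m \<Longrightarrow> continuous_on UNIV m"
  by (simp add: smooth_continuous test_fun_smooth)

lemma test_fun_measurable: "test_fun m \<Longrightarrow> m \<in> borel_measurable borel"
  by (simp add: borel_measurable_continuous_onI test_fun_continuous)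

lemma test_fun_bounded:
  assumes "test_fun m" shows "\<exists>B\<ge>0. \<forall>x. \<bar>m x\<bar> \<le> B"
proof -
  from assms obtain R where m: "\<And>x. R < norm x \<Longrightarrow> m x = 0" by (auto simp: test_fun_iff)
  have "compact (m ` cball 0 R)"
    by (intro compact_continuous_image continuous_on_subset[OF test_fun_continuous[OF assms]]) auto
  then have "bounded (m ` cball 0 R)" by (rule compact_imp_bounded)
  then obtain B where "\<forall>y\<in>m ` cball 0 R. norm y \<le> B" unfolding bounded_iff by blast
  then have "\<bar>m x\<bar> \<le> B" if "x \<in> cball 0 R" for x using that by auto
  then have "\<bar>m x\<bar> \<le> max B 0" for x using m by (cases "R < norm x") (auto simp: le_max_iff_disj)
  then show ?thesis by (intro exI[of _ "max B 0"]) simp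
qed

lemma integrable_compact_support:
  fixes f :: "'a::euclidean_space \<Rightarrow> real"
  assumes "f \<in> borel_measurable borel" "\<And>x. R < norm x \<Longrightarrow> f x = 0" "\<And>x. \<bar>f x\<bar> \<le> B"
  shows "integrable lborel f"
proof (rule Bochner_Integration.integrable_bound[where f="\<lambda>x. B * indicator (cball 0 R) x"])
  have "emeasure lborel (cball (0::'a) R) < \<infinity>" by (intro emeasure_bounded_finite) auto
  then show "integrable lborel (\<lambda>x. B * indicator (cball (0::'a) R) x)"
    by (intro integrable_mult_right integrable_real_indicator) auto
  have "\<bar>f x\<bar> \<le> \<bar>B * indicator (cball 0 R) x\<bar>" for x
    using assms(2)[of x] assms(3)[of x] by (auto simp: indicator_def)
  then show "AE x in lborel. norm (f x) \<le> norm (B * indicator (cball 0 R) x)" by simp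
qed (use assms in auto)

lemma test_fun_integrable: "test_fun m \<Longrightarrow> integrable lborel m"
proof -
  assume m: "test_fun m"
  obtain B where "\<And>x. \<bar>m x\<bar> \<le> B" using test_fun_bounded[OF m] by blast
  moreover obtain R where "\<And>x. R < norm x \<Longrightarrow> m x = 0" using m by (auto simp: test_fun_iff)
  ultimately show ?thesis by (intro integrable_compact_support test_fun_measurable m)
qed

lemma test_fun_partials_bounded:
  assumes "test_fun m"
  shows "\<exists>B\<ge>0. (\<forall>i j x. \<bar>partial_deriv j (partial_deriv i m) x\<bar> \<le> B) \<and> (\<forall>i x. \<bar>partial_deriv i m x\<bar> \<le> B)"
proof -
  have ex: "\<exists>B. \<forall>x. \<bar>u x\<bar> \<le> B" if "test_fun u" for u :: "real^'n \<Rightarrow> real"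
    using test_fun_bounded[OF that] by blast
  have "\<exists>B. \<forall>x. \<bar>partial_deriv j (partial_deriv i m) x\<bar> \<le> B" for i j
    by (intro ex test_fun_partial assms)
  then have "\<forall>i. \<exists>B. \<forall>j x. \<bar>partial_deriv j (partial_deriv i m) x\<bar> \<le> B j" by (intro allI choice)
  from choice[OF this] obtain B where "\<forall>i j x. \<bar>partial_deriv j (partial_deriv i m) x\<bar> \<le> B i j" by (elim exE)
  then have B: "\<bar>partial_deriv j (partial_deriv i m) x\<bar> \<le> B i j" for i j x by simp
  have "\<exists>B. \<forall>x. \<bar>partial_deriv i m x\<bar> \<le> B" for i
    by (intro ex test_fun_partial assms)
  then have "\<forall>i. \<exists>B. \<forall>x. \<bar>partial_deriv i m x\<bar> \<le> B" by simp
  from choice[OF this] obtain B' where "\<forall>i x. \<bar>partial_deriv i m x\<bar> \<le> B' i" by (elim exE)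
  then have B': "\<bar>partial_deriv i m x\<bar> \<le> B' i" for i x by simp
  \<comment> \<open>Summing the finitely many bounds yields one constant for all indices; each bound
    is nonnegative because it dominates an absolute value.\<close>
  define C where "C = (\<Sum>i\<in>UNIV. \<Sum>j\<in>UNIV. B i j) + (\<Sum>i\<in>UNIV. B' i)"
  have nn: "0 \<le> B i j" "0 \<le> B' i" for i j
    using B[of j i 0] B'[of i 0] by linarith+
  have "B i j \<le> (\<Sum>j\<in>UNIV. B i j)" for i j
    by (rule member_le_sum) (auto intro: nn)
  moreover have "(\<Sum>j\<in>UNIV. B i j) \<le> (\<Sum>i\<in>UNIV. \<Sum>j\<in>UNIV. B i j)" for i
    by (rule member_le_sum) (auto intro: sum_nonneg nn)
  ultimately have "B i j \<le> (\<Sum>i\<in>UNIV. \<Sum>j\<in>UNIV. B i j)" for i j by (meson order_trans)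
  moreover have "0 \<le> (\<Sum>i\<in>UNIV. B' i)" by (intro sum_nonneg nn)
  ultimately have 1: "B i j \<le> C" for i j unfolding C_def by (meson add_increasing2)
  have "B' i \<le> (\<Sum>i\<in>UNIV. B' i)" for i by (rule member_le_sum) (auto intro: nn)
  moreover have "0 \<le> (\<Sum>i\<in>UNIV. \<Sum>j\<in>UNIV. B i j)" by (intro sum_nonneg nn)
  ultimately have 2: "B' i \<le> C" for i unfolding C_def by (meson add_increasing)
  show ?thesis
  proof (intro exI[of _ C] conjI allI)
    show "\<bar>partial_deriv j (partial_deriv i m) x\<bar> \<le> C" for i j x using B 1 by (rule order_trans)
    show "\<bar>partial_deriv i m x\<bar> \<le> C" for i x using B' 2 by (rule order_trans)
    show "0 \<le> C" using nn(2) 2 by (rule order_trans)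
  qed
qed

section \<open>Oscillatory integrals and rapid decay\<close>

lemma lborel_integral_affine:
  fixes f :: "'a::euclidean_space \<Rightarrow> real"
  assumes c: "c \<noteq> 0" and f: "f \<in> borel_measurable borel"
  shows "(LINT x|lborel. f x) = \<bar>c\<bar> ^ DIM('a) * (LINT x|lborel. f (t + c *\<^sub>R x))"
    and "integrable lborel f \<longleftrightarrow> integrable lborel (\<lambda>x. f (t + c *\<^sub>R x))"
proof -
  let ?T = "\<lambda>x. t + c *\<^sub>R x"
  have eq: "(lborel :: 'a measure) = density (distr lborel borel ?T) (\<lambda>_. ennreal (\<bar>c\<bar> ^ DIM('a)))"
    using lborel_affine[OF c, of t] by simp
  have T: "?T \<in> measurable lborel borel" by simp
  have fm: "f \<in> borel_measurable (distr lborel borel ?T)" using f by simp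
  have "(LINT x|lborel. f x) = (LINT x|distr lborel borel ?T. \<bar>c\<bar> ^ DIM('a) *\<^sub>R f x)"
    by (subst eq, rule integral_density[OF fm]) auto
  also have "\<dots> = (LINT x|lborel. \<bar>c\<bar> ^ DIM('a) *\<^sub>R f (?T x))"
    by (rule integral_distr[OF T]) (use f in auto)
  finally show "(LINT x|lborel. f x) = \<bar>c\<bar> ^ DIM('a) * (LINT x|lborel. f (t + c *\<^sub>R x))"
    by simp
  have "integrable lborel f \<longleftrightarrow> integrable (distr lborel borel ?T) (\<lambda>x. \<bar>c\<bar> ^ DIM('a) *\<^sub>R f x)"
    by (subst eq, rule integrable_density[OF fm]) auto
  also have "\<dots> \<longleftrightarrow> integrable lborel (\<lambda>x. \<bar>c\<bar> ^ DIM('a) *\<^sub>R f (?T x))"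
    by (rule integrable_distr_eq[OF T]) (use f in auto)
  also have "\<dots> \<longleftrightarrow> integrable lborel (\<lambda>x. f (?T x))" using c by simp
  finally show "integrable lborel f \<longleftrightarrow> integrable lborel (\<lambda>x. f (t + c *\<^sub>R x))" .
qed

lemma lborel_integral_reflect:
  fixes f :: "'a::euclidean_space \<Rightarrow> real"
  assumes "f \<in> borel_measurable borel"
  shows "(LINT y|lborel. f (x - y)) = (LINT y|lborel. f y)"
    "integrable lborel f \<Longrightarrow> integrable lborel (\<lambda>y. f (x - y))"
  using lborel_integral_affine[OF _ assms, of "-1" x] by auto

lemma lborel_integral_translate:
  fixes f :: "'a::euclidean_space \<Rightarrow> real"
  assumes "f \<in> borel_measurable borel"
  shows "(LINT y|lborel. f (x + y)) = (LINT y|lborel. f y)"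
    "integrable lborel f \<Longrightarrow> integrable lborel (\<lambda>y. f (x + y))"
  using lborel_integral_affine[OF _ assms, of 1 x] by auto

text \<open>Lebesgue measure is the image of a product measure indexed by \<open>Basis\<close>;
  identifying the coordinate \<open>i\<close> with the basis vector \<open>axis i 1\<close> reduces
  the claim to Fubini for finite products.\<close>

lemma lborel_prod_cart:
  fixes f :: "'n::finite \<Rightarrow> real \<Rightarrow> 'b::{real_normed_field,banach,second_countable_topology}"
  assumes f: "\<And>i. integrable lborel (f i)"
  shows "integrable lborel (\<lambda>x::real^'n. \<Prod>i\<in>UNIV. f i (x $ i))"
    and "(LINT x|(lborel :: (real^'n) measure). (\<Prod>i\<in>UNIV. f i (x $ i))) = (\<Prod>i\<in>UNIV. LINT t|lborel. f i t)"
proof -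
  interpret product_sigma_finite "\<lambda>b::real^'n. lborel :: real measure"
    by (simp add: product_sigma_finite_def sigma_finite_lborel)
  define F where "F b = f (THE i. b = axis i 1)" for b :: "real^'n"
  have F: "F (axis i 1) = f i" for i
    unfolding F_def by (rule arg_cong[of _ _ f], rule the_equality) (auto simp: axis_eq_axis)
  have B: "(Basis :: (real^'n) set) = range (\<lambda>i. axis i 1)" by (auto simp: Basis_vec_def)
  have inj: "inj (\<lambda>i::'n. axis i (1::real))" by (auto simp: inj_on_def axis_eq_axis)
  have comp: "(\<Sum>b\<in>Basis. x b *\<^sub>R b) $ i = x (axis i 1)" for x :: "real^'n \<Rightarrow> real" and i
    unfolding B using inj
    by (simp add: sum.reindex axis_def if_distrib[of "\<lambda>x. _ * x"] cong: if_cong)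
  let ?S = "\<lambda>x::real^'n \<Rightarrow> real. \<Sum>b\<in>Basis. x b *\<^sub>R b"
  have pr: "(\<Prod>i\<in>UNIV. f i (?S x $ i)) = (\<Prod>b\<in>Basis. F b (x b))" for x
    unfolding comp unfolding B using inj by (simp add: prod.reindex F)
  have Fi: "integrable lborel (F b)" for b unfolding F_def by (rule f)
  have S: "?S \<in> measurable (Pi\<^sub>M Basis (\<lambda>b. lborel)) borel" by measurable
  have fi: "f i \<in> borel_measurable borel" for i using f[of i] by auto
  have "(\<lambda>x::real^'n. f i (x $ i)) \<in> borel_measurable borel" for i
    by (rule measurable_compose[OF _ fi]) (auto intro!: borel_measurable_continuous_onI continuous_intros)
  then have m: "(\<lambda>x::real^'n. \<Prod>i\<in>UNIV. f i (x $ i)) \<in> borel_measurable borel" by auto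
  have "integrable (Pi\<^sub>M Basis (\<lambda>b. lborel)) (\<lambda>x. \<Prod>b\<in>Basis. F b (x b))"
    by (rule product_integrable_prod) (auto intro: Fi)
  then show "integrable lborel (\<lambda>x::real^'n. \<Prod>i\<in>UNIV. f i (x $ i))"
    by (subst lborel_eq, subst integrable_distr_eq[OF S m]) (simp only: pr)
  have "(LINT x|(lborel :: (real^'n) measure). (\<Prod>i\<in>UNIV. f i (x $ i))) = (LINT x|Pi\<^sub>M Basis (\<lambda>b. lborel). (\<Prod>b\<in>Basis. F b (x b)))"
    by (subst lborel_eq, subst integral_distr[OF S m]) (simp only: pr)
  also have "\<dots> = (\<Prod>b\<in>Basis. LINT t|lborel. F b t)"
    by (rule product_integral_prod) (auto intro: Fi)
  also have "\<dots> = (\<Prod>i\<in>UNIV. LINT t|lborel. f i t)"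
    unfolding B using inj by (simp add: prod.reindex F)
  finally show "(LINT x|(lborel :: (real^'n) measure). (\<Prod>i\<in>UNIV. f i (x $ i))) = (\<Prod>i\<in>UNIV. LINT t|lborel. f i t)" .
qed

text \<open>Compares the radial weight with a product of one-dimensional weights, so that its
  integrability reduces to that of \<open>1 / (1 + t\<^sup>2)\<close> on the line.\<close>

lemma weight_prod: "(1 + norm (x::real^'n)) ^ (2 * CARD('n)) \<ge> (\<Prod>i\<in>UNIV. 1 + (x $ i)\<^sup>2)"
proof -
    have "(\<Prod>i\<in>(UNIV::'n set). 1 + (x $ i)\<^sup>2) \<le> (\<Prod>i\<in>(UNIV::'n set). (1 + norm x)\<^sup>2)"
    proof (rule prod_mono)
      fix i :: 'n
      have "(x $ i)\<^sup>2 \<le> (norm x)\<^sup>2"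
        using component_le_norm_cart[of x i] by (simp add: abs_le_square_iff[symmetric])
      moreover have "(1 + norm x)\<^sup>2 = 1 + (norm x)\<^sup>2 + 2 * norm x" by (simp add: power2_sum)
      ultimately have "1 + (x $ i)\<^sup>2 \<le> (1 + norm x)\<^sup>2" using norm_ge_zero[of x] by linarith
      then show "0 \<le> 1 + (x $ i)\<^sup>2 \<and> 1 + (x $ i)\<^sup>2 \<le> (1 + norm x)\<^sup>2" by (simp add: add_nonneg_nonneg)
    qed
    also have "\<dots> = (1 + norm x) ^ (2 * CARD('n))" by (simp only: prod_constant power_mult)
    finally show ?thesis .
qed

lemma weight_prod_inverse: "norm (1 / (1 + norm x) ^ (2 * CARD('n))) \<le> norm (\<Prod>i\<in>UNIV. inverse (1 + ((x::real^'n) $ i)\<^sup>2))"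
proof -
    have "0 < (\<Prod>i\<in>(UNIV::'n set). 1 + (x $ i)\<^sup>2)" by (intro prod_pos) (auto intro: add_pos_nonneg)
    then have le: "inverse ((1 + norm x) ^ (2 * CARD('n))) \<le> inverse (\<Prod>i\<in>(UNIV::'n set). 1 + (x $ i)\<^sup>2)"
      by (intro le_imp_inverse_le weight_prod)
    have eq: "inverse (\<Prod>i\<in>(UNIV::'n set). 1 + (x $ i)\<^sup>2) = (\<Prod>i\<in>UNIV. inverse (1 + (x $ i)\<^sup>2))"
      using prod_inversef[of "\<lambda>i. 1 + (x $ i)\<^sup>2" "UNIV::'n set"] by (simp only: o_def)
    have "norm (1 / (1 + norm x) ^ (2 * CARD('n))) = inverse ((1 + norm x) ^ (2 * CARD('n)))"
      by (simp add: inverse_eq_divide)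
    also note le
    also have "inverse (\<Prod>i\<in>(UNIV::'n set). 1 + (x $ i)\<^sup>2) \<le> norm (\<Prod>i\<in>UNIV. inverse (1 + (x $ i)\<^sup>2))"
      unfolding eq by simp
    finally show ?thesis .
qed

lemma integrable_weight: "integrable lborel (\<lambda>x::real^'n. 1 / (1 + norm x) ^ (2 * CARD('n)))"
proof (rule Bochner_Integration.integrable_bound)
  have "set_integrable lborel (einterval (-\<infinity>) \<infinity>) (\<lambda>x. inverse (1 + x^2))"
    by (rule integrable_inverse_1_plus_square)
  then have i: "integrable lborel (\<lambda>t::real. inverse (1 + t\<^sup>2))"
    by (simp add: set_integrable_def einterval_def)
  show "integrable lborel (\<lambda>x::real^'n. \<Prod>i\<in>UNIV. inverse (1 + (x $ i)\<^sup>2))"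
    by (rule lborel_prod_cart(1)[of "\<lambda>i t. inverse (1 + t\<^sup>2)", OF i])
  show "AE x in lborel. norm (1 / (1 + norm x) ^ (2 * CARD('n))) \<le> norm (\<Prod>i\<in>UNIV. inverse (1 + ((x::real^'n) $ i)\<^sup>2))"
    by (rule AE_I2) (rule weight_prod_inverse)
  show "(\<lambda>x::real^'n. 1 / (1 + norm x) ^ (2 * CARD('n))) \<in> borel_measurable lborel"
    by (auto intro!: borel_measurable_continuous_onI continuous_intros simp: add_nonneg_eq_0_iff)
qed

text \<open>Decay of the function alone, without its derivatives: this is what the convolution
  estimates ask of a kernel.\<close>

definition rapid :: "(real^'n \<Rightarrow> real) \<Rightarrow> bool" where
  "rapid f \<longleftrightarrow> f \<in> borel_measurable borel \<and> (\<forall>N. \<exists>C. \<forall>x. (1 + norm x) ^ N * \<bar>f x\<bar> \<le> C)"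

lemma weight_measurable [measurable]: "(\<lambda>x::real^'n. (1 + norm x) ^ N) \<in> borel_measurable borel"
  by (auto intro!: borel_measurable_continuous_onI continuous_intros)

lemma rapid_bound: "rapid f \<Longrightarrow> \<exists>C\<ge>0. \<forall>x. (1 + norm x) ^ N * \<bar>f x\<bar> \<le> C"
proof -
  assume "rapid f"
  then obtain C where C: "\<And>x. (1 + norm x) ^ N * \<bar>f x\<bar> \<le> C" unfolding rapid_def by blast
  moreover have "0 \<le> C" using C[of 0] by simp
  ultimately show ?thesis by blast
qed

lemma rapid_measurable: "rapid f \<Longrightarrow> f \<in> borel_measurable borel" by (simp add: rapid_def)

text \<open>Asking for \<open>2 * CARD('n)\<close> additional powers of decay leaves the integrable
  factor of \<open>integrable_weight\<close>.\<close>

lemma rapid_weight_integrable: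
  fixes f :: "real^'n \<Rightarrow> real"
  assumes f: "rapid f"
  shows "integrable lborel (\<lambda>x. (1 + norm x) ^ N * f x)"
proof -
  obtain C where C: "\<And>x. (1 + norm x) ^ (N + 2 * CARD('n)) * \<bar>f x\<bar> \<le> C" "0 \<le> C"
    using rapid_bound[OF f] by blast
  show ?thesis
  proof (rule Bochner_Integration.integrable_bound[OF integrable_mult_right[OF integrable_weight, of C]])
    show "AE x in lborel. norm ((1 + norm x) ^ N * f x) \<le> norm (C * (1 / (1 + norm (x::real^'n)) ^ (2 * CARD('n))))"
    proof (rule AE_I2)
      fix x :: "real^'n"
      have p: "0 < (1 + norm x) ^ (2 * CARD('n))" by (simp add: add_pos_nonneg)
      have "(1 + norm x) ^ N * \<bar>f x\<bar> \<le> C / (1 + norm x) ^ (2 * CARD('n))"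
        using C(1)[of x] p by (simp add: pos_le_divide_eq power_add mult_ac)
      then show "norm ((1 + norm x) ^ N * f x) \<le> norm (C * (1 / (1 + norm x) ^ (2 * CARD('n))))"
        using C(2) by (simp add: abs_mult)
    qed
  qed (use rapid_measurable[OF f] in measurable)
qed

lemma rapid_integrable: "rapid f \<Longrightarrow> integrable lborel f"
  using rapid_weight_integrable[of f 0] by simp

text \<open>The linear coefficient is \<open>- sin a\<close>, written as
  \<open>cos (a + pi / 2)\<close>: with derivatives expressed as phase shifts, the family
  \<open>osc_int\<close> is closed under differentiation.\<close>

lemma cos_quadratic: "\<bar>cos (a + u) - cos a - u * cos (a + pi / 2)\<bar> \<le> u\<^sup>2" for a u :: real
proof -
  let ?g = "\<lambda>t. cos (a + t) - t * cos (a + pi / 2)"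
  have sinl: "\<bar>sin (a + t) - sin a\<bar> \<le> \<bar>t\<bar>" for t
  proof -
    have "norm (sin (a + t) - sin a) \<le> 1 * norm (a + t - a)"
      by (rule field_differentiable_bound[of UNIV _ cos]) (auto intro!: derivative_eq_intros)
    then show ?thesis by simp
  qed
  have "norm (?g u - ?g 0) \<le> \<bar>u\<bar> * norm (u - 0)"
  proof (rule field_differentiable_bound[of "{-\<bar>u\<bar>..\<bar>u\<bar>}" _ "\<lambda>t. sin a - sin (a + t)"])
    fix t assume t: "t \<in> {-\<bar>u\<bar>..\<bar>u\<bar>}"
    show "(?g has_field_derivative (sin a - sin (a + t))) (at t within {-\<bar>u\<bar>..\<bar>u\<bar>})"
      by (auto intro!: derivative_eq_intros simp: cos_add sin_add)
    show "norm (sin a - sin (a + t)) \<le> \<bar>u\<bar>" using sinl[of t] t by auto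
  qed auto
  then show ?thesis by (simp add: power2_eq_square)
qed

text \<open>For even \<open>m\<close> and phase 0 this is the Fourier integral of \<open>m\<close>,
  without the normalising constant. The phases obtained by adding multiples of \<open>pi / 2\<close>
  describe its derivatives while everything stays real.\<close>

definition osc_int :: "real \<Rightarrow> (real^'n \<Rightarrow> real) \<Rightarrow> real^'n \<Rightarrow> real" where
  "osc_int \<theta> m x = (LINT \<xi>|lborel. m \<xi> * cos (x \<bullet> \<xi> + \<theta>))"

lemma osc_integrable:
  fixes m :: "real^'n \<Rightarrow> real"
  assumes "integrable lborel m" shows "integrable lborel (\<lambda>\<xi>. m \<xi> * cos (x \<bullet> \<xi> + \<theta>))"
proof (rule Bochner_Integration.integrable_bound[OF assms])
  show "(\<lambda>\<xi>. m \<xi> * cos (x \<bullet> \<xi> + \<theta>)) \<in> borel_measurable lborel"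
    using assms by (intro borel_measurable_times) (auto intro!: borel_measurable_continuous_onI continuous_intros)
  show "AE \<xi> in lborel. norm (m \<xi> * cos (x \<bullet> \<xi> + \<theta>)) \<le> norm (m \<xi>)"
    by (auto simp: abs_mult intro!: mult_left_le)
qed

lemma osc_int_bound:
  assumes "integrable lborel m" shows "\<bar>osc_int \<theta> m x\<bar> \<le> (LINT \<xi>|lborel. \<bar>m \<xi>\<bar>)"
  unfolding osc_int_def
  by (rule order_trans[OF integral_abs_bound], rule integral_mono,
      rule integrable_abs[OF osc_integrable[OF assms]], rule integrable_abs[OF assms])
     (auto simp: abs_mult intro!: mult_left_le)

lemma inner_cart: "x \<bullet> y = (\<Sum>i\<in>UNIV. x $ i * y $ i)" for x y :: "real^'n"
  by (simp add: inner_vec_def)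

lemma osc_quadratic:
  fixes x h \<xi> :: "real^'n"
  shows "\<bar>m * cos ((x + h) \<bullet> \<xi> + \<theta>) - m * cos (x \<bullet> \<xi> + \<theta>) - (\<Sum>i\<in>UNIV. h $ i * (\<xi> $ i * m * cos (x \<bullet> \<xi> + (\<theta> + pi / 2))))\<bar>
    \<le> \<bar>m\<bar> * (norm \<xi>)\<^sup>2 * (norm h)\<^sup>2"
proof -
  have "(\<Sum>i\<in>UNIV. h $ i * (\<xi> $ i * m * cos (x \<bullet> \<xi> + (\<theta> + pi / 2)))) = m * ((h \<bullet> \<xi>) * cos (x \<bullet> \<xi> + \<theta> + pi / 2))"
    by (simp add: inner_cart[of h] sum_distrib_left sum_distrib_right mult_ac add.assoc)
  then have "\<bar>m * cos ((x + h) \<bullet> \<xi> + \<theta>) - m * cos (x \<bullet> \<xi> + \<theta>) - (\<Sum>i\<in>UNIV. h $ i * (\<xi> $ i * m * cos (x \<bullet> \<xi> + (\<theta> + pi / 2))))\<bar>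
    = \<bar>m\<bar> * \<bar>cos ((x \<bullet> \<xi> + \<theta>) + h \<bullet> \<xi>) - cos (x \<bullet> \<xi> + \<theta>) - (h \<bullet> \<xi>) * cos (x \<bullet> \<xi> + \<theta> + pi / 2)\<bar>"
    by (simp add: abs_mult[symmetric] right_diff_distrib inner_add_left add_ac)
  also have "\<dots> \<le> \<bar>m\<bar> * (h \<bullet> \<xi>)\<^sup>2" by (intro mult_left_mono cos_quadratic) auto
  also have "\<dots> \<le> \<bar>m\<bar> * ((norm \<xi>)\<^sup>2 * (norm h)\<^sup>2)"
  proof (rule mult_left_mono)
    have "\<bar>h \<bullet> \<xi>\<bar> \<le> norm h * norm \<xi>" by (rule Cauchy_Schwarz_ineq2)
    then have "(h \<bullet> \<xi>)\<^sup>2 \<le> (norm h * norm \<xi>)\<^sup>2" by (simp add: abs_le_square_iff[symmetric] abs_mult)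
    then show "(h \<bullet> \<xi>)\<^sup>2 \<le> (norm \<xi>)\<^sup>2 * (norm h)\<^sup>2" by (simp add: power_mult_distrib mult.commute)
  qed auto
  finally show ?thesis by (simp add: mult.assoc)
qed

lemma osc_int_has_derivative:
  fixes m :: "real^'n \<Rightarrow> real"
  assumes m: "test_fun m"
  shows "(osc_int \<theta> m has_derivative (\<lambda>h. \<Sum>i\<in>UNIV. h $ i * osc_int (\<theta> + pi / 2) (\<lambda>\<xi>. \<xi> $ i * m \<xi>) x)) (at x)"
  unfolding osc_int_def[abs_def]
proof (rule has_derivative_integral_quadratic)
  have "\<bar>m \<xi>\<bar> * (norm \<xi>)\<^sup>2 = (\<Sum>i\<in>UNIV. \<bar>\<xi> $ i * (\<xi> $ i * m \<xi>)\<bar>)" for \<xi>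
    by (simp add: power2_norm_eq_inner inner_cart sum_distrib_left abs_mult mult_ac)
  then show "integrable lborel (\<lambda>\<xi>. \<bar>m \<xi>\<bar> * (norm \<xi>)\<^sup>2)"
    by (simp only:) (intro Bochner_Integration.integrable_sum integrable_abs test_fun_integrable test_fun_coord_mult m)
  show "integrable lborel (\<lambda>\<xi>. m \<xi> * cos (y \<bullet> \<xi> + \<theta>))" for y
    by (intro osc_integrable test_fun_integrable m)
  show "integrable lborel (\<lambda>\<xi>. \<xi> $ i * m \<xi> * cos (x \<bullet> \<xi> + (\<theta> + pi / 2)))" for i
    by (intro osc_integrable test_fun_integrable test_fun_coord_mult m)
qed (rule osc_quadratic)

lemma osc_partial:
  assumes "test_fun m"
  shows "partial_deriv i (osc_int \<theta> m) = osc_int (\<theta> + pi / 2) (\<lambda>\<xi>. \<xi> $ i * m \<xi>)"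
  using partial_deriv_coords[OF osc_int_has_derivative[OF assms]] by (simp add: fun_eq_iff)

lemma osc_iter_partial:
  assumes "test_fun m"
  shows "\<exists>\<theta>' m'. test_fun m' \<and> iter_partial is (osc_int \<theta> m) = osc_int \<theta>' m'"
proof (induction "is")
  case (Cons i "is")
  then obtain \<theta>' m' where "test_fun m'" "iter_partial is (osc_int \<theta> m) = osc_int \<theta>' m'" by blast
  then show ?case using osc_partial[of m' i \<theta>'] test_fun_coord_mult[of m' i] by auto
qed (use assms in auto)

lemma osc_smooth:
  assumes "test_fun m" shows "smooth (osc_int \<theta> m)"
  unfolding smooth_def
proof
  fix "is"
  obtain \<theta>' m' where "test_fun m'" "iter_partial is (osc_int \<theta> m) = osc_int \<theta>' m'"
    using osc_iter_partial[OF assms] by metis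
  then show "iter_partial is (osc_int \<theta> m) differentiable_on UNIV"
    using osc_int_has_derivative[of m' \<theta>']
    unfolding differentiable_on_def differentiable_def by auto
qed

text \<open>Integration by parts in the frequency variable, obtained by translating \<open>m\<close>
  by \<open>h\<close> and differentiating at \<open>h = 0\<close> in two ways: on \<open>m\<close>
  itself, and, after undoing the translation, on the cosine.\<close>

lemma osc_coord:
  fixes m :: "real^'n \<Rightarrow> real"
  assumes m: "test_fun m"
  shows "x $ i * osc_int \<theta> m x = osc_int (\<theta> + pi / 2) (partial_deriv i m) x"
proof -
  \<comment> \<open>The phase starts at \<open>\<theta> - pi / 2\<close> so that differentiating the
    cosine arrives at \<open>\<theta>\<close>.\<close>
  let ?A = "\<lambda>h. LINT \<xi>|lborel. m (\<xi> + h) * cos (x \<bullet> \<xi> + (\<theta> - pi / 2))"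
  obtain B where B: "\<And>i j x. \<bar>partial_deriv j (partial_deriv i m) x\<bar> \<le> B" "0 \<le> B"
    using test_fun_partials_bounded[OF m] by blast
  obtain R where R: "\<And>x. R < norm x \<Longrightarrow> m x = 0" using m by (auto simp: test_fun_iff)
  define C where "C = (real CARD('n))\<^sup>2 * B"
  have quad: "\<bar>m (\<xi> + h) - m \<xi> - (\<Sum>i\<in>UNIV. h $ i * partial_deriv i m \<xi>)\<bar> \<le> C * (norm h)\<^sup>2" for \<xi> h
    unfolding C_def by (rule smooth_quadratic[OF test_fun_smooth[OF m] B(1)])
  have C0: "0 \<le> C" using B(2) by (simp add: C_def)
  have "((\<lambda>h. ?A h) has_derivative (\<lambda>h. \<Sum>i\<in>UNIV. h $ i * osc_int (\<theta> - pi / 2) (partial_deriv i m) x)) (at 0)"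
    unfolding osc_int_def
  \<comment> \<open>For \<open>norm h \<le> 1\<close> the remainder vanishes outside the ball of
    radius \<open>R + 1\<close>, so a constant bound on that ball is integrable.\<close>
  proof (rule has_derivative_integral_quadratic[where b="\<lambda>\<xi>. C * indicator (cball 0 (R + 1)) \<xi>"])
    have "emeasure lborel (cball (0::real^'n) (R + 1)) < \<infinity>" by (intro emeasure_bounded_finite) auto
    then show "integrable lborel (\<lambda>\<xi>::real^'n. C * indicator (cball 0 (R + 1)) \<xi>)"
      by (intro integrable_mult_right integrable_real_indicator) auto
    have "test_fun (\<lambda>\<xi>. m (\<xi> + y))" for y using test_fun_affine[OF m, of 1 y] by (simp add: add.commute)
    then show "integrable lborel (\<lambda>\<xi>. m (\<xi> + y) * cos (x \<bullet> \<xi> + (\<theta> - pi / 2)))" for y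
      by (intro osc_integrable test_fun_integrable)
    show "integrable lborel (\<lambda>\<xi>. partial_deriv i m \<xi> * cos (x \<bullet> \<xi> + (\<theta> - pi / 2)))" for i
      by (intro osc_integrable test_fun_integrable test_fun_partial m)
    fix h \<xi> :: "real^'n" assume h: "norm h \<le> 1"
    let ?c = "cos (x \<bullet> \<xi> + (\<theta> - pi / 2))"
    let ?D = "m (\<xi> + h) - m \<xi> - (\<Sum>i\<in>UNIV. h $ i * partial_deriv i m \<xi>)"
    have D: "\<bar>?D\<bar> \<le> C * indicator (cball 0 (R + 1)) \<xi> * (norm h)\<^sup>2"
    proof (cases "norm \<xi> \<le> R + 1")
      case False
      then have n: "R + 1 < norm \<xi>" by simp
      have "m (\<xi> + h) = 0" using n h norm_diff_ineq[of \<xi> h] by (intro R) linarith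
      moreover have "m \<xi> = 0" using n by (intro R) simp
      moreover have "partial_deriv i m \<xi> = 0" for i
        using n by (intro partial_deriv_zero_outside[OF test_fun_smooth[OF m] R]) auto
      ultimately show ?thesis using C0 by simp
    qed (use quad in simp)
    have "m (\<xi> + h) * ?c - m (\<xi> + 0) * ?c - (\<Sum>i\<in>UNIV. h $ i * (partial_deriv i m \<xi> * ?c)) = ?D * ?c"
      by (simp add: left_diff_distrib sum_distrib_right mult.assoc)
    moreover have "\<bar>?D * ?c\<bar> \<le> \<bar>?D\<bar>" by (simp add: abs_mult mult_left_le)
    ultimately show "\<bar>m (\<xi> + (0 + h)) * ?c - m (\<xi> + 0) * ?c - (\<Sum>i\<in>UNIV. h $ i * (partial_deriv i m \<xi> * ?c))\<bar>
        \<le> C * indicator (cball 0 (R + 1)) \<xi> * (norm h)\<^sup>2"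
      using D by simp
  qed
  from partial_deriv_coords[OF this] have 1: "partial_deriv i ?A 0 = osc_int (\<theta> - pi / 2) (partial_deriv i m) x" .
  have A: "?A h = (LINT \<xi>|lborel. m \<xi> * cos ((x \<bullet> \<xi> + (\<theta> - pi / 2)) - h \<bullet> x))" for h
  proof -
    have "?A h = (LINT \<xi>|lborel. (\<lambda>\<xi>. m \<xi> * cos ((x \<bullet> \<xi> + (\<theta> - pi / 2)) - h \<bullet> x)) (h + \<xi>))"
      by (intro Bochner_Integration.integral_cong refl)
         (simp add: inner_add_right inner_commute[of h x] add_ac)
    also have "\<dots> = (LINT \<xi>|lborel. m \<xi> * cos ((x \<bullet> \<xi> + (\<theta> - pi / 2)) - h \<bullet> x))"
      by (rule lborel_integral_translate)
         (intro borel_measurable_times test_fun_measurable m borel_measurable_continuous_onI continuous_intros)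
    finally show ?thesis .
  qed
  have "((\<lambda>h. ?A h) has_derivative (\<lambda>h. \<Sum>i\<in>UNIV. h $ i * (LINT \<xi>|lborel. (- x $ i) * (m \<xi> * cos (x \<bullet> \<xi> + \<theta>))))) (at 0)"
    unfolding A
  proof (rule has_derivative_integral_quadratic[where b="\<lambda>\<xi>. \<bar>m \<xi>\<bar> * (norm x)\<^sup>2"])
    show "integrable lborel (\<lambda>\<xi>. \<bar>m \<xi>\<bar> * (norm x)\<^sup>2)"
      by (intro integrable_mult_left integrable_abs test_fun_integrable m)
    show "integrable lborel (\<lambda>\<xi>. m \<xi> * cos (x \<bullet> \<xi> + (\<theta> - pi / 2) - y \<bullet> x))" for y
      using osc_integrable[OF test_fun_integrable[OF m], of x "\<theta> - pi / 2 - y \<bullet> x"] by (simp add: add_diff_eq)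
    show "integrable lborel (\<lambda>\<xi>. - x $ i * (m \<xi> * cos (x \<bullet> \<xi> + \<theta>)))" for i
      by (intro integrable_mult_right osc_integrable test_fun_integrable m)
    fix h \<xi> :: "real^'n"
    have e: "cos (x \<bullet> \<xi> + (\<theta> - pi / 2) - (0 + h) \<bullet> x) = cos (h \<bullet> (- x) + (x \<bullet> \<xi> + (\<theta> - pi / 2)))" by (simp add: add.commute)
    show "\<bar>m \<xi> * cos (x \<bullet> \<xi> + (\<theta> - pi / 2) - (0 + h) \<bullet> x) - m \<xi> * cos (x \<bullet> \<xi> + (\<theta> - pi / 2) - 0 \<bullet> x) -
        (\<Sum>i\<in>UNIV. h $ i * (- x $ i * (m \<xi> * cos (x \<bullet> \<xi> + \<theta>))))\<bar> \<le> \<bar>m \<xi>\<bar> * (norm x)\<^sup>2 * (norm h)\<^sup>2"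
      unfolding e using osc_quadratic[of "m \<xi>" 0 h "-x" "x \<bullet> \<xi> + (\<theta> - pi / 2)"] by (simp add: mult_ac add_ac)
  qed
  from partial_deriv_coords[OF this] have "partial_deriv i ?A 0 = - x $ i * osc_int \<theta> m x"
    by (simp add: osc_int_def)
  with 1 have "x $ i * osc_int \<theta> m x = - osc_int (\<theta> - pi / 2) (partial_deriv i m) x" by simp
  also have "\<dots> = osc_int (\<theta> + pi / 2) (partial_deriv i m) x"
  proof -
    have "cos (x \<bullet> \<xi> + (\<theta> + pi / 2)) = - cos (x \<bullet> \<xi> + (\<theta> - pi / 2))" for \<xi>
      by (simp add: cos_add sin_add cos_diff sin_diff algebra_simps)
    then show ?thesis unfolding osc_int_def by simp
  qed
  finally show ?thesis .
qed

text \<open>One power of the weight is bounded by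
  \<open>1 + (\<Sum>i\<in>UNIV. \<bar>x $ i\<bar>)\<close>, and \<open>osc_coord\<close> trades each
  coordinate for a derivative of \<open>m\<close>. The induction therefore runs over all phases and
  all test functions.\<close>

lemma osc_decay:
  fixes m :: "real^'n \<Rightarrow> real"
  assumes "test_fun m" shows "\<exists>C. \<forall>x. (1 + norm x) ^ N * \<bar>osc_int \<theta> m x\<bar> \<le> C"
  using assms
proof (induction N arbitrary: \<theta> m)
  case 0
  then show ?case using osc_int_bound[OF test_fun_integrable] by auto
next
  case (Suc N)
  obtain C where C: "\<And>x. (1 + norm x) ^ N * \<bar>osc_int \<theta> m x\<bar> \<le> C" using Suc by blast
  have "\<forall>i. \<exists>C. \<forall>x. (1 + norm x) ^ N * \<bar>osc_int (\<theta> + pi / 2) (partial_deriv i m) x\<bar> \<le> C"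
    using Suc test_fun_partial by blast
  from choice[OF this] obtain C' where C': "\<And>i x. (1 + norm x) ^ N * \<bar>osc_int (\<theta> + pi / 2) (partial_deriv i m) x\<bar> \<le> C' i"
    by auto
  have "(1 + norm x) ^ Suc N * \<bar>osc_int \<theta> m x\<bar> \<le> C + (\<Sum>i\<in>UNIV. C' i)" for x
  proof -
    have "(1 + norm x) ^ Suc N * \<bar>osc_int \<theta> m x\<bar> \<le> (1 + (\<Sum>i\<in>UNIV. \<bar>x $ i\<bar>)) * ((1 + norm x) ^ N * \<bar>osc_int \<theta> m x\<bar>)"
      unfolding power_Suc mult.assoc by (intro mult_right_mono) (auto simp: norm_le_l1_cart)
    also have "\<dots> = (1 + norm x) ^ N * \<bar>osc_int \<theta> m x\<bar> + (\<Sum>i\<in>UNIV. (1 + norm x) ^ N * \<bar>x $ i * osc_int \<theta> m x\<bar>)"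
      by (simp add: distrib_left sum_distrib_left abs_mult mult_ac)
    also have "\<dots> \<le> C + (\<Sum>i\<in>UNIV. C' i)"
      unfolding osc_coord[OF Suc.prems] by (intro add_mono sum_mono C C')
    finally show ?thesis .
  qed
  then show ?case by blast
qed

lemma osc_rapid: "test_fun m \<Longrightarrow> rapid (osc_int \<theta> m)"
  unfolding rapid_def
  using osc_decay by (auto intro!: borel_measurable_continuous_onI smooth_continuous osc_smooth)

section \<open>Schwartz functions\<close>

lemma schwartz_iff:
  fixes f :: "real^'n \<Rightarrow> real"
  shows "f \<in> schwartz \<longleftrightarrow> smooth f \<and> (\<forall>N is. \<exists>C. \<forall>x. (1 + norm x) ^ N * \<bar>iter_partial is f x\<bar> \<le> C)"
  by (auto simp: schwartz_def bounded_iff abs_mult)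

lemma osc_schwartz: "test_fun m \<Longrightarrow> osc_int \<theta> m \<in> schwartz"
  unfolding schwartz_iff using osc_smooth osc_iter_partial osc_decay by metis

lemma schwartz_scale_add:
  fixes f g :: "real^'n \<Rightarrow> real"
  assumes "f \<in> schwartz" "g \<in> schwartz" shows "(\<lambda>x. a * f x + b * g x) \<in> schwartz"
  unfolding schwartz_iff
proof (intro conjI allI)
  from assms have s: "smooth f" "smooth g" by (auto simp: schwartz_iff)
  then show "smooth (\<lambda>x. a * f x + b * g x)" by (rule smooth_scale_add)
  fix N "is"
  from assms obtain C C' where C: "\<And>x. (1 + norm x) ^ N * \<bar>iter_partial is f x\<bar> \<le> C"
    "\<And>x. (1 + norm x) ^ N * \<bar>iter_partial is g x\<bar> \<le> C'" unfolding schwartz_iff by metis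
  have "(1 + norm x) ^ N * \<bar>iter_partial is (\<lambda>x. a * f x + b * g x) x\<bar> \<le> \<bar>a\<bar> * C + \<bar>b\<bar> * C'" for x
  proof -
    have "(1 + norm x) ^ N * \<bar>iter_partial is (\<lambda>x. a * f x + b * g x) x\<bar>
      \<le> (1 + norm x) ^ N * (\<bar>a\<bar> * \<bar>iter_partial is f x\<bar> + \<bar>b\<bar> * \<bar>iter_partial is g x\<bar>)"
      unfolding iter_partial_scale_add[OF s] abs_mult[symmetric] by (intro mult_left_mono abs_triangle_ineq) auto
    also have "\<dots> = \<bar>a\<bar> * ((1 + norm x) ^ N * \<bar>iter_partial is f x\<bar>) + \<bar>b\<bar> * ((1 + norm x) ^ N * \<bar>iter_partial is g x\<bar>)"
      by (simp add: algebra_simps)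
    also have "\<dots> \<le> \<bar>a\<bar> * C + \<bar>b\<bar> * C'" by (intro add_mono mult_left_mono C) auto
    finally show ?thesis .
  qed
  then show "\<exists>C. \<forall>x. (1 + norm x) ^ N * \<bar>iter_partial is (\<lambda>x. a * f x + b * g x) x\<bar> \<le> C" by blast
qed

text \<open>Peetre's inequality, from \<open>1 + a + b \<le> (1 + a) * (1 + b)\<close>. It moves
  polynomial weights from one variable of a convolution to the other.\<close>

lemma weight_triangle: "(1 + norm x) ^ N \<le> (1 + norm (x - y)) ^ N * (1 + norm y) ^ N" for x y :: "'a::real_normed_vector"
proof -
  have "1 + norm x \<le> 1 + (norm (x - y) + norm y)" using norm_triangle_ineq[of "x - y" y] by simp
  also have "\<dots> \<le> (1 + norm (x - y)) * (1 + norm y)" by (simp add: algebra_simps)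
  finally show ?thesis unfolding power_mult_distrib[symmetric] by (intro power_mono) auto
qed

lemma schwartz_reflect:
  fixes f :: "real^'n \<Rightarrow> real"
  assumes "f \<in> schwartz" shows "(\<lambda>x. f (a - x)) \<in> schwartz"
  unfolding schwartz_iff
proof (intro conjI allI)
  from assms have s: "smooth f" by (auto simp: schwartz_iff)
  from smooth_affine[OF s, of a "-1"] show "smooth (\<lambda>x. f (a - x))" by simp
  fix N "is"
  from assms obtain C where C: "\<And>x. (1 + norm x) ^ N * \<bar>iter_partial is f x\<bar> \<le> C"
    unfolding schwartz_iff by metis
  have "(1 + norm x) ^ N * \<bar>iter_partial is (\<lambda>x. f (a - x)) x\<bar> \<le> (1 + norm a) ^ N * C" for x
  proof -
    have "(1 + norm x) ^ N * \<bar>iter_partial is (\<lambda>x. f (a - x)) x\<bar> = (1 + norm x) ^ N * \<bar>iter_partial is f (a - x)\<bar>"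
      using iter_partial_affine[OF s, of "is" a "-1"] by (simp add: abs_mult power_abs)
    also have "\<dots> \<le> ((1 + norm (x - a)) ^ N * (1 + norm a) ^ N) * \<bar>iter_partial is f (a - x)\<bar>"
      by (intro mult_right_mono weight_triangle) auto
    also have "\<dots> = (1 + norm a) ^ N * ((1 + norm (a - x)) ^ N * \<bar>iter_partial is f (a - x)\<bar>)"
      by (simp add: norm_minus_commute mult_ac)
    also have "\<dots> \<le> (1 + norm a) ^ N * C" by (intro mult_left_mono C) auto
    finally show ?thesis .
  qed
  then show "\<exists>C. \<forall>x. (1 + norm x) ^ N * \<bar>iter_partial is (\<lambda>x. f (a - x)) x\<bar> \<le> C" by blast
qed

lemma schwartz_rapid: "f \<in> schwartz \<Longrightarrow> rapid f"
proof -
  assume f: "f \<in> schwartz"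
  then have "\<forall>N. \<exists>C. \<forall>x. (1 + norm x) ^ N * \<bar>iter_partial [] f x\<bar> \<le> C" unfolding schwartz_iff by blast
  then show "rapid f" using f unfolding rapid_def
    by (auto simp: schwartz_iff intro!: borel_measurable_continuous_onI smooth_continuous)
qed

lemma test_fun_schwartz:
  fixes m :: "real^'n \<Rightarrow> real"
  assumes "test_fun m" shows "m \<in> schwartz"
  unfolding schwartz_iff
proof (intro conjI allI)
  show "smooth m" by (rule test_fun_smooth[OF assms])
  fix N "is"
  have t: "test_fun (iter_partial is m)" by (rule test_fun_iter_partial[OF assms])
  obtain B where B: "\<And>x. \<bar>iter_partial is m x\<bar> \<le> B" "0 \<le> B" using test_fun_bounded[OF t] by blast
  obtain R where R: "\<And>x. R < norm x \<Longrightarrow> iter_partial is m x = 0" using t by (auto simp: test_fun_iff)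
  have "(1 + norm x) ^ N * \<bar>iter_partial is m x\<bar> \<le> (1 + \<bar>R\<bar>) ^ N * B" for x
    using B R[of x] by (cases "R < norm x") (auto intro!: mult_mono power_mono)
  then show "\<exists>C. \<forall>x. (1 + norm x) ^ N * \<bar>iter_partial is m x\<bar> \<le> C" by blast
qed

section \<open>Fourier inversion for kernels\<close>

text \<open>Fubini under domination by a tensor product of integrable functions: each later exchange
  only has to check measurability and one pointwise bound.\<close>

lemma fubini_bound:
  fixes F :: "'a::euclidean_space \<Rightarrow> 'b::euclidean_space \<Rightarrow> 'c::{banach,second_countable_topology}"
  assumes a: "integrable lborel a" and b: "integrable lborel b"
    and F: "(\<lambda>p. F (fst p) (snd p)) \<in> borel_measurable borel"
    and le: "\<And>x y. norm (F x y) \<le> \<bar>(a x :: real) * b y\<bar>"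
  shows "(LINT x|lborel. LINT y|lborel. F x y) = (LINT y|lborel. LINT x|lborel. F x y)"
    and "integrable lborel (\<lambda>x. LINT y|lborel. F x y)"
    and "integrable lborel (\<lambda>y. LINT x|lborel. F x y)"
proof -
  have am: "(\<lambda>p::'a \<times> 'b. a (fst p) * b (snd p)) \<in> borel_measurable (lborel \<Otimes>\<^sub>M lborel)"
    using a b by measurable
  have "integrable (lborel \<Otimes>\<^sub>M lborel) (\<lambda>p::'a \<times> 'b. a (fst p) * b (snd p))"
  proof (rule lborel_pair.Fubini_integrable[OF am])
    have "integrable lborel (\<lambda>x. \<bar>a x\<bar> * (LINT y|lborel. \<bar>b y\<bar>))"
      by (intro integrable_mult_left integrable_abs a)
    then show "integrable lborel (\<lambda>x. LINT y|lborel. norm (a (fst (x, y)) * b (snd (x, y))))"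
      by (simp add: abs_mult)
    show "AE x in lborel. integrable lborel (\<lambda>y. a (fst (x, y)) * b (snd (x, y)))"
      using b by simp
  qed
  then have Fi: "integrable (lborel \<Otimes>\<^sub>M lborel) (\<lambda>p. F (fst p) (snd p))"
  proof (rule Bochner_Integration.integrable_bound)
    show "(\<lambda>p. F (fst p) (snd p)) \<in> borel_measurable (lborel \<Otimes>\<^sub>M lborel)"
      using F by (simp add: lborel_prod)
  qed (use le in auto)
  then have Fi': "integrable (lborel \<Otimes>\<^sub>M lborel) (\<lambda>(x, y). F x y)" by (simp add: case_prod_beta')
  show "(LINT x|lborel. LINT y|lborel. F x y) = (LINT y|lborel. LINT x|lborel. F x y)"
    using lborel_pair.Fubini_integral[OF Fi'] by simp
  show "integrable lborel (\<lambda>x. LINT y|lborel. F x y)"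
    using lborel_pair.integrable_fst[OF Fi'] by simp
  show "integrable lborel (\<lambda>y. LINT x|lborel. F x y)"
    using lborel_pair.integrable_snd[OF Fi'] by simp
qed

lemma borel_measurable_fst: "f \<in> borel_measurable borel \<Longrightarrow> (\<lambda>p. f (fst p)) \<in> borel_measurable borel"
  for f :: "'a::second_countable_topology \<Rightarrow> 'c::topological_space"
  by (rule measurable_compose[OF borel_measurable_continuous_onI[OF continuous_on_fst[OF continuous_on_id]]])

lemma borel_measurable_snd: "f \<in> borel_measurable borel \<Longrightarrow> (\<lambda>p. f (snd p)) \<in> borel_measurable borel"
  for f :: "'a::second_countable_topology \<Rightarrow> 'c::topological_space"
  by (rule measurable_compose[OF borel_measurable_continuous_onI[OF continuous_on_snd[OF continuous_on_id]]])

section \<open>Gaussian regularisation\<close>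

definition gauss :: "real^'n \<Rightarrow> real" where
  "gauss y = (\<Prod>i\<in>UNIV. std_normal_density (y $ i))"

lemma sum_sq_cart: "(\<Sum>i\<in>UNIV. - (y $ i)\<^sup>2 / 2) = - (norm y)\<^sup>2 / 2" for y :: "real^'n"
proof -
  have "(norm y)\<^sup>2 = (\<Sum>i\<in>UNIV. (y $ i)\<^sup>2)"
    unfolding power2_norm_eq_inner inner_cart by (simp add: power2_eq_square)
  then show ?thesis by (simp only: sum_divide_distrib[symmetric] sum_negf)
qed

lemma gauss_eq: "gauss (y::real^'n) = (1 / sqrt (2 * pi)) ^ CARD('n) * exp (- (norm y)\<^sup>2 / 2)"
proof -
  have "gauss y = (\<Prod>i\<in>(UNIV::'n set). (1 / sqrt (2 * pi)) * exp (- (y $ i)\<^sup>2 / 2))"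
    by (simp only: gauss_def std_normal_density_def)
  also have "\<dots> = (1 / sqrt (2 * pi)) ^ CARD('n) * exp (\<Sum>i\<in>UNIV. - (y $ i)\<^sup>2 / 2)"
    by (simp only: prod.distrib prod_constant exp_sum finite)
  also note sum_sq_cart
  finally show ?thesis .
qed

lemma gauss_zero: "gauss (0::real^'n) = (1 / sqrt (2 * pi)) ^ CARD('n)"
  by (simp add: gauss_eq)

lemma gauss_zero_pos: "0 < gauss (0::real^'n)"
  by (simp add: gauss_zero)

lemma gauss_bounds: "0 \<le> gauss y" "gauss y \<le> gauss (0::real^'n)" for y :: "real^'n"
  unfolding gauss_eq by (auto intro!: mult_left_mono)

lemma gauss_measurable [measurable]: "gauss \<in> borel_measurable borel"
  unfolding gauss_eq[abs_def] by (auto intro!: borel_measurable_continuous_onI continuous_intros)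

text \<open>Complex exponentials factor over the coordinates, cosines do not. So the integral is
  computed as a product of characteristic functions of the standard normal distribution, and the
  real part is taken at the end.\<close>

lemma gauss_fourier:
  shows "integrable lborel (gauss :: real^'n \<Rightarrow> real)"
    and "(LINT y|lborel. gauss y * cos (x \<bullet> y)) = exp (- (norm (x::real^'n))\<^sup>2 / 2)"
proof -
  show "integrable lborel (gauss :: real^'n \<Rightarrow> real)"
    unfolding gauss_def[abs_def] using lborel_prod_cart(1)[of "\<lambda>i. std_normal_density"] by simp
  define f where "f i t = complex_of_real (std_normal_density t) * cis (x $ i * t)" for i t
  have fi: "integrable lborel (f i)" for i
  proof (rule Bochner_Integration.integrable_bound[OF integrable_normal_density[where \<mu>=0 and \<sigma>=1]])
    have "(\<lambda>t. cis (x $ i * t)) \<in> borel_measurable borel"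
      by (intro borel_measurable_continuous_onI continuous_intros)
    then show "f i \<in> borel_measurable lborel" unfolding f_def by simp
  qed (auto simp: f_def norm_mult)
  have cis_sum: "(\<Prod>i\<in>UNIV. f i (y $ i)) = complex_of_real (gauss y) * cis (x \<bullet> y)" for y :: "real^'n"
  proof -
    have "(\<Prod>i\<in>UNIV. cis (x $ i * y $ i)) = cis (x \<bullet> y)"
      by (simp add: cis_conv_exp exp_sum[symmetric] inner_cart sum_distrib_left)
    then show ?thesis by (simp add: f_def prod.distrib gauss_def)
  qed
  have "(LINT t|lborel. f i t) = complex_of_real (exp (- (x $ i)\<^sup>2 / 2))" for i
  proof -
    have "complex_of_real (exp (- (x $ i)\<^sup>2 / 2)) = char std_normal_distribution (x $ i)"
      by (simp add: char_std_normal_distribution)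
    also have "\<dots> = (LINT t|lborel. std_normal_density t *\<^sub>R iexp (x $ i * t))"
      unfolding char_def by (rule integral_density) auto
    also have "\<dots> = (LINT t|lborel. f i t)"
      by (simp add: f_def cis_conv_exp scaleR_conv_of_real)
    finally show ?thesis by simp
  qed
  then have "(LINT y|(lborel::(real^'n) measure). (\<Prod>i\<in>UNIV. f i (y $ i))) = complex_of_real (\<Prod>i\<in>UNIV. exp (- (x $ i)\<^sup>2 / 2))"
    by (simp add: lborel_prod_cart(2)[OF fi])
  also have "(\<Prod>i\<in>UNIV. exp (- (x $ i)\<^sup>2 / 2)) = exp (- (norm x)\<^sup>2 / 2)"
    by (simp only: exp_sum[symmetric] sum_sq_cart finite)
  finally have e: "(LINT y|lborel. complex_of_real (gauss y) * cis (x \<bullet> y)) = complex_of_real (exp (- (norm x)\<^sup>2 / 2))"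
    unfolding cis_sum .
  have "integrable lborel (\<lambda>y. complex_of_real (gauss y) * cis (x \<bullet> y))"
    using lborel_prod_cart(1)[where f=f, OF fi] unfolding cis_sum .
  from integral_Re[OF this] e show "(LINT y|lborel. gauss y * cos (x \<bullet> y)) = exp (- (norm x)\<^sup>2 / 2)"
    by simp
qed

lemma integral_gauss: "(LINT y|lborel. gauss (y::real^'n)) = 1"
  using gauss_fourier(2)[of "0::real^'n"] by simp

text \<open>The Gaussian is its own Fourier transform up to a constant. The factor is kept on the
  left so that the right-hand side is \<open>gauss\<close> at scale \<epsilon>, an approximate
  identity once normalised.\<close>

lemma gauss_scaled_fourier:
  assumes "0 < \<epsilon>"
  shows "(LINT y|lborel. gauss (\<epsilon> *\<^sub>R y) * cos (x \<bullet> y)) * (\<epsilon> ^ CARD('n) * gauss (0::real^'n)) = gauss ((1 / \<epsilon>) *\<^sub>R (x::real^'n))"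
proof -
  let ?g = "\<lambda>y::real^'n. gauss y * cos (((1 / \<epsilon>) *\<^sub>R x) \<bullet> y)"
  have "(LINT y|lborel. ?g y) = \<bar>\<epsilon>\<bar> ^ DIM(real^'n) * (LINT y|lborel. ?g (0 + \<epsilon> *\<^sub>R y))"
    by (rule lborel_integral_affine)
       (use assms in \<open>auto intro!: borel_measurable_times borel_measurable_continuous_onI continuous_intros gauss_measurable\<close>)
  moreover have "(LINT y|lborel. ?g y) = exp (- (norm ((1 / \<epsilon>) *\<^sub>R x))\<^sup>2 / 2)" by (rule gauss_fourier(2))
  moreover have "?g (0 + \<epsilon> *\<^sub>R y) = gauss (\<epsilon> *\<^sub>R y) * cos (x \<bullet> y)" for y using assms by simp
  ultimately have "\<epsilon> ^ CARD('n) * (LINT y|lborel. gauss (\<epsilon> *\<^sub>R y) * cos (x \<bullet> y)) = exp (- (norm ((1 / \<epsilon>) *\<^sub>R x))\<^sup>2 / 2)"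
    using assms by (simp only: abs_of_pos DIM_cart DIM_real mult_1_right)
  then show ?thesis
    by (simp add: gauss_eq[of "(1 / \<epsilon>) *\<^sub>R x"] gauss_zero mult_ac)
qed

lemma osc_int_zero: "osc_int 0 m x = (LINT \<xi>|lborel. m \<xi> * cos (x \<bullet> \<xi>))"
  by (simp add: osc_int_def)

lemma osc_even: "osc_int 0 m (- x) = osc_int 0 m x"
  by (simp add: osc_int_zero)

lemma cos_inner_measurable: "(\<lambda>y::'a::euclidean_space. cos (x \<bullet> y)) \<in> borel_measurable borel"
  by (intro borel_measurable_continuous_onI continuous_intros)

text \<open>Fourier inversion with a damping factor: without
  \<open>gauss (\<epsilon> *\<^sub>R y)\<close> the double integral over \<open>y\<close> and \<eta>
  does not converge absolutely.\<close>

lemma osc_inversion_gauss: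
  fixes m :: "real^'n \<Rightarrow> real"
  assumes m: "test_fun m" and even: "\<And>\<xi>. m (- \<xi>) = m \<xi>" and e: "0 < \<epsilon>"
  shows "(LINT y|lborel. osc_int 0 m y * (cos (y \<bullet> \<xi>) * gauss (\<epsilon> *\<^sub>R y))) * gauss (0::real^'n) =
    (LINT u|lborel. m (\<xi> + \<epsilon> *\<^sub>R u) * gauss u)"
proof -
  let ?g = "\<lambda>y::real^'n. gauss (\<epsilon> *\<^sub>R y)"
  define E where "E x = (LINT y|lborel. ?g y * cos (x \<bullet> y))" for x
  have mi: "integrable lborel m" and mm: "m \<in> borel_measurable borel"
    using m by (auto intro: test_fun_integrable test_fun_measurable)
  have gi: "integrable lborel ?g"
    using lborel_integral_affine(2)[of \<epsilon> "gauss::real^'n \<Rightarrow> real" 0] gauss_fourier(1) e by auto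
  have gm: "?g \<in> borel_measurable borel" using gi by auto
  have Ex: "integrable lborel (\<lambda>y. ?g y * cos (x \<bullet> y))" for x
    using osc_integrable[OF gi, of x 0] by (simp add: inner_commute)
  have E_even: "E (- x) = E x" for x by (simp add: E_def)
  have Em: "E \<in> borel_measurable borel"
  proof -
    have "E x = gauss ((1 / \<epsilon>) *\<^sub>R x) / (\<epsilon> ^ CARD('n) * gauss (0::real^'n))" for x
      using gauss_scaled_fourier[OF e, of x] gauss_zero_pos[where 'n='n] e unfolding E_def
      by (simp add: eq_divide_eq)
    then show ?thesis by (simp cong: measurable_cong)
  qed
  have Eb: "\<bar>E x\<bar> \<le> E 0" for x
    unfolding E_def by (rule order_trans[OF integral_abs_bound], rule integral_mono, rule integrable_abs[OF Ex], rule Ex)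
      (auto simp: abs_mult gauss_bounds intro!: mult_left_le)
  have mE: "integrable lborel (\<lambda>\<eta>. m \<eta> * E (\<eta> + a))" for a
  proof (rule Bochner_Integration.integrable_bound[OF integrable_mult_left[OF mi, of "E 0"]])
    show "(\<lambda>\<eta>. m \<eta> * E (\<eta> + a)) \<in> borel_measurable lborel" using mm Em by simp
    show "AE \<eta> in lborel. norm (m \<eta> * E (\<eta> + a)) \<le> norm (m \<eta> * E 0)"
      using Eb by (auto simp: abs_mult intro!: mult_left_mono order_trans[OF Eb])
  qed
  have "(LINT y|lborel. osc_int 0 m y * (cos (y \<bullet> \<xi>) * ?g y)) =
      (LINT y|lborel. LINT \<eta>|lborel. m \<eta> * cos (y \<bullet> \<eta>) * (cos (y \<bullet> \<xi>) * ?g y))"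
    unfolding osc_int_zero by simp
  also have "\<dots> = (LINT \<eta>|lborel. LINT y|lborel. m \<eta> * cos (y \<bullet> \<eta>) * (cos (y \<bullet> \<xi>) * ?g y))"
  proof (rule fubini_bound(1)[OF gi mi])
    show "(\<lambda>p. m (snd p) * cos (fst p \<bullet> snd p) * (cos (fst p \<bullet> \<xi>) * ?g (fst p))) \<in> borel_measurable borel"
      by (intro borel_measurable_times borel_measurable_snd[OF mm] borel_measurable_fst[OF gm]
          borel_measurable_continuous_onI continuous_intros)
    show "norm (m y * cos (x \<bullet> y) * (cos (x \<bullet> \<xi>) * ?g x)) \<le> \<bar>?g x * m y\<bar>" for x y
    proof -
      have "\<bar>cos (x \<bullet> y) * cos (x \<bullet> \<xi>)\<bar> \<le> 1 * 1" unfolding abs_mult by (intro mult_mono) auto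
      then have "\<bar>?g x * m y\<bar> * \<bar>cos (x \<bullet> y) * cos (x \<bullet> \<xi>)\<bar> \<le> \<bar>?g x * m y\<bar>" by (intro mult_left_le) auto
      then show ?thesis by (simp add: abs_mult mult_ac)
    qed
  qed
  \<comment> \<open>The product of two cosines is half the sum of the cosines of difference and sum;
    each half is a value of \<open>E\<close>.\<close>
  also have "\<dots> = (LINT \<eta>|lborel. (m \<eta> * E (\<eta> + - \<xi>) + m \<eta> * E (\<eta> + \<xi>)) / 2)"
  proof (rule Bochner_Integration.integral_cong[OF refl])
    fix \<eta>
    have "m \<eta> * cos (y \<bullet> \<eta>) * (cos (y \<bullet> \<xi>) * ?g y) =
        m \<eta> / 2 * (?g y * cos ((\<eta> + - \<xi>) \<bullet> y) + ?g y * cos ((\<eta> + \<xi>) \<bullet> y))" for y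
      by (simp add: inner_diff_left inner_add_left inner_commute[of y] cos_add cos_diff algebra_simps)
    then show "(LINT y|lborel. m \<eta> * cos (y \<bullet> \<eta>) * (cos (y \<bullet> \<xi>) * ?g y)) = (m \<eta> * E (\<eta> + - \<xi>) + m \<eta> * E (\<eta> + \<xi>)) / 2"
      using Ex[of "\<eta> + - \<xi>"] Ex[of "\<eta> + \<xi>"] unfolding E_def
      by (simp only: integral_mult_right_zero Bochner_Integration.integral_add) (simp add: algebra_simps add_divide_distrib)
  qed
  \<comment> \<open>Both halves agree under the reflection of \<eta>, because \<open>m\<close> and
    \<open>E\<close> are even.\<close>
  also have "\<dots> = (LINT \<eta>|lborel. m \<eta> * E (\<eta> + - \<xi>))"
  proof -
    have "(LINT \<eta>|lborel. m \<eta> * E (\<eta> + \<xi>)) = (LINT \<eta>|lborel. m (0 - \<eta>) * E (0 - \<eta> + \<xi>))"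
      by (rule lborel_integral_reflect(1)[symmetric]) (use mm Em in simp)
    also have "\<dots> = (LINT \<eta>|lborel. m \<eta> * E (\<eta> + - \<xi>))"
    proof (rule Bochner_Integration.integral_cong[OF refl])
      fix \<eta> show "m (0 - \<eta>) * E (0 - \<eta> + \<xi>) = m \<eta> * E (\<eta> + - \<xi>)"
        using E_even[of "\<eta> + - \<xi>"] even by (simp add: add.commute)
    qed
    finally show ?thesis using mE[of \<xi>] mE[of "-\<xi>"] by (simp del: add_uminus_conv_diff)
  qed
  \<comment> \<open>Substitution \<open>\<eta> = \<xi> + \<epsilon> *\<^sub>R u\<close>, which turns
    the peaked \<open>E\<close> into a fixed Gaussian in \<open>u\<close>.\<close>
  also have "\<dots> = \<bar>\<epsilon>\<bar> ^ DIM(real^'n) * (LINT u|lborel. m (\<xi> + \<epsilon> *\<^sub>R u) * E (\<xi> + \<epsilon> *\<^sub>R u + - \<xi>))"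
    by (rule lborel_integral_affine) (use e mm Em in auto)
  also have "\<dots> * gauss (0::real^'n) = (LINT u|lborel. m (\<xi> + \<epsilon> *\<^sub>R u) * (E (\<epsilon> *\<^sub>R u) * (\<epsilon> ^ CARD('n) * gauss (0::real^'n))))"
  proof -
    have "(LINT u|lborel. m (\<xi> + \<epsilon> *\<^sub>R u) * (E (\<epsilon> *\<^sub>R u) * (\<epsilon> ^ CARD('n) * gauss (0::real^'n))))
      = (LINT u|lborel. (m (\<xi> + \<epsilon> *\<^sub>R u) * E (\<epsilon> *\<^sub>R u)) * (\<epsilon> ^ CARD('n) * gauss (0::real^'n)))"
      by (simp only: mult.assoc)
    also have "\<dots> = (LINT u|lborel. m (\<xi> + \<epsilon> *\<^sub>R u) * E (\<epsilon> *\<^sub>R u)) * (\<epsilon> ^ CARD('n) * gauss (0::real^'n))"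
      by (rule integral_mult_left_zero)
    finally show ?thesis using e by simp
  qed
  also have "\<dots> = (LINT u|lborel. m (\<xi> + \<epsilon> *\<^sub>R u) * gauss u)"
    unfolding E_def gauss_scaled_fourier[OF e] using e by simp
  finally show ?thesis .
qed

text \<open>Both sides of \<open>osc_inversion_gauss\<close> converge as \<epsilon> tends to 0 by
  dominated convergence: the left because \<open>osc_int 0 m\<close> is integrable, the right
  because \<open>m\<close> is bounded and continuous.\<close>

lemma osc_inversion:
  fixes m :: "real^'n \<Rightarrow> real"
  assumes m: "test_fun m" and even: "\<And>\<xi>. m (- \<xi>) = m \<xi>"
  shows "(LINT y|lborel. osc_int 0 m y * cos (y \<bullet> \<xi>)) = (2 * pi) ^ CARD('n) * m \<xi>"
proof -
  let ?e = "\<lambda>N. 1 / real (Suc N)"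
  have e0: "?e \<longlonglongrightarrow> 0" using LIMSEQ_inverse_real_of_nat by (simp add: inverse_eq_divide)
  have Ki: "integrable lborel (osc_int 0 m)" by (rule rapid_integrable[OF osc_rapid[OF m]])
  have Km: "osc_int 0 m \<in> borel_measurable borel" using Ki by auto
  have cm: "(\<lambda>y. cos (y \<bullet> \<xi>)) \<in> borel_measurable borel" by (intro borel_measurable_continuous_onI continuous_intros)
  have gcont: "continuous_on UNIV (gauss :: real^'n \<Rightarrow> real)"
    unfolding gauss_eq[abs_def] by (intro continuous_intros) auto
  obtain B where B: "\<And>x. \<bar>m x\<bar> \<le> B" "0 \<le> B" using test_fun_bounded[OF m] by blast
  have L1: "(\<lambda>N. LINT y|lborel. osc_int 0 m y * (cos (y \<bullet> \<xi>) * gauss (?e N *\<^sub>R y))) \<longlonglongrightarrow>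
      (LINT y|lborel. osc_int 0 m y * (cos (y \<bullet> \<xi>) * gauss (0::real^'n)))"
  proof (rule integral_dominated_convergence[where w="\<lambda>y. \<bar>osc_int 0 m y\<bar> * gauss (0::real^'n)"])
    show "AE y in lborel. (\<lambda>N. osc_int 0 m y * (cos (y \<bullet> \<xi>) * gauss (?e N *\<^sub>R y))) \<longlonglongrightarrow> osc_int 0 m y * (cos (y \<bullet> \<xi>) * gauss (0::real^'n))"
    proof (rule AE_I2)
      fix y :: "real^'n"
      have "(\<lambda>N. ?e N *\<^sub>R y) \<longlonglongrightarrow> 0 *\<^sub>R y" by (intro tendsto_scaleR e0 tendsto_const)
      then have "(\<lambda>N. gauss (?e N *\<^sub>R y)) \<longlonglongrightarrow> gauss (0::real^'n)"
        using continuous_on_tendsto_compose[OF gcont, of "\<lambda>N. ?e N *\<^sub>R y" 0] by simp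
      then show "(\<lambda>N. osc_int 0 m y * (cos (y \<bullet> \<xi>) * gauss (?e N *\<^sub>R y))) \<longlonglongrightarrow> osc_int 0 m y * (cos (y \<bullet> \<xi>) * gauss (0::real^'n))"
        by (intro tendsto_intros)
    qed
    show "AE y in lborel. norm (osc_int 0 m y * (cos (y \<bullet> \<xi>) * gauss (?e N *\<^sub>R y))) \<le> \<bar>osc_int 0 m y\<bar> * gauss (0::real^'n)" for N
    proof (rule AE_I2)
      fix y :: "real^'n"
      have "\<bar>cos (y \<bullet> \<xi>) * gauss (?e N *\<^sub>R y)\<bar> \<le> 1 * gauss (0::real^'n)"
        unfolding abs_mult by (intro mult_mono) (auto simp: gauss_bounds)
      then show "norm (osc_int 0 m y * (cos (y \<bullet> \<xi>) * gauss (?e N *\<^sub>R y))) \<le> \<bar>osc_int 0 m y\<bar> * gauss (0::real^'n)"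
        unfolding real_norm_def abs_mult[of "osc_int 0 m y"] by (intro mult_left_mono) auto
    qed
  qed (use Km cm Ki in \<open>auto intro!: borel_measurable_times measurable_compose[OF _ gauss_measurable]\<close>)
  have L2: "(\<lambda>N. LINT u|lborel. m (\<xi> + ?e N *\<^sub>R u) * gauss u) \<longlonglongrightarrow> (LINT u|lborel. m \<xi> * gauss (u::real^'n))"
  proof (rule integral_dominated_convergence[where w="\<lambda>u::real^'n. B * gauss u"])
    show "AE u in lborel. (\<lambda>N. m (\<xi> + ?e N *\<^sub>R u) * gauss u) \<longlonglongrightarrow> m \<xi> * gauss u"
    proof (rule AE_I2)
      fix u :: "real^'n"
      have "(\<lambda>N. \<xi> + ?e N *\<^sub>R u) \<longlonglongrightarrow> \<xi> + 0 *\<^sub>R u" by (intro tendsto_intros e0)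
      then have "(\<lambda>N. m (\<xi> + ?e N *\<^sub>R u)) \<longlonglongrightarrow> m \<xi>"
        using continuous_on_tendsto_compose[OF test_fun_continuous[OF m], of "\<lambda>N. \<xi> + ?e N *\<^sub>R u" \<xi>] by simp
      then show "(\<lambda>N. m (\<xi> + ?e N *\<^sub>R u) * gauss u) \<longlonglongrightarrow> m \<xi> * gauss u" by (intro tendsto_intros)
    qed
    show "AE u in lborel. norm (m (\<xi> + ?e N *\<^sub>R u) * gauss u) \<le> B * gauss u" for N
      using B by (auto simp: abs_mult gauss_bounds intro!: mult_right_mono)
    show "(\<lambda>u. m (\<xi> + ?e N *\<^sub>R u) * gauss u) \<in> borel_measurable lborel" for N
      using measurable_compose[OF _ test_fun_measurable[OF m], of "\<lambda>u. \<xi> + ?e N *\<^sub>R u"] by simp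
  qed (use gauss_fourier(1) in auto)
  have "(\<lambda>N. LINT u|lborel. m (\<xi> + ?e N *\<^sub>R u) * gauss u) \<longlonglongrightarrow>
      (LINT y|lborel. osc_int 0 m y * (cos (y \<bullet> \<xi>) * gauss (0::real^'n))) * gauss (0::real^'n)"
    using tendsto_mult_right[OF L1, of "gauss (0::real^'n)"] osc_inversion_gauss[OF m even, of "?e _" \<xi>] by simp
  \<comment> \<open>Two factors \<open>gauss 0\<close> meet here, one from the limit of the damping
    and one from the normalisation; their product is the reciprocal of
    \<open>(2 * pi) ^ CARD('n)\<close>.\<close>
  from LIMSEQ_unique[OF this L2]
  have "(LINT y|lborel. osc_int 0 m y * cos (y \<bullet> \<xi>)) * (gauss (0::real^'n))\<^sup>2 = m \<xi>"
    by (simp add: integral_gauss mult.assoc[symmetric] power2_eq_square)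
  moreover have "(gauss (0::real^'n))\<^sup>2 = 1 / (2 * pi) ^ CARD('n)"
    by (simp add: gauss_zero power_mult[symmetric] mult.commute[of _ 2]) (simp add: power_mult power_divide)
  ultimately show ?thesis by (simp add: field_simps)
qed

text \<open>For even \<open>m\<close> this is the inverse Fourier transform of \<open>m\<close>: the
  sine part integrates to zero.\<close>

definition kern :: "(real^'n \<Rightarrow> real) \<Rightarrow> real^'n \<Rightarrow> real" where
  "kern m x = osc_int 0 m x / (2 * pi) ^ CARD('n)"

lemma kern_even: "kern m (- x) = kern m x"
  by (simp add: kern_def osc_even)

lemma kern_minus_commute: "kern m (x - y) = kern m (y - x)"
  using kern_even[of m "y - x"] by simp

lemma rapid_cmult: "rapid f \<Longrightarrow> rapid (\<lambda>x. c * f x)"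
proof -
  assume f: "rapid f"
  have "\<exists>C. \<forall>x. (1 + norm x) ^ N * \<bar>c * f x\<bar> \<le> C" for N
  proof -
    obtain C where "\<And>x. (1 + norm x) ^ N * \<bar>f x\<bar> \<le> C" using rapid_bound[OF f] by blast
    then have "\<bar>c\<bar> * ((1 + norm x) ^ N * \<bar>f x\<bar>) \<le> \<bar>c\<bar> * C" for x by (intro mult_left_mono) auto
    then show ?thesis by (auto simp: abs_mult mult_ac)
  qed
  then show ?thesis using rapid_measurable[OF f] by (auto simp: rapid_def)
qed

lemma kern_rapid: "test_fun m \<Longrightarrow> rapid (kern m)"
  using rapid_cmult[OF osc_rapid[of m 0], of "1 / (2 * pi) ^ CARD('n)"]
  by (simp add: kern_def[abs_def])

lemma kern_schwartz: "test_fun m \<Longrightarrow> kern m \<in> schwartz"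
  for m :: "real^'n \<Rightarrow> real"
  using schwartz_scale_add[OF osc_schwartz osc_schwartz, of m m "1 / (2 * pi) ^ CARD('n)" 0 0 0]
  by (simp add: kern_def[abs_def])

lemma kern_inversion:
  fixes m :: "real^'n \<Rightarrow> real"
  assumes "test_fun m" "\<And>\<xi>. m (- \<xi>) = m \<xi>"
  shows "(LINT y|lborel. kern m y * cos (y \<bullet> \<xi>)) = m \<xi>"
  using osc_inversion[OF assms, of \<xi>] by (simp add: kern_def)

lemma kern_scale_add:
  assumes "test_fun m" "test_fun m'"
  shows "kern (\<lambda>\<xi>. a * m \<xi> + b * m' \<xi>) x = a * kern m x + b * kern m' x"
  using osc_integrable[OF test_fun_integrable[OF assms(1)], of x 0] osc_integrable[OF test_fun_integrable[OF assms(2)], of x 0]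
  by (simp add: kern_def osc_int_zero distrib_right add_divide_distrib mult.assoc)

text \<open>Convolving with \<open>kern M\<close> multiplies the frequency density by
  \<open>M\<close>, which does not change \<open>m\<close>. The sine part of the addition formula
  drops out by symmetry of the kernel, and evenness of \<open>M\<close> enters through
  \<open>kern_inversion\<close>.\<close>

lemma kern_conv:
  fixes m M :: "real^'n \<Rightarrow> real"
  assumes m: "test_fun m" and M: "test_fun M" and even: "\<And>\<xi>. M (- \<xi>) = M \<xi>"
    and Mm: "\<And>\<xi>. M \<xi> * m \<xi> = m \<xi>"
  shows "(LINT y|lborel. kern M (x0 - y) * kern m (x - y)) = kern m (x - x0)"
proof -
  define z where "z = x - x0"
  let ?c = "1 / (2 * pi) ^ CARD('n)"
  have Ki: "integrable lborel (kern M)" by (rule rapid_integrable[OF kern_rapid[OF M]])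
  have Km: "kern M \<in> borel_measurable borel" using Ki by auto
  have mi: "integrable lborel m" by (rule test_fun_integrable[OF m])
  have mm: "m \<in> borel_measurable borel" using mi by auto
  have "(LINT y|lborel. kern M (x0 - y) * kern m (x - y)) = (LINT y|lborel. (\<lambda>u. kern M u * kern m (z + u)) (x0 - y))"
    by (simp add: z_def)
  also have "\<dots> = (LINT u|lborel. kern M u * kern m (z + u))"
    by (rule lborel_integral_reflect)
       (intro borel_measurable_times Km measurable_compose[OF _ rapid_measurable[OF kern_rapid[OF m]]], simp)
  also have "\<dots> = ?c * (LINT u|lborel. LINT \<xi>|lborel. kern M u * (m \<xi> * cos ((z + u) \<bullet> \<xi>)))"
    unfolding kern_def[of m] osc_int_zero by (simp del: inner_add_left)
  also have "(LINT u|lborel. LINT \<xi>|lborel. kern M u * (m \<xi> * cos ((z + u) \<bullet> \<xi>))) =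
      (LINT \<xi>|lborel. LINT u|lborel. kern M u * (m \<xi> * cos ((z + u) \<bullet> \<xi>)))"
  proof (rule fubini_bound(1)[OF Ki mi])
    show "(\<lambda>p. kern M (fst p) * (m (snd p) * cos ((z + fst p) \<bullet> snd p))) \<in> borel_measurable borel"
      by (intro borel_measurable_times borel_measurable_snd[OF mm] borel_measurable_fst[OF Km]
          borel_measurable_continuous_onI continuous_intros)
    show "norm (kern M u * (m \<xi> * cos ((z + u) \<bullet> \<xi>))) \<le> \<bar>kern M u * m \<xi>\<bar>" for u \<xi>
      unfolding real_norm_def mult.assoc[symmetric] abs_mult[of _ "cos _"] by (rule mult_left_le) auto
  qed
  also have "\<dots> = (LINT \<xi>|lborel. m \<xi> * cos (z \<bullet> \<xi>))"
  proof (rule Bochner_Integration.integral_cong[OF refl])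
    fix \<xi>
    have c: "integrable lborel (\<lambda>u. kern M u * cos (u \<bullet> \<xi>))"
      using osc_integrable[OF Ki, of \<xi> 0] by (simp add: inner_commute)
    have s: "integrable lborel (\<lambda>u. kern M u * sin (u \<bullet> \<xi>))"
      using osc_integrable[OF Ki, of \<xi> "- (pi / 2)"] by (simp add: inner_commute cos_diff)
    have s0: "(LINT u|lborel. kern M u * sin (u \<bullet> \<xi>)) = 0"
    proof -
      have "(LINT u|lborel. kern M u * sin (u \<bullet> \<xi>)) = (LINT u|lborel. kern M (0 - u) * sin ((0 - u) \<bullet> \<xi>))"
        using s by (intro lborel_integral_reflect(1)[symmetric]) auto
      then show ?thesis by (simp add: kern_even)
    qed
    have "kern M u * (m \<xi> * cos ((z + u) \<bullet> \<xi>)) = m \<xi> * cos (z \<bullet> \<xi>) * (kern M u * cos (u \<bullet> \<xi>)) - m \<xi> * sin (z \<bullet> \<xi>) * (kern M u * sin (u \<bullet> \<xi>))" for u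
      by (simp add: inner_add_left cos_add algebra_simps)
    then have "(LINT u|lborel. kern M u * (m \<xi> * cos ((z + u) \<bullet> \<xi>))) =
      m \<xi> * cos (z \<bullet> \<xi>) * (LINT u|lborel. kern M u * cos (u \<bullet> \<xi>)) - m \<xi> * sin (z \<bullet> \<xi>) * (LINT u|lborel. kern M u * sin (u \<bullet> \<xi>))"
      using c s by simp
    also have "\<dots> = M \<xi> * m \<xi> * cos (z \<bullet> \<xi>)" using s0 kern_inversion[OF M even, of \<xi>] by (simp add: mult_ac)
    finally show "(LINT u|lborel. kern M u * (m \<xi> * cos ((z + u) \<bullet> \<xi>))) = m \<xi> * cos (z \<bullet> \<xi>)" by (simp add: Mm)
  qed
  finally show ?thesis by (simp add: kern_def osc_int_zero z_def)
qed

section \<open>From complex distributions to real convolutions\<close>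

lemma osc_complex:
  fixes m :: "real^'n \<Rightarrow> real"
  assumes mi: "integrable lborel m" and even: "\<And>\<xi>. m (- \<xi>) = m \<xi>"
  shows "(LINT \<xi>|lborel. complex_of_real (m \<xi>) * cis (z \<bullet> \<xi>)) = complex_of_real (osc_int 0 m z)"
proof -
  have c: "integrable lborel (\<lambda>\<xi>. m \<xi> * cos (z \<bullet> \<xi>))" using osc_integrable[OF mi, of z 0] by simp
  have s: "integrable lborel (\<lambda>\<xi>. m \<xi> * sin (z \<bullet> \<xi>))"
    using osc_integrable[OF mi, of z "- (pi / 2)"] by (simp add: cos_diff)
  have "(LINT \<xi>|lborel. m \<xi> * sin (z \<bullet> \<xi>)) = (LINT \<xi>|lborel. m (0 - \<xi>) * sin (z \<bullet> (0 - \<xi>)))"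
    using s by (intro lborel_integral_reflect(1)[symmetric]) auto
  then have s0: "(LINT \<xi>|lborel. m \<xi> * sin (z \<bullet> \<xi>)) = 0" by (simp add: even)
  have "complex_of_real (m \<xi>) * cis (z \<bullet> \<xi>) = complex_of_real (m \<xi> * cos (z \<bullet> \<xi>)) + \<i> * complex_of_real (m \<xi> * sin (z \<bullet> \<xi>))" for \<xi>
    by (simp add: complex_eq_iff)
  then have "(LINT \<xi>|lborel. complex_of_real (m \<xi>) * cis (z \<bullet> \<xi>)) =
    (LINT \<xi>|lborel. complex_of_real (m \<xi> * cos (z \<bullet> \<xi>)) + \<i> * complex_of_real (m \<xi> * sin (z \<bullet> \<xi>)))" by simp
  also have "\<dots> = (LINT \<xi>|lborel. complex_of_real (m \<xi> * cos (z \<bullet> \<xi>))) + (LINT \<xi>|lborel. \<i> * complex_of_real (m \<xi> * sin (z \<bullet> \<xi>)))"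
    by (intro Bochner_Integration.integral_add integrable_of_real integrable_mult_right c s)
  also have "\<dots> = complex_of_real (osc_int 0 m z)"
    unfolding integral_complex_of_real integral_mult_right_zero s0 osc_int_zero by simp
  finally show ?thesis .
qed

text \<open>The operations on distributions act by transposition, so a block applies to its test
  function the inverse transform first, then the multiplier, then the transform. On a real test
  function this composition is convolution with a real kernel.\<close>

lemma fourier_multiplier:
  fixes m \<phi> :: "real^'n \<Rightarrow> real"
  assumes m: "test_fun m" and even: "\<And>\<xi>. m (- \<xi>) = m \<xi>" and \<phi>: "integrable lborel \<phi>"
  shows "fourier (\<lambda>\<xi>. complex_of_real (m \<xi>) * inv_fourier (\<lambda>x. complex_of_real (\<phi> x)) \<xi>) x =
    complex_of_real (LINT y|lborel. \<phi> y * kern m (x - y))"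
proof -
  let ?c = "complex_of_real (1 / (2 * pi) ^ CARD('n))"
  have mi: "integrable lborel m" by (rule test_fun_integrable[OF m])
  have mm: "m \<in> borel_measurable borel" and \<phi>m: "\<phi> \<in> borel_measurable borel" using mi \<phi> by auto
  have "fourier (\<lambda>\<xi>. complex_of_real (m \<xi>) * inv_fourier (\<lambda>x. complex_of_real (\<phi> x)) \<xi>) x =
      ?c * (LINT \<xi>|lborel. LINT y|lborel. complex_of_real (m \<xi> * \<phi> y) * cis ((y - x) \<bullet> \<xi>))"
  proof -
    have "cis (- (\<xi> \<bullet> x)) * (complex_of_real (m \<xi>) * inv_fourier (\<lambda>x. complex_of_real (\<phi> x)) \<xi>) =
      ?c * (LINT y|lborel. complex_of_real (m \<xi> * \<phi> y) * cis ((y - x) \<bullet> \<xi>))" for \<xi>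
    proof -
      have "complex_of_real (m \<xi> * \<phi> y) * cis ((y - x) \<bullet> \<xi>) =
        (cis (- (\<xi> \<bullet> x)) * complex_of_real (m \<xi>)) * (cis (\<xi> \<bullet> y) * complex_of_real (\<phi> y))" for y
      proof -
        have "cis ((y - x) \<bullet> \<xi>) = cis (- (\<xi> \<bullet> x)) * cis (\<xi> \<bullet> y)"
          by (simp add: cis_mult inner_diff_left inner_commute[of \<xi>])
        then show ?thesis by (simp add: mult_ac)
      qed
      then have "(LINT y|lborel. complex_of_real (m \<xi> * \<phi> y) * cis ((y - x) \<bullet> \<xi>)) =
        (cis (- (\<xi> \<bullet> x)) * complex_of_real (m \<xi>)) * (LINT y|lborel. cis (\<xi> \<bullet> y) * complex_of_real (\<phi> y))"
        by (simp only: integral_mult_right_zero)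
      then show ?thesis by (simp only: inv_fourier_def mult_ac)
    qed
    then show ?thesis unfolding fourier_def by (simp only: integral_mult_right_zero)
  qed
  also have "(LINT \<xi>|lborel. LINT y|lborel. complex_of_real (m \<xi> * \<phi> y) * cis ((y - x) \<bullet> \<xi>)) =
      (LINT y|lborel. LINT \<xi>|lborel. complex_of_real (m \<xi> * \<phi> y) * cis ((y - x) \<bullet> \<xi>))"
  proof (rule fubini_bound(1)[OF mi \<phi>])
    show "(\<lambda>p. complex_of_real (m (fst p) * \<phi> (snd p)) * cis ((snd p - x) \<bullet> fst p)) \<in> borel_measurable borel"
    proof -
      have "(\<lambda>p. cis ((snd p - x) \<bullet> fst p)) \<in> borel_measurable borel"
        by (intro borel_measurable_continuous_onI continuous_intros)
      from borel_measurable_times[OF measurable_compose[OF borel_measurable_times[OF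
          borel_measurable_fst[OF mm] borel_measurable_snd[OF \<phi>m]] borel_measurable_of_real] this]
      show ?thesis .
    qed
  qed (simp add: norm_mult)
  also have "\<dots> = (LINT y|lborel. complex_of_real (\<phi> y * osc_int 0 m (x - y)))"
  proof (rule Bochner_Integration.integral_cong[OF refl])
    fix y
    have "(LINT \<xi>|lborel. complex_of_real (m \<xi> * \<phi> y) * cis ((y - x) \<bullet> \<xi>)) =
      complex_of_real (\<phi> y) * (LINT \<xi>|lborel. complex_of_real (m \<xi>) * cis ((y - x) \<bullet> \<xi>))"
      by (subst integral_mult_right_zero[symmetric]) (simp add: mult_ac)
    also have "\<dots> = complex_of_real (\<phi> y * osc_int 0 m (x - y))"
      unfolding osc_complex[OF mi even] using osc_even[of m "x - y"] by simp
    finally show "(LINT \<xi>|lborel. complex_of_real (m \<xi> * \<phi> y) * cis ((y - x) \<bullet> \<xi>)) = complex_of_real (\<phi> y * osc_int 0 m (x - y))" .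
  qed
  also have "?c * \<dots> = complex_of_real (LINT y|lborel. \<phi> y * kern m (x - y))"
    unfolding integral_complex_of_real by (simp add: kern_def)
  finally show ?thesis .
qed

text \<open>The argument is real, so \<open>complexify\<close> evaluates \<open>u\<close> at the
  zero function for the imaginary part; this is where \<open>u (\<lambda>x. 0) = 0\<close>
  enters.\<close>

lemma LP_block_conv:
  fixes \<phi> :: "real^'n \<Rightarrow> real"
  assumes "test_fun (LP_function \<phi>0 j)" "\<And>\<xi>. LP_function \<phi>0 j (- \<xi>) = LP_function \<phi>0 j \<xi>"
    and "integrable lborel \<phi>" and "u (\<lambda>x. 0) = 0"
  shows "LP_block \<phi>0 j u (\<lambda>x. complex_of_real (\<phi> x)) =
    complex_of_real (u (\<lambda>x. LINT y|lborel. \<phi> y * kern (LP_function \<phi>0 j) (x - y)))"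
  using fourier_multiplier[OF assms(1,2,3)] assms(4)
  by (simp add: LP_block_def inv_fourier_dist_def mult_dist_def fourier_dist_def complexify_def complex_eq_iff fun_eq_iff)

section \<open>Littlewood--Paley kernels and convolution\<close>

text \<open>For \<open>m = \<phi>0\<close> this is the sum of the Littlewood--Paley functions of
  index 0 to \<open>J\<close>, by telescoping.\<close>

definition dil :: "(real^'n \<Rightarrow> real) \<Rightarrow> nat \<Rightarrow> real^'n \<Rightarrow> real" where
  "dil m J \<xi> = m ((1 / 2 ^ J) *\<^sub>R \<xi>)"

lemma LP_test_fun: "LP_generator \<phi>0 \<Longrightarrow> test_fun \<phi>0"
  by (simp add: LP_generator_def test_functions_def)

lemma LP_zero:
  assumes "LP_generator \<phi>0" "2 < norm \<xi>" shows "\<phi>0 \<xi> = 0"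
proof (rule ccontr)
  assume "\<phi>0 \<xi> \<noteq> 0"
  then have "\<xi> \<in> fun_support \<phi>0" unfolding fun_support_def by (intro closure_subset[THEN subsetD]) auto
  moreover have "fun_support \<phi>0 \<subseteq> {\<xi>. norm \<xi> \<le> 2}" using assms(1) unfolding LP_generator_def by (elim conjE)
  ultimately show False using assms(2) by auto
qed

lemma LP_one:
  assumes "LP_generator \<phi>0" "norm \<xi> \<le> 1" shows "\<phi>0 \<xi> = 1"
proof -
  have "\<forall>\<xi>. norm \<xi> \<le> 1 \<longrightarrow> \<phi>0 \<xi> = 1" using assms(1) unfolding LP_generator_def by (elim conjE)
  then show ?thesis using assms(2) by simp
qed

lemma LP_even:
  assumes "LP_generator \<phi>0" shows "\<phi>0 (- \<xi>) = \<phi>0 \<xi>"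
proof -
  have "\<forall>\<xi> \<eta>. norm \<xi> = norm \<eta> \<longrightarrow> \<phi>0 \<xi> = \<phi>0 \<eta>"
    using assms unfolding LP_generator_def by (elim conjE)
  from spec[OF spec[OF this, of "- \<xi>"], of \<xi>] norm_minus_cancel[of \<xi>] show ?thesis by (rule mp)
qed

lemma dil_test_fun: "test_fun m \<Longrightarrow> test_fun (dil m J)"
  using test_fun_affine[of m "1 / 2 ^ J" 0] by (simp add: dil_def[abs_def])

lemma dil_even: "(\<And>\<xi>. m (- \<xi>) = m \<xi>) \<Longrightarrow> dil m J (- \<xi>) = dil m J \<xi>"
  by (simp add: dil_def)

lemma LP_function_0: "LP_function \<phi>0 0 = dil \<phi>0 0"
  by (simp add: LP_function_def dil_def fun_eq_iff)

lemma LP_function_Suc: "LP_function \<phi>0 (Suc j) = (\<lambda>\<xi>. 1 * dil \<phi>0 (Suc j) \<xi> + (-1) * dil \<phi>0 j \<xi>)"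
proof
  fix \<xi>
  have a: "(2::real) powr (- real n) = 1 / 2 ^ n" for n
    by (simp only: powr_minus_divide powr_realpow zero_less_numeral)
  have e: "- real (Suc j) + 1 = - real j" by simp
  show "LP_function \<phi>0 (Suc j) \<xi> = 1 * dil \<phi>0 (Suc j) \<xi> + (-1) * dil \<phi>0 j \<xi>"
    unfolding LP_function_def dil_def e a by simp
qed

lemma LP_function_test_fun:
  assumes "LP_generator \<phi>0" shows "test_fun (LP_function \<phi>0 j)"
proof -
  have d: "test_fun (dil \<phi>0 J)" for J by (rule dil_test_fun[OF LP_test_fun[OF assms]])
  show ?thesis by (cases j) (simp_all only: LP_function_0 LP_function_Suc d test_fun_scale_add)
qed

lemma LP_function_even:
  assumes "LP_generator \<phi>0" shows "LP_function \<phi>0 j (- \<xi>) = LP_function \<phi>0 j \<xi>"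
proof -
  have d: "dil \<phi>0 J (- \<xi>) = dil \<phi>0 J \<xi>" for J
    by (rule dil_even) (rule LP_even[OF assms])
  show ?thesis by (cases j) (simp_all only: LP_function_0 LP_function_Suc d)
qed

text \<open>The function of index \<open>j\<close> vanishes beyond radius \<open>2 ^ Suc j\<close>,
  and \<open>dil \<phi>0 J\<close> is 1 up to radius \<open>2 ^ J\<close>. Hence the scale
  \<open>2 ^ Suc j\<close>, rather than \<open>2 ^ j\<close>, in every block estimate.\<close>

lemma dil_mult_LP_function:
  assumes LP: "LP_generator \<phi>0" and J: "Suc j \<le> J"
  shows "dil \<phi>0 J \<xi> * LP_function \<phi>0 j \<xi> = LP_function \<phi>0 j \<xi>"
proof (cases "norm \<xi> \<le> 2 ^ J")
  case True
  then have "norm ((1 / 2 ^ J) *\<^sub>R \<xi>) \<le> 1" by (simp add: pos_divide_le_eq)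
  then have "dil \<phi>0 J \<xi> = 1" unfolding dil_def by (rule LP_one[OF LP])
  then show ?thesis by simp
next
  case False
  have "dil \<phi>0 i \<xi> = 0" if "i \<le> j" for i
  proof -
    have "2 * 2 ^ i \<le> (2::real) ^ J" unfolding power_Suc[symmetric] using that J by (intro power_increasing) auto
    then have "2 * 2 ^ i < norm \<xi>" using False by simp
    then have "2 < norm ((1 / 2 ^ i) *\<^sub>R \<xi>)" by (simp add: pos_less_divide_eq)
    then show ?thesis unfolding dil_def by (rule LP_zero[OF LP])
  qed
  then have "LP_function \<phi>0 j \<xi> = 0" by (cases j) (simp_all add: LP_function_0 LP_function_Suc)
  then show ?thesis by simp
qed

lemma kern_dil:
  fixes m :: "real^'n \<Rightarrow> real"
  assumes "test_fun m"
  shows "kern (dil m J) z = (2 ^ J) ^ CARD('n) * kern m (2 ^ J *\<^sub>R z)"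
proof -
  have "(LINT \<xi>|lborel. dil m J \<xi> * cos (z \<bullet> \<xi>)) =
      \<bar>2 ^ J\<bar> ^ DIM(real^'n) * (LINT \<xi>|lborel. dil m J (0 + 2 ^ J *\<^sub>R \<xi>) * cos (z \<bullet> (0 + 2 ^ J *\<^sub>R \<xi>)))"
    by (rule lborel_integral_affine)
       (auto intro!: borel_measurable_times cos_inner_measurable test_fun_measurable[OF dil_test_fun[OF assms]])
  then show ?thesis by (simp add: kern_def osc_int_zero dil_def)
qed

lemma kern_mult_integrable:
  fixes w :: "real^'n \<Rightarrow> real"
  assumes "rapid K" "w \<in> borel_measurable borel" "\<And>x. \<bar>w x\<bar> \<le> B"
  shows "integrable lborel (\<lambda>y. K y * w (x - y))"
proof (rule Bochner_Integration.integrable_bound[OF integrable_mult_left[OF rapid_integrable[OF assms(1)], of B]])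
  have "(\<lambda>y. w (x - y)) \<in> borel_measurable borel"
    by (rule measurable_compose[OF _ assms(2)]) simp
  then show "(\<lambda>y. K y * w (x - y)) \<in> borel_measurable lborel"
    using rapid_measurable[OF assms(1)] by simp
  have "\<bar>w (x - y)\<bar> \<le> \<bar>B\<bar>" for y using assms(3)[of "x - y"] by linarith
  then show "AE y in lborel. norm (K y * w (x - y)) \<le> norm (K y * B)"
    by (auto simp: abs_mult intro!: mult_left_mono)
qed

section \<open>Convolution with dilated kernels\<close>

definition conv :: "(real^'n \<Rightarrow> real) \<Rightarrow> (real^'n \<Rightarrow> real) \<Rightarrow> real^'n \<Rightarrow> real" where
  "conv K w x = (LINT y|lborel. K y * w (x - y))"

lemma conv_commute:
  fixes w :: "real^'n \<Rightarrow> real"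
  assumes "K \<in> borel_measurable borel" "w \<in> borel_measurable borel"
  shows "(LINT y|lborel. w y * K (x - y)) = conv K w x"
proof -
  have "(\<lambda>y. K y * w (x - y)) \<in> borel_measurable borel"
    by (intro borel_measurable_times assms(1) measurable_compose[OF _ assms(2)]) simp
  from lborel_integral_reflect(1)[OF this, of x] show ?thesis
    by (simp add: conv_def mult.commute)
qed

lemma kern_approx:
  fixes w :: "real^'n \<Rightarrow> real"
  assumes LP: "LP_generator \<phi>0" and L: "\<And>x y. \<bar>w x - w y\<bar> \<le> L * norm (x - y)"
    and \<rho>: "\<And>x. \<rho> < norm x \<Longrightarrow> w x = 0"
  shows "\<exists>C\<ge>0. \<forall>J x. (1 + norm x) ^ N * \<bar>conv (kern (dil \<phi>0 J)) w x - w x\<bar> \<le> C / 2 ^ J"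
proof -
  let ?K = "kern \<phi>0"
  \<comment> \<open>The weight in \<open>x\<close> is at most
    \<open>(1 + \<bar>\<rho>\<bar>) ^ N\<close> times a weight in the displacement whenever
    \<open>w\<close> is nonzero at one of the two points. The exponent \<open>Suc N\<close> below
    has one more power for the Lipschitz factor \<open>norm z\<close>.\<close>
  define C1 where "C1 = L * (1 + \<bar>\<rho>\<bar>) ^ N"
  define C where "C = C1 * (LINT z|lborel. (1 + norm z) ^ Suc N * \<bar>?K z\<bar>)"
  have L0: "0 \<le> L" using order_trans[OF abs_ge_zero L[of "axis undefined 1" 0]] by simp
  have Kr: "rapid ?K" by (rule kern_rapid[OF LP_test_fun[OF LP]])
  have Km: "?K \<in> borel_measurable borel" by (rule rapid_measurable[OF Kr])
  have Kw: "integrable lborel (\<lambda>z. (1 + norm z) ^ Suc N * \<bar>?K z\<bar>)"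
    using integrable_abs[OF rapid_weight_integrable[OF Kr, of "Suc N"]] by (simp add: abs_mult)
  have "L-lipschitz_on UNIV w"
    using L L0 by (auto simp: lipschitz_on_def dist_norm)
  then have wc: "continuous_on UNIV w" by (rule lipschitz_on_continuous_on)
  then have wm: "w \<in> borel_measurable borel" by (rule borel_measurable_continuous_onI)
  have bounded: "\<bar>w x\<bar> \<le> L * (2 * \<bar>\<rho>\<bar> + 2)" for x
  proof -
    \<comment> \<open>A point beyond the support, where \<open>w\<close> vanishes: comparing with it
      turns the Lipschitz bound into a sup bound.\<close>
    define v where "v = (\<bar>\<rho>\<bar> + 1) *\<^sub>R (axis undefined 1 :: real^'n)"
    have v: "norm v = \<bar>\<rho>\<bar> + 1" by (simp add: v_def)
    show ?thesis
    proof (cases "\<rho> < norm x")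
      case False
      have "\<bar>w x - w v\<bar> \<le> L * norm (x - v)" by (rule L)
      also have "\<dots> \<le> L * (2 * \<bar>\<rho>\<bar> + 2)"
        using norm_triangle_ineq4[of x v] False v by (intro mult_left_mono L0) linarith
      finally show ?thesis using \<rho>[of v] v by simp
    qed (use \<rho> L0 in simp)
  qed
  have "(1 + norm x) ^ N * \<bar>conv (kern (dil \<phi>0 J)) w x - w x\<bar> \<le> C / 2 ^ J" for J x
  proof -
    have r: "(\<lambda>y. kern (dil \<phi>0 J) y * w (x - y)) \<in> borel_measurable borel"
      by (intro borel_measurable_times rapid_measurable[OF kern_rapid] dil_test_fun LP_test_fun LP measurable_compose[OF _ wm]) simp
    have "conv (kern (dil \<phi>0 J)) w x = \<bar>1 / 2 ^ J\<bar> ^ DIM(real^'n) * (LINT z|lborel. kern (dil \<phi>0 J) (0 + (1 / 2 ^ J) *\<^sub>R z) * w (x - (0 + (1 / 2 ^ J) *\<^sub>R z)))"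
      unfolding conv_def by (rule lborel_integral_affine[OF _ r]) simp
    also have "\<dots> = (LINT z|lborel. ?K z * w (x - (1 / 2 ^ J) *\<^sub>R z))"
      by (simp add: kern_dil[OF LP_test_fun[OF LP]] power_one_over mult.assoc)
    finally have c: "conv (kern (dil \<phi>0 J)) w x = (LINT z|lborel. ?K z * w (x - (1 / 2 ^ J) *\<^sub>R z))" .
    have "(LINT z|lborel. ?K z) = 1"
      using kern_inversion[OF LP_test_fun[OF LP] LP_even[OF LP], of 0] LP_one[OF LP, of 0] by simp
    then have o: "w x = (LINT z|lborel. ?K z * w x)" by simp
    have m: "(\<lambda>z. ?K z * w (x - (1 / 2 ^ J) *\<^sub>R z)) \<in> borel_measurable borel"
      by (intro borel_measurable_times Km measurable_compose[OF _ wm]) simp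
    have i1: "integrable lborel (\<lambda>z. ?K z * w (x - (1 / 2 ^ J) *\<^sub>R z))"
    proof (rule Bochner_Integration.integrable_bound[OF integrable_mult_left[OF rapid_integrable[OF Kr], of "L * (2 * \<bar>\<rho>\<bar> + 2)"]])
      have "\<bar>w (x - (1 / 2 ^ J) *\<^sub>R z)\<bar> \<le> \<bar>L * (2 * \<bar>\<rho>\<bar> + 2)\<bar>" for z
        using bounded[of "x - (1 / 2 ^ J) *\<^sub>R z"] by linarith
      then show "AE z in lborel. norm (?K z * w (x - (1 / 2 ^ J) *\<^sub>R z)) \<le> norm (?K z * (L * (2 * \<bar>\<rho>\<bar> + 2)))"
        by (auto simp only: real_norm_def abs_mult[of "?K _"] intro!: mult_left_mono AE_I2)
    qed (use m in simp)
    have i2: "integrable lborel (\<lambda>z. ?K z * w x)" by (intro integrable_mult_left rapid_integrable Kr)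
    have "conv (kern (dil \<phi>0 J)) w x - w x = (LINT z|lborel. ?K z * w (x - (1 / 2 ^ J) *\<^sub>R z)) - (LINT z|lborel. ?K z * w x)"
      using c o by simp
    also have "\<dots> = (LINT z|lborel. ?K z * w (x - (1 / 2 ^ J) *\<^sub>R z) - ?K z * w x)"
      by (rule Bochner_Integration.integral_diff[OF i1 i2, symmetric])
    finally have e: "conv (kern (dil \<phi>0 J)) w x - w x = (LINT z|lborel. ?K z * w (x - (1 / 2 ^ J) *\<^sub>R z) - ?K z * w x)" .
    have "(1 + norm x) ^ N * \<bar>conv (kern (dil \<phi>0 J)) w x - w x\<bar> \<le>
        (1 + norm x) ^ N * (LINT z|lborel. \<bar>?K z * w (x - (1 / 2 ^ J) *\<^sub>R z) - ?K z * w x\<bar>)"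
      unfolding e by (intro mult_left_mono integral_abs_bound) auto
    also have "\<dots> = (LINT z|lborel. (1 + norm x) ^ N * \<bar>?K z * w (x - (1 / 2 ^ J) *\<^sub>R z) - ?K z * w x\<bar>)"
      by simp
    also have "\<dots> \<le> (LINT z|lborel. (C1 / 2 ^ J) * ((1 + norm z) ^ Suc N * \<bar>?K z\<bar>))"
    proof (rule integral_mono)
      show "integrable lborel (\<lambda>z. (1 + norm x) ^ N * \<bar>?K z * w (x - (1 / 2 ^ J) *\<^sub>R z) - ?K z * w x\<bar>)"
        by (intro integrable_mult_right integrable_abs Bochner_Integration.integrable_diff i1 i2)
      show "integrable lborel (\<lambda>z. (C1 / 2 ^ J) * ((1 + norm z) ^ Suc N * \<bar>?K z\<bar>))"
        by (intro integrable_mult_right Kw)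
      fix z :: "real^'n"
      define y where "y = (1 / 2 ^ J) *\<^sub>R z"
      have y: "norm y = norm z / 2 ^ J" by (simp add: y_def)
      have yz: "norm y \<le> norm z"
        using divide_left_mono[of 1 "2 ^ J" "norm z"] by (simp add: y)
      have "(1 + norm x) ^ N * \<bar>w (x - y) - w x\<bar> \<le> C1 * norm y * (1 + norm y) ^ N"
      proof (cases "\<rho> < norm (x - y) \<and> \<rho> < norm x")
        case True
        then show ?thesis using \<rho> L0 by (simp add: C1_def)
      next
        case False
        have tri: "norm x \<le> norm (x - y) + norm y" using norm_triangle_ineq[of "x - y" y] by simp
        from False have "norm (x - y) \<le> \<rho> \<or> norm x \<le> \<rho>" by auto
        then have "norm x \<le> \<bar>\<rho>\<bar> + norm y"
          by (elim disjE) (use tri norm_ge_zero[of y] abs_ge_self[of \<rho>] in linarith)+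
        moreover have "0 \<le> \<bar>\<rho>\<bar> * norm y" by simp
        moreover have "(1 + \<bar>\<rho>\<bar>) * (1 + norm y) = 1 + \<bar>\<rho>\<bar> + norm y + \<bar>\<rho>\<bar> * norm y" by (simp add: algebra_simps)
        ultimately have "1 + norm x \<le> (1 + \<bar>\<rho>\<bar>) * (1 + norm y)" by linarith
        then have "(1 + norm x) ^ N \<le> ((1 + \<bar>\<rho>\<bar>) * (1 + norm y)) ^ N" by (intro power_mono) auto
        moreover have "\<bar>w (x - y) - w x\<bar> \<le> L * norm y" using L[of "x - y" x] by simp
        ultimately have "(1 + norm x) ^ N * \<bar>w (x - y) - w x\<bar> \<le> ((1 + \<bar>\<rho>\<bar>) * (1 + norm y)) ^ N * (L * norm y)"
          by (intro mult_mono) auto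
        then show ?thesis by (simp add: C1_def power_mult_distrib mult_ac)
      qed
      also have "\<dots> \<le> C1 * (norm z / 2 ^ J) * (1 + norm z) ^ N"
        unfolding y using L0 yz unfolding y by (intro mult_left_mono power_mono) (auto simp: C1_def)
      also have "\<dots> \<le> (C1 / 2 ^ J) * (1 + norm z) ^ Suc N"
      proof -
        have "norm z * (1 + norm z) ^ N \<le> (1 + norm z) ^ Suc N" by simp (intro mult_right_mono, auto)
        then have "(C1 / 2 ^ J) * (norm z * (1 + norm z) ^ N) \<le> (C1 / 2 ^ J) * (1 + norm z) ^ Suc N"
          using L0 by (intro mult_left_mono) (auto simp: C1_def)
        then show ?thesis by (simp add: mult_ac)
      qed
      finally have "(1 + norm x) ^ N * \<bar>w (x - y) - w x\<bar> * \<bar>?K z\<bar> \<le> (C1 / 2 ^ J) * (1 + norm z) ^ Suc N * \<bar>?K z\<bar>"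
        by (rule mult_right_mono) simp
      moreover have "\<bar>?K z * w (x - y) - ?K z * w x\<bar> = \<bar>w (x - y) - w x\<bar> * \<bar>?K z\<bar>"
        by (simp add: abs_mult[symmetric] algebra_simps)
      ultimately show "(1 + norm x) ^ N * \<bar>?K z * w (x - (1 / 2 ^ J) *\<^sub>R z) - ?K z * w x\<bar> \<le> (C1 / 2 ^ J) * ((1 + norm z) ^ Suc N * \<bar>?K z\<bar>)"
        unfolding y_def[symmetric] by (simp only: mult.assoc)
    qed
    also have "\<dots> = C / 2 ^ J" by (simp add: C_def)
    finally show ?thesis .
  qed
  moreover have "0 \<le> C" unfolding C_def C1_def using L0 by (intro mult_nonneg_nonneg integral_nonneg_AE) auto
  ultimately show ?thesis by blast
qed

lemma test_fun_lipschitz: "test_fun m \<Longrightarrow> \<exists>L. \<forall>x y. \<bar>m x - m y\<bar> \<le> L * norm (x - y)"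
  for m :: "real^'n \<Rightarrow> real"
proof -
  assume m: "test_fun m"
  obtain B where "\<And>i x. \<bar>partial_deriv i m x\<bar> \<le> B" using test_fun_partials_bounded[OF m] by blast
  then show ?thesis using smooth_lipschitz[OF test_fun_smooth[OF m]] by blast
qed

lemma conv_has_derivative:
  fixes \<phi> :: "real^'n \<Rightarrow> real"
  assumes K: "rapid K" and \<phi>: "test_fun \<phi>"
  shows "(conv K \<phi> has_derivative (\<lambda>h. \<Sum>i\<in>UNIV. h $ i * conv K (partial_deriv i \<phi>) x)) (at x)"
proof -
  obtain B where B: "\<And>i j x. \<bar>partial_deriv j (partial_deriv i \<phi>) x\<bar> \<le> B" "0 \<le> B"
    using test_fun_partials_bounded[OF \<phi>] by blast
  define C where "C = (real CARD('n))\<^sup>2 * B"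
  have int: "integrable lborel (\<lambda>y. K y * \<psi> (x - y))" if t: "test_fun \<psi>" for \<psi> x
  proof -
    obtain B where "\<And>x. \<bar>\<psi> x\<bar> \<le> B" using test_fun_bounded[OF t] by blast
    then show ?thesis by (intro kern_mult_integrable K test_fun_measurable t)
  qed
  show ?thesis
    unfolding conv_def[abs_def]
  proof (rule has_derivative_integral_quadratic[where b="\<lambda>y. \<bar>K y\<bar> * C"])
  show "integrable lborel (\<lambda>y. K y * \<phi> (x - y))" for x by (rule int[OF \<phi>])
  show "integrable lborel (\<lambda>y. K y * partial_deriv i \<phi> (x - y))" for i by (intro int test_fun_partial \<phi>)
  show "integrable lborel (\<lambda>y. \<bar>K y\<bar> * C)" by (intro integrable_mult_left integrable_abs rapid_integrable K)
  fix h y :: "real^'n"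
  have "\<bar>\<phi> (x - y + h) - \<phi> (x - y) - (\<Sum>i\<in>UNIV. h $ i * partial_deriv i \<phi> (x - y))\<bar> \<le> C * (norm h)\<^sup>2"
    unfolding C_def by (rule smooth_quadratic[OF test_fun_smooth[OF \<phi>] B(1)])
  then have "\<bar>K y\<bar> * \<bar>\<phi> (x - y + h) - \<phi> (x - y) - (\<Sum>i\<in>UNIV. h $ i * partial_deriv i \<phi> (x - y))\<bar> \<le> \<bar>K y\<bar> * (C * (norm h)\<^sup>2)"
    by (intro mult_left_mono) auto
  moreover have "K y * \<phi> (x + h - y) - K y * \<phi> (x - y) - (\<Sum>i\<in>UNIV. h $ i * (K y * partial_deriv i \<phi> (x - y))) =
      K y * (\<phi> (x - y + h) - \<phi> (x - y) - (\<Sum>i\<in>UNIV. h $ i * partial_deriv i \<phi> (x - y)))"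
    by (simp add: right_diff_distrib sum_distrib_left algebra_simps)
  ultimately show "\<bar>K y * \<phi> (x + h - y) - K y * \<phi> (x - y) - (\<Sum>i\<in>UNIV. h $ i * (K y * partial_deriv i \<phi> (x - y)))\<bar> \<le> \<bar>K y\<bar> * C * (norm h)\<^sup>2"
    by (simp only: abs_mult mult.assoc)
  qed
qed

lemma conv_iter_partial:
  fixes \<phi> :: "real^'n \<Rightarrow> real"
  assumes K: "rapid K" and \<phi>: "test_fun \<phi>"
  shows "iter_partial is (conv K \<phi>) = conv K (iter_partial is \<phi>)"
proof (induction "is")
  case (Cons i "is")
  show ?case
    using partial_deriv_coords[OF conv_has_derivative[OF K test_fun_iter_partial[OF \<phi>]], of i "is"]
    by (simp add: Cons fun_eq_iff)
qed simp

lemma conv_smooth: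
  fixes \<phi> :: "real^'n \<Rightarrow> real"
  assumes K: "rapid K" and \<phi>: "test_fun \<phi>"
  shows "smooth (conv K \<phi>)"
  unfolding smooth_def conv_iter_partial[OF assms] differentiable_on_def differentiable_def
  using conv_has_derivative[OF K test_fun_iter_partial[OF \<phi>]] by auto

lemma kern_approx_test_fun:
  fixes \<phi> :: "real^'n \<Rightarrow> real"
  assumes LP: "LP_generator \<phi>0" and \<phi>: "test_fun \<phi>"
  shows "\<exists>C\<ge>0. \<forall>J x. (1 + norm x) ^ N * \<bar>conv (kern (dil \<phi>0 J)) \<phi> x - \<phi> x\<bar> \<le> C / 2 ^ J"
proof -
  obtain L where L: "\<And>x y. \<bar>\<phi> x - \<phi> y\<bar> \<le> L * norm (x - y)" using test_fun_lipschitz[OF \<phi>] by blast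
  obtain R where R: "\<And>x. R < norm x \<Longrightarrow> \<phi> x = 0" using \<phi> by (auto simp: test_fun_iff)
  show ?thesis by (rule kern_approx[OF LP L R])
qed

text \<open>Decay follows from the approximation estimate: each derivative of the convolution
  differs from that of \<phi> by a rapidly decreasing error.\<close>

lemma conv_dil_schwartz:
  fixes \<phi> :: "real^'n \<Rightarrow> real"
  assumes LP: "LP_generator \<phi>0" and \<phi>: "test_fun \<phi>"
  shows "conv (kern (dil \<phi>0 J)) \<phi> \<in> schwartz"
  unfolding schwartz_iff
proof (intro conjI allI)
  have K: "rapid (kern (dil \<phi>0 J))" by (intro kern_rapid dil_test_fun LP_test_fun LP)
  show "smooth (conv (kern (dil \<phi>0 J)) \<phi>)" by (rule conv_smooth[OF K \<phi>])
  fix N "is"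
  let ?\<psi> = "iter_partial is \<phi>"
  have t: "test_fun ?\<psi>" by (rule test_fun_iter_partial[OF \<phi>])
  obtain C where C: "\<And>J x. (1 + norm x) ^ N * \<bar>conv (kern (dil \<phi>0 J)) ?\<psi> x - ?\<psi> x\<bar> \<le> C / 2 ^ J"
    using kern_approx_test_fun[OF LP t] by blast
  obtain C' where C': "\<And>x. (1 + norm x) ^ N * \<bar>?\<psi> x\<bar> \<le> C'"
    using rapid_bound[OF schwartz_rapid[OF test_fun_schwartz[OF t]]] by blast
  have "(1 + norm x) ^ N * \<bar>iter_partial is (conv (kern (dil \<phi>0 J)) \<phi>) x\<bar> \<le> C / 2 ^ J + C'" for x
  proof -
    have "(1 + norm x) ^ N * \<bar>conv (kern (dil \<phi>0 J)) ?\<psi> x\<bar> \<le>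
        (1 + norm x) ^ N * (\<bar>conv (kern (dil \<phi>0 J)) ?\<psi> x - ?\<psi> x\<bar> + \<bar>?\<psi> x\<bar>)"
      by (intro mult_left_mono) auto
    then show ?thesis unfolding conv_iter_partial[OF K \<phi>] using C[of x J] C'[of x] by (simp add: distrib_left)
  qed
  then show "\<exists>C. \<forall>x. (1 + norm x) ^ N * \<bar>iter_partial is (conv (kern (dil \<phi>0 J)) \<phi>) x\<bar> \<le> C" by blast
qed

lemma conv_LP_Suc:
  fixes \<phi> :: "real^'n \<Rightarrow> real"
  assumes LP: "LP_generator \<phi>0" and \<phi>: "test_fun \<phi>"
  shows "conv (kern (LP_function \<phi>0 (Suc j))) \<phi> = (\<lambda>x. 1 * conv (kern (dil \<phi>0 (Suc j))) \<phi> x + (-1) * conv (kern (dil \<phi>0 j)) \<phi> x)"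
proof
  fix x
  obtain B where B: "\<And>x. \<bar>\<phi> x\<bar> \<le> B" using test_fun_bounded[OF \<phi>] by blast
  have i: "integrable lborel (\<lambda>y. kern (dil \<phi>0 J) y * \<phi> (x - y))" for J
    by (intro kern_mult_integrable[OF _ test_fun_measurable[OF \<phi>] B] kern_rapid dil_test_fun LP_test_fun LP)
  have "kern (LP_function \<phi>0 (Suc j)) y = kern (dil \<phi>0 (Suc j)) y - kern (dil \<phi>0 j) y" for y
    using kern_scale_add[OF dil_test_fun[OF LP_test_fun[OF LP]] dil_test_fun[OF LP_test_fun[OF LP]], of 1 "Suc j" "-1" j y]
    unfolding LP_function_Suc by simp
  then show "conv (kern (LP_function \<phi>0 (Suc j))) \<phi> x = 1 * conv (kern (dil \<phi>0 (Suc j))) \<phi> x + (-1) * conv (kern (dil \<phi>0 j)) \<phi> x"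
    using i[of "Suc j"] i[of j] by (simp add: conv_def left_diff_distrib)
qed

section \<open>Littlewood--Paley series of a tempered distribution\<close>

lemma tempered_linear:
  assumes "f \<in> tempered_distributions" "\<phi> \<in> schwartz" "\<psi> \<in> schwartz"
  shows "f (\<lambda>x. a * \<phi> x + b * \<psi> x) = a * f \<phi> + b * f \<psi>"
  using assms unfolding tempered_distributions_def linear_functional_on_def by blast

lemma schwartz_zero: "(\<lambda>x::real^'n. 0::real) \<in> schwartz"
  using test_fun_schwartz[of "\<lambda>x::real^'n. 0"] smooth_zero by (auto simp: test_fun_iff)

lemma tempered_zero: "f \<in> tempered_distributions \<Longrightarrow> f (\<lambda>x. 0) = 0"
  using tempered_linear[OF _ schwartz_zero schwartz_zero, of f 0 0] by simp

lemma schwartz_seminorm_le: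
  fixes \<psi> :: "real^'n \<Rightarrow> real"
  assumes "\<And>is x. length is \<le> N \<Longrightarrow> (1 + norm x) ^ N * \<bar>iter_partial is \<psi> x\<bar> \<le> C is"
  shows "schwartz_seminorm N \<psi> \<le> (\<Sum>is | length is \<le> N. C is)"
  unfolding schwartz_seminorm_def
  by (rule sum_mono, rule cSUP_least) (use assms in auto)

text \<open>The partial sums telescope to \<open>f\<close> of the convolution with
  \<open>kern (dil \<phi>0 J)\<close>, which converges to \<phi> at rate \<open>1 / 2 ^ J\<close> in
  every Schwartz seminorm, because derivatives fall on \<phi>.\<close>

lemma tempered_LP_sums:
  fixes \<phi> :: "real^'n \<Rightarrow> real"
  assumes LP: "LP_generator \<phi>0" and f: "f \<in> tempered_distributions" and \<phi>: "test_fun \<phi>"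
  shows "(\<lambda>j. f (conv (kern (LP_function \<phi>0 j)) \<phi>)) sums f \<phi>"
proof -
  let ?c = "\<lambda>J. conv (kern (dil \<phi>0 J)) \<phi>"
  have \<phi>s: "\<phi> \<in> schwartz" by (rule test_fun_schwartz[OF \<phi>])
  have cs: "?c J \<in> schwartz" for J by (rule conv_dil_schwartz[OF LP \<phi>])
  have sum: "(\<Sum>j\<le>J. f (conv (kern (LP_function \<phi>0 j)) \<phi>)) = f (?c J)" for J
  proof (induction J)
    case (Suc J)
    have "f (conv (kern (LP_function \<phi>0 (Suc J))) \<phi>) = 1 * f (?c (Suc J)) + (-1) * f (?c J)"
      unfolding conv_LP_Suc[OF LP \<phi>] by (rule tempered_linear[OF f cs cs])
    with Suc show ?case by simp
  qed (simp add: LP_function_0)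
  from f obtain C N where CN: "\<And>\<psi>. \<psi> \<in> schwartz \<Longrightarrow> \<bar>f \<psi>\<bar> \<le> C * schwartz_seminorm N \<psi>"
    unfolding tempered_distributions_def by blast
  have "\<forall>is. \<exists>B\<ge>0. \<forall>J x. (1 + norm x) ^ N * \<bar>conv (kern (dil \<phi>0 J)) (iter_partial is \<phi>) x - iter_partial is \<phi> x\<bar> \<le> B / 2 ^ J"
    by (intro allI kern_approx_test_fun LP test_fun_iter_partial \<phi>)
  from choice[OF this] obtain B where B: "\<And>is. 0 \<le> B is"
    "\<And>is J x. (1 + norm x) ^ N * \<bar>conv (kern (dil \<phi>0 J)) (iter_partial is \<phi>) x - iter_partial is \<phi> x\<bar> \<le> B is / 2 ^ J"
    by auto
  define S where "S = (\<Sum>is | length is \<le> N. B (is :: 'n list))"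
  have "\<bar>f (?c J) - f \<phi>\<bar> \<le> \<bar>C\<bar> * S * (1 / 2) ^ J" for J
  proof -
    let ?\<psi> = "\<lambda>x. 1 * ?c J x + (-1) * \<phi> x"
    have K: "rapid (kern (dil \<phi>0 J))" by (intro kern_rapid dil_test_fun LP_test_fun LP)
    have "schwartz_seminorm N ?\<psi> \<le> (\<Sum>is | length is \<le> N. B is / 2 ^ J)"
    proof (rule schwartz_seminorm_le)
      fix "is" x
      have "iter_partial is ?\<psi> x = conv (kern (dil \<phi>0 J)) (iter_partial is \<phi>) x - iter_partial is \<phi> x"
        unfolding iter_partial_scale_add[OF conv_smooth[OF K \<phi>] test_fun_smooth[OF \<phi>]]
        by (simp add: conv_iter_partial[OF K \<phi>])
      then show "(1 + norm x) ^ N * \<bar>iter_partial is ?\<psi> x\<bar> \<le> B is / 2 ^ J" using B(2) by simp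
    qed
    also have "\<dots> = S / 2 ^ J" by (simp add: S_def sum_divide_distrib)
    finally have sn: "schwartz_seminorm N ?\<psi> \<le> S / 2 ^ J" .
    have sn0: "0 \<le> S / 2 ^ J" unfolding S_def by (intro divide_nonneg_pos sum_nonneg B) auto
    have "\<bar>f (?c J) - f \<phi>\<bar> = \<bar>f ?\<psi>\<bar>" unfolding tempered_linear[OF f cs \<phi>s] by simp
    also have "\<dots> \<le> C * schwartz_seminorm N ?\<psi>" by (intro CN schwartz_scale_add cs \<phi>s)
    also have "\<dots> \<le> \<bar>C\<bar> * (S / 2 ^ J)"
    proof (cases "0 \<le> schwartz_seminorm N ?\<psi>")
      case True
      then show ?thesis using sn by (intro mult_mono) auto
    next
      case False
      \<comment> \<open>A supremum of reals is informative only on a bounded set, so the sign of the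
        seminorm rests on \<open>?\<psi>\<close> being a Schwartz function.\<close>
      have "0 \<le> schwartz_seminorm N ?\<psi>"
        unfolding schwartz_seminorm_def
      proof (intro sum_nonneg)
        fix "is" assume "is \<in> {is :: 'n list. length is \<le> N}"
        have "?\<psi> \<in> schwartz" by (intro schwartz_scale_add cs \<phi>s)
        then obtain D where "\<And>x. (1 + norm x) ^ N * \<bar>iter_partial is ?\<psi> x\<bar> \<le> D" unfolding schwartz_iff by metis
        then have "bdd_above (range (\<lambda>x. (1 + norm x) ^ N * norm (iter_partial is ?\<psi> x)))" by (intro bdd_aboveI2) auto
        then show "0 \<le> (SUP x. (1 + norm x) ^ N * norm (iter_partial is ?\<psi> x))"
          by (rule cSUP_upper2[where x=0]) auto
      qed
      with False show ?thesis by simp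
    qed
    finally show ?thesis by (simp add: power_one_over)
  qed
  then have bd: "norm (f (?c J) - f \<phi>) \<le> \<bar>C\<bar> * S * (1 / 2) ^ J" for J by simp
  have lim: "(\<lambda>J. \<bar>C\<bar> * S * (1 / 2) ^ J) \<longlonglongrightarrow> 0"
    by (rule tendsto_mult_right_zero) (rule LIMSEQ_realpow_zero, auto)
  have "(\<lambda>J. f (?c J) - f \<phi>) \<longlonglongrightarrow> 0"
    by (rule Lim_null_comparison[OF _ lim]) (rule always_eventually, rule allI, rule bd)
  then have "(\<lambda>J. f (?c J)) \<longlonglongrightarrow> f \<phi>" by (simp add: LIM_zero_iff)
  then show ?thesis unfolding sums_def_le sum .
qed

lemma iter_partial_of_real:
  fixes \<phi> :: "real^'n \<Rightarrow> real"
  assumes "smooth \<phi>"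
  shows "iter_partial is (\<lambda>x. complex_of_real (\<phi> x)) = (\<lambda>x. complex_of_real (iter_partial is \<phi> x))"
proof (induction "is")
  case (Cons i "is")
  have "partial_deriv i (\<lambda>x. complex_of_real (iter_partial is \<phi> x)) x = complex_of_real (partial_deriv i (iter_partial is \<phi>) x)" for x
  proof -
    have d: "(iter_partial is \<phi> has_derivative frechet_derivative (iter_partial is \<phi>) (at x)) (at x)"
      using smooth_differentiable[OF smooth_iter_partial[OF assms]] by (simp add: frechet_derivative_works)
    show ?thesis
      using partial_deriv_has_derivative[OF has_derivative_of_real[OF d]] by (simp add: partial_deriv_def)
  qed
  then show ?case by (simp add: Cons fun_eq_iff)
qed simp

lemma schwartz_of_real:
  fixes \<phi> :: "real^'n \<Rightarrow> real"
  assumes "\<phi> \<in> schwartz" shows "(\<lambda>x. complex_of_real (\<phi> x)) \<in> schwartz"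
proof -
  have s: "smooth \<phi>" using assms by (simp add: schwartz_iff)
  have "bounded (range (\<lambda>x. (1 + norm x) ^ N *\<^sub>R complex_of_real (iter_partial is \<phi> x)))" for N "is"
  proof -
    obtain C where "\<And>x. (1 + norm x) ^ N * \<bar>iter_partial is \<phi> x\<bar> \<le> C" using assms unfolding schwartz_iff by metis
    then show ?thesis by (auto simp: bounded_iff norm_mult)
  qed
  moreover have "(\<lambda>x. complex_of_real (iter_partial is \<phi> x)) differentiable_on UNIV" for "is"
  proof -
    have "(iter_partial is \<phi> has_derivative frechet_derivative (iter_partial is \<phi>) (at x)) (at x)" for x
      using smooth_differentiable[OF smooth_iter_partial[OF s]] by (simp add: frechet_derivative_works)
    from has_derivative_of_real[OF this] show ?thesis
      by (auto simp: differentiable_on_def differentiable_def)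
  qed
  ultimately show ?thesis
    by (simp add: schwartz_def smooth_def iter_partial_of_real[OF s])
qed

section \<open>Uniform approximation by convex combinations\<close>

text \<open>The budget \<open>T\<close> stands for the total variation of a representing measure.
  The empty combination \<open>N = 0\<close> is allowed, so that \<open>T = 0\<close> makes sense
  for the zero function.\<close>

definition approx_hull ::
  "'x set \<Rightarrow> ('x \<Rightarrow> real) set \<Rightarrow> real \<Rightarrow> ('x \<Rightarrow> real) \<Rightarrow> bool" where
  "approx_hull \<Omega> D T g \<longleftrightarrow> (\<forall>\<epsilon>>0. \<exists>N a v. (\<forall>i<N. v i \<in> D) \<and> (\<Sum>i<(N::nat). \<bar>a i\<bar>) \<le> T \<and>
     (\<forall>x\<in>\<Omega>. \<bar>g x - (\<Sum>i<N. a i * v i x)\<bar> \<le> \<epsilon>))"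

lemma approx_hullE:
  assumes "approx_hull \<Omega> D T g" "\<epsilon> > 0"
  obtains N a v where "\<And>i. i < N \<Longrightarrow> v i \<in> D" "(\<Sum>i<(N::nat). \<bar>a i\<bar>) \<le> T"
    "\<And>x. x \<in> \<Omega> \<Longrightarrow> \<bar>g x - (\<Sum>i<N. a i * v i x)\<bar> \<le> \<epsilon>"
  using assms unfolding approx_hull_def by metis

lemma approx_hull_limit:
  assumes "\<And>\<epsilon>. \<epsilon> > 0 \<Longrightarrow> \<exists>g'. approx_hull \<Omega> D T g' \<and> (\<forall>x\<in>\<Omega>. \<bar>g x - g' x\<bar> \<le> \<epsilon>)"
  shows "approx_hull \<Omega> D T g"
  unfolding approx_hull_def
proof (intro allI impI)
  fix \<epsilon> :: real assume e: "\<epsilon> > 0"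
  then obtain g' where g': "approx_hull \<Omega> D T g'" "\<And>x. x \<in> \<Omega> \<Longrightarrow> \<bar>g x - g' x\<bar> \<le> \<epsilon> / 2"
    using assms[of "\<epsilon> / 2"] by auto
  from e have "\<epsilon> / 2 > 0" by simp
  from approx_hullE[OF g'(1) this] obtain N a v where n:
    "\<And>i. i < N \<Longrightarrow> v i \<in> D" "(\<Sum>i<(N::nat). \<bar>a i\<bar>) \<le> T"
    "\<And>x. x \<in> \<Omega> \<Longrightarrow> \<bar>g' x - (\<Sum>i<N. a i * v i x)\<bar> \<le> \<epsilon> / 2" by metis
  have "\<bar>g x - (\<Sum>i<N. a i * v i x)\<bar> \<le> \<epsilon>" if "x \<in> \<Omega>" for x
    using g'(2)[OF that] n(3)[OF that] by linarith
  with n show "\<exists>N a v. (\<forall>i<N. v i \<in> D) \<and> (\<Sum>i<(N::nat). \<bar>a i\<bar>) \<le> T \<and>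
     (\<forall>x\<in>\<Omega>. \<bar>g x - (\<Sum>i<N. a i * v i x)\<bar> \<le> \<epsilon>)" by blast
qed

lemma approx_hull_mono: "approx_hull \<Omega> D T g \<Longrightarrow> T \<le> T' \<Longrightarrow> approx_hull \<Omega> D T' g"
  unfolding approx_hull_def by (meson order_trans)

lemma approx_hull_cong: "(\<And>x. x \<in> \<Omega> \<Longrightarrow> g x = g' x) \<Longrightarrow> approx_hull \<Omega> D T g = approx_hull \<Omega> D T g'"
  unfolding approx_hull_def by simp

lemma approx_hull_zero: "approx_hull \<Omega> D 0 (\<lambda>x. 0)"
  unfolding approx_hull_def by (intro allI impI exI[of _ "0::nat"]) auto

lemma approx_hull_mem: "g \<in> D \<Longrightarrow> approx_hull \<Omega> D 1 g"
  unfolding approx_hull_def by (intro allI impI exI[of _ "Suc 0"] exI[of _ "\<lambda>_. 1"] exI[of _ "\<lambda>_. g"]) auto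

lemma approx_hull_scale:
  assumes "approx_hull \<Omega> D T g"
  shows "approx_hull \<Omega> D (\<bar>c\<bar> * T) (\<lambda>x. c * g x)"
  unfolding approx_hull_def
proof (intro allI impI)
  fix \<epsilon> :: real assume e: "\<epsilon> > 0"
  \<comment> \<open>The summand 1 keeps the quotient defined when \<open>c = 0\<close>.\<close>
  define \<delta> where "\<delta> = \<epsilon> / (\<bar>c\<bar> + 1)"
  have d: "\<delta> > 0" "\<bar>c\<bar> * \<delta> \<le> \<epsilon>" using e by (auto simp: \<delta>_def field_simps)
  from approx_hullE[OF assms d(1)] obtain N a v where n:
    "\<And>i. i < N \<Longrightarrow> v i \<in> D" "(\<Sum>i<(N::nat). \<bar>a i\<bar>) \<le> T"
    "\<And>x. x \<in> \<Omega> \<Longrightarrow> \<bar>g x - (\<Sum>i<N. a i * v i x)\<bar> \<le> \<delta>" by metis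
  show "\<exists>N a v. (\<forall>i<N. v i \<in> D) \<and> (\<Sum>i<(N::nat). \<bar>a i\<bar>) \<le> \<bar>c\<bar> * T \<and>
     (\<forall>x\<in>\<Omega>. \<bar>c * g x - (\<Sum>i<N. a i * v i x)\<bar> \<le> \<epsilon>)"
  proof (intro exI[of _ N] exI[of _ "\<lambda>i. c * a i"] exI[of _ v] conjI ballI)
    show "(\<Sum>i<N. \<bar>c * a i\<bar>) \<le> \<bar>c\<bar> * T"
      using n(2) by (simp add: abs_mult flip: sum_distrib_left) (simp add: mult_left_mono)
    fix x assume "x \<in> \<Omega>"
    have "\<bar>c * g x - (\<Sum>i<N. c * a i * v i x)\<bar> = \<bar>c\<bar> * \<bar>g x - (\<Sum>i<N. a i * v i x)\<bar>"
      by (simp add: abs_mult[symmetric] right_diff_distrib sum_distrib_left mult.assoc)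
    also have "\<dots> \<le> \<bar>c\<bar> * \<delta>" by (intro mult_left_mono n(3) \<open>x \<in> \<Omega>\<close>) auto
    finally show "\<bar>c * g x - (\<Sum>i<N. c * a i * v i x)\<bar> \<le> \<epsilon>" using d(2) by simp
  qed (use n in auto)
qed

lemma approx_hull_add:
  assumes "approx_hull \<Omega> D T g" "approx_hull \<Omega> D T' g'"
  shows "approx_hull \<Omega> D (T + T') (\<lambda>x. g x + g' x)"
  unfolding approx_hull_def
proof (intro allI impI)
  fix \<epsilon> :: real assume e: "\<epsilon> > 0"
  then have e2: "\<epsilon> / 2 > 0" by simp
  from approx_hullE[OF assms(1) e2] obtain N a v where n:
    "\<And>i. i < N \<Longrightarrow> v i \<in> D" "(\<Sum>i<(N::nat). \<bar>a i\<bar>) \<le> T"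
    "\<And>x. x \<in> \<Omega> \<Longrightarrow> \<bar>g x - (\<Sum>i<N. a i * v i x)\<bar> \<le> \<epsilon> / 2" by metis
  from approx_hullE[OF assms(2) e2] obtain N' a' v' where n':
    "\<And>i. i < N' \<Longrightarrow> v' i \<in> D" "(\<Sum>i<(N'::nat). \<bar>a' i\<bar>) \<le> T'"
    "\<And>x. x \<in> \<Omega> \<Longrightarrow> \<bar>g' x - (\<Sum>i<N'. a' i * v' i x)\<bar> \<le> \<epsilon> / 2" by metis
  have split: "(\<Sum>i<N + N'. F i) = (\<Sum>i<N. F i) + (\<Sum>i<N'. F (i + N))" for F :: "nat \<Rightarrow> real"
  proof -
    have "(\<Sum>i<N + N'. F i) = (\<Sum>i<N. F i) + (\<Sum>i=N..<N + N'. F i)"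
      by (metis lessThan_atLeast0 le_add1 sum.atLeastLessThan_concat zero_le)
    also have "(\<Sum>i=N..<N + N'. F i) = (\<Sum>i<N'. F (i + N))"
      using sum.shift_bounds_nat_ivl[of F 0 N N'] by (simp add: lessThan_atLeast0 add.commute)
    finally show ?thesis .
  qed
  let ?a = "\<lambda>i. if i < N then a i else a' (i - N)" and ?v = "\<lambda>i. if i < N then v i else v' (i - N)"
  show "\<exists>N a v. (\<forall>i<N. v i \<in> D) \<and> (\<Sum>i<(N::nat). \<bar>a i\<bar>) \<le> T + T' \<and>
     (\<forall>x\<in>\<Omega>. \<bar>g x + g' x - (\<Sum>i<N. a i * v i x)\<bar> \<le> \<epsilon>)"
  proof (intro exI[of _ "N + N'"] exI[of _ ?a] exI[of _ ?v] conjI ballI allI impI)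
    show "(\<Sum>i<N + N'. \<bar>?a i\<bar>) \<le> T + T'" unfolding split using n(2) n'(2) by simp
    fix x assume "x \<in> \<Omega>"
    then show "\<bar>g x + g' x - (\<Sum>i<N + N'. ?a i * ?v i x)\<bar> \<le> \<epsilon>"
      unfolding split using n(3)[of x] n'(3)[of x] by (simp only: abs_le_iff) simp
  qed (use n(1) n'(1) in auto)
qed

lemma approx_hull_sum:
  assumes "finite I" "\<And>i. i \<in> I \<Longrightarrow> approx_hull \<Omega> D (T i) (g i)"
  shows "approx_hull \<Omega> D (\<Sum>i\<in>I. T i) (\<lambda>x. \<Sum>i\<in>I. g i x)"
  using assms by (induction I) (auto simp: approx_hull_zero intro: approx_hull_add)

text \<open>A Riemann sum: cut \<open>S\<close> into small Borel pieces, replace \<open>V\<close> on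
  each piece by its value at a sample point, and take the integral of \<open>h\<close> over the
  piece as coefficient. The coefficients add up to at most the L^1 norm of \<open>h\<close> in
  absolute value. Since \<open>S\<close> may be unbounded, finitely many pieces are kept and the
  others are charged to the tail of \<open>h\<close>.\<close>

lemma approx_hull_integral:
  fixes h :: "'b::euclidean_space \<Rightarrow> real" and V :: "'b \<Rightarrow> 'x \<Rightarrow> real"
  assumes h: "integrable lborel h" and S: "S \<in> sets borel" and h0: "\<And>a. a \<notin> S \<Longrightarrow> h a = 0"
    and bound: "\<And>a x. a \<in> S \<Longrightarrow> x \<in> \<Omega> \<Longrightarrow> \<bar>V a x\<bar> \<le> M"
    and equi: "\<And>\<epsilon>. \<epsilon> > 0 \<Longrightarrow> \<exists>\<delta>>0. \<forall>a\<in>S. \<forall>b\<in>S. dist a b < \<delta> \<longrightarrow> (\<forall>x\<in>\<Omega>. \<bar>V a x - V b x\<bar> \<le> \<epsilon>)"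
    and meas: "\<And>x. x \<in> \<Omega> \<Longrightarrow> (\<lambda>a. h a * V a x) \<in> borel_measurable borel"
    and hull: "\<And>a. a \<in> S \<Longrightarrow> approx_hull \<Omega> D T (V a)" and T: "0 \<le> T"
  shows "approx_hull \<Omega> D (T * (LINT a|lborel. \<bar>h a\<bar>)) (\<lambda>x. LINT a|lborel. h a * V a x)"
proof (rule approx_hull_limit)
  fix \<epsilon> :: real assume e: "\<epsilon> > 0"
  define I where "I = (LINT a|lborel. \<bar>h a\<bar>)"
  \<comment> \<open>\<open>e1 * I\<close> pays for the variation of \<open>V\<close> inside the
    pieces, \<open>\<bar>M\<bar> * e1\<close> for the discarded ones.\<close>
  define e1 where "e1 = \<epsilon> / (I + \<bar>M\<bar> + 1)"
  have I0: "0 \<le> I" by (simp add: I_def)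
  have e1: "e1 > 0" using e I0 by (auto simp: e1_def intro!: divide_pos_pos)
  have "e1 * (I + \<bar>M\<bar> + 1) = \<epsilon>" using I0 by (simp add: e1_def)
  then have e1': "e1 * I + \<bar>M\<bar> * e1 \<le> \<epsilon>" using e1 by (simp add: algebra_simps)
  from equi[OF e1] obtain \<delta> where d: "\<delta> > 0"
    "\<And>a b x. a \<in> S \<Longrightarrow> b \<in> S \<Longrightarrow> dist a b < \<delta> \<Longrightarrow> x \<in> \<Omega> \<Longrightarrow> \<bar>V a x - V b x\<bar> \<le> e1" by metis
  \<comment> \<open>Balls around a countable dense set cover \<open>S\<close> without any
    compactness; making them disjoint keeps them Borel and small.\<close>
  obtain Q :: "'b set" where Q: "countable Q" "\<And>X. open X \<Longrightarrow> X \<noteq> {} \<Longrightarrow> \<exists>q\<in>Q. q \<in> X"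
    by (rule countable_dense_setE) blast
  have Qne: "Q \<noteq> {}" using Q(2)[of UNIV] by auto
  define q where "q = from_nat_into Q"
  define B where "B n = S \<inter> ball (q n) (\<delta> / 2)" for n
  define A where "A = disjointed B"
  have Bs: "B n \<in> sets borel" for n using S by (simp add: B_def)
  have As: "A n \<in> sets borel" for n
    unfolding A_def using sets.range_disjointed_sets[of B borel] Bs by (auto simp: image_subset_iff)
  have AB: "A n \<subseteq> B n" for n by (simp add: A_def disjointed_subset)
  have UA: "(\<Union>n. A n) = S"
  proof -
    have "a \<in> (\<Union>n. B n)" if "a \<in> S" for a
    proof -
      from Q(2)[of "ball a (\<delta> / 2)"] d obtain p where "p \<in> Q" "p \<in> ball a (\<delta> / 2)" by auto
      moreover obtain n where "q n = p"
        using from_nat_into_surj[OF Q(1) \<open>p \<in> Q\<close>] by (auto simp: q_def)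
      ultimately show ?thesis using that by (auto simp: B_def dist_commute)
    qed
    then show ?thesis unfolding A_def UN_disjointed_eq by (auto simp: B_def)
  qed
  have disj: "disjoint_family A" by (simp add: A_def disjoint_family_disjointed)
  have "\<exists>N. (LINT a|lborel. \<bar>h a\<bar> * indicator (- (\<Union>n<N. A n)) a) \<le> e1"
  proof -
    have "(\<lambda>N. LINT a|lborel. \<bar>h a\<bar> * indicator (- (\<Union>n<N. A n)) a) \<longlonglongrightarrow> (LINT a|(lborel::'b measure). 0)"
    proof (rule integral_dominated_convergence[where w="\<lambda>a. \<bar>h a\<bar>"])
      show "AE a in lborel. (\<lambda>N. \<bar>h a\<bar> * indicator (- (\<Union>n<N. A n)) a) \<longlonglongrightarrow> 0"
      proof (rule AE_I2)
        fix a
        show "(\<lambda>N. \<bar>h a\<bar> * indicator (- (\<Union>n<N. A n)) a) \<longlonglongrightarrow> 0"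
        proof (cases "a \<in> S")
          case True
          then obtain n where "a \<in> A n" using UA by auto
          then have "eventually (\<lambda>N. \<bar>h a\<bar> * indicator (- (\<Union>n<N. A n)) a = 0) sequentially"
            by (intro eventually_sequentiallyI[of "Suc n"]) (auto simp: indicator_def)
          then show ?thesis by (rule tendsto_eventually)
        qed (simp add: h0)
      qed
    qed (use h As in \<open>auto simp: indicator_def intro!: borel_measurable_times borel_measurable_indicator\<close>)
    then have "eventually (\<lambda>N. (LINT a|lborel. \<bar>h a\<bar> * indicator (- (\<Union>n<N. A n)) a) < e1) sequentially"
      using e1 by (auto intro: order_tendstoD)
    then show ?thesis by (auto simp: eventually_sequentially intro: less_imp_le)
  qed
  then obtain N where N: "(LINT a|lborel. \<bar>h a\<bar> * indicator (- (\<Union>n<N. A n)) a) \<le> e1" by auto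
  \<comment> \<open>On an empty piece the sample point is arbitrary and may lie outside
    \<open>S\<close>, but the coefficient \<open>c n\<close> is then 0.\<close>
  define p where "p n = (SOME a. a \<in> A n)" for n
  have p: "p n \<in> A n" if "a \<in> A n" for n a
    using that by (auto simp: p_def intro: someI)
  define c where "c n = (LINT a|lborel. h a * indicator (A n) a)" for n
  have hi: "integrable lborel (\<lambda>a. h a * indicator E a)" if "E \<in> sets borel" for E
    using integrable_mult_indicator[OF _ h, of E] that by (simp add: mult.commute)
  have ahi: "integrable lborel (\<lambda>a. \<bar>h a\<bar> * indicator E a)" if "E \<in> sets borel" for E
    using integrable_mult_indicator[OF _ integrable_abs[OF h], of E] that by (simp add: mult.commute)
  have c0: "c n = 0" if "A n = {}" for n using that by (simp add: c_def)
  define g' where "g' x = (\<Sum>n<N. c n * V (p n) x)" for x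
  have cs: "(\<Sum>n<N. \<bar>c n\<bar>) \<le> I"
  proof -
    have "(\<Sum>n<N. \<bar>c n\<bar>) \<le> (\<Sum>n<N. LINT a|lborel. \<bar>h a\<bar> * indicator (A n) a)"
      unfolding c_def
      by (intro sum_mono order_trans[OF integral_abs_bound]) (simp add: abs_mult)
    also have "\<dots> = (LINT a|lborel. (\<Sum>n<N. \<bar>h a\<bar> * indicator (A n) a))"
      by (rule Bochner_Integration.integral_sum[symmetric]) (auto intro: ahi As)
    also have "\<dots> \<le> I" unfolding I_def
    proof (rule integral_mono)
      fix a
      have "(\<Sum>n<N. indicator (A n) a) \<le> (1::real)"
      proof -
        have "(\<Sum>n<N. indicator (A n) a) = (indicator (\<Union>n<N. A n) a :: real)"
          by (rule indicator_UN_disjoint[symmetric]) (use disj in \<open>auto simp: disjoint_family_on_def\<close>)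
        then show ?thesis by (simp add: indicator_def)
      qed
      then have "\<bar>h a\<bar> * (\<Sum>n<N. indicator (A n) a) \<le> \<bar>h a\<bar> * 1" by (intro mult_left_mono) auto
      then show "(\<Sum>n<N. \<bar>h a\<bar> * indicator (A n) a) \<le> \<bar>h a\<bar>" by (simp add: sum_distrib_left)
    qed (rule Bochner_Integration.integrable_sum, rule ahi, rule As, rule integrable_abs[OF h])
    finally show ?thesis .
  qed
  have "approx_hull \<Omega> D (\<Sum>n<N. \<bar>c n\<bar> * T) g'"
    unfolding g'_def
  proof (rule approx_hull_sum)
    fix n assume "n \<in> {..<N}"
    show "approx_hull \<Omega> D (\<bar>c n\<bar> * T) (\<lambda>x. c n * V (p n) x)"
    proof (cases "A n = {}")
      case True
      then show ?thesis by (simp add: c0 approx_hull_zero)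
    next
      case False
      then have "p n \<in> S" using p AB by (auto simp: B_def)
      then show ?thesis by (intro approx_hull_scale hull)
    qed
  qed simp
  moreover have "(\<Sum>n<N. \<bar>c n\<bar> * T) \<le> T * I"
    using mult_right_mono[OF cs T] by (simp add: sum_distrib_left mult.commute)
  ultimately have "approx_hull \<Omega> D (T * (LINT a|lborel. \<bar>h a\<bar>)) g'"
    unfolding I_def by (rule approx_hull_mono)
  moreover have "\<forall>x\<in>\<Omega>. \<bar>(LINT a|lborel. h a * V a x) - g' x\<bar> \<le> \<epsilon>"
  proof
    fix x assume x: "x \<in> \<Omega>"
    \<comment> \<open>The step function in the parameter whose integral against \<open>h\<close> is
      the finite combination \<open>g' x\<close>.\<close>
    define W where "W a = (\<Sum>n<N. indicator (A n) a * V (p n) x)" for a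
    have hV: "integrable lborel (\<lambda>a. h a * V a x)"
    proof (rule Bochner_Integration.integrable_bound[where f="\<lambda>a. \<bar>M\<bar> * h a"])
      show "AE a in lborel. norm (h a * V a x) \<le> norm (\<bar>M\<bar> * h a)"
      proof (rule AE_I2)
        fix a
        show "norm (h a * V a x) \<le> norm (\<bar>M\<bar> * h a)"
        proof (cases "a \<in> S")
          case True
          then have "\<bar>V a x\<bar> \<le> \<bar>M\<bar>" using bound[OF True x] by simp
          then have "\<bar>h a\<bar> * \<bar>V a x\<bar> \<le> \<bar>h a\<bar> * \<bar>M\<bar>" by (intro mult_left_mono) auto
          then show ?thesis by (simp add: abs_mult mult.commute)
        qed (simp add: h0)
      qed
    qed (use h meas x in auto)
    have hW: "integrable lborel (\<lambda>a. h a * W a)" "(LINT a|lborel. h a * W a) = g' x"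
    proof -
      have *: "h a * W a = (\<Sum>n<N. h a * indicator (A n) a * V (p n) x)" for a
        unfolding W_def sum_distrib_left by (simp only: mult.assoc)
      show "integrable lborel (\<lambda>a. h a * W a)"
        unfolding * by (intro Bochner_Integration.integrable_sum integrable_mult_left hi As)
      show "(LINT a|lborel. h a * W a) = g' x"
        unfolding * g'_def c_def by (subst Bochner_Integration.integral_sum) (auto intro!: hi As)
    qed
    have i3: "integrable lborel (\<lambda>a. \<bar>h a\<bar> * indicator (- (\<Union>n<N. A n)) a)"
      by (rule ahi, rule borel_comp, rule sets.finite_UN) (use As in auto)
    have "(LINT a|lborel. h a * V a x) - g' x = (LINT a|lborel. h a * V a x - h a * W a)"
      using hV hW by simp
    also have "\<bar>\<dots>\<bar> \<le> (LINT a|lborel. \<bar>h a * V a x - h a * W a\<bar>)" by (rule integral_abs_bound)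
    also have "\<dots> \<le> (LINT a|lborel. e1 * \<bar>h a\<bar> + \<bar>M\<bar> * (\<bar>h a\<bar> * indicator (- (\<Union>n<N. A n)) a))"
    proof (rule integral_mono)
      fix a
      show "\<bar>h a * V a x - h a * W a\<bar> \<le> e1 * \<bar>h a\<bar> + \<bar>M\<bar> * (\<bar>h a\<bar> * indicator (- (\<Union>n<N. A n)) a)"
      proof (cases "a \<in> S")
        case True
        show ?thesis
        proof (cases "a \<in> (\<Union>n<N. A n)")
          case in_U: True
          then obtain n where n: "n < N" "a \<in> A n" by auto
          have "W a = (\<Sum>m<N. if m = n then V (p n) x else 0)"
            unfolding W_def
          proof (rule sum.cong[OF refl])
            fix m assume "m \<in> {..<N}"
            show "indicator (A m) a * V (p m) x = (if m = n then V (p n) x else 0)"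
              using n disj by (auto simp: disjoint_family_on_def indicator_def)
          qed
          then have W: "W a = V (p n) x" using n by simp
          have pn: "p n \<in> B n" "a \<in> B n" using n p AB by auto
          then have "dist a (p n) < \<delta>"
            using dist_triangle_half_r[of "q n" a \<delta> "p n"] by (auto simp: B_def)
          then have "\<bar>V a x - W a\<bar> \<le> e1" using d(2)[of a "p n" x] pn x by (auto simp: W B_def)
          then have "\<bar>h a\<bar> * \<bar>V a x - W a\<bar> \<le> \<bar>h a\<bar> * e1" by (intro mult_left_mono) auto
          then show ?thesis using in_U by (simp add: abs_mult[symmetric] right_diff_distrib mult.commute)
        next
          case False
          then have "W a = 0" by (simp add: W_def)
          moreover have "\<bar>V a x\<bar> \<le> \<bar>M\<bar>" using bound[OF True x] by simp
          then have "\<bar>h a\<bar> * \<bar>V a x\<bar> \<le> \<bar>h a\<bar> * \<bar>M\<bar>" by (intro mult_left_mono) auto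
          moreover have "0 \<le> e1 * \<bar>h a\<bar>" using e1 by simp
          ultimately show ?thesis using False by (simp add: abs_mult mult.commute)
        qed
      qed (simp add: h0)
    qed (intro Bochner_Integration.integrable_add integrable_mult_right integrable_abs
        Bochner_Integration.integrable_diff h hV hW(1) i3)+
    also have "\<dots> = e1 * I + \<bar>M\<bar> * (LINT a|lborel. \<bar>h a\<bar> * indicator (- (\<Union>n<N. A n)) a)"
      unfolding I_def using h i3 by (subst Bochner_Integration.integral_add) (auto simp del: Compl_UN)
    also have "\<dots> \<le> e1 * I + \<bar>M\<bar> * e1" by (intro add_left_mono mult_left_mono N) auto
    also have "\<dots> \<le> \<epsilon>" by (rule e1')
    finally show "\<bar>(LINT a|lborel. h a * V a x) - g' x\<bar> \<le> \<epsilon>" .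
  qed
  ultimately show "\<exists>g'. approx_hull \<Omega> D (T * (LINT a|lborel. \<bar>h a\<bar>)) g' \<and>
      (\<forall>x\<in>\<Omega>. \<bar>(LINT a|lborel. h a * V a x) - g' x\<bar> \<le> \<epsilon>)" by blast
qed

lemma approx_hull_bound:
  assumes "approx_hull \<Omega> D T g" and D: "\<And>v x. v \<in> D \<Longrightarrow> x \<in> \<Omega> \<Longrightarrow> \<bar>v x\<bar> \<le> M" and x: "x \<in> \<Omega>" and M: "0 \<le> M"
  shows "\<bar>g x\<bar> \<le> T * M"
proof (rule field_le_epsilon)
  fix e :: real assume "e > 0"
  from approx_hullE[OF assms(1) this] obtain N a v where n:
    "\<And>i. i < N \<Longrightarrow> v i \<in> D" "(\<Sum>i<(N::nat). \<bar>a i\<bar>) \<le> T"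
    "\<And>x. x \<in> \<Omega> \<Longrightarrow> \<bar>g x - (\<Sum>i<N. a i * v i x)\<bar> \<le> e" by metis
  have "\<bar>\<Sum>i<N. a i * v i x\<bar> \<le> (\<Sum>i<N. \<bar>a i\<bar> * M)"
    by (intro order_trans[OF sum_abs] sum_mono) (auto simp: abs_mult intro!: mult_left_mono D n x)
  also have "\<dots> \<le> T * M" using n(2) M by (simp add: sum_distrib_right[symmetric] mult_right_mono)
  finally show "\<bar>g x\<bar> \<le> T * M + e" using n(3)[OF x] by linarith
qed

section \<open>From uniform approximation to the variation norm\<close>

lemma dictionary_bound:
  assumes "v \<in> dictionary k c" "norm x \<le> R" "0 \<le> R" "0 \<le> c"
  shows "\<bar>v x\<bar> \<le> (R + c) ^ k"
proof -
  from assms obtain w b where v: "v = (\<lambda>x. relu_power k (w \<bullet> x - b))" "norm w = 1" "-c \<le> b" "b \<le> c"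
    by (auto simp: dictionary_def)
  have "w \<bullet> x \<le> R" using norm_cauchy_schwarz[of w x] v assms by simp
  then have "max (w \<bullet> x - b) 0 \<le> R + c" using v assms by simp
  then show ?thesis unfolding v relu_power_def by (simp add: power_mono)
qed

lemma dictionary_measurable: "v \<in> dictionary k c \<Longrightarrow> v \<in> borel_measurable borel"
  by (auto simp: dictionary_def relu_power_def)

lemma dictionary_nonempty: "0 \<le> c \<Longrightarrow> (dictionary k c :: (real^'n \<Rightarrow> real) set) \<noteq> {}"
proof -
  assume "0 \<le> c"
  then have "(\<lambda>x::real^'n. relu_power k (axis undefined 1 \<bullet> x - 0)) \<in> dictionary k c"
    unfolding dictionary_def by (intro CollectI exI[of _ "axis undefined 1"] exI[of _ 0]) auto
  then show ?thesis by blast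
qed

text \<open>The alternative \<open>\<Omega> = {}\<close> appears because \<open>B\<close> has no
  sign when there is no point at which it bounds anything.\<close>

lemma L2_bounded:
  assumes \<Omega>: "open \<Omega>" "bounded \<Omega>" and g: "(\<lambda>x. indicator \<Omega> x * g x) \<in> borel_measurable borel"
    and B: "\<And>x. x \<in> \<Omega> \<Longrightarrow> \<bar>g x\<bar> \<le> B"
  shows "g \<in> L2 \<Omega>" and "L2_norm_on \<Omega> g \<le> B * sqrt (measure lborel \<Omega>) \<or> \<Omega> = {}"
proof -
  have fin: "emeasure lborel \<Omega> < \<infinity>" using emeasure_bounded_finite[OF \<Omega>(2)] .
  have ci: "integrable lborel (\<lambda>x. indicator \<Omega> x * B\<^sup>2)"
    using fin \<Omega>(1) by (intro integrable_mult_left) (auto intro!: integrable_real_indicator)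
  have m: "(\<lambda>x. indicator \<Omega> x * (g x)\<^sup>2) \<in> borel_measurable borel"
  proof -
    have "(\<lambda>x. indicator \<Omega> x * (g x)\<^sup>2) = (\<lambda>x. (indicator \<Omega> x * g x)\<^sup>2)"
      by (auto simp: indicator_def)
    then show ?thesis using g by simp
  qed
  have le: "indicator \<Omega> x * (g x)\<^sup>2 \<le> indicator \<Omega> x * B\<^sup>2" for x
    using B[of x] by (auto simp: indicator_def intro!: abs_le_square_iff[THEN iffD1])
  have gi: "integrable lborel (\<lambda>x. indicator \<Omega> x * (g x)\<^sup>2)"
    by (rule Bochner_Integration.integrable_bound[OF ci]) (use m le in \<open>auto intro!: AE_I2\<close>)
  show "g \<in> L2 \<Omega>" using g gi by (simp add: L2_def set_borel_measurable_def set_integrable_def)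
  show "L2_norm_on \<Omega> g \<le> B * sqrt (measure lborel \<Omega>) \<or> \<Omega> = {}"
  proof (cases "\<Omega> = {}")
    case False
    then have B0: "0 \<le> B" using B by force
    have "(LINT x|lborel. indicator \<Omega> x * (g x)\<^sup>2) \<le> (LINT x|lborel. indicator \<Omega> x * B\<^sup>2)"
      by (rule integral_mono[OF gi ci le])
    also have "\<dots> = B\<^sup>2 * measure lborel \<Omega>" by simp
    finally have "L2_norm_on \<Omega> g \<le> sqrt (B\<^sup>2 * measure lborel \<Omega>)"
      by (simp add: L2_norm_on_def set_lebesgue_integral_def)
    then show ?thesis using B0 by (simp add: real_sqrt_mult)
  qed simp
qed

lemma approx_hull_variation:
  fixes \<Omega> :: "(real^'n) set"
  assumes \<Omega>: "open \<Omega>" "bounded \<Omega>" and c: "0 \<le> c" and t: "0 < t"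
    and g: "(\<lambda>x. indicator \<Omega> x * g x) \<in> borel_measurable borel"
    and hull: "approx_hull \<Omega> (dictionary k c) t g"
  shows "g \<in> variation_space \<Omega> (dictionary k c)" "variation_norm \<Omega> (dictionary k c) g \<le> ennreal t"
proof -
  obtain R where R: "\<And>x. x \<in> \<Omega> \<Longrightarrow> norm x \<le> R" "0 < R"
    using \<Omega>(2) by (meson bounded_pos)
  define M where "M = (R + c) ^ k"
  have M: "0 \<le> M" using R c by (simp add: M_def)
  have D: "\<bar>v x\<bar> \<le> M" if "v \<in> dictionary k c" "x \<in> \<Omega>" for v :: "real^'n \<Rightarrow> real" and x
    unfolding M_def using dictionary_bound that R c by (metis less_imp_le)
  have gb: "\<bar>g x\<bar> \<le> t * M" if "x \<in> \<Omega>" for x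
    using approx_hull_bound[OF hull, of M x] D that M by blast
  define h where "h x = g x / t" for x
  have hm: "(\<lambda>x. indicator \<Omega> x * h x) \<in> borel_measurable borel"
    using borel_measurable_divide[OF g, of "\<lambda>_. t"] by (simp add: h_def)
  have h2: "h \<in> L2 \<Omega>"
    by (rule L2_bounded(1)[OF \<Omega> hm, of M]) (use gb t in \<open>auto simp: h_def field_simps\<close>)
  have gL: "g \<in> L2 \<Omega>" by (rule L2_bounded(1)[OF \<Omega> g gb])
  have "h \<in> closed_hull \<Omega> (dictionary k c)"
    unfolding closed_hull_def
  proof (intro CollectI conjI allI impI h2)
    fix \<epsilon> :: real assume e: "\<epsilon> > 0"
    \<comment> \<open>A uniform error \<delta> on \<Omega> is an L^2 error of at most
      \<open>\<delta> * sqrt (measure lborel \<Omega>)\<close>.\<close>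
    define \<delta> where "\<delta> = \<epsilon> / (sqrt (measure lborel \<Omega>) + 1)"
    have d: "\<delta> > 0" "\<delta> * sqrt (measure lborel \<Omega>) < \<epsilon>"
      using e by (auto simp: \<delta>_def field_simps add_strict_increasing add_nonneg_pos
        intro!: divide_pos_pos real_sqrt_ge_zero)
    have "\<delta> * t > 0" using d t by simp
    from approx_hullE[OF hull this] obtain N a v where n:
      "\<And>i. i < N \<Longrightarrow> v i \<in> dictionary k c" "(\<Sum>i<(N::nat). \<bar>a i\<bar>) \<le> t"
      "\<And>x. x \<in> \<Omega> \<Longrightarrow> \<bar>g x - (\<Sum>i<N. a i * v i x)\<bar> \<le> \<delta> * t" by metis
    obtain v0 :: "real^'n \<Rightarrow> real" where v0: "v0 \<in> dictionary k c"
      using dictionary_nonempty[OF c] by blast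
    \<comment> \<open>Shift from \<open>{..<N}\<close> to \<open>{1..Suc N}\<close> with one padding
      term of coefficient 0: the convex combinations of the definition have at least one term,
      whereas \<open>N\<close> may be 0 here.\<close>
    define a' where "a' i = (if i \<le> N \<and> i \<ge> 1 then a (i - 1) / t else 0)" for i
    define v' where "v' i = (if i \<le> N \<and> i \<ge> 1 then v (i - 1) else v0)" for i
    define u where "u x = (\<Sum>i=1..Suc N. a' i * v' i x)" for x
    have shift: "(\<Sum>i=1..Suc N. F i) = (\<Sum>i<N. F (Suc i)) + F (Suc N)" for F :: "nat \<Rightarrow> real"
      by (simp add: sum.atLeast1_atMost_eq)
    have u: "u x = (\<Sum>i<N. a i * v i x) / t" for x
      unfolding u_def shift by (simp add: a'_def v'_def sum_divide_distrib)
    have "(\<Sum>i=1..Suc N. \<bar>a' i\<bar>) = (\<Sum>i<N. \<bar>a i\<bar>) / t"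
      unfolding shift using t by (simp add: a'_def sum_divide_distrib)
    then have "(\<Sum>i=1..Suc N. \<bar>a' i\<bar>) \<le> 1" using n(2) t by simp
    moreover have "\<forall>i\<in>{1..Suc N}. v' i \<in> dictionary k c" using n(1) v0 by (auto simp: v'_def)
    ultimately have uD: "u \<in> abs_convex_combinations (dictionary k c)"
      unfolding abs_convex_combinations_def u_def by (intro CollectI exI[of _ "Suc N"] exI[of _ a'] exI[of _ v']) auto
    have um: "u \<in> borel_measurable borel"
    proof -
      have "v' i \<in> dictionary k c" for i using n(1) v0 by (auto simp: v'_def)
      then show ?thesis unfolding u_def
        by (intro borel_measurable_sum borel_measurable_times borel_measurable_const dictionary_measurable)
    qed
    have "(\<lambda>x. indicator \<Omega> x * h x - indicator \<Omega> x * u x) \<in> borel_measurable borel"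
      using \<Omega>(1) by (intro borel_measurable_diff hm borel_measurable_times[OF borel_measurable_indicator um]) auto
    then have m: "(\<lambda>x. indicator \<Omega> x * (h x - u x)) \<in> borel_measurable borel"
      by (simp add: right_diff_distrib)
    have b: "\<bar>h x - u x\<bar> \<le> \<delta>" if "x \<in> \<Omega>" for x
      using n(3)[OF that] t by (simp add: h_def u field_simps flip: diff_divide_distrib)
    have "L2_norm_on \<Omega> (\<lambda>x. h x - u x) < \<epsilon>"
      using L2_bounded(2)[OF \<Omega> m b] d e by (auto simp: L2_norm_on_def set_lebesgue_integral_def)
    then show "\<exists>u\<in>abs_convex_combinations (dictionary k c). L2_norm_on \<Omega> (\<lambda>x. h x - u x) < \<epsilon>"
      using uD by blast
  qed
  moreover have "g = (\<lambda>x. t * h x)" using t by (auto simp: h_def)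
  ultimately have "g \<in> (\<lambda>h x. t * h x) ` closed_hull \<Omega> (dictionary k c)" by blast
  then show vn: "variation_norm \<Omega> (dictionary k c) g \<le> ennreal t"
    unfolding variation_norm_def using t by (intro Inf_lower) auto
  then show "g \<in> variation_space \<Omega> (dictionary k c)"
    using gL by (auto simp: variation_space_def intro: le_less_trans ennreal_less_top)
qed

section \<open>Growth of functions pairing with Schwartz functions\<close>

text \<open>The coefficient \<open>1 / R n ^ n\<close> eventually beats every fixed power of
  \<open>R n\<close>, and dilation by \<open>R n \<ge> 1\<close> only shrinks derivatives. Writing
  the series as an integral over counting measure makes
  \<open>has_derivative_integral_quadratic\<close> applicable.\<close>

lemma schwartz_lacunary_sum:
  fixes m :: "real^'n \<Rightarrow> real" and R :: "nat \<Rightarrow> real"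
  assumes m: "test_fun m" and m0: "\<And>x. 2 < norm x \<Longrightarrow> m x = 0" and R: "\<And>n. 2 ^ n \<le> R n"
  defines "S \<equiv> \<lambda>x. LINT n|count_space UNIV. 1 / R n ^ n * m ((1 / R n) *\<^sub>R x)"
  shows "S \<in> schwartz"
    and "\<And>x. integrable (count_space UNIV) (\<lambda>n. 1 / R n ^ n * m ((1 / R n) *\<^sub>R x))"
proof -
  have R1: "1 \<le> R n" for n using R[of n] one_le_power[of "2::real" n] by linarith
  then have R0: "0 < R n" for n using less_le_trans[OF zero_less_one] by blast
  \<comment> \<open>This class of coefficients is stable under the factor \<open>1 / R n\<close>
    that each differentiation produces.\<close>
  define good where "good c \<longleftrightarrow> (\<forall>n. \<bar>c n\<bar> \<le> 1 / R n ^ n)" for c :: "nat \<Rightarrow> real"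
  define Sg where "Sg c \<psi> = (\<lambda>x::real^'n. LINT n|count_space UNIV. c n * \<psi> ((1 / R n) *\<^sub>R x))" for c :: "nat \<Rightarrow> real" and \<psi> :: "real^'n \<Rightarrow> real"
  have Rp: "1 / R n ^ n \<le> 2 * (1 / 2) ^ n" for n
  proof (cases n)
    case (Suc k)
    have "2 ^ n \<le> R n ^ 1" using R[of n] by simp
    also have "R n ^ 1 \<le> R n ^ n" using R1[of n] Suc by (intro power_increasing) auto
    finally have "1 / R n ^ n \<le> 1 / 2 ^ n" by (intro divide_left_mono) (auto simp: R0)
    also have "\<dots> \<le> 2 * (1 / 2) ^ n" using divide_right_mono[of 1 2 "(2::real) ^ n"] by (simp add: power_one_over)
    finally show ?thesis .
  qed simp
  \<comment> \<open>Once \<open>n > N\<close>, the quotient is at most \<open>1 / R n\<close>, hence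
    at most \<open>(1 / 2) ^ n\<close>.\<close>
  have RN: "summable (\<lambda>n. R n ^ N / R n ^ n)" for N
  proof (rule summable_comparison_test_ev)
    show "\<forall>\<^sub>F n in sequentially. norm (R n ^ N / R n ^ n) \<le> (1 / 2) ^ n"
    proof (rule eventually_sequentiallyI)
      fix n assume n: "Suc N \<le> n"
      have "2 ^ n * R n ^ N \<le> R n * R n ^ N" using R[of n] R0[of n] by (intro mult_right_mono) auto
      also have "\<dots> = R n ^ Suc N" by simp
      also have "\<dots> \<le> R n ^ n" using n R1[of n] by (intro power_increasing) auto
      finally have "R n ^ N \<le> R n ^ n / 2 ^ n" by (simp add: pos_le_divide_eq mult.commute)
      then have "R n ^ N / R n ^ n \<le> (R n ^ n / 2 ^ n) / R n ^ n"
        using R0[of n] by (intro divide_right_mono) auto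
      also have "\<dots> = (1 / 2) ^ n" using R0[of n] by (simp add: power_one_over)
      finally show "norm (R n ^ N / R n ^ n) \<le> (1 / 2) ^ n" using R0[of n] by simp
    qed
  qed (simp add: summable_geometric)
  have sumc: "integrable (count_space UNIV) (\<lambda>n. c n * q n)" if c: "good c" and q: "\<And>n. \<bar>q n\<bar> \<le> B" for c q B
  proof -
    have "summable (\<lambda>n. norm (c n * q n))"
    proof (rule summable_comparison_test')
      show "summable (\<lambda>n. 1 / R n ^ n * B)" using summable_mult2[OF RN[of 0], of B] by simp
      fix n
      show "norm (norm (c n * q n)) \<le> 1 / R n ^ n * B"
      proof -
        have "\<bar>c n\<bar> * \<bar>q n\<bar> \<le> 1 / R n ^ n * B"
          using c q[of n] R0[of n] by (intro mult_mono) (auto simp: good_def)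
        then show ?thesis by (simp add: abs_mult)
      qed
    qed
    then show ?thesis by (simp add: integrable_count_space_nat_iff)
  qed
  have int: "integrable (count_space UNIV) (\<lambda>n. c n * \<psi> ((1 / R n) *\<^sub>R x))" if c: "good c" and t: "test_fun \<psi>" for c \<psi> x
  proof -
    obtain B where "\<And>x. \<bar>\<psi> x\<bar> \<le> B" using test_fun_bounded[OF t] by blast
    then show ?thesis by (intro sumc[OF c])
  qed
  have good': "good (\<lambda>n. c n * (1 / R n))" if "good c" for c
    unfolding good_def
  proof
    fix n
    have "\<bar>c n * (1 / R n)\<bar> \<le> \<bar>c n\<bar> * 1"
      unfolding abs_mult using R1[of n] by (intro mult_left_mono) auto
    then show "\<bar>c n * (1 / R n)\<bar> \<le> 1 / R n ^ n" using that by (auto simp: good_def intro: order_trans)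
  qed
  have deriv: "(Sg c \<psi> has_derivative (\<lambda>h. \<Sum>i\<in>UNIV. h $ i * Sg (\<lambda>n. c n * (1 / R n)) (partial_deriv i \<psi>) x)) (at x)"
    if c: "good c" and t: "test_fun \<psi>" for c \<psi> x
  proof -
    obtain B where B: "\<And>i j x. \<bar>partial_deriv j (partial_deriv i \<psi>) x\<bar> \<le> B" "0 \<le> B"
      using test_fun_partials_bounded[OF t] by blast
    define C where "C = (real CARD('n))\<^sup>2 * B"
    have C0: "0 \<le> C" using B by (simp add: C_def)
    show ?thesis
      unfolding Sg_def
    proof (rule has_derivative_integral_quadratic[where b="\<lambda>n. \<bar>c n\<bar> * C"])
    show "integrable (count_space UNIV) (\<lambda>n. \<bar>c n\<bar> * C)"
      by (rule sumc[where B=C]) (use c C0 in \<open>auto simp: good_def\<close>)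
    show "integrable (count_space UNIV) (\<lambda>n. c n * \<psi> ((1 / R n) *\<^sub>R y))" for y by (rule int[OF c t])
    show "integrable (count_space UNIV) (\<lambda>n. c n * (1 / R n) * partial_deriv i \<psi> ((1 / R n) *\<^sub>R x))" for i
      by (rule int[OF good'[OF c] test_fun_partial[OF t]])
    fix h n
    let ?e = "1 / R n"
    have "\<bar>\<psi> (?e *\<^sub>R x + ?e *\<^sub>R h) - \<psi> (?e *\<^sub>R x) - (\<Sum>i\<in>UNIV. (?e *\<^sub>R h) $ i * partial_deriv i \<psi> (?e *\<^sub>R x))\<bar> \<le> C * (norm (?e *\<^sub>R h))\<^sup>2"
      unfolding C_def by (rule smooth_quadratic[OF test_fun_smooth[OF t] B(1)])
    also have "\<dots> \<le> C * (norm h)\<^sup>2"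
    proof (intro mult_left_mono C0 power_mono)
      have "\<bar>?e\<bar> * norm h \<le> 1 * norm h" using R1[of n] by (intro mult_right_mono) auto
      then show "norm (?e *\<^sub>R h) \<le> norm h" by simp
    qed auto
    finally have "\<bar>c n\<bar> * \<bar>\<psi> (?e *\<^sub>R x + ?e *\<^sub>R h) - \<psi> (?e *\<^sub>R x) - (\<Sum>i\<in>UNIV. (?e *\<^sub>R h) $ i * partial_deriv i \<psi> (?e *\<^sub>R x))\<bar> \<le> \<bar>c n\<bar> * (C * (norm h)\<^sup>2)"
      by (intro mult_left_mono) auto
    moreover have "c n * \<psi> (?e *\<^sub>R (x + h)) - c n * \<psi> (?e *\<^sub>R x) - (\<Sum>i\<in>UNIV. h $ i * (c n * ?e * partial_deriv i \<psi> (?e *\<^sub>R x))) =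
      c n * (\<psi> (?e *\<^sub>R x + ?e *\<^sub>R h) - \<psi> (?e *\<^sub>R x) - (\<Sum>i\<in>UNIV. (?e *\<^sub>R h) $ i * partial_deriv i \<psi> (?e *\<^sub>R x)))"
      by (simp add: right_diff_distrib sum_distrib_left scaleR_add_right mult_ac)
    ultimately show "\<bar>c n * \<psi> (?e *\<^sub>R (x + h)) - c n * \<psi> (?e *\<^sub>R x) - (\<Sum>i\<in>UNIV. h $ i * (c n * ?e * partial_deriv i \<psi> (?e *\<^sub>R x)))\<bar> \<le> \<bar>c n\<bar> * C * (norm h)\<^sup>2"
      by (simp only: abs_mult mult.assoc)
    qed
  qed
  have iter: "\<exists>c' \<psi>'. good c' \<and> test_fun \<psi>' \<and> (\<forall>x. 2 < norm x \<longrightarrow> \<psi>' x = 0) \<and> iter_partial is (Sg c \<psi>) = Sg c' \<psi>'"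
    if c: "good c" and t: "test_fun \<psi>" and z: "\<And>x. 2 < norm x \<Longrightarrow> \<psi> x = 0" for c \<psi> "is"
  proof (induction "is")
    case Nil
    show ?case using c t z by (intro exI[of _ c] exI[of _ \<psi>]) simp
  next
    case (Cons i "is")
    then obtain c' \<psi>' where *: "good c'" "test_fun \<psi>'" "\<And>x. 2 < norm x \<Longrightarrow> \<psi>' x = 0" "iter_partial is (Sg c \<psi>) = Sg c' \<psi>'" by auto
    have "partial_deriv i (Sg c' \<psi>') = Sg (\<lambda>n. c' n * (1 / R n)) (partial_deriv i \<psi>')"
      using partial_deriv_coords[OF deriv[OF *(1,2)]] by (simp add: fun_eq_iff)
    moreover have "partial_deriv i \<psi>' x = 0" if "2 < norm x" for x
      by (rule partial_deriv_zero_outside[OF test_fun_smooth[OF *(2)] *(3) that])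
    ultimately show ?case
      using good'[OF *(1)] test_fun_partial[OF *(2), of i] *(4)
      by (intro exI[of _ "\<lambda>n. c' n * (1 / R n)"] exI[of _ "partial_deriv i \<psi>'"]) simp
  qed
  have decay: "\<exists>C. \<forall>x. (1 + norm x) ^ N * \<bar>Sg c \<psi> x\<bar> \<le> C"
    if c: "good c" and t: "test_fun \<psi>" and z: "\<And>x. 2 < norm x \<Longrightarrow> \<psi> x = 0" for c \<psi> N
  proof -
    obtain B where B: "\<And>x. \<bar>\<psi> x\<bar> \<le> B" "0 \<le> B" using test_fun_bounded[OF t] by blast
    have RNi: "integrable (count_space UNIV) (\<lambda>n. (3 ^ N * B) * (R n ^ N / R n ^ n))"
    proof -
      have "norm ((3 ^ N * B) * (R n ^ N / R n ^ n)) = (3 ^ N * B) * (R n ^ N / R n ^ n)" for n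
      proof -
        have "0 \<le> (3 ^ N * B) * (R n ^ N / R n ^ n)"
          using R0[of n] B(2) by (intro mult_nonneg_nonneg divide_nonneg_nonneg) auto
        then show ?thesis unfolding real_norm_def by (rule abs_of_nonneg)
      qed
      then show ?thesis
        using summable_mult[OF RN[of N], of "3 ^ N * B"] by (simp only: integrable_count_space_nat_iff)
    qed
    have "(1 + norm x) ^ N * \<bar>Sg c \<psi> x\<bar> \<le> (LINT n|count_space UNIV. (3 ^ N * B) * (R n ^ N / R n ^ n))" for x
    proof -
      have "(1 + norm x) ^ N * \<bar>Sg c \<psi> x\<bar> \<le> (1 + norm x) ^ N * (LINT n|count_space UNIV. \<bar>c n * \<psi> ((1 / R n) *\<^sub>R x)\<bar>)"
        unfolding Sg_def by (intro mult_left_mono integral_abs_bound) auto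
      also have "\<dots> = (LINT n|count_space UNIV. (1 + norm x) ^ N * \<bar>c n * \<psi> ((1 / R n) *\<^sub>R x)\<bar>)" by simp
      also have "\<dots> \<le> (LINT n|count_space UNIV. (3 ^ N * B) * (R n ^ N / R n ^ n))"
      proof (rule integral_mono[OF _ RNi])
        show "integrable (count_space UNIV) (\<lambda>n. (1 + norm x) ^ N * \<bar>c n * \<psi> ((1 / R n) *\<^sub>R x)\<bar>)"
          by (intro integrable_mult_right integrable_abs int c t)
        fix n
        show "(1 + norm x) ^ N * \<bar>c n * \<psi> ((1 / R n) *\<^sub>R x)\<bar> \<le> (3 ^ N * B) * (R n ^ N / R n ^ n)"
        proof (cases "2 < norm ((1 / R n) *\<^sub>R x)")
          case True
          then show ?thesis using z R0[of n] B(2) by simp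
        next
          case False
          then have "norm x / R n \<le> 2" using R0[of n] by simp
          then have "norm x \<le> 2 * R n" using R0[of n] by (simp only: pos_divide_le_eq)
          \<comment> \<open>On the support of the dilated bump the weight is at most
            \<open>1 + 2 * R n\<close>, and \<open>R n \<ge> 1\<close> gives the factor 3.\<close>
          then have "(1 + norm x) ^ N \<le> (3 * R n) ^ N" using R1[of n] by (intro power_mono) auto
          moreover have "\<bar>c n * \<psi> ((1 / R n) *\<^sub>R x)\<bar> \<le> 1 / R n ^ n * B"
            unfolding abs_mult using c B R0[of n] by (intro mult_mono) (auto simp: good_def)
          ultimately have "(1 + norm x) ^ N * \<bar>c n * \<psi> ((1 / R n) *\<^sub>R x)\<bar> \<le> (3 * R n) ^ N * (1 / R n ^ n * B)"
            using R0[of n] by (intro mult_mono) auto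
          then show ?thesis by (simp add: power_mult_distrib mult_ac)
        qed
      qed
      finally show ?thesis .
    qed
    then show ?thesis by blast
  qed
  have g0: "good (\<lambda>n. 1 / R n ^ n)" by (simp add: good_def abs_of_pos[OF zero_less_power[OF R0]])
  have S: "S = Sg (\<lambda>n. 1 / R n ^ n) m" by (simp add: S_def Sg_def)
  show "integrable (count_space UNIV) (\<lambda>n. 1 / R n ^ n * m ((1 / R n) *\<^sub>R x))" for x by (rule int[OF g0 m])
  show "S \<in> schwartz"
    unfolding schwartz_iff smooth_def
  proof (intro conjI allI)
    fix "is" N
    obtain c' \<psi>' where *: "good c'" "test_fun \<psi>'" "\<And>x. 2 < norm x \<Longrightarrow> \<psi>' x = 0" "iter_partial is S = Sg c' \<psi>'"
      using iter[OF g0 m m0, of "is"] unfolding S by blast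
    show "iter_partial is S differentiable_on UNIV"
      unfolding *(4) differentiable_on_def differentiable_def using deriv[OF *(1,2)] by auto
    show "\<exists>C. \<forall>x. (1 + norm x) ^ N * \<bar>iter_partial is S x\<bar> \<le> C"
      unfolding *(4) by (rule decay[OF *(1-3)])
  qed
qed

text \<open>A function that pairs absolutely with every Schwartz function has polynomial mass growth:
  otherwise a lacunary sum of dilated bumps would be a Schwartz function pairing to \<open>\<infinity>\<close>.\<close>

lemma schwartz_pairing_growth:
  fixes r \<phi>0 :: "real^'n \<Rightarrow> real"
  assumes LP: "LP_generator \<phi>0" and rm: "r \<in> borel_measurable borel"
    and pair: "\<And>\<phi>. \<phi> \<in> schwartz \<Longrightarrow> integrable lborel (\<lambda>x. r x * \<phi> x)"
  shows "\<And>\<rho>. integrable lborel (\<lambda>x. \<bar>r x\<bar> * indicator (cball 0 \<rho>) x)"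
    and "\<exists>N C. \<forall>\<rho>\<ge>1. (LINT x|lborel. \<bar>r x\<bar> * indicator (cball 0 \<rho>) x) \<le> C * \<rho> ^ N"
proof -
  have t: "test_fun \<phi>0" by (rule LP_test_fun[OF LP])
  have b01: "0 \<le> \<phi>0 x" "\<phi>0 x \<le> 1" for x
  proof -
    have "\<forall>x. 0 \<le> \<phi>0 x \<and> \<phi>0 x \<le> 1" using LP unfolding LP_generator_def by (elim conjE)
    then show "0 \<le> \<phi>0 x" "\<phi>0 x \<le> 1" by auto
  qed
  let ?I = "\<lambda>\<rho>. LINT x|lborel. \<bar>r x\<bar> * indicator (cball 0 \<rho>) x"
  have ind: "indicator (cball 0 \<rho>) x \<le> \<phi>0 ((1 / \<rho>) *\<^sub>R x)" if "0 < \<rho>" for \<rho> and x :: "real^'n"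
  proof (cases "norm x \<le> \<rho>")
    case True
    then have "norm x / \<rho> \<le> 1" using that by (simp only: pos_divide_le_eq mult_1)
    then have "norm ((1 / \<rho>) *\<^sub>R x) \<le> 1" using that by simp
    then have "\<phi>0 ((1 / \<rho>) *\<^sub>R x) = 1" by (rule LP_one[OF LP])
    then show ?thesis by (simp add: indicator_def)
  qed (simp add: b01)
  have loc': "integrable lborel (\<lambda>x. \<bar>r x\<bar> * indicator (cball 0 \<rho>) x)" if r0: "0 < \<rho>" for \<rho>
  proof (rule Bochner_Integration.integrable_bound)
    have "test_fun (\<lambda>x. \<phi>0 (0 + (1 / \<rho>) *\<^sub>R x))" by (rule test_fun_affine[OF t]) (use r0 in simp)
    then show "integrable lborel (\<lambda>x. r x * \<phi>0 (0 + (1 / \<rho>) *\<^sub>R x))" by (intro pair test_fun_schwartz)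
    show "AE x in lborel. norm (\<bar>r x\<bar> * indicator (cball 0 \<rho>) x) \<le> norm (r x * \<phi>0 (0 + (1 / \<rho>) *\<^sub>R x))"
      using ind[OF r0] b01 by (auto simp: abs_mult intro!: mult_left_mono)
  qed (intro borel_measurable_times borel_measurable_abs borel_measurable_indicator, use rm in auto)
  show loc: "integrable lborel (\<lambda>x. \<bar>r x\<bar> * indicator (cball 0 \<rho>) x)" for \<rho>
  proof (rule Bochner_Integration.integrable_bound[OF loc'[of "\<bar>\<rho>\<bar> + 1"]])
    show "AE x in lborel. norm (\<bar>r x\<bar> * indicator (cball 0 \<rho>) x) \<le> norm (\<bar>r x\<bar> * indicator (cball 0 (\<bar>\<rho>\<bar> + 1)) x)"
      by (auto simp: indicator_def)
  qed (auto intro!: borel_measurable_times borel_measurable_abs borel_measurable_indicator rm)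
  have mono: "?I \<rho> \<le> ?I \<rho>'" if "\<rho> \<le> \<rho>'" for \<rho> \<rho>'
    by (rule integral_mono[OF loc loc]) (use that in \<open>auto simp: indicator_def\<close>)
  show "\<exists>N C. \<forall>\<rho>\<ge>1. ?I \<rho> \<le> C * \<rho> ^ N"
  proof (rule ccontr)
    assume neg: "\<not> (\<exists>N C. \<forall>\<rho>\<ge>1. ?I \<rho> \<le> C * \<rho> ^ N)"
    have "\<exists>\<rho>. 2 ^ n \<le> \<rho> \<and> real n * \<rho> ^ n \<le> ?I \<rho>" for n
    proof -
      \<comment> \<open>One constant serves two ends: the first summand, with monotonicity of the
        mass in \<rho>, forces \<open>2 ^ n \<le> \<rho>\<close>; the second gives
        \<open>real n * \<rho> ^ n \<le> ?I \<rho>\<close>.\<close>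
      define C where "C = ?I (2 ^ n) + real n"
      have I0: "0 \<le> ?I (2 ^ n)" by simp
      obtain \<rho> where \<rho>: "\<rho> \<ge> 1" "C * \<rho> ^ n < ?I \<rho>" using neg by (meson not_le)
      have p1: "1 \<le> \<rho> ^ n" using \<rho>(1) by (rule one_le_power)
      have "2 ^ n \<le> \<rho>"
      proof (rule ccontr)
        assume "\<not> 2 ^ n \<le> \<rho>"
        then have "?I \<rho> \<le> ?I (2 ^ n)" by (intro mono) simp
        also have "\<dots> \<le> C * 1" by (simp add: C_def)
        also have "\<dots> \<le> C * \<rho> ^ n" using p1 I0 by (intro mult_left_mono) (auto simp: C_def)
        finally show False using \<rho>(2) by simp
      qed
      moreover have "real n * \<rho> ^ n \<le> C * \<rho> ^ n" using p1 I0 by (intro mult_right_mono) (auto simp: C_def)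
      ultimately show ?thesis using \<rho>(2) by (intro exI[of _ \<rho>]) simp
    qed
    then have "\<forall>n. \<exists>\<rho>. 2 ^ n \<le> \<rho> \<and> real n * \<rho> ^ n \<le> ?I \<rho>" by blast
    from choice[OF this] obtain R where R: "\<And>n. 2 ^ n \<le> R n" "\<And>n. real n * R n ^ n \<le> ?I (R n)" by blast
    have R0: "0 < R n" for n using R(1)[of n] by (rule less_le_trans[rotated]) simp
    define S where "S x = (LINT n|count_space UNIV. 1 / R n ^ n * \<phi>0 ((1 / R n) *\<^sub>R x))" for x
    have Ss: "S \<in> schwartz" unfolding S_def by (rule schwartz_lacunary_sum(1)[OF t LP_zero[OF LP] R(1)])
    have Si: "integrable (count_space UNIV) (\<lambda>n. 1 / R n ^ n * \<phi>0 ((1 / R n) *\<^sub>R x))" for x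
      by (rule schwartz_lacunary_sum(2)[OF t LP_zero[OF LP] R(1)])
    \<comment> \<open>All terms are nonnegative, so any single one bounds \<open>S\<close> from
      below, and on the ball of radius \<open>R n\<close> the bump of index \<open>n\<close> is 1.
      The pairing of \<open>S\<close> with \<open>\<bar>r\<bar>\<close> then exceeds every
      integer.\<close>
    have low: "1 / R n ^ n * indicator (cball 0 (R n)) x \<le> S x" for n x
    proof -
      have sm: "summable (\<lambda>n. 1 / R n ^ n * \<phi>0 ((1 / R n) *\<^sub>R x))"
        using Si[of x] by (simp add: integrable_count_space_nat_iff summable_norm_cancel)
      have "1 / R n ^ n * indicator (cball 0 (R n)) x \<le> 1 / R n ^ n * \<phi>0 ((1 / R n) *\<^sub>R x)"
        using R0[of n] by (intro mult_left_mono ind) auto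
      also have "\<dots> = (\<Sum>k\<in>{n}. 1 / R k ^ k * \<phi>0 ((1 / R k) *\<^sub>R x))" by simp
      also have "\<dots> \<le> (\<Sum>k. 1 / R k ^ k * \<phi>0 ((1 / R k) *\<^sub>R x))"
        using R0 b01 by (intro sum_le_suminf sm) (auto intro!: divide_nonneg_nonneg simp: less_imp_le)
      also have "\<dots> = S x" unfolding S_def by (rule integral_count_space_nat[OF Si, symmetric])
      finally show ?thesis .
    qed
    have rS: "integrable lborel (\<lambda>x. \<bar>r x * S x\<bar>)" by (intro integrable_abs pair Ss)
    have "real n \<le> (LINT x|lborel. \<bar>r x * S x\<bar>)" for n
    proof -
      have "real n = 1 / R n ^ n * (real n * R n ^ n)" using R0[of n] by simp
      also have "\<dots> \<le> 1 / R n ^ n * ?I (R n)" using R(2)[of n] R0[of n] by (intro mult_left_mono) auto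
      also have "\<dots> = (LINT x|lborel. 1 / R n ^ n * (\<bar>r x\<bar> * indicator (cball 0 (R n)) x))" by simp
      also have "\<dots> \<le> (LINT x|lborel. \<bar>r x * S x\<bar>)"
      proof (rule integral_mono[OF integrable_mult_right[OF loc] rS])
        fix x :: "real^'n"
        have "0 \<le> 1 / R n ^ n * indicator (cball 0 (R n)) x" using R0[of n] by simp
        then have "1 / R n ^ n * indicator (cball 0 (R n)) x \<le> \<bar>S x\<bar>" using low[of n x] by linarith
        then have "\<bar>r x\<bar> * (1 / R n ^ n * indicator (cball 0 (R n)) x) \<le> \<bar>r x\<bar> * \<bar>S x\<bar>" by (intro mult_left_mono) auto
        then show "1 / R n ^ n * (\<bar>r x\<bar> * indicator (cball 0 (R n)) x) \<le> \<bar>r x * S x\<bar>" by (simp add: abs_mult mult_ac)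
      qed
      finally show ?thesis .
    qed
    then show False using reals_Archimedean2[of "LINT x|lborel. \<bar>r x * S x\<bar>"] by (meson not_le)
  qed
qed

text \<open>Dyadic summation: dividing by one power more than the growth exponent leaves the
  geometric series \<open>(1 / 2) ^ j\<close> over the balls of radius \<open>2 ^ j\<close>.\<close>

lemma schwartz_pairing_weight:
  fixes r \<phi>0 :: "real^'n \<Rightarrow> real"
  assumes LP: "LP_generator \<phi>0" and rm: "r \<in> borel_measurable borel"
    and pair: "\<And>\<phi>. \<phi> \<in> schwartz \<Longrightarrow> integrable lborel (\<lambda>x. r x * \<phi> x)"
  shows "\<exists>N. integrable lborel (\<lambda>x. \<bar>r x\<bar> / (1 + norm x) ^ N)"
proof -
  have loc: "integrable lborel (\<lambda>x. \<bar>r x\<bar> * indicator (cball 0 \<rho>) x)" for \<rho>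
    by (rule schwartz_pairing_growth(1)[OF LP rm pair])
  obtain N C where NC: "\<And>\<rho>. \<rho> \<ge> 1 \<Longrightarrow> (LINT x|lborel. \<bar>r x\<bar> * indicator (cball 0 \<rho>) x) \<le> C * \<rho> ^ N"
    using schwartz_pairing_growth(2)[OF LP rm pair] by blast
  let ?a = "\<lambda>j. 2 ^ Suc N / 2 ^ (j * Suc N) :: real"
  let ?s = "\<lambda>j x. ?a j * (\<bar>r x\<bar> * indicator (cball 0 (2 ^ j)) x)"
  have si: "integrable lborel (?s j)" for j by (intro integrable_mult_right loc)
  have le: "ennreal (\<bar>r x\<bar> / (1 + norm x) ^ Suc N) \<le> (\<Sum>j. ennreal (?s j x))" for x
  proof -
    obtain j0 where "1 + norm x < 2 ^ j0" using real_arch_pow[of 2 "1 + norm x"] by auto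
    then have ex: "\<exists>j. 1 + norm x \<le> (2::real) ^ j" by (auto intro: less_imp_le)
    \<comment> \<open>The least such \<open>j\<close> makes \<open>2 ^ j\<close> comparable to
      \<open>1 + norm x\<close> from both sides; the factor 2 lost here is the
      \<open>2 ^ Suc N\<close> in \<open>?a\<close>.\<close>
    define j where "j = (LEAST j. 1 + norm x \<le> (2::real) ^ j)"
    have j: "1 + norm x \<le> 2 ^ j" unfolding j_def by (rule LeastI_ex[OF ex])
    have j2: "2 ^ j \<le> 2 * (1 + norm x)"
    proof (cases j)
      case (Suc i)
      then have "\<not> 1 + norm x \<le> 2 ^ i" using not_less_Least[of i "\<lambda>j. 1 + norm x \<le> (2::real) ^ j"] by (simp add: j_def)
      then show ?thesis using Suc by simp
    qed simp
    have p: "0 < (1 + norm x) ^ Suc N" by (intro zero_less_power) (simp add: add_pos_nonneg)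
    have "(2 ^ j) ^ Suc N \<le> (2 * (1 + norm x)) ^ Suc N" using j2 by (intro power_mono) auto
    then have "1 / (1 + norm x) ^ Suc N \<le> ?a j"
      unfolding power_mult[symmetric] power_mult_distrib using p
      by (simp only: pos_divide_le_eq) (simp only: times_divide_eq_left pos_le_divide_eq zero_less_power zero_less_numeral mult_1)
    then have "\<bar>r x\<bar> * (1 / (1 + norm x) ^ Suc N) \<le> \<bar>r x\<bar> * ?a j" by (intro mult_left_mono) auto
    then have "\<bar>r x\<bar> / (1 + norm x) ^ Suc N \<le> ?s j x" using j by (simp add: mult_ac)
    then have "ennreal (\<bar>r x\<bar> / (1 + norm x) ^ Suc N) \<le> ennreal (?s j x)" by (rule ennreal_leI)
    also have "\<dots> = (\<Sum>k\<in>{j}. ennreal (?s k x))" by simp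
    also have "\<dots> \<le> (\<Sum>j. ennreal (?s j x))" by (rule sum_le_suminf) auto
    finally show ?thesis .
  qed
  have bnd: "(LINT x|lborel. ?s j x) \<le> (2 ^ Suc N * \<bar>C\<bar>) * (1 / 2) ^ j" for j
  proof -
    have "(LINT x|lborel. ?s j x) = ?a j * (LINT x|lborel. \<bar>r x\<bar> * indicator (cball 0 (2 ^ j)) x)" by simp
    also have "\<dots> \<le> ?a j * (\<bar>C\<bar> * (2 ^ j) ^ N)"
    proof (rule mult_left_mono)
      have "(LINT x|lborel. \<bar>r x\<bar> * indicator (cball 0 (2 ^ j)) x) \<le> C * (2 ^ j) ^ N" by (rule NC) simp
      also have "\<dots> \<le> \<bar>C\<bar> * (2 ^ j) ^ N" by (intro mult_right_mono) auto
      finally show "(LINT x|lborel. \<bar>r x\<bar> * indicator (cball 0 (2 ^ j)) x) \<le> \<bar>C\<bar> * (2 ^ j) ^ N" .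
    qed simp
    also have "\<dots> = (2 ^ Suc N * \<bar>C\<bar>) * (1 / 2) ^ j"
    proof -
      have "(2::real) ^ (j * Suc N) = 2 ^ j * (2 ^ j) ^ N" by (simp add: power_add power_mult)
      then show ?thesis by (simp add: power_one_over)
    qed
    finally show ?thesis .
  qed
  have "(\<integral>\<^sup>+x. ennreal (\<bar>r x\<bar> / (1 + norm x) ^ Suc N) \<partial>lborel) \<le> (\<integral>\<^sup>+x. (\<Sum>j. ennreal (?s j x)) \<partial>lborel)"
    by (intro nn_integral_mono le)
  also have "\<dots> = (\<Sum>j. \<integral>\<^sup>+x. ennreal (?s j x) \<partial>lborel)"
    using si by (intro nn_integral_suminf) auto
  also have "\<dots> = (\<Sum>j. ennreal (LINT x|lborel. ?s j x))"
    using si by (intro suminf_cong nn_integral_eq_integral) auto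
  also have "\<dots> \<le> (\<Sum>j. ennreal ((2 ^ Suc N * \<bar>C\<bar>) * (1 / 2) ^ j))"
    by (intro suminf_le ennreal_leI bnd) auto
  also have "\<dots> = ennreal (\<Sum>j. (2 ^ Suc N * \<bar>C\<bar>) * (1 / 2) ^ j)"
    by (intro suminf_ennreal2 summable_mult summable_geometric) auto
  also have "\<dots> < \<infinity>" by simp
  finally have fin: "(\<integral>\<^sup>+x. ennreal (\<bar>r x\<bar> / (1 + norm x) ^ Suc N) \<partial>lborel) < \<infinity>" .
  have "integrable lborel (\<lambda>x. \<bar>r x\<bar> / (1 + norm x) ^ Suc N)"
    by (rule integrableI_nonneg) (use rm fin in \<open>auto simp del: power_Suc\<close>)
  then show ?thesis by blast
qed

text \<open>Inner regularity: if \<open>g\<close> were positive on a set of positive measure, so it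
  would be on a non-null compact set, over which its integral could not vanish.\<close>

lemma AE_zero_if_compact_integrals:
  fixes g :: "'a::euclidean_space \<Rightarrow> real"
  assumes gm: "g \<in> borel_measurable borel" and loc: "\<And>\<rho>. integrable lborel (\<lambda>x. g x * indicator (cball 0 \<rho>) x)"
    and zero: "\<And>T. compact T \<Longrightarrow> (LINT x|lborel. g x * indicator T x) = 0"
  shows "AE x in lborel. g x \<le> 0"
proof (rule ccontr)
  assume neg: "\<not> (AE x in lborel. g x \<le> 0)"
  \<comment> \<open>Intersecting with balls gives finite measure, and makes the closed set obtained
    below compact.\<close>
  define E where "E n = {x. 0 < g x} \<inter> cball 0 (real n)" for n
  have Es: "E n \<in> sets borel" for n unfolding E_def using gm by measurable
  have "\<exists>n. emeasure lborel (E n) \<noteq> 0"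
  proof (rule ccontr)
    assume "\<not> (\<exists>n. emeasure lborel (E n) \<noteq> 0)"
    then have "E n \<in> null_sets lborel" for n using Es by (auto simp: null_sets_def)
    then have "(\<Union>n. E n) \<in> null_sets lborel" by (rule null_sets_UN)
    then have "AE x in lborel. x \<notin> (\<Union>n. E n)" by (rule AE_not_in)
    moreover have "g x \<le> 0" if "x \<notin> (\<Union>n. E n)" for x
    proof (rule ccontr)
      assume "\<not> g x \<le> 0"
      moreover obtain n where "norm x \<le> real n" using real_arch_simple by blast
      ultimately show False using that by (auto simp: E_def)
    qed
    ultimately have "AE x in lborel. g x \<le> 0" by (rule eventually_mono)
    with neg show False by simp
  qed
  then obtain n where n: "emeasure lborel (E n) \<noteq> 0" by blast
  have Ef: "emeasure lborel (E n) < \<infinity>"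
    by (rule emeasure_bounded_finite) (auto simp: E_def intro: bounded_subset[OF bounded_cball])
  define e where "e = measure lborel (E n)"
  have e: "emeasure lborel (E n) = ennreal e" unfolding e_def using Ef by (simp add: emeasure_eq_ennreal_measure)
  have "e \<noteq> 0" using n e by auto
  moreover have "0 \<le> e" by (simp add: e_def)
  ultimately have e0: "0 < e" by simp
  have "E n \<in> sets lebesgue" using Es by (simp add: sets_completionI_sets)
  from this e0 obtain T where T: "closed T" "T \<subseteq> E n" "E n - T \<in> lmeasurable" "emeasure lebesgue (E n - T) < ennreal e"
    by (rule sets_lebesgue_inner_closed)
  have Tc: "compact T" unfolding compact_eq_bounded_closed
    using T by (auto simp: E_def intro: bounded_subset[OF bounded_cball])
  have Ts: "T \<in> sets borel" using T(1) by simp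
  have "emeasure lborel T \<noteq> 0"
  proof
    assume T0: "emeasure lborel T = 0"
    have "emeasure lborel (E n) \<le> emeasure lborel (E n - T) + emeasure lborel T"
      using emeasure_subadditive[of "E n - T" lborel T] Es Ts T(2) by (simp add: Un_absorb2)
    also have "emeasure lborel (E n - T) = emeasure lebesgue (E n - T)" using Es Ts by simp
    finally show False using T(4) T0 e by simp
  qed
  moreover have "AE x in lborel. g x * indicator T x = 0"
  proof (rule integral_nonneg_eq_0_iff_AE[THEN iffD1])
    have "integrable lborel (\<lambda>x. indicator T x *\<^sub>R (g x * indicator (cball 0 (real n)) x))"
      by (rule integrable_mult_indicator[OF _ loc]) (use Ts in simp)
    moreover have "indicator T x *\<^sub>R (g x * indicator (cball 0 (real n)) x) = g x * indicator T x" for x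
      using T(2) by (auto simp: indicator_def E_def)
    ultimately show "integrable lborel (\<lambda>x. g x * indicator T x)" by (simp only:)
    show "AE x in lborel. 0 \<le> g x * indicator T x" using T(2) by (auto simp: indicator_def E_def intro!: AE_I2)
    show "(LINT x|lborel. g x * indicator T x) = 0" by (rule zero[OF Tc])
  qed
  then have "AE x in lborel. x \<notin> T"
    by (rule AE_mp[OF _ AE_I2]) (use T(2) in \<open>auto simp: indicator_def E_def\<close>)
  then have "emeasure lborel T = 0" using Ts by (subst (asm) AE_iff_measurable[where N=T]) auto
  ultimately show False by simp
qed

text \<open>The indicator of a compact set is a decreasing limit of Lipschitz functions of the
  distance to it, all supported within distance 1. The previous lemma is then applied to
  \<open>g\<close> and to \<open>- g\<close>.\<close>

lemma AE_zero_if_lipschitz_integrals: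
  fixes g :: "real^'n \<Rightarrow> real"
  assumes gm: "g \<in> borel_measurable borel" and loc: "\<And>\<rho>. integrable lborel (\<lambda>x. g x * indicator (cball 0 \<rho>) x)"
    and zero: "\<And>w L \<rho>. (\<And>x y. \<bar>w x - w y\<bar> \<le> L * norm (x - y)) \<Longrightarrow> (\<And>x. \<rho> < norm x \<Longrightarrow> w x = 0) \<Longrightarrow> (LINT x|lborel. g x * w x) = 0"
  shows "AE x in lborel. g x = 0"
proof -
  have z: "(LINT x|lborel. g x * indicator T x) = 0" if T: "compact T" for T
  \<comment> \<open>The distance to the empty set is 0 by convention, so the cutoffs below would not
    vanish anywhere.\<close>
  proof (cases "T = {}")
    case False
    obtain \<rho> where \<rho>: "\<And>x. x \<in> T \<Longrightarrow> norm x \<le> \<rho>" using compact_imp_bounded[OF T] unfolding bounded_iff by blast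
    define w where "w n x = max 0 (1 - real (Suc n) * infdist x T)" for n x
    have lip: "\<bar>w n x - w n y\<bar> \<le> real (Suc n) * norm (x - y)" for n x y
    proof -
      have "\<bar>infdist x T - infdist y T\<bar> \<le> norm (x - y)"
        using infdist_triangle_abs[of x T y] by (simp add: dist_norm)
      then have "\<bar>real (Suc n) * infdist x T - real (Suc n) * infdist y T\<bar> \<le> real (Suc n) * norm (x - y)"
        unfolding right_diff_distrib[symmetric] abs_mult by (simp add: mult_left_mono)
      then show ?thesis unfolding w_def by linarith
    qed
    have w1: "w n x = 1" if "x \<in> T" for n x using that by (simp add: w_def)
    have wb: "0 \<le> w n x" "w n x \<le> 1" for n x by (auto simp: w_def infdist_nonneg)
    have w0: "w n x = 0" if "\<rho> + 1 < norm x" for n x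
    proof -
      have "1 \<le> infdist x T"
      proof (rule ccontr)
        assume "\<not> 1 \<le> infdist x T"
        moreover obtain t where t: "t \<in> T" "infdist x T = dist x t"
          using infdist_attains_inf[OF compact_imp_closed[OF T] False] by blast
        ultimately have "norm (x - t) < 1" by (simp add: dist_norm)
        then show False using \<rho>[OF t(1)] that norm_triangle_ineq[of "x - t" t] by simp
      qed
      then have "1 * 1 \<le> real (Suc n) * infdist x T" by (intro mult_mono) auto
      then show ?thesis by (simp add: w_def)
    qed
    have wc: "w n \<in> borel_measurable borel" for n
      unfolding w_def[abs_def] by (intro borel_measurable_continuous_onI continuous_intros)
    have "(\<lambda>n. LINT x|lborel. g x * w n x) \<longlonglongrightarrow> (LINT x|lborel. g x * indicator T x)"
    proof (rule integral_dominated_convergence[where w="\<lambda>x. \<bar>g x * indicator (cball 0 (\<rho> + 1)) x\<bar>"])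
      show "(\<lambda>x. g x * indicator T x) \<in> borel_measurable lborel"
        using gm compact_imp_closed[OF T] by simp
      show "(\<lambda>x. g x * w n x) \<in> borel_measurable lborel" for n using gm wc by simp
      show "integrable lborel (\<lambda>x. \<bar>g x * indicator (cball 0 (\<rho> + 1)) x\<bar>)" by (intro integrable_abs loc)
      show "AE x in lborel. (\<lambda>n. g x * w n x) \<longlonglongrightarrow> g x * indicator T x"
      proof (rule AE_I2)
        fix x
        have "(\<lambda>n. w n x) \<longlonglongrightarrow> indicator T x"
        proof (cases "x \<in> T")
          case True
          then show ?thesis using w1 by simp
        next
          case xT: False
          then have d: "0 < infdist x T"
            using in_closed_iff_infdist_zero[OF compact_imp_closed[OF T] False] infdist_nonneg[of x T] by (simp add: order_le_less)
          obtain M where M: "1 / infdist x T < real M" using reals_Archimedean2 by blast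
          have "w n x = 0" if "M \<le> n" for n
          proof -
            have "1 < real M * infdist x T" using M d by (simp add: pos_divide_less_eq)
            also have "\<dots> \<le> real (Suc n) * infdist x T" using that d by (intro mult_right_mono) auto
            finally show ?thesis by (simp add: w_def)
          qed
          then have "eventually (\<lambda>n. w n x = 0) sequentially" by (rule eventually_sequentiallyI)
          then show ?thesis using xT by (auto intro: tendsto_eventually)
        qed
        then show "(\<lambda>n. g x * w n x) \<longlonglongrightarrow> g x * indicator T x" by (intro tendsto_intros)
      qed
      show "AE x in lborel. norm (g x * w n x) \<le> \<bar>g x * indicator (cball 0 (\<rho> + 1)) x\<bar>" for n
      proof (rule AE_I2)
        fix x
        show "norm (g x * w n x) \<le> \<bar>g x * indicator (cball 0 (\<rho> + 1)) x\<bar>"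
          using w0[of x n] wb[of n x] by (cases "\<rho> + 1 < norm x") (auto simp: abs_mult indicator_def mult_left_le)
      qed
    qed
    moreover have "(LINT x|lborel. g x * w n x) = 0" for n by (rule zero[OF lip w0])
    ultimately show ?thesis by (simp add: LIMSEQ_const_iff)
  qed simp
  have "AE x in lborel. g x \<le> 0" by (rule AE_zero_if_compact_integrals[OF gm loc z])
  moreover have "AE x in lborel. - g x \<le> 0"
  proof (rule AE_zero_if_compact_integrals)
    show "(\<lambda>x. - g x) \<in> borel_measurable borel" using gm by simp
    show "integrable lborel (\<lambda>x. - g x * indicator (cball 0 \<rho>) x)" for \<rho>
      using loc[of \<rho>] by simp
    show "(LINT x|lborel. - g x * indicator T x) = 0" if "compact T" for T
      using z[OF that] by simp
  qed
  ultimately show ?thesis by (rule AE_mp[OF _ AE_mp[OF _ AE_I2]]) simp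
qed

section \<open>Reproducing formula and Nikolskii inequality\<close>

text \<open>Peetre's inequality splits the weight in \<open>y\<close> between \<open>x\<close> and
  \<open>x - y\<close>; the decay of the kernel absorbs the second part, so integrability of
  \<open>r\<close> against a negative power of the weight is enough to convolve.\<close>

lemma weighted_conv_growth:
  fixes r K :: "real^'n \<Rightarrow> real"
  assumes rm: "r \<in> borel_measurable borel" and W: "integrable lborel (\<lambda>x. \<bar>r x\<bar> / (1 + norm x) ^ N)"
    and K: "rapid K"
  shows "integrable lborel (\<lambda>y. r y * K (x - y))"
    and "\<exists>G\<ge>0. \<forall>x y. \<bar>r y * K (x - y)\<bar> \<le> (1 + norm x) ^ N * G * (\<bar>r y\<bar> / (1 + norm y) ^ N)"
    and "\<exists>G\<ge>0. \<forall>x. \<bar>LINT y|lborel. r y * K (x - y)\<bar> \<le> G * (1 + norm x) ^ N"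
proof -
  obtain G where G: "\<And>x. (1 + norm x) ^ N * \<bar>K x\<bar> \<le> G" "0 \<le> G" using rapid_bound[OF K] by blast
  have b: "\<bar>r y * K (x - y)\<bar> \<le> (1 + norm x) ^ N * G * (\<bar>r y\<bar> / (1 + norm y) ^ N)" for x y
  proof -
    have p: "0 < (1 + norm y) ^ N" by (intro zero_less_power) (simp add: add_pos_nonneg)
    have "(1 + norm y) ^ N * \<bar>K (x - y)\<bar> \<le> ((1 + norm (y - x)) ^ N * (1 + norm x) ^ N) * \<bar>K (x - y)\<bar>"
      by (intro mult_right_mono weight_triangle) auto
    also have "\<dots> = (1 + norm x) ^ N * ((1 + norm (x - y)) ^ N * \<bar>K (x - y)\<bar>)"
      by (simp add: norm_minus_commute mult_ac)
    also have "\<dots> \<le> (1 + norm x) ^ N * G" by (intro mult_left_mono G) auto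
    finally have "\<bar>K (x - y)\<bar> \<le> (1 + norm x) ^ N * G / (1 + norm y) ^ N" using p by (simp add: pos_le_divide_eq mult.commute)
    then have "\<bar>r y\<bar> * \<bar>K (x - y)\<bar> \<le> \<bar>r y\<bar> * ((1 + norm x) ^ N * G / (1 + norm y) ^ N)" by (intro mult_left_mono) auto
    then show ?thesis by (simp add: abs_mult mult_ac)
  qed
  then show "\<exists>G\<ge>0. \<forall>x y. \<bar>r y * K (x - y)\<bar> \<le> (1 + norm x) ^ N * G * (\<bar>r y\<bar> / (1 + norm y) ^ N)" using G(2) by blast
  have Wx: "integrable lborel (\<lambda>y. (1 + norm x) ^ N * G * (\<bar>r y\<bar> / (1 + norm y) ^ N))" for x
    by (intro integrable_mult_right W)
  show i: "integrable lborel (\<lambda>y. r y * K (x - y))" for x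
  proof (rule Bochner_Integration.integrable_bound[OF Wx[of x]])
    have "(\<lambda>y. K (x - y)) \<in> borel_measurable borel"
      by (rule measurable_compose[OF _ rapid_measurable[OF K]]) simp
    then show "(\<lambda>y. r y * K (x - y)) \<in> borel_measurable lborel" using rm by simp
    show "AE y in lborel. norm (r y * K (x - y)) \<le> norm ((1 + norm x) ^ N * G * (\<bar>r y\<bar> / (1 + norm y) ^ N))"
      using b[of _ x] by (intro AE_I2) (simp only: real_norm_def, rule order_trans[OF _ abs_ge_self])
  qed
  have "\<bar>LINT y|lborel. r y * K (x - y)\<bar> \<le> (G * (LINT y|lborel. \<bar>r y\<bar> / (1 + norm y) ^ N)) * (1 + norm x) ^ N" for x
  proof -
    have "\<bar>LINT y|lborel. r y * K (x - y)\<bar> \<le> (LINT y|lborel. \<bar>r y * K (x - y)\<bar>)" by (rule integral_abs_bound)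
    also have "\<dots> \<le> (LINT y|lborel. (1 + norm x) ^ N * G * (\<bar>r y\<bar> / (1 + norm y) ^ N))"
      by (rule integral_mono[OF integrable_abs[OF i] Wx b])
    also have "\<dots> = ((1 + norm x) ^ N * G) * (LINT y|lborel. \<bar>r y\<bar> / (1 + norm y) ^ N)"
      by (rule integral_mult_right_zero)
    finally show ?thesis by (simp only: mult_ac)
  qed
  moreover have "0 \<le> G * (LINT y|lborel. \<bar>r y\<bar> / (1 + norm y) ^ N)"
    using G(2) by (intro mult_nonneg_nonneg integral_nonneg_AE) auto
  ultimately show "\<exists>G\<ge>0. \<forall>x. \<bar>LINT y|lborel. r y * K (x - y)\<bar> \<le> G * (1 + norm x) ^ N" by blast
qed

lemma conv_measurable:
  fixes r K :: "real^'n \<Rightarrow> real"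
  assumes rm: "r \<in> borel_measurable borel" and Km: "K \<in> borel_measurable borel"
  shows "(\<lambda>x. LINT y|lborel. r y * K (x - y)) \<in> borel_measurable borel"
proof -
  have "(\<lambda>p. K (fst p - snd p)) \<in> borel_measurable (borel :: ((real^'n) \<times> (real^'n)) measure)"
    by (rule measurable_compose[OF _ Km]) (intro borel_measurable_continuous_onI continuous_intros)
  note rK = borel_measurable_times[OF borel_measurable_snd[OF rm] this]
  have st: "sets (borel \<Otimes>\<^sub>M lborel) = sets (borel :: ((real^'n) \<times> (real^'n)) measure)"
    unfolding borel_prod[symmetric] by (rule sets_pair_measure_cong) simp_all
  have "(\<lambda>(x, y). r y * K (x - y)) \<in> borel_measurable (borel \<Otimes>\<^sub>M lborel)"
    using rK unfolding case_prod_beta' by (simp only: measurable_cong_sets[OF st refl])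
  then show ?thesis by (rule lborel.borel_measurable_lebesgue_integral)
qed

lemma bounded_lipschitz_support:
  fixes w :: "real^'n \<Rightarrow> real"
  assumes L: "\<And>x y. \<bar>w x - w y\<bar> \<le> L * norm (x - y)" and \<rho>: "\<And>x. \<rho> < norm x \<Longrightarrow> w x = 0"
  shows "w \<in> borel_measurable borel" "\<exists>B. \<forall>x. \<bar>w x\<bar> \<le> B"
proof -
  have L0: "0 \<le> L" using order_trans[OF abs_ge_zero L[of "axis undefined 1" 0]] by simp
  have "L-lipschitz_on UNIV w" using L L0 by (auto simp: lipschitz_on_def dist_norm)
  then have c: "continuous_on UNIV w" by (rule lipschitz_on_continuous_on)
  then show "w \<in> borel_measurable borel" by (rule borel_measurable_continuous_onI)
  have "compact (w ` cball 0 \<rho>)" by (intro compact_continuous_image continuous_on_subset[OF c]) auto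
  then have "bounded (w ` cball 0 \<rho>)" by (rule compact_imp_bounded)
  then obtain B where B: "\<forall>y\<in>w ` cball 0 \<rho>. norm y \<le> B" unfolding bounded_iff by blast
  have "\<bar>w x\<bar> \<le> max B 0" for x
  proof (cases "\<rho> < norm x")
    case False
    then have "w x \<in> w ` cball 0 \<rho>" by auto
    then have "norm (w x) \<le> B" using B by blast
    then show ?thesis by simp
  qed (simp add: \<rho>)
  then show "\<exists>B. \<forall>x. \<bar>w x\<bar> \<le> B" by blast
qed

text \<open>The convolutions no longer depend on \<open>J\<close> once \<open>J0 \<le> J\<close>,
  yet the kernels form an approximate identity. Tested against a Lipschitz \<open>w\<close>, the
  difference of \<open>F\<close> and \<open>r\<close> is at most a multiple of
  \<open>(1 / 2) ^ J\<close> for all such \<open>J\<close>, hence zero.\<close>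

lemma reproducing_AE:
  fixes r F \<phi>0 :: "real^'n \<Rightarrow> real"
  assumes LP: "LP_generator \<phi>0" and rm: "r \<in> borel_measurable borel"
    and W: "integrable lborel (\<lambda>x. \<bar>r x\<bar> / (1 + norm x) ^ N)"
    and F: "\<And>J x. J0 \<le> J \<Longrightarrow> (LINT y|lborel. r y * kern (dil \<phi>0 J) (x - y)) = F x"
  shows "AE x in lborel. r x = F x"
proof -
  have K: "rapid (kern (dil \<phi>0 J))" for J by (intro kern_rapid dil_test_fun LP_test_fun LP)
  have Fm: "F \<in> borel_measurable borel"
    using conv_measurable[OF rm rapid_measurable[OF K[of J0]]] F[OF order_refl] by (simp cong: measurable_cong)
  obtain G where G: "\<And>x. \<bar>F x\<bar> \<le> G * (1 + norm x) ^ N" "0 \<le> G"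
    using weighted_conv_growth(3)[OF rm W K[of J0]] F[OF order_refl] by auto
  have rl: "integrable lborel (\<lambda>x. r x * indicator (cball 0 \<rho>) x)" for \<rho>
  proof (rule Bochner_Integration.integrable_bound[OF integrable_mult_right[OF W, of "(1 + \<bar>\<rho>\<bar>) ^ N"]])
    show "AE x in lborel. norm (r x * indicator (cball 0 \<rho>) x) \<le> norm ((1 + \<bar>\<rho>\<bar>) ^ N * (\<bar>r x\<bar> / (1 + norm x) ^ N))"
    proof (rule AE_I2)
      fix x :: "real^'n"
      have p: "0 < (1 + norm x) ^ N" by (intro zero_less_power) (simp add: add_pos_nonneg)
      show "norm (r x * indicator (cball 0 \<rho>) x) \<le> norm ((1 + \<bar>\<rho>\<bar>) ^ N * (\<bar>r x\<bar> / (1 + norm x) ^ N))"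
      proof (cases "norm x \<le> \<rho>")
        case True
        then have "(1 + norm x) ^ N \<le> (1 + \<bar>\<rho>\<bar>) ^ N" by (intro power_mono) auto
        then have "\<bar>r x\<bar> * (1 + norm x) ^ N \<le> \<bar>r x\<bar> * (1 + \<bar>\<rho>\<bar>) ^ N" by (intro mult_left_mono) auto
        then have "\<bar>r x\<bar> \<le> (1 + \<bar>\<rho>\<bar>) ^ N * (\<bar>r x\<bar> / (1 + norm x) ^ N)" using p by (simp add: pos_le_divide_eq mult.commute)
        then show ?thesis using True by (simp add: indicator_def)
      qed simp
    qed
  qed (auto intro!: borel_measurable_times borel_measurable_indicator rm)
  have Fl: "integrable lborel (\<lambda>x. F x * indicator (cball 0 \<rho>) x)" for \<rho>
  proof (rule integrable_compact_support[where R=\<rho> and B="G * (1 + \<bar>\<rho>\<bar>) ^ N"])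
    show "(\<lambda>x. F x * indicator (cball 0 \<rho>) x) \<in> borel_measurable borel"
      by (auto intro!: borel_measurable_times borel_measurable_indicator Fm)
    fix x
    show "\<bar>F x * indicator (cball 0 \<rho>) x\<bar> \<le> G * (1 + \<bar>\<rho>\<bar>) ^ N"
    proof (cases "norm x \<le> \<rho>")
      case True
      have "G * (1 + norm x) ^ N \<le> G * (1 + \<bar>\<rho>\<bar>) ^ N" using True by (intro mult_left_mono G power_mono) auto
      then show ?thesis using G(1)[of x] True by simp
    qed (use G(2) in simp)
  qed simp
  have "AE x in lborel. r x - F x = 0"
  proof (rule AE_zero_if_lipschitz_integrals)
    show "(\<lambda>x. r x - F x) \<in> borel_measurable borel" using rm Fm by simp
    show "integrable lborel (\<lambda>x. (r x - F x) * indicator (cball 0 \<rho>) x)" for \<rho>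
      using Bochner_Integration.integrable_diff[OF rl Fl, of \<rho> \<rho>] by (simp add: left_diff_distrib)
    fix w :: "real^'n \<Rightarrow> real" and L \<rho> assume L: "\<And>x y. \<bar>w x - w y\<bar> \<le> L * norm (x - y)" and \<rho>: "\<And>x. \<rho> < norm x \<Longrightarrow> w x = 0"
    have wm: "w \<in> borel_measurable borel"
      by (rule bounded_lipschitz_support(1)[where L=L and \<rho>=\<rho>]) (use L \<rho> in auto)
    have "\<exists>B. \<forall>x. \<bar>w x\<bar> \<le> B"
      by (rule bounded_lipschitz_support(2)[where L=L and \<rho>=\<rho>]) (use L \<rho> in auto)
    then obtain B where B: "\<And>x. \<bar>w x\<bar> \<le> B" by blast
    have B0: "0 \<le> B" using B[of 0] by linarith
    have times_w: "integrable lborel (\<lambda>x. u x * w x)" if "integrable lborel (\<lambda>x. u x * indicator (cball 0 \<rho>) x)" "u \<in> borel_measurable borel" for u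
    proof (rule Bochner_Integration.integrable_bound[OF integrable_mult_left[OF that(1), of B]])
      show "AE x in lborel. norm (u x * w x) \<le> norm (u x * indicator (cball 0 \<rho>) x * B)"
      proof (rule AE_I2)
        fix x
        show "norm (u x * w x) \<le> norm (u x * indicator (cball 0 \<rho>) x * B)"
        proof (cases "norm x \<le> \<rho>")
          case True
          then show ?thesis using B[of x] B0 by (simp add: abs_mult mult_left_mono)
        qed (simp add: \<rho>)
      qed
    qed (use that wm in simp)
    have rw: "integrable lborel (\<lambda>x. r x * w x)" by (rule times_w[OF rl rm])
    have Fw: "integrable lborel (\<lambda>x. F x * w x)" by (rule times_w[OF Fl Fm])
    obtain C where C: "0 \<le> C" "\<And>J x. (1 + norm x) ^ N * \<bar>conv (kern (dil \<phi>0 J)) w x - w x\<bar> \<le> C / 2 ^ J"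
      using kern_approx[OF LP L \<rho>] by blast
    define Wc where "Wc = (LINT y|lborel. \<bar>r y\<bar> / (1 + norm y) ^ N)"
    have main: "\<bar>(LINT x|lborel. F x * w x) - (LINT x|lborel. r x * w x)\<bar> \<le> C * Wc * (1 / 2) ^ J" if J: "J0 \<le> J" for J
    proof -
      let ?K = "kern (dil \<phi>0 J)"
      obtain G' where G': "0 \<le> G'" "\<And>x y. \<bar>r y * ?K (x - y)\<bar> \<le> (1 + norm x) ^ N * G' * (\<bar>r y\<bar> / (1 + norm y) ^ N)"
        using weighted_conv_growth(2)[OF rm W K[of J]] by blast
      have a: "integrable lborel (\<lambda>x. \<bar>w x\<bar> * ((1 + norm x) ^ N * G'))"
      proof (rule integrable_compact_support[where R=\<rho> and B="B * ((1 + \<bar>\<rho>\<bar>) ^ N * G')"])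
        show "(\<lambda>x. \<bar>w x\<bar> * ((1 + norm x) ^ N * G')) \<in> borel_measurable borel" using wm by simp
        fix x
        show "\<bar>\<bar>w x\<bar> * ((1 + norm x) ^ N * G')\<bar> \<le> B * ((1 + \<bar>\<rho>\<bar>) ^ N * G')"
        proof (cases "norm x \<le> \<rho>")
          case True
          have "\<bar>w x\<bar> * ((1 + norm x) ^ N * G') \<le> B * ((1 + \<bar>\<rho>\<bar>) ^ N * G')"
            using True B B0 G'(1) by (intro mult_mono mult_right_mono power_mono) auto
          then show ?thesis using G'(1) by simp
        qed (use B0 G'(1) \<rho>[of x] in simp)
      qed (simp add: \<rho>)
      have "(LINT x|lborel. F x * w x) = (LINT x|lborel. LINT y|lborel. w x * (r y * ?K (x - y)))"
        unfolding F[OF J, symmetric] by (simp add: mult.commute)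
      also have "\<dots> = (LINT y|lborel. LINT x|lborel. w x * (r y * ?K (x - y)))"
      proof (rule fubini_bound(1)[OF a W])
        have "(\<lambda>p. ?K (fst p - snd p)) \<in> borel_measurable (borel :: ((real^'n) \<times> (real^'n)) measure)"
          by (rule measurable_compose[OF _ rapid_measurable[OF K]]) (intro borel_measurable_continuous_onI continuous_intros)
        then show "(\<lambda>p. w (fst p) * (r (snd p) * ?K (fst p - snd p))) \<in> borel_measurable borel"
          by (intro borel_measurable_times borel_measurable_fst[OF wm] borel_measurable_snd[OF rm])
        fix x y
        have "\<bar>w x\<bar> * \<bar>r y * ?K (x - y)\<bar> \<le> \<bar>w x\<bar> * ((1 + norm x) ^ N * G' * (\<bar>r y\<bar> / (1 + norm y) ^ N))"
          by (intro mult_left_mono G') auto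
        also have "\<dots> \<le> \<bar>\<bar>w x\<bar> * ((1 + norm x) ^ N * G') * (\<bar>r y\<bar> / (1 + norm y) ^ N)\<bar>"
          by (rule order_trans[OF _ abs_ge_self]) (simp only: mult.assoc order_refl)
        finally show "norm (w x * (r y * ?K (x - y))) \<le> \<bar>\<bar>w x\<bar> * ((1 + norm x) ^ N * G') * (\<bar>r y\<bar> / (1 + norm y) ^ N)\<bar>"
          by (simp only: real_norm_def abs_mult[of "w x"])
      qed
      \<comment> \<open>Evenness of the kernel lets the convolution fall on \<open>w\<close>, where
        \<open>kern_approx\<close> applies.\<close>
      also have "\<dots> = (LINT y|lborel. r y * conv ?K w y)"
      proof (rule Bochner_Integration.integral_cong[OF refl])
        fix y
        have "(LINT x|lborel. w x * (r y * ?K (x - y))) = (LINT x|lborel. r y * (w x * ?K (y - x)))"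
          by (simp add: kern_minus_commute[of "dil \<phi>0 J" _ y] mult_ac)
        also have "\<dots> = r y * conv ?K w y"
          using conv_commute[OF rapid_measurable[OF K[of J]] wm] by simp
        finally show "(LINT x|lborel. w x * (r y * ?K (x - y))) = r y * conv ?K w y" .
      qed
      finally have Fe: "(LINT x|lborel. F x * w x) = (LINT y|lborel. r y * conv ?K w y)" .
      have le: "\<bar>r y * conv ?K w y - r y * w y\<bar> \<le> C / 2 ^ J * (\<bar>r y\<bar> / (1 + norm y) ^ N)" for y
      proof -
        have p: "0 < (1 + norm y) ^ N" by (intro zero_less_power) (simp add: add_pos_nonneg)
        have "\<bar>conv ?K w y - w y\<bar> \<le> C / 2 ^ J / (1 + norm y) ^ N"
          using C(2)[of y J] p by (simp only: pos_le_divide_eq mult.commute)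
        then have "\<bar>r y\<bar> * \<bar>conv ?K w y - w y\<bar> \<le> \<bar>r y\<bar> * (C / 2 ^ J / (1 + norm y) ^ N)" by (intro mult_left_mono) auto
        then show ?thesis by (simp add: abs_mult[symmetric] right_diff_distrib mult_ac)
      qed
      have cm: "conv ?K w \<in> borel_measurable borel"
        using conv_measurable[OF wm rapid_measurable[OF K[of J]]] unfolding conv_commute[OF rapid_measurable[OF K[of J]] wm] .
      have i1: "integrable lborel (\<lambda>y. r y * conv ?K w y - r y * w y)"
      proof (rule Bochner_Integration.integrable_bound[OF integrable_mult_right[OF W, of "C / 2 ^ J"]])
        show "AE y in lborel. norm (r y * conv ?K w y - r y * w y) \<le> norm (C / 2 ^ J * (\<bar>r y\<bar> / (1 + norm y) ^ N))"
          using le by (intro AE_I2) (simp only: real_norm_def, rule order_trans[OF _ abs_ge_self])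
      qed (use rm wm cm in simp)
      have i2: "integrable lborel (\<lambda>y. r y * conv ?K w y)"
        using Bochner_Integration.integrable_add[OF i1 rw] by simp
      have "(LINT x|lborel. F x * w x) - (LINT x|lborel. r x * w x) = (LINT y|lborel. r y * conv ?K w y - r y * w y)"
        unfolding Fe using i2 rw by simp
      also have "\<bar>\<dots>\<bar> \<le> (LINT y|lborel. \<bar>r y * conv ?K w y - r y * w y\<bar>)" by (rule integral_abs_bound)
      also have "\<dots> \<le> (LINT y|lborel. C / 2 ^ J * (\<bar>r y\<bar> / (1 + norm y) ^ N))"
        by (rule integral_mono[OF integrable_abs[OF i1] integrable_mult_right[OF W] le])
      also have "\<dots> = C / 2 ^ J * Wc" unfolding Wc_def by (rule integral_mult_right_zero)
      finally show ?thesis by (simp add: power_one_over)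
    qed
    have lim: "(\<lambda>J. C * Wc * (1 / 2) ^ J) \<longlonglongrightarrow> 0"
      by (rule tendsto_mult_right_zero) (rule LIMSEQ_realpow_zero, auto)
    have "\<bar>(LINT x|lborel. F x * w x) - (LINT x|lborel. r x * w x)\<bar> \<le> 0"
      by (rule LIMSEQ_le_const[OF lim]) (use main in blast)
    then show "(LINT x|lborel. (r x - F x) * w x) = 0"
      using rw Fw by (simp add: left_diff_distrib)
  qed
  then show ?thesis by simp
qed

text \<open>A self-improving bound. With \<open>A\<close> the supremum of
  \<open>\<omega> x * \<bar>F x\<bar>\<close> and \<open>S\<close> the integral of
  \<open>\<bar>r x\<bar> powr p\<close>, interpolation gives
  \<open>A \<le> B * A powr (1 - p) * S\<close>, and the power of \<open>A\<close> cancels. The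
  cancellation needs \<open>A\<close> finite, which is the purpose of \<open>bound\<close>.\<close>

lemma nikolskii_step:
  fixes r F K \<omega> :: "real^'n \<Rightarrow> real"
  assumes p: "0 < p" "p \<le> 1" and rp: "integrable lborel (\<lambda>x. \<bar>r x\<bar> powr p)"
    and rF: "AE x in lborel. r x = F x" and F: "\<And>x. F x = (LINT y|lborel. r y * K (x - y))"
    and rK: "\<And>x. integrable lborel (\<lambda>y. r y * K (x - y))"
    and \<omega>: "\<And>x. 0 < \<omega> x" "\<And>x. \<omega> x \<le> 1"
    and \<omega>K: "\<And>x y. \<omega> x * \<bar>K (x - y)\<bar> \<le> \<omega> y * B"
    and bound: "\<And>x. \<omega> x * \<bar>F x\<bar> \<le> A0"
  shows "(\<omega> x * \<bar>F x\<bar>) powr p \<le> B * (LINT x|lborel. \<bar>r x\<bar> powr p)"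
proof -
  define S where "S = (LINT x|lborel. \<bar>r x\<bar> powr p)"
  have S0: "0 \<le> S" by (simp add: S_def)
  have B0: "0 \<le> B"
  proof -
    have "0 \<le> \<omega> x * \<bar>K (x - x)\<bar>" using \<omega>(1)[of x] by simp
    also have "\<dots> \<le> \<omega> x * B" by (rule \<omega>K)
    finally show ?thesis using \<omega>(1)[of x] by (simp add: zero_le_mult_iff)
  qed
  define A where "A = (SUP x. \<omega> x * \<bar>F x\<bar>)"
  have bdd: "bdd_above (range (\<lambda>x. \<omega> x * \<bar>F x\<bar>))" using bound by (intro bdd_aboveI2) auto
  have A: "\<omega> x * \<bar>F x\<bar> \<le> A" for x unfolding A_def by (rule cSUP_upper[OF _ bdd]) simp
  have A0': "0 \<le> A" using A[of 0] \<omega>(1)[of 0] by (meson abs_ge_zero less_imp_le mult_nonneg_nonneg order_trans)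
  show ?thesis
  proof (cases "A = 0")
    case True
    then have z: "\<omega> x * \<bar>F x\<bar> = 0" using A[of x] \<omega>(1)[of x] by (metis abs_ge_zero antisym less_imp_le mult_nonneg_nonneg)
    show ?thesis unfolding z S_def[symmetric] using B0 S0 by simp
  next
    case False
    then have Ap: "0 < A" using A0' by simp
    have key: "\<omega> x * \<bar>F x\<bar> \<le> B * A powr (1 - p) * S" for x
    proof -
      have "\<omega> x * \<bar>F x\<bar> \<le> \<omega> x * (LINT y|lborel. \<bar>r y * K (x - y)\<bar>)"
        unfolding F[of x] using \<omega>(1)[of x] by (intro mult_left_mono integral_abs_bound) auto
      also have "\<dots> = (LINT y|lborel. \<omega> x * \<bar>r y * K (x - y)\<bar>)" by simp
      also have "\<dots> \<le> (LINT y|lborel. (B * A powr (1 - p)) * \<bar>r y\<bar> powr p)"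
      proof (rule integral_mono_AE)
        show "integrable lborel (\<lambda>y. \<omega> x * \<bar>r y * K (x - y)\<bar>)" by (intro integrable_mult_right integrable_abs rK)
        show "integrable lborel (\<lambda>y. (B * A powr (1 - p)) * \<bar>r y\<bar> powr p)" by (intro integrable_mult_right rp)
        show "AE y in lborel. \<omega> x * \<bar>r y * K (x - y)\<bar> \<le> (B * A powr (1 - p)) * \<bar>r y\<bar> powr p"
          using rF
        proof (rule AE_mp[OF _ AE_I2], intro impI)
          fix y assume e: "r y = F y"
          define u where "u = \<omega> y * \<bar>r y\<bar>"
          have u: "0 \<le> u" "u \<le> A" using A[of y] \<omega>(1)[of y] by (simp_all add: u_def e less_imp_le)
          have "\<omega> x * \<bar>r y * K (x - y)\<bar> = \<bar>r y\<bar> * (\<omega> x * \<bar>K (x - y)\<bar>)" by (simp add: abs_mult mult_ac)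
          also have "\<dots> \<le> \<bar>r y\<bar> * (\<omega> y * B)" by (intro mult_left_mono \<omega>K) auto
          also have "\<dots> = B * u" by (simp add: u_def mult_ac)
          also have "\<dots> \<le> B * (A powr (1 - p) * \<bar>r y\<bar> powr p)"
          proof (rule mult_left_mono[OF _ B0])
            \<comment> \<open>Split \<open>u\<close> into powers \<open>1 - p\<close> and
              \<open>p\<close>: the first is bounded by \<open>A\<close>, and in the second the
              weight is dropped since it is at most 1.\<close>
            show "u \<le> A powr (1 - p) * \<bar>r y\<bar> powr p"
            proof (cases "u = 0")
              case False
              then have up: "0 < u" using u by simp
              have "u = u powr (1 - p) * u powr p" using up by (simp add: powr_add[symmetric])
              also have "\<dots> \<le> A powr (1 - p) * \<bar>r y\<bar> powr p"
              proof (intro mult_mono powr_mono2)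
                have "\<omega> y * \<bar>r y\<bar> \<le> 1 * \<bar>r y\<bar>" by (intro mult_right_mono \<omega>) auto
                then show "u \<le> \<bar>r y\<bar>" by (simp add: u_def)
              qed (use u up p in auto)
              finally show ?thesis .
            qed simp
          qed
          finally show "\<omega> x * \<bar>r y * K (x - y)\<bar> \<le> (B * A powr (1 - p)) * \<bar>r y\<bar> powr p" by (simp only: mult.assoc)
        qed
      qed
      also have "\<dots> = B * A powr (1 - p) * S" unfolding S_def by (rule integral_mult_right_zero)
      finally show ?thesis .
    qed
    have "A \<le> B * A powr (1 - p) * S" unfolding A_def by (rule cSUP_least) (use key in \<open>auto simp: A_def\<close>)
    moreover have "A = A powr p * A powr (1 - p)" using Ap by (simp add: powr_add[symmetric])
    ultimately have "A powr p * A powr (1 - p) \<le> (B * S) * A powr (1 - p)" by (simp add: mult_ac)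
    then have "A powr p \<le> B * S" using Ap by simp
    moreover have "(\<omega> x * \<bar>F x\<bar>) powr p \<le> A powr p" using A[of x] \<omega>(1)[of x] p by (intro powr_mono2) auto
    ultimately show ?thesis by (simp add: S_def)
  qed
qed

text \<open>The step is used twice. The weights \<open>1 / (1 + e * norm x) ^ N\<close> make the
  supremum finite and give a bound independent of \<open>e\<close>; letting \<open>e\<close> tend to
  0 shows that \<open>F\<close> is bounded. Then the weight 1 is admissible and yields a bound in
  terms of the supremum of \<open>K\<close> alone.\<close>

lemma nikolskii:
  fixes r F K :: "real^'n \<Rightarrow> real"
  assumes p: "0 < p" "p \<le> 1" and rm: "r \<in> borel_measurable borel" and rp: "integrable lborel (\<lambda>x. \<bar>r x\<bar> powr p)"
    and rF: "AE x in lborel. r x = F x" and F: "\<And>x. F x = (LINT y|lborel. r y * K (x - y))"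
    and rK: "\<And>x. integrable lborel (\<lambda>y. r y * K (x - y))"
    and G: "\<And>x. \<bar>F x\<bar> \<le> G * (1 + norm x) ^ N" and K: "rapid K" and B: "\<And>x. \<bar>K x\<bar> \<le> B"
  shows "integrable lborel r"
    and "(LINT x|lborel. \<bar>r x\<bar>) \<le> (B * (LINT x|lborel. \<bar>r x\<bar> powr p)) powr ((1 - p) / p) * (LINT x|lborel. \<bar>r x\<bar> powr p)"
proof -
  define S where "S = (LINT x|lborel. \<bar>r x\<bar> powr p)"
  have S0: "0 \<le> S" by (simp add: S_def)
  have G0: "0 \<le> G" using G[of 0] by simp
  obtain BN where BN: "\<And>x. (1 + norm x) ^ N * \<bar>K x\<bar> \<le> BN" "0 \<le> BN" using rapid_bound[OF K] by blast
  \<comment> \<open>This constant depends on the decay of \<open>K\<close>, not only on its size; it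
    serves to know that \<open>F\<close> is bounded and disappears from the conclusion.\<close>
  define M where "M = (BN * S) powr (1 / p)"
  have growth: "\<bar>F x\<bar> \<le> M * (1 + e * norm x) ^ N" if e: "0 < e" "e \<le> 1" for e x
  proof -
    define \<omega> where "\<omega> x = 1 / (1 + e * norm x) ^ N" for x :: "real^'n"
    have pos: "0 < (1 + e * norm x) ^ N" for x :: "real^'n" using e by (intro zero_less_power) (simp add: add_pos_nonneg)
    have \<omega>0: "0 < \<omega> x" for x using pos by (simp add: \<omega>_def)
    have "(\<omega> x * \<bar>F x\<bar>) powr p \<le> BN * S"
      unfolding S_def
    proof (rule nikolskii_step[OF p rp rF F rK \<omega>0])
      fix x y :: "real^'n"
      have "1 \<le> (1 + e * norm x) ^ N" using e by (intro one_le_power) simp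
      then show "\<omega> x \<le> 1" by (simp add: \<omega>_def)
      have "(e * (1 + norm x)) ^ N \<le> (1 + e * norm x) ^ N" using e by (intro power_mono) (auto simp: distrib_left)
      then have "(1 + norm x) ^ N \<le> (1 + e * norm x) ^ N / e ^ N" using e by (simp add: power_mult_distrib pos_le_divide_eq mult.commute)
      then have "G * (1 + norm x) ^ N \<le> G * ((1 + e * norm x) ^ N / e ^ N)" by (intro mult_left_mono G0)
      then have "\<bar>F x\<bar> \<le> (G / e ^ N) * (1 + e * norm x) ^ N" using G[of x] by (simp add: mult_ac)
      then show "\<omega> x * \<bar>F x\<bar> \<le> G / e ^ N" using pos[of x] by (simp add: \<omega>_def pos_divide_le_eq)
      \<comment> \<open>The weight is moderate uniformly in \<open>e \<le> 1\<close>, so the factor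
        \<open>1 + norm (x - y)\<close> charged to the kernel does not involve
        \<open>e\<close>.\<close>
      have "1 + e * norm y \<le> 1 + e * (norm x + norm (x - y))"
        using e norm_triangle_ineq4[of x "x - y"] by (intro add_left_mono mult_left_mono) auto
      also have "\<dots> \<le> (1 + e * norm x) * (1 + norm (x - y))"
      proof -
        have "e * norm (x - y) \<le> 1 * norm (x - y)" using e by (intro mult_right_mono) auto
        moreover have "0 \<le> e * norm x * norm (x - y)" using e by simp
        ultimately show ?thesis by (simp add: algebra_simps)
      qed
      finally have "(1 + e * norm y) ^ N \<le> ((1 + e * norm x) * (1 + norm (x - y))) ^ N" using e by (intro power_mono) auto
      then have "(1 + e * norm y) ^ N * \<bar>K (x - y)\<bar> \<le> (1 + e * norm x) ^ N * (1 + norm (x - y)) ^ N * \<bar>K (x - y)\<bar>"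
        unfolding power_mult_distrib by (intro mult_right_mono) auto
      also have "\<dots> \<le> (1 + e * norm x) ^ N * BN"
        unfolding mult.assoc using pos[of x] by (intro mult_left_mono BN) auto
      finally show "\<omega> x * \<bar>K (x - y)\<bar> \<le> \<omega> y * BN"
        using pos[of x] pos[of y] by (simp add: \<omega>_def field_simps)
    qed
    then have "((\<omega> x * \<bar>F x\<bar>) powr p) powr (1 / p) \<le> M" unfolding M_def using p by (intro powr_mono2) auto
    then have "\<omega> x * \<bar>F x\<bar> \<le> M" using p \<omega>0[of x] by (simp add: powr_powr)
    then show ?thesis using pos[of x] by (simp add: \<omega>_def pos_divide_le_eq)
  qed
  have bounded: "\<bar>F x\<bar> \<le> M" for x
  proof (rule LIMSEQ_le_const)
    have "(\<lambda>n. M * (1 + 1 / real (Suc n) * norm x) ^ N) \<longlonglongrightarrow> M * (1 + 0 * norm x) ^ N"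
      by (intro tendsto_intros) (use LIMSEQ_inverse_real_of_nat in \<open>simp add: inverse_eq_divide\<close>)
    then show "(\<lambda>n. M * (1 + 1 / real (Suc n) * norm x) ^ N) \<longlonglongrightarrow> M" by simp
    show "\<exists>n0. \<forall>n\<ge>n0. \<bar>F x\<bar> \<le> M * (1 + 1 / real (Suc n) * norm x) ^ N"
    proof (intro exI[of _ 0] allI impI)
      show "\<bar>F x\<bar> \<le> M * (1 + 1 / real (Suc n) * norm x) ^ N" for n by (rule growth) simp_all
    qed
  qed
  define Q where "Q = (B * S) powr ((1 - p) / p)"
  have Fp: "\<bar>F x\<bar> powr p \<le> B * S" for x
    using nikolskii_step[OF p rp rF F rK, of "\<lambda>_. 1" B M x] bounded B by (simp add: S_def)
  have FQ: "\<bar>F x\<bar> \<le> Q * \<bar>F x\<bar> powr p" for x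
  proof (cases "F x = 0")
    case False
    have "\<bar>F x\<bar> = (\<bar>F x\<bar> powr p) powr ((1 - p) / p) * \<bar>F x\<bar> powr p"
      using False p by (simp add: powr_powr powr_add[symmetric])
    also have "\<dots> \<le> Q * \<bar>F x\<bar> powr p"
      unfolding Q_def using p by (intro mult_right_mono powr_mono2 Fp) auto
    finally show ?thesis .
  qed simp
  have le: "AE x in lborel. \<bar>r x\<bar> \<le> Q * \<bar>r x\<bar> powr p"
    using rF by (rule AE_mp[OF _ AE_I2]) (use FQ in auto)
  show ri: "integrable lborel r"
  proof (rule Bochner_Integration.integrable_bound[OF integrable_mult_right[OF rp, of Q]])
    show "AE x in lborel. norm (r x) \<le> norm (Q * \<bar>r x\<bar> powr p)"
      using le by (rule AE_mp[OF _ AE_I2]) (auto simp: Q_def)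
  qed (use rm in simp)
  have "(LINT x|lborel. \<bar>r x\<bar>) \<le> (LINT x|lborel. Q * \<bar>r x\<bar> powr p)"
    by (rule integral_mono_AE[OF integrable_abs[OF ri] integrable_mult_right[OF rp] le])
  then show "(LINT x|lborel. \<bar>r x\<bar>) \<le> (B * (LINT x|lborel. \<bar>r x\<bar> powr p)) powr ((1 - p) / p) * (LINT x|lborel. \<bar>r x\<bar> powr p)"
    by (simp add: Q_def S_def)
qed

text \<open>Replaces the functional \<open>LP_block\<close> by an L^1 density. Testing with a
  translated kernel at scale \<open>J\<close> evaluates \<open>f\<close> at a translate of the block
  kernel, whatever \<open>J \<ge> Suc j\<close> is; this is the independence of \<open>J\<close> on
  which \<open>reproducing_AE\<close> relies.\<close>

lemma LP_block_density:
  fixes f :: "(real^'n \<Rightarrow> real) \<Rightarrow> real" and \<phi>0 :: "real^'n \<Rightarrow> real"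
  assumes LP: "LP_generator \<phi>0" and f: "f \<in> tempered_distributions" and p: "0 < p" "p \<le> 1"
    and rep: "represented_by (LP_block \<phi>0 j f) g" and gp: "integrable lborel (\<lambda>x. norm (g x) powr p)"
    and b: "\<And>x. \<bar>kern \<phi>0 x\<bar> \<le> b"
  shows "\<exists>h. integrable lborel h \<and>
    (LINT x|lborel. \<bar>h x\<bar>) \<le> ((2 ^ Suc j) ^ CARD('n) * b * (LINT x|lborel. norm (g x) powr p)) powr ((1 - p) / p) * (LINT x|lborel. norm (g x) powr p) \<and>
    (\<forall>\<phi>. test_fun \<phi> \<longrightarrow> f (conv (kern (LP_function \<phi>0 j)) \<phi>) = (LINT x|lborel. h x * \<phi> x)) \<and>
    (AE x in lborel. h x = (LINT y|lborel. h y * kern (dil \<phi>0 (Suc j)) (x - y)))"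
proof -
  let ?L = "LP_function \<phi>0 j"
  define r where "r x = Re (g x)" for x
  note t = LP_test_fun[OF LP]
  have lt: "test_fun ?L" by (rule LP_function_test_fun[OF LP])
  have le: "?L (- \<xi>) = ?L \<xi>" for \<xi> by (rule LP_function_even[OF LP])
  have gm: "g \<in> borel_measurable borel" using rep by (simp add: represented_by_def)
  have rm: "r \<in> borel_measurable borel" unfolding r_def using gm by simp
  have pair: "integrable lborel (\<lambda>x. r x * \<phi> x)" "f (conv (kern ?L) \<phi>) = (LINT x|lborel. r x * \<phi> x)"
    if \<phi>: "\<phi> \<in> schwartz" for \<phi> :: "real^'n \<Rightarrow> real"
  proof -
    have c: "(\<lambda>x. complex_of_real (\<phi> x)) \<in> schwartz" by (rule schwartz_of_real[OF \<phi>])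
    have i: "integrable lborel (\<lambda>x. g x * complex_of_real (\<phi> x))"
      and e: "LP_block \<phi>0 j f (\<lambda>x. complex_of_real (\<phi> x)) = (LINT x|lborel. g x * complex_of_real (\<phi> x))"
      using rep c by (auto simp: represented_by_def)
    have R: "Re (g x * complex_of_real (\<phi> x)) = r x * \<phi> x" for x by (simp add: r_def)
    show "integrable lborel (\<lambda>x. r x * \<phi> x)" using integrable_Re[OF i] unfolding R .
    have "LP_block \<phi>0 j f (\<lambda>x. complex_of_real (\<phi> x)) =
        complex_of_real (f (\<lambda>x. LINT y|lborel. \<phi> y * kern ?L (x - y)))"
      by (rule LP_block_conv[OF lt le rapid_integrable[OF schwartz_rapid[OF \<phi>]]]) (rule tempered_zero[OF f])
    also have "(\<lambda>x. LINT y|lborel. \<phi> y * kern ?L (x - y)) = conv (kern ?L) \<phi>"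
      using conv_commute[OF rapid_measurable[OF kern_rapid[OF lt]] rapid_measurable[OF schwartz_rapid[OF \<phi>]]] by auto
    finally have "f (conv (kern ?L) \<phi>) = Re (LINT x|lborel. g x * complex_of_real (\<phi> x))" using e by (metis Re_complex_of_real)
    also have "\<dots> = (LINT x|lborel. r x * \<phi> x)" using integral_Re[OF i] unfolding R by simp
    finally show "f (conv (kern ?L) \<phi>) = (LINT x|lborel. r x * \<phi> x)" .
  qed
  obtain N where W: "integrable lborel (\<lambda>x. \<bar>r x\<bar> / (1 + norm x) ^ N)"
    using schwartz_pairing_weight[OF LP rm pair(1)] by blast
  define F where "F x = f (\<lambda>z. kern ?L (z - x))" for x
  have F: "(LINT y|lborel. r y * kern (dil \<phi>0 J) (x - y)) = F x" if J: "Suc j \<le> J" for J x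
  proof -
    have dt: "test_fun (dil \<phi>0 J)" by (rule dil_test_fun[OF t])
    have s: "(\<lambda>y. kern (dil \<phi>0 J) (x - y)) \<in> schwartz" by (rule schwartz_reflect[OF kern_schwartz[OF dt]])
    have e: "conv (kern ?L) (\<lambda>y. kern (dil \<phi>0 J) (x - y)) = (\<lambda>z. kern ?L (z - x))"
    proof (rule ext)
      fix z
      have "conv (kern ?L) (\<lambda>y. kern (dil \<phi>0 J) (x - y)) z = (LINT y|lborel. kern (dil \<phi>0 J) (x - y) * kern ?L (z - y))"
        using conv_commute[OF rapid_measurable[OF kern_rapid[OF lt]] rapid_measurable[OF schwartz_rapid[OF s]], of z] by simp
      also have "\<dots> = kern ?L (z - x)"
        by (rule kern_conv[OF lt dt _ dil_mult_LP_function[OF LP J]]) (rule dil_even, rule LP_even[OF LP])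
      finally show "conv (kern ?L) (\<lambda>y. kern (dil \<phi>0 J) (x - y)) z = kern ?L (z - x)" .
    qed
    show ?thesis by (simp only: F_def e pair(2)[OF s, symmetric])
  qed
  have rF: "AE x in lborel. r x = F x" by (rule reproducing_AE[OF LP rm W F])
  let ?K = "kern (dil \<phi>0 (Suc j))"
  have K: "rapid ?K" by (rule kern_rapid[OF dil_test_fun[OF t]])
  have F': "F x = (LINT y|lborel. r y * ?K (x - y))" for x using F[OF order_refl] by simp
  have rK: "integrable lborel (\<lambda>y. r y * ?K (x - y))" for x by (rule weighted_conv_growth(1)[OF rm W K])
  obtain G where G: "\<And>x. \<bar>F x\<bar> \<le> G * (1 + norm x) ^ N"
    using weighted_conv_growth(3)[OF rm W K] unfolding F'[symmetric] by blast
  \<comment> \<open>The sup norm of the kernel at scale \<open>2 ^ Suc j\<close>, from the dilation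
    factor in \<open>kern_dil\<close>.\<close>
  define B where "B = (2 ^ Suc j) ^ CARD('n) * b"
  have B: "\<bar>?K x\<bar> \<le> B" for x unfolding B_def kern_dil[OF t] abs_mult by (intro mult_mono b) auto
  have b0: "0 \<le> b" using b[of 0] by linarith
  have rle: "\<bar>r x\<bar> powr p \<le> norm (g x) powr p" for x
    unfolding r_def using p abs_Re_le_cmod by (intro powr_mono2) auto
  have rp: "integrable lborel (\<lambda>x. \<bar>r x\<bar> powr p)"
    by (rule Bochner_Integration.integrable_bound[OF gp]) (use rm rle in auto)
  have Sle: "(LINT x|lborel. \<bar>r x\<bar> powr p) \<le> (LINT x|lborel. norm (g x) powr p)"
    by (rule integral_mono[OF rp gp rle])
  have S0: "0 \<le> (LINT x|lborel. \<bar>r x\<bar> powr p)" by simp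
  have B0: "0 \<le> B" using b0 by (simp add: B_def)
  have "(LINT x|lborel. \<bar>r x\<bar>) \<le> (B * (LINT x|lborel. \<bar>r x\<bar> powr p)) powr ((1 - p) / p) * (LINT x|lborel. \<bar>r x\<bar> powr p)"
    by (rule nikolskii(2)[OF p rm rp rF F' rK G K B])
  also have "\<dots> \<le> (B * (LINT x|lborel. norm (g x) powr p)) powr ((1 - p) / p) * (LINT x|lborel. norm (g x) powr p)"
    using Sle S0 B0 p by (intro mult_mono powr_mono2 mult_left_mono) auto
  finally have est: "(LINT x|lborel. \<bar>r x\<bar>) \<le> (B * (LINT x|lborel. norm (g x) powr p)) powr ((1 - p) / p) * (LINT x|lborel. norm (g x) powr p)" .
  show ?thesis
    using nikolskii(1)[OF p rm rp rF F' rK G K B] est pair(2)[OF test_fun_schwartz] rF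
    unfolding B_def F' by (intro exI[of _ r]) blast
qed

section \<open>Ridge expansion of kernels\<close>

text \<open>Lagrange interpolation at \<open>k + 1\<close> nodes reproduces every polynomial of
  degree at most \<open>k\<close>. Reading off the coefficient of order \<open>r\<close> in the
  interpolant of the monomial of degree \<open>m\<close> gives the weights.\<close>

lemma vandermonde_dual:
  fixes z :: "nat \<Rightarrow> real"
  assumes z: "inj_on z {..k}" and r: "r \<le> k"
  shows "\<exists>a. \<forall>m\<le>k. (\<Sum>l\<le>k. a l * z l ^ m) = (if m = r then 1 else 0)"
proof -
  define L where "L l = smult (inverse (\<Prod>j\<in>{..k} - {l}. z l - z j)) (\<Prod>j\<in>{..k} - {l}. [:- z j, 1:])" for l
  have deg: "degree (L l) \<le> k" if "l \<le> k" for l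
  proof -
    have "degree (\<Prod>j\<in>{..k} - {l}. [:- z j, 1:]) \<le> (\<Sum>j\<in>{..k} - {l}. degree [:- z j, 1:])"
      by (rule order_trans[OF degree_prod_sum_le]) auto
    also have "\<dots> = k" using that by simp
    finally show ?thesis unfolding L_def using degree_smult_le order_trans by blast
  qed
  have val: "poly (L l) (z j) = (if j = l then 1 else 0)" if "l \<le> k" "j \<le> k" for l j
  proof (cases "j = l")
    case True
    have "(\<Prod>j\<in>{..k} - {l}. z l - z j) \<noteq> 0"
      using z that by (auto simp: inj_on_def)
    then show ?thesis using True by (simp add: L_def poly_prod)
  next
    case False
    then have "(\<Prod>i\<in>{..k} - {l}. z j - z i) = 0" using that by (intro prod_zero) auto
    then show ?thesis using False by (simp add: L_def poly_prod)
  qed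
  have "(\<Sum>l\<le>k. coeff (L l) r * z l ^ m) = (if m = r then 1 else 0)" if m: "m \<le> k" for m
  proof -
    \<comment> \<open>The interpolation error has degree at most \<open>k\<close> and the
      \<open>k + 1\<close> nodes among its roots.\<close>
    define D where "D = monom 1 m - (\<Sum>l\<le>k. smult (z l ^ m) (L l))"
    have "D = 0"
    proof (rule ccontr)
      assume D: "D \<noteq> 0"
      have "degree (\<Sum>l\<le>k. smult (z l ^ m) (L l)) \<le> k"
        by (rule degree_sum_le) (auto intro: order_trans[OF degree_smult_le] deg)
      then have "degree D \<le> k" unfolding D_def using m by (intro degree_diff_le) (auto simp: degree_monom_eq)
      moreover have "card {x. poly D x = 0} \<le> degree D" by (rule card_poly_roots_bound[OF D])
      moreover have "Suc k \<le> card {x. poly D x = 0}"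
      proof -
        have "poly D (z j) = 0" if "j \<le> k" for j
        proof -
          have "poly D (z j) = z j ^ m - (\<Sum>l\<le>k. z l ^ m * poly (L l) (z j))"
            by (simp add: D_def poly_monom poly_sum)
          also have "(\<Sum>l\<le>k. z l ^ m * poly (L l) (z j)) = (\<Sum>l\<le>k. if l = j then z j ^ m else 0)"
            using that by (intro sum.cong) (auto simp: val)
          finally show ?thesis using that by simp
        qed
        then have "z ` {..k} \<subseteq> {x. poly D x = 0}" by auto
        then have "card (z ` {..k}) \<le> card {x. poly D x = 0}" by (intro card_mono poly_roots_finite D)
        then show ?thesis using z by (simp add: card_image)
      qed
      ultimately show False by linarith
    qed
    then have "coeff D r = 0" by simp
    then show ?thesis by (auto simp: D_def coeff_sum mult.commute)
  qed
  then show ?thesis by (intro exI[of _ "\<lambda>l. coeff (L l) r"]) auto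
qed

text \<open>The coefficients depend on the breakpoints only, so one \<open>T\<close> works for all
  directions \<omega>.\<close>

lemma approx_hull_ridge_monomial:
  fixes \<Omega> :: "(real^'n) set"
  assumes k: "1 \<le> k" and i: "i \<le> k" and c: "c' < c"
    and \<Omega>: "\<And>x \<omega>. x \<in> \<Omega> \<Longrightarrow> norm \<omega> = 1 \<Longrightarrow> \<bar>\<omega> \<bullet> x\<bar> \<le> c'"
  shows "\<exists>T\<ge>0. \<forall>\<omega>. norm \<omega> = 1 \<longrightarrow> approx_hull \<Omega> (dictionary k c) T (\<lambda>x. (\<omega> \<bullet> x + c) ^ i)"
proof (cases "\<Omega> = {}")
  case True
  then show ?thesis using approx_hull_cong[of \<Omega> "\<lambda>x. 0"] approx_hull_zero by (metis empty_iff order_refl)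
next
  case False
  have c': "0 \<le> c'" using False \<Omega>[of _ "axis undefined 1"] by (metis abs_ge_zero ex_in_conv norm_axis_1 order_trans)
  \<comment> \<open>Equally spaced breakpoints from \<open>- c\<close> at \<open>l = 0\<close> to
    \<open>- c'\<close> at \<open>l = k\<close>: all are admissible in the dictionary, and none lies
    to the right of a value \<open>\<omega> \<bullet> x\<close> on \<Omega>.\<close>
  define b where "b l = - c + (c - c') * real l / real k" for l
  have bI: "- c \<le> b l" "b l \<le> - c'" if "l \<le> k" for l
  proof -
    have "(c - c') * (real l / real k) \<le> (c - c') * 1" using that k c by (intro mult_left_mono) auto
    then show "b l \<le> - c'" by (simp add: b_def)
    show "- c \<le> b l" using k c by (simp add: b_def)
  qed
  have "inj_on (\<lambda>l. - (b l + c)) {..k}" using k c by (auto simp: inj_on_def b_def)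
  \<comment> \<open>In the binomial expansion of \<open>(u - z) ^ k\<close> the monomial
    \<open>u ^ i\<close> comes with \<open>z ^ (k - i)\<close>, so that is the power to be
    selected.\<close>
  from vandermonde_dual[OF this, of "k - i"] obtain a where
    a: "\<And>m. m \<le> k \<Longrightarrow> (\<Sum>l\<le>k. a l * (- (b l + c)) ^ m) = (if m = k - i then 1 else 0)" by auto
  define N where "N = real (k choose (k - i))"
  have N: "N > 0" by (simp add: N_def)
  have main: "(u :: real) ^ i = (\<Sum>l\<le>k. a l / N * (u - (b l + c)) ^ k)" for u
  proof -
    have "(\<Sum>l\<le>k. a l * (u - (b l + c)) ^ k) = (\<Sum>l\<le>k. a l * (\<Sum>m\<le>k. real (k choose m) * (- (b l + c)) ^ m * u ^ (k - m)))"
    proof (intro sum.cong refl arg_cong2[where f = "(*)"])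
      fix l
      have "u - (b l + c) = - (b l + c) + u" by simp
      then show "(u - (b l + c)) ^ k = (\<Sum>m\<le>k. real (k choose m) * (- (b l + c)) ^ m * u ^ (k - m))"
        by (simp only: binomial_ring)
    qed
    also have "\<dots> = (\<Sum>m\<le>k. real (k choose m) * u ^ (k - m) * (\<Sum>l\<le>k. a l * (- (b l + c)) ^ m))"
      unfolding sum_distrib_left by (subst sum.swap) (simp only: mult_ac)
    also have "\<dots> = (\<Sum>m\<le>k. if m = k - i then N * u ^ i else 0)"
    proof (intro sum.cong refl)
      fix m assume "m \<in> {..k}"
      then have "(\<Sum>l\<le>k. a l * (- (b l + c)) ^ m) = (if m = k - i then 1 else 0)" by (intro a) simp
      then show "real (k choose m) * u ^ (k - m) * (\<Sum>l\<le>k. a l * (- (b l + c)) ^ m) = (if m = k - i then N * u ^ i else 0)"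
        using i unfolding N_def by (simp only:) simp
    qed
    also have "\<dots> = N * u ^ i" by simp
    finally show ?thesis using N by (simp add: sum_divide_distrib[symmetric])
  qed
  show ?thesis
  proof (intro exI[of _ "\<Sum>l\<le>k. \<bar>a l / N\<bar> * 1"] conjI allI impI)
    show "0 \<le> (\<Sum>l\<le>k. \<bar>a l / N\<bar> * 1)" by (intro sum_nonneg) auto
    fix \<omega> :: "real^'n" assume w: "norm \<omega> = 1"
    have "approx_hull \<Omega> (dictionary k c) (\<Sum>l\<le>k. \<bar>a l / N\<bar> * 1) (\<lambda>x. \<Sum>l\<le>k. a l / N * relu_power k (\<omega> \<bullet> x - b l))"
    proof (intro approx_hull_sum approx_hull_scale approx_hull_mem)
      fix l assume "l \<in> {..k}"
      then show "(\<lambda>x. relu_power k (\<omega> \<bullet> x - b l)) \<in> dictionary k c"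
        unfolding dictionary_def using w bI[of l] c c' by (intro CollectI exI[of _ \<omega>] exI[of _ "b l"]) auto
    qed auto
    also have "?this \<longleftrightarrow> approx_hull \<Omega> (dictionary k c) (\<Sum>l\<le>k. \<bar>a l / N\<bar> * 1) (\<lambda>x. (\<omega> \<bullet> x + c) ^ i)"
    proof (rule approx_hull_cong)
      fix x assume x: "x \<in> \<Omega>"
      have "relu_power k (\<omega> \<bullet> x - b l) = (\<omega> \<bullet> x + c - (b l + c)) ^ k" if "l \<le> k" for l
        using bI(2)[OF that] \<Omega>[OF x w] by (simp add: relu_power_def)
      then show "(\<Sum>l\<le>k. a l / N * relu_power k (\<omega> \<bullet> x - b l)) = (\<omega> \<bullet> x + c) ^ i"
        unfolding main by (intro sum.cong) auto
    qed
    finally show "approx_hull \<Omega> (dictionary k c) (\<Sum>l\<le>k. \<bar>a l / N\<bar> * 1) (\<lambda>x. (\<omega> \<bullet> x + c) ^ i)" .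
  qed
qed

text \<open>The bound is independent of \<kappa>: one factor \<kappa> is consumed by the
  concentration of the integrand. This is the saving from \<kappa>^(k+1) to \<kappa>^k.\<close>

lemma arctan_scaled_integral:
  fixes \<kappa> \<theta> c :: real
  assumes "0 \<le> \<kappa>" "0 \<le> c"
  shows "integral {-c..c} (\<lambda>s. \<kappa> / (1 + (\<kappa> * s - \<theta>)\<^sup>2)) \<le> pi"
proof -
  have "((\<lambda>s. \<kappa> / (1 + (\<kappa> * s - \<theta>)\<^sup>2)) has_integral (arctan (\<kappa> * c - \<theta>) - arctan (\<kappa> * (- c) - \<theta>))) {-c..c}"
  proof (rule fundamental_theorem_of_calculus)
    show "- c \<le> c" using assms by simp
    fix s
    have "((\<lambda>s. arctan (\<kappa> * s - \<theta>)) has_real_derivative \<kappa> / (1 + (\<kappa> * s - \<theta>)\<^sup>2)) (at s within {-c..c})"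
      by (auto intro!: derivative_eq_intros simp: field_simps add_nonneg_eq_0_iff)
    then show "((\<lambda>s. arctan (\<kappa> * s - \<theta>)) has_vector_derivative \<kappa> / (1 + (\<kappa> * s - \<theta>)\<^sup>2)) (at s within {-c..c})"
      by (simp add: has_real_derivative_iff_has_vector_derivative)
  qed
  then have "integral {-c..c} (\<lambda>s. \<kappa> / (1 + (\<kappa> * s - \<theta>)\<^sup>2)) = arctan (\<kappa> * c - \<theta>) - arctan (\<kappa> * (- c) - \<theta>)"
    by (rule integral_unique)
  then show ?thesis using arctan_ubound[of "\<kappa> * c - \<theta>"] arctan_lbound[of "\<kappa> * (- c) - \<theta>"] by linarith
qed

lemma relu_power_continuous: "continuous_on A (relu_power k)"
  unfolding relu_power_def[abs_def] by (intro continuous_intros)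

lemma approx_hull_relu_integral:
  fixes \<Omega> :: "(real^'n) set"
  assumes c: "0 < c" and \<Omega>: "\<And>x. x \<in> \<Omega> \<Longrightarrow> \<bar>\<omega> \<bullet> x\<bar> \<le> c" and w: "norm \<omega> = 1"
    and h: "continuous_on {-c..c} h"
  shows "approx_hull \<Omega> (dictionary k c) (integral {-c..c} (\<lambda>s. \<bar>h s\<bar>))
    (\<lambda>x. integral {-c..c} (\<lambda>s. h s * relu_power k (\<omega> \<bullet> x - s)))"
proof -
  let ?h = "\<lambda>s. indicator {-c..c} s * h s"
  have hi: "integrable lborel ?h"
    using borel_integrable_atLeastAtMost'[OF h] by (simp add: set_integrable_def)
  have Vc: "continuous_on A (\<lambda>s. relu_power k (t - s))" for t A
    unfolding relu_power_def by (intro continuous_intros)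
  \<comment> \<open>For \<open>\<omega> \<bullet> x\<close> and breakpoints in
    \<open>{-c..c}\<close> their difference stays in \<open>{-2*c..2*c}\<close>.\<close>
  have uc: "uniformly_continuous_on {-2*c..2*c} (relu_power k)"
    by (intro compact_uniformly_continuous relu_power_continuous) auto
  have *: "approx_hull \<Omega> (dictionary k c) (1 * (LINT a|lborel. \<bar>?h a\<bar>)) (\<lambda>x. LINT a|lborel. ?h a * relu_power k (\<omega> \<bullet> x - a))"
  proof (rule approx_hull_integral[OF hi, where S="{-c..c}" and M="(2*c)^k"])
    show "\<bar>relu_power k (\<omega> \<bullet> x - a)\<bar> \<le> (2 * c) ^ k" if "a \<in> {-c..c}" "x \<in> \<Omega>" for a x
      using \<Omega>[OF that(2)] that(1) c unfolding relu_power_def power_abs by (intro power_mono) auto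
    show "\<exists>\<delta>>0. \<forall>a\<in>{-c..c}. \<forall>b\<in>{-c..c}. dist a b < \<delta> \<longrightarrow> (\<forall>x\<in>\<Omega>. \<bar>relu_power k (\<omega> \<bullet> x - a) - relu_power k (\<omega> \<bullet> x - b)\<bar> \<le> \<epsilon>)"
      if e: "\<epsilon> > 0" for \<epsilon>
    proof -
      obtain d where d: "d > 0" "\<And>s t. s \<in> {-2*c..2*c} \<Longrightarrow> t \<in> {-2*c..2*c} \<Longrightarrow> dist t s < d \<Longrightarrow> dist (relu_power k t) (relu_power k s) < \<epsilon>"
        using uc e unfolding uniformly_continuous_on_def by metis
      show ?thesis
      proof (intro exI[of _ d] conjI ballI impI d(1))
        fix a b x assume ab: "a \<in> {-c..c}" "b \<in> {-c..c}" "dist a b < d" and x: "x \<in> \<Omega>"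
        have "dist (relu_power k (\<omega> \<bullet> x - a)) (relu_power k (\<omega> \<bullet> x - b)) < \<epsilon>"
          using ab \<Omega>[OF x] by (intro d(2)) (auto simp: dist_real_def abs_minus_commute)
        then show "\<bar>relu_power k (\<omega> \<bullet> x - a) - relu_power k (\<omega> \<bullet> x - b)\<bar> \<le> \<epsilon>" by (simp add: dist_real_def)
      qed
    qed
    show "(\<lambda>a. ?h a * relu_power k (\<omega> \<bullet> x - a)) \<in> borel_measurable borel" for x
      by (intro borel_measurable_times[of ?h] borel_measurable_continuous_onI[OF Vc])
         (use borel_measurable_integrable[OF hi] in simp)
    show "approx_hull \<Omega> (dictionary k c) 1 (\<lambda>x. relu_power k (\<omega> \<bullet> x - a))" if "a \<in> {-c..c}" for a
      by (rule approx_hull_mem) (use that w in \<open>auto simp: dictionary_def\<close>)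
  qed auto
  have "(LINT a|lborel. \<bar>?h a\<bar>) = integral {-c..c} (\<lambda>s. \<bar>h s\<bar>)"
    using set_borel_integral_eq_integral(2)[OF borel_integrable_atLeastAtMost'[OF continuous_on_rabs[OF h]]]
    by (simp add: set_lebesgue_integral_def abs_mult)
  moreover have "(LINT a|lborel. ?h a * relu_power k (\<omega> \<bullet> x - a)) = integral {-c..c} (\<lambda>s. h s * relu_power k (\<omega> \<bullet> x - s))" for x
    using set_borel_integral_eq_integral(2)[OF borel_integrable_atLeastAtMost'[OF continuous_on_mult[OF h Vc]], of "\<omega> \<bullet> x"]
    by (simp add: set_lebesgue_integral_def mult.assoc)
  ultimately show ?thesis using * by simp
qed

text \<open>Truncation makes the integrand vanish beyond \<open>t\<close>, so the domain of
  integration no longer depends on \<open>t\<close>. This uses \<open>1 \<le> k\<close>, as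
  \<open>relu_power 0\<close> is constantly 1.\<close>

lemma Taylor_relu:
  fixes G :: "nat \<Rightarrow> real \<Rightarrow> real"
  assumes G: "\<And>n t. n \<le> k \<Longrightarrow> (G n has_real_derivative G (Suc n) t) (at t)"
    and Gc: "continuous_on UNIV (G (Suc k))" and k: "1 \<le> k" and t: "- c \<le> t" "t \<le> c"
  shows "G 0 t = (\<Sum>i\<le>k. G i (- c) / fact i * (t + c) ^ i) +
    integral {-c..c} (\<lambda>s. (G (Suc k) s / fact k) * relu_power k (t - s))"
proof -
  let ?f = "\<lambda>s. (G (Suc k) s / fact k) * relu_power k (t - s)"
  have fc: "continuous_on A ?f" for A
    unfolding relu_power_def by (intro continuous_intros continuous_on_subset[OF Gc]) auto
  have "G 0 t = (\<Sum>i<Suc k. ((t - (- c)) ^ i / fact i) *\<^sub>R G i (- c)) +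
      integral {-c..t} (\<lambda>x. ((t - x) ^ (Suc k - 1) / fact (Suc k - 1)) *\<^sub>R G (Suc k) x)"
  proof (rule Taylor_integral)
    fix m s assume "m < Suc k"
    then show "(G m has_vector_derivative G (Suc m) s) (at s within {-c..t})"
      using G[of m s] by (simp add: has_real_derivative_iff_has_vector_derivative has_vector_derivative_at_within)
  qed (use t in auto)
  also have "integral {-c..t} (\<lambda>x. ((t - x) ^ (Suc k - 1) / fact (Suc k - 1)) *\<^sub>R G (Suc k) x) = integral {-c..t} ?f"
    by (rule integral_cong) (auto simp: relu_power_def)
  also have "\<dots> = integral {-c..c} ?f"
  proof -
    have "integral {-c..t} ?f + integral {t..c} ?f = integral {-c..c} ?f"
      using t by (intro Henstock_Kurzweil_Integration.integral_combine integrable_continuous_real fc) auto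
    moreover have "integral {t..c} ?f = integral {t..c} (\<lambda>s. 0)"
      using k by (intro integral_cong) (auto simp: relu_power_def)
    ultimately show ?thesis by simp
  qed
  finally show ?thesis by (simp add: lessThan_Suc_atMost mult_ac)
qed

text \<open>The chain rule costs one power of \<kappa> per derivative. The Taylor coefficients at
  \<open>- c\<close> cost at most \<open>\<kappa> ^ k\<close>; the remainder costs one power more,
  which its integral over \<open>{-c..c}\<close> recovers through the decay hypothesis. The base
  \<open>1 + \<kappa>\<close> covers small \<kappa>, and \<open>C\<close> is common to all
  profiles.\<close>

lemma approx_hull_profile:
  fixes \<Omega> :: "(real^'n) set"
  assumes k: "1 \<le> k" and c: "c' < c" "0 < c"
    and \<Omega>: "\<And>x \<omega>. x \<in> \<Omega> \<Longrightarrow> norm \<omega> = 1 \<Longrightarrow> \<bar>\<omega> \<bullet> x\<bar> \<le> c'"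
  shows "\<exists>C\<ge>0. \<forall>D B \<kappa> \<theta> \<omega>. 0 \<le> \<kappa> \<longrightarrow> norm \<omega> = 1 \<longrightarrow>
    (\<forall>n t. n \<le> k \<longrightarrow> (D n has_real_derivative D (Suc n) t) (at t)) \<longrightarrow> continuous_on UNIV (D (Suc k)) \<longrightarrow>
    (\<forall>n t. n \<le> Suc k \<longrightarrow> \<bar>D n t\<bar> \<le> B / (1 + t\<^sup>2)) \<longrightarrow>
    approx_hull \<Omega> (dictionary k c) (C * B * (1 + \<kappa>) ^ k) (\<lambda>x. D 0 (\<kappa> * (\<omega> \<bullet> x) - \<theta>))"
proof -
  have "\<forall>i\<in>{..k}. \<exists>T. 0 \<le> T \<and> (\<forall>\<omega>. norm \<omega> = 1 \<longrightarrow> approx_hull \<Omega> (dictionary k c) T (\<lambda>x. (\<omega> \<bullet> x + c) ^ i))"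
    using approx_hull_ridge_monomial[OF k _ c(1) \<Omega>] by blast
  from bchoice[OF this] obtain T where T: "\<And>i. i \<le> k \<Longrightarrow> 0 \<le> T i"
    "\<And>i \<omega>. i \<le> k \<Longrightarrow> norm \<omega> = 1 \<Longrightarrow> approx_hull \<Omega> (dictionary k c) (T i) (\<lambda>x. (\<omega> \<bullet> x + c) ^ i)" by auto
  \<comment> \<open>The sum bounds the polynomial part, \<open>pi\<close> the remainder.\<close>
  define C where "C = (\<Sum>i\<le>k. T i) + pi"
  have C: "0 \<le> C" unfolding C_def using T(1) by (intro add_nonneg_nonneg sum_nonneg) auto
  show ?thesis
  proof (intro exI[of _ C] conjI allI impI C)
    fix D :: "nat \<Rightarrow> real \<Rightarrow> real" and B \<kappa> \<theta> :: real and \<omega> :: "real^'n"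
    assume l: "0 \<le> \<kappa>" and w: "norm \<omega> = 1"
      and D: "\<forall>n t. n \<le> k \<longrightarrow> (D n has_real_derivative D (Suc n) t) (at t)"
      and Dc: "continuous_on UNIV (D (Suc k))"
      and B: "\<forall>n t. n \<le> Suc k \<longrightarrow> \<bar>D n t\<bar> \<le> B / (1 + t\<^sup>2)"
    have B0: "0 \<le> B" using B[rule_format, of 0 0] by simp
    have Bb: "\<bar>D n t\<bar> \<le> B" if "n \<le> Suc k" for n t
    proof -
      have "B / (1 + t\<^sup>2) \<le> B / 1" using B0 by (intro divide_left_mono) (auto intro: add_pos_nonneg)
      then show ?thesis using B[rule_format, OF that, of t] by simp
    qed
    define G where "G n t = \<kappa> ^ n * D n (\<kappa> * t - \<theta>)" for n t
    have Gd: "(G n has_real_derivative G (Suc n) t) (at t)" if "n \<le> k" for n t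
    proof -
      have "((\<lambda>t. D n (\<kappa> * t - \<theta>)) has_real_derivative D (Suc n) (\<kappa> * t - \<theta>) * \<kappa>) (at t)"
        by (rule DERIV_chain2[OF D[rule_format, OF that]]) (auto intro!: derivative_eq_intros)
      from DERIV_cmult[OF this, of "\<kappa> ^ n"] show ?thesis by (simp add: G_def[abs_def] mult_ac)
    qed
    have Gc: "continuous_on UNIV (G (Suc k))"
      unfolding G_def[abs_def] by (intro continuous_intros continuous_on_compose2[OF Dc]) auto
    have Gc': "continuous_on A (\<lambda>s. G (Suc k) s / fact k)" for A
      by (intro continuous_intros continuous_on_subset[OF Gc]) auto
    have \<Omega>c: "\<bar>\<omega> \<bullet> x\<bar> \<le> c" if "x \<in> \<Omega>" for x using \<Omega>[OF that w] c by simp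
    let ?T1 = "\<Sum>i\<le>k. \<bar>G i (- c) / fact i\<bar> * T i" and ?T2 = "integral {-c..c} (\<lambda>s. \<bar>G (Suc k) s / fact k\<bar>)"
    have "approx_hull \<Omega> (dictionary k c) ?T1 (\<lambda>x. \<Sum>i\<le>k. G i (- c) / fact i * (\<omega> \<bullet> x + c) ^ i)"
      by (intro approx_hull_sum approx_hull_scale T(2) w) auto
    moreover have "approx_hull \<Omega> (dictionary k c) ?T2 (\<lambda>x. integral {-c..c} (\<lambda>s. (G (Suc k) s / fact k) * relu_power k (\<omega> \<bullet> x - s)))"
      by (rule approx_hull_relu_integral[OF c(2) \<Omega>c w Gc'])
    ultimately have "approx_hull \<Omega> (dictionary k c) (?T1 + ?T2)
      (\<lambda>x. (\<Sum>i\<le>k. G i (- c) / fact i * (\<omega> \<bullet> x + c) ^ i) + integral {-c..c} (\<lambda>s. (G (Suc k) s / fact k) * relu_power k (\<omega> \<bullet> x - s)))"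
      by (rule approx_hull_add)
    also have "?this \<longleftrightarrow> approx_hull \<Omega> (dictionary k c) (?T1 + ?T2) (\<lambda>x. D 0 (\<kappa> * (\<omega> \<bullet> x) - \<theta>))"
    proof (rule approx_hull_cong)
      fix x assume "x \<in> \<Omega>"
      then have "- c \<le> \<omega> \<bullet> x" "\<omega> \<bullet> x \<le> c" using \<Omega>c[of x] by auto
      from Taylor_relu[of k G, OF Gd Gc k this]
      show "(\<Sum>i\<le>k. G i (- c) / fact i * (\<omega> \<bullet> x + c) ^ i) + integral {-c..c} (\<lambda>s. (G (Suc k) s / fact k) * relu_power k (\<omega> \<bullet> x - s)) = D 0 (\<kappa> * (\<omega> \<bullet> x) - \<theta>)"
        by (simp add: G_def)
    qed
    finally have hull: "approx_hull \<Omega> (dictionary k c) (?T1 + ?T2) (\<lambda>x. D 0 (\<kappa> * (\<omega> \<bullet> x) - \<theta>))" .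
    have f1: "1 \<le> (fact n :: real)" for n by (rule fact_ge_1)
    have lk: "\<kappa> ^ i \<le> (1 + \<kappa>) ^ k" if "i \<le> k" for i
    proof -
      have "\<kappa> ^ i \<le> (1 + \<kappa>) ^ i" using l by (intro power_mono) auto
      also have "\<dots> \<le> (1 + \<kappa>) ^ k" using l that by (intro power_increasing) auto
      finally show ?thesis .
    qed
    have "?T1 \<le> (\<Sum>i\<le>k. (B * (1 + \<kappa>) ^ k) * T i)"
    proof (intro sum_mono mult_right_mono T(1))
      fix i assume i: "i \<in> {..k}"
      have "\<bar>G i (- c) / fact i\<bar> \<le> \<bar>G i (- c)\<bar> / 1"
        unfolding abs_divide using f1 by (intro frac_le) auto
      also have "\<dots> \<le> (1 + \<kappa>) ^ k * B"
        unfolding G_def abs_mult div_by_1 using i l lk[of i] Bb[of i] by (intro mult_mono) auto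
      finally show "\<bar>G i (- c) / fact i\<bar> \<le> B * (1 + \<kappa>) ^ k" by (simp add: mult.commute)
    qed auto
    moreover have "?T2 \<le> (B * (1 + \<kappa>) ^ k) * pi"
    proof -
      have nz: "1 + (\<kappa> * s - \<theta>)\<^sup>2 \<noteq> 0" for s by (simp add: add_nonneg_eq_0_iff)
      have "?T2 \<le> integral {-c..c} (\<lambda>s. (B * \<kappa> ^ k) * (\<kappa> / (1 + (\<kappa> * s - \<theta>)\<^sup>2)))"
      proof (rule integral_le)
        show "(\<lambda>s. \<bar>G (Suc k) s / fact k\<bar>) integrable_on {-c..c}"
          by (intro integrable_continuous_real continuous_on_rabs Gc')
        show "(\<lambda>s. (B * \<kappa> ^ k) * (\<kappa> / (1 + (\<kappa> * s - \<theta>)\<^sup>2))) integrable_on {-c..c}"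
          by (intro integrable_continuous_real continuous_intros) (use nz in auto)
        fix s
        have "\<bar>G (Suc k) s / fact k\<bar> \<le> \<bar>G (Suc k) s\<bar> / 1"
          unfolding abs_divide using f1 by (intro frac_le) auto
        also have "\<dots> \<le> \<kappa> ^ Suc k * (B / (1 + (\<kappa> * s - \<theta>)\<^sup>2))"
          unfolding G_def abs_mult div_by_1 using l B by (intro mult_mono) auto
        finally show "\<bar>G (Suc k) s / fact k\<bar> \<le> (B * \<kappa> ^ k) * (\<kappa> / (1 + (\<kappa> * s - \<theta>)\<^sup>2))"
          by (simp add: mult_ac)
      qed
      also have "\<dots> = (B * \<kappa> ^ k) * integral {-c..c} (\<lambda>s. \<kappa> / (1 + (\<kappa> * s - \<theta>)\<^sup>2))"
        by (rule integral_mult_right)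
      also have "\<dots> \<le> (B * (1 + \<kappa>) ^ k) * pi"
        using B0 l lk[of k] c arctan_scaled_integral[OF l, of c \<theta>]
        by (intro mult_mono mult_left_mono) (auto intro!: Henstock_Kurzweil_Integration.integral_nonneg integrable_continuous_real continuous_intros simp: nz)
      finally show ?thesis .
    qed
    ultimately have "?T1 + ?T2 \<le> C * B * (1 + \<kappa>) ^ k"
      unfolding C_def by (simp add: sum_distrib_left[symmetric] sum_distrib_right[symmetric] algebra_simps)
    with hull show "approx_hull \<Omega> (dictionary k c) (C * B * (1 + \<kappa>) ^ k) (\<lambda>x. D 0 (\<kappa> * (\<omega> \<bullet> x) - \<theta>))"
      by (rule approx_hull_mono)
  qed
qed

section \<open>Oscillatory profiles and their decay\<close>

lemma oscillatory_by_parts: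
  fixes a a' a'' :: "real \<Rightarrow> real"
  assumes a: "\<And>r. (a has_real_derivative a' r) (at r)" and a': "\<And>r. (a' has_real_derivative a'' r) (at r)"
    and a'': "continuous_on {1..2} a''" and ends: "a 1 = 0" "a 2 = 0" "a' 1 = 0" "a' 2 = 0"
  shows "\<tau>\<^sup>2 * integral {1..2} (\<lambda>r. a r * cos (r * \<tau> + \<theta>)) = - integral {1..2} (\<lambda>r. a'' r * cos (r * \<tau> + \<theta>))"
proof -
  \<comment> \<open>Two integrations by parts at once: \<open>?F\<close> is an antiderivative of the
    sum of both integrands, and the end conditions make it vanish at 1 and 2.\<close>
  let ?F = "\<lambda>r. a r * \<tau> * sin (r * \<tau> + \<theta>) + a' r * cos (r * \<tau> + \<theta>)"
  have ac: "continuous_on A a" for A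
    using a by (meson DERIV_isCont continuous_at_imp_continuous_on)
  have "((\<lambda>r. \<tau>\<^sup>2 * (a r * cos (r * \<tau> + \<theta>)) + a'' r * cos (r * \<tau> + \<theta>)) has_integral (?F 2 - ?F 1)) {1..2}"
  proof (rule fundamental_theorem_of_calculus)
    fix r :: real
    have "(?F has_real_derivative (\<tau>\<^sup>2 * (a r * cos (r * \<tau> + \<theta>)) + a'' r * cos (r * \<tau> + \<theta>))) (at r)"
      by (rule derivative_eq_intros a a' refl)+ (simp add: power2_eq_square algebra_simps)
    then show "(?F has_vector_derivative (\<tau>\<^sup>2 * (a r * cos (r * \<tau> + \<theta>)) + a'' r * cos (r * \<tau> + \<theta>))) (at r within {1..2})"
      by (simp add: has_real_derivative_iff_has_vector_derivative has_vector_derivative_at_within)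
  qed simp
  then have "integral {1..2} (\<lambda>r. \<tau>\<^sup>2 * (a r * cos (r * \<tau> + \<theta>)) + a'' r * cos (r * \<tau> + \<theta>)) = 0"
    using ends by (simp add: integral_unique)
  moreover have "integral {1..2} (\<lambda>r. \<tau>\<^sup>2 * (a r * cos (r * \<tau> + \<theta>)) + a'' r * cos (r * \<tau> + \<theta>)) =
      \<tau>\<^sup>2 * integral {1..2} (\<lambda>r. a r * cos (r * \<tau> + \<theta>)) + integral {1..2} (\<lambda>r. a'' r * cos (r * \<tau> + \<theta>))"
    by (subst Henstock_Kurzweil_Integration.integral_add)
       (auto intro!: integrable_continuous_real continuous_intros ac a'')
  ultimately show ?thesis by simp
qed

text \<open>The quadratic is \<open>(r - 1) * (2 - r)\<close>; its square vanishes to second order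
  at 1 and 2, as two integrations by parts demand. The factor 30 normalises the integral over
  \<open>{1..2}\<close> for \<open>N = 0\<close>, since u^2 (1 - u)^2 has integral 1/30 over
  [0, 1].\<close>

definition wt :: "nat \<Rightarrow> real poly" where
  "wt N = [:-2, 3, -1:]\<^sup>2 * monom 30 N"

lemma wt_eq: "poly (wt N) r = 30 * ((r - 1) * (2 - r))\<^sup>2 * r ^ N"
  by (simp add: wt_def poly_monom poly_power) (simp add: algebra_simps power2_eq_square)

lemma wt_ends: "poly (wt N) 1 = 0" "poly (wt N) 2 = 0" "poly (pderiv (wt N)) 1 = 0" "poly (pderiv (wt N)) 2 = 0"
  by (simp_all only: wt_def pderiv_mult power2_eq_square poly_add poly_mult) simp_all

text \<open>The index \<open>n\<close> counts derivatives in \<tau>, each producing a factor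
  \<open>r\<close> and a quarter turn of the phase. The remaining power \<open>CARD('n)\<close> of
  \<open>r\<close> is the Jacobian of the dilation.\<close>

definition osc_profile :: "(real^'n \<Rightarrow> real) \<Rightarrow> real^'n \<Rightarrow> nat \<Rightarrow> real \<Rightarrow> real" where
  "osc_profile m \<xi> n \<tau> = integral {1..2} (\<lambda>r. poly (wt (CARD('n) + n)) r * m (r *\<^sub>R \<xi>) * cos (r * \<tau> + real n * (pi / 2)))"

lemma test_fun_continuous_ray: "test_fun m \<Longrightarrow> continuous_on A (\<lambda>r. m (r *\<^sub>R \<xi>))"
  by (rule continuous_on_compose2[OF test_fun_continuous]) (auto intro!: continuous_intros)

lemma osc_profile_deriv:
  fixes m :: "real^'n \<Rightarrow> real"
  assumes m: "test_fun m"
  shows "(osc_profile m \<xi> n has_real_derivative osc_profile m \<xi> (Suc n) t) (at t)"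
proof -
  let ?f = "\<lambda>n \<tau> r. poly (wt (CARD('n) + n)) r * m (r *\<^sub>R \<xi>) * cos (r * \<tau> + real n * (pi / 2))"
  have "((\<lambda>\<tau>. integral (cbox 1 2) (?f n \<tau>)) has_real_derivative integral (cbox 1 2) (?f (Suc n) t)) (at t within UNIV)"
  proof (rule leibniz_rule_field_derivative)
    fix \<tau> r :: real
    have "((\<lambda>\<tau>. ?f n \<tau> r) has_real_derivative poly (wt (CARD('n) + n)) r * m (r *\<^sub>R \<xi>) * (- sin (r * \<tau> + real n * (pi / 2)) * r)) (at \<tau> within UNIV)"
      by (auto intro!: derivative_eq_intros)
    moreover have "poly (wt (CARD('n) + n)) r * m (r *\<^sub>R \<xi>) * (- sin (r * \<tau> + real n * (pi / 2)) * r) = ?f (Suc n) \<tau> r"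
    proof -
      have "cos (r * \<tau> + real (Suc n) * (pi / 2)) = - sin (r * \<tau> + real n * (pi / 2))"
        using cos_add[of "r * \<tau> + real n * (pi / 2)" "pi / 2"] by (simp add: algebra_simps add_divide_distrib)
      then show ?thesis by (simp add: wt_eq)
    qed
    ultimately show "((\<lambda>\<tau>. ?f n \<tau> r) has_real_derivative ?f (Suc n) \<tau> r) (at \<tau> within UNIV)" by simp
  next
    fix \<tau> :: real
    show "?f n \<tau> integrable_on cbox 1 2"
      by (intro integrable_continuous continuous_intros test_fun_continuous_ray m)
    have "continuous_on (UNIV \<times> cbox 1 2) (\<lambda>p. m (snd p *\<^sub>R \<xi>))"
      by (rule continuous_on_compose2[OF test_fun_continuous[OF m]]) (auto intro!: continuous_intros)
    then show "continuous_on (UNIV \<times> cbox 1 2) (\<lambda>(\<tau>, r). ?f (Suc n) \<tau> r)"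
      unfolding case_prod_beta' by (intro continuous_intros)
  qed auto
  then show ?thesis by (simp add: osc_profile_def[abs_def] cbox_interval)
qed

lemma ray_deriv:
  fixes m :: "real^'n \<Rightarrow> real"
  assumes m: "test_fun m"
  shows "((\<lambda>r. m (r *\<^sub>R \<xi>)) has_real_derivative (\<Sum>i\<in>UNIV. \<xi> $ i * partial_deriv i m (r *\<^sub>R \<xi>))) (at r)"
proof -
  have "((\<lambda>r. r *\<^sub>R \<xi>) has_derivative (\<lambda>h. h *\<^sub>R \<xi>)) (at r)" by (auto intro!: derivative_eq_intros)
  from diff_chain_at[OF this smooth_has_derivative[OF test_fun_smooth[OF m]], unfolded o_def]
  show ?thesis unfolding has_field_derivative_def
    by (rule has_derivative_eq_rhs) (auto simp: fun_eq_iff sum_distrib_left sum_distrib_right mult_ac)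
qed

text \<open>The trivial bound and the bound on \<open>t\<^sup>2\<close> times the profile add up to
  one on \<open>1 + t\<^sup>2\<close> times it. Uniformity in \<xi> holds because only derivatives
  of \<open>m\<close> along rays of bounded speed enter.\<close>

lemma osc_profile_decay:
  fixes m :: "real^'n \<Rightarrow> real"
  assumes m: "test_fun m"
  shows "\<exists>B. \<forall>\<xi> n t. norm \<xi> \<le> 2 \<longrightarrow> n \<le> K \<longrightarrow> \<bar>osc_profile m \<xi> n t\<bar> \<le> B / (1 + t\<^sup>2)"
proof -
  obtain B0 where B0: "\<And>x. \<bar>m x\<bar> \<le> B0" "0 \<le> B0" using test_fun_bounded[OF m] by blast
  obtain B1 where B1: "0 \<le> B1" "\<And>i j x. \<bar>partial_deriv j (partial_deriv i m) x\<bar> \<le> B1" "\<And>i x. \<bar>partial_deriv i m x\<bar> \<le> B1"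
    using test_fun_partials_bounded[OF m] by blast
  \<comment> \<open>A common bound for the function \<open>m (r *\<^sub>R \<xi>)\<close> of
    \<open>r\<close> and its first two derivatives; each derivative along the ray costs a factor
    \<open>2 * CARD('n)\<close>, as \<open>norm \<xi> \<le> 2\<close>.\<close>
  define A where "A = B0 + 2 * real CARD('n) * B1 + (2 * real CARD('n))\<^sup>2 * B1"
  have A: "0 \<le> A" using B0 B1 by (simp add: A_def)
  have ex: "\<exists>B. \<forall>r\<in>{1..2}. \<bar>poly p r\<bar> \<le> B" for p :: "real poly"
  proof -
    have "compact (poly p ` {1..2::real})" by (intro compact_continuous_image continuous_intros) auto
    then show ?thesis using compact_imp_bounded[of "poly p ` {1..2}"] unfolding bounded_iff by auto
  qed
  have key: "\<exists>B. \<forall>\<xi> t. norm \<xi> \<le> 2 \<longrightarrow> \<bar>osc_profile m \<xi> n t\<bar> \<le> B / (1 + t\<^sup>2)" for n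
  proof -
    let ?p = "wt (CARD('n) + n)"
    obtain C0 C1 C2 where C: "\<forall>r\<in>{1..2}. \<bar>poly ?p r\<bar> \<le> C0" "\<forall>r\<in>{1..2}. \<bar>poly (pderiv ?p) r\<bar> \<le> C1"
      "\<forall>r\<in>{1..2}. \<bar>poly (pderiv (pderiv ?p)) r\<bar> \<le> C2" using ex by meson
    have Cn: "0 \<le> C0" "0 \<le> C1" "0 \<le> C2" using C by (force dest: bspec[of _ _ 1])+
    \<comment> \<open>The binomial weights of the second derivative of a product.\<close>
    define E where "E = (C0 + 2 * C1 + C2) * A"
    show ?thesis
    proof (intro exI[of _ "C0 * A + E"] allI impI)
      fix \<xi> :: "real^'n" and t :: real assume x: "norm \<xi> \<le> 2"
      let ?\<theta> = "real n * (pi / 2)"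
      define u where "u r = m (r *\<^sub>R \<xi>)" for r
      define u' where "u' r = (\<Sum>i\<in>UNIV. \<xi> $ i * partial_deriv i m (r *\<^sub>R \<xi>))" for r
      define u'' where "u'' r = (\<Sum>i\<in>UNIV. \<xi> $ i * (\<Sum>j\<in>UNIV. \<xi> $ j * partial_deriv j (partial_deriv i m) (r *\<^sub>R \<xi>)))" for r
      have ud: "(u has_real_derivative u' r) (at r)" for r unfolding u_def[abs_def] u'_def by (rule ray_deriv[OF m])
      have u'd: "(u' has_real_derivative u'' r) (at r)" for r
        unfolding u'_def[abs_def] u''_def by (intro DERIV_sum DERIV_cmult ray_deriv test_fun_partial m)
      have u''c: "continuous_on S u''" for S
        unfolding u''_def[abs_def] by (intro continuous_intros test_fun_continuous_ray test_fun_partial m)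
      have lin: "\<bar>\<Sum>i\<in>UNIV. \<xi> $ i * q i\<bar> \<le> 2 * real CARD('n) * Z" if "\<And>i. \<bar>q i\<bar> \<le> Z" for q :: "'n \<Rightarrow> real" and Z
      proof -
        have "0 \<le> Z" using that[of undefined] by linarith
        then show ?thesis using abs_coord_sum_le[of q Z \<xi>, OF that] mult_left_mono[OF x, of "real CARD('n) * Z"] by (simp add: mult_ac)
      qed
      have ub: "\<bar>u r\<bar> \<le> A" "\<bar>u' r\<bar> \<le> A" "\<bar>u'' r\<bar> \<le> A" for r
      proof -
        show "\<bar>u r\<bar> \<le> A" using B0(1)[of "r *\<^sub>R \<xi>"] B0(2) B1(1) by (simp add: u_def A_def add_increasing2)
        have "\<bar>u' r\<bar> \<le> 2 * real CARD('n) * B1" unfolding u'_def by (rule lin[OF B1(3)])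
        then show "\<bar>u' r\<bar> \<le> A" using B0(2) B1(1) by (simp add: A_def add_increasing2 add_increasing)
        have "\<bar>u'' r\<bar> \<le> 2 * real CARD('n) * (2 * real CARD('n) * B1)" unfolding u''_def by (intro lin B1(2))
        then show "\<bar>u'' r\<bar> \<le> A" using B0(2) B1(1) by (simp add: A_def power2_eq_square mult_ac add_increasing)
      qed
      define a where "a r = poly ?p r * u r" for r
      define a' where "a' r = poly (pderiv ?p) r * u r + poly ?p r * u' r" for r
      define a'' where "a'' r = poly (pderiv (pderiv ?p)) r * u r + 2 * (poly (pderiv ?p) r * u' r) + poly ?p r * u'' r" for r
      have ad: "(a has_real_derivative a' r) (at r)" for r
        unfolding a_def[abs_def] a'_def by (rule derivative_eq_intros poly_DERIV ud refl)+ simp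
      have a'd: "(a' has_real_derivative a'' r) (at r)" for r
        unfolding a'_def[abs_def] a''_def by (rule derivative_eq_intros poly_DERIV ud u'd refl)+ simp
      have uc: "continuous_on S u" "continuous_on S u'" for S
        using ud u'd by (meson DERIV_isCont continuous_at_imp_continuous_on)+
      have a''c: "continuous_on S a''" for S
        unfolding a''_def[abs_def] by (intro continuous_intros u''c uc)
      have ac: "continuous_on S a" for S unfolding a_def[abs_def] by (intro continuous_intros uc)
      have prof: "osc_profile m \<xi> n t = integral {1..2} (\<lambda>r. a r * cos (r * t + ?\<theta>))"
        by (simp add: osc_profile_def a_def u_def)
      have ib: "\<bar>integral {1..2} (\<lambda>r. g r * cos (r * t + ?\<theta>))\<bar> \<le> Z" if g: "continuous_on {1..2} g" "\<And>r. r \<in> {1..2} \<Longrightarrow> \<bar>g r\<bar> \<le> Z" for g Z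
      proof -
        have "norm (integral {1..2} (\<lambda>r. g r * cos (r * t + ?\<theta>))) \<le> Z * (2 - 1)"
        proof (rule integral_bound)
          fix r :: real assume r: "r \<in> {1..2}"
          show "norm (g r * cos (r * t + ?\<theta>)) \<le> Z"
            using g(2)[OF r] by (simp add: abs_mult) (metis abs_cos_le_one abs_ge_zero mult_left_le order_trans)
        qed (auto intro!: continuous_intros g)
        then show ?thesis by simp
      qed
      have 1: "\<bar>osc_profile m \<xi> n t\<bar> \<le> C0 * A"
        unfolding prof using C ub Cn by (intro ib ac) (auto simp: a_def abs_mult intro!: mult_mono)
      have "t\<^sup>2 * osc_profile m \<xi> n t = - integral {1..2} (\<lambda>r. a'' r * cos (r * t + ?\<theta>))"
        unfolding prof by (rule oscillatory_by_parts[OF ad a'd a''c]) (simp_all add: a_def a'_def wt_ends)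
      moreover have "\<bar>integral {1..2} (\<lambda>r. a'' r * cos (r * t + ?\<theta>))\<bar> \<le> E"
      proof (rule ib[OF a''c])
        fix r :: real assume r: "r \<in> {1..2}"
        have "\<bar>a'' r\<bar> \<le> \<bar>poly (pderiv (pderiv ?p)) r\<bar> * \<bar>u r\<bar> + 2 * (\<bar>poly (pderiv ?p) r\<bar> * \<bar>u' r\<bar>) + \<bar>poly ?p r\<bar> * \<bar>u'' r\<bar>"
          unfolding a''_def abs_mult[symmetric] by linarith
        also have "\<dots> \<le> C2 * A + 2 * (C1 * A) + C0 * A"
          using C r ub Cn by (intro add_mono mult_mono mult_left_mono) auto
        finally show "\<bar>a'' r\<bar> \<le> E" by (simp add: E_def algebra_simps)
      qed
      ultimately have "t\<^sup>2 * \<bar>osc_profile m \<xi> n t\<bar> \<le> E" by (simp add: abs_mult[symmetric, of "t\<^sup>2", simplified])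
      with 1 have "(1 + t\<^sup>2) * \<bar>osc_profile m \<xi> n t\<bar> \<le> C0 * A + E" by (simp add: distrib_right)
      then show "\<bar>osc_profile m \<xi> n t\<bar> \<le> (C0 * A + E) / (1 + t\<^sup>2)"
        by (subst pos_le_divide_eq) (auto intro: add_pos_nonneg simp: mult.commute)
    qed
  qed
  then have "\<forall>n. \<exists>B. \<forall>\<xi> t. norm \<xi> \<le> 2 \<longrightarrow> \<bar>osc_profile m \<xi> n t\<bar> \<le> B / (1 + t\<^sup>2)" by blast
  from choice[OF this] obtain B where B: "\<And>n \<xi> t. norm \<xi> \<le> 2 \<Longrightarrow> \<bar>osc_profile m \<xi> n t\<bar> \<le> B n / (1 + t\<^sup>2)" by blast
  have Bn: "0 \<le> B n" for n using B[of 0 n 0] by simp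
  show ?thesis
  proof (intro exI[of _ "\<Sum>n\<le>K. B n"] allI impI)
    fix \<xi> :: "real^'n" and n t assume x: "norm \<xi> \<le> 2" "n \<le> K"
    have "B n \<le> (\<Sum>n\<le>K. B n)" using x by (intro member_le_sum Bn) auto
    then have "B n / (1 + t\<^sup>2) \<le> (\<Sum>n\<le>K. B n) / (1 + t\<^sup>2)" by (intro divide_right_mono) auto
    then show "\<bar>osc_profile m \<xi> n t\<bar> \<le> (\<Sum>n\<le>K. B n) / (1 + t\<^sup>2)" using B[OF x(1), of n t] by simp
  qed
qed

lemma wt_integral: "((\<lambda>r. poly (wt 0) r) has_integral 1) {1..2}"
proof -
  \<comment> \<open>In \<open>u = r - 1\<close> the weight is 30 u^2 - 60 u^3 + 30 u^4, integrated
    term by term.\<close>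
  let ?F = "\<lambda>r::real. 10 * (r - 1) ^ 3 - 15 * (r - 1) ^ 4 + 6 * (r - 1) ^ 5"
  have "((\<lambda>r. poly (wt 0) r) has_integral (?F 2 - ?F 1)) {1..2}"
  proof (rule fundamental_theorem_of_calculus)
    fix r :: real
    have "(?F has_real_derivative poly (wt 0) r) (at r within {1..2})"
      by (auto intro!: derivative_eq_intros simp: wt_eq) (simp add: algebra_simps power2_eq_square power3_eq_cube power4_eq_xxxx)
    then show "(?F has_vector_derivative poly (wt 0) r) (at r within {1..2})"
      by (simp add: has_real_derivative_iff_has_vector_derivative)
  qed simp
  then show ?thesis by simp
qed

text \<open>For each \<open>r\<close> the substitution of \<open>r *\<^sub>R \<xi>\<close> for \<xi>
  leaves the frequency integral unchanged, and the weight has mass 1. Since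
  \<open>r \<ge> 1\<close>, the dilated \<open>m\<close> still vanishes beyond radius 2, so the
  frequencies stay in that ball.\<close>

lemma kern_profile_integral:
  fixes m :: "real^'n \<Rightarrow> real"
  assumes m: "test_fun m" and m0: "\<And>\<xi>. 2 < norm \<xi> \<Longrightarrow> m \<xi> = 0"
  shows "osc_int 0 m z = (LINT \<xi>|lborel. indicator (cball 0 2) \<xi> * osc_profile m \<xi> 0 (z \<bullet> \<xi>))"
proof -
  obtain B0 where B0: "\<And>x. \<bar>m x\<bar> \<le> B0" "0 \<le> B0" using test_fun_bounded[OF m] by blast
  have mm: "m \<in> borel_measurable borel" by (rule test_fun_measurable[OF m])
  let ?W = "\<lambda>r. indicator {1..2} r * poly (wt 0) r :: real"
  let ?F = "\<lambda>r \<xi>. indicator {1..2} r * (poly (wt CARD('n)) r * (m (r *\<^sub>R \<xi>) * cos (r * (z \<bullet> \<xi>))))"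
  have Wi: "set_integrable lborel {1..2} (poly (wt N))" for N
    by (intro borel_integrable_atLeastAtMost' continuous_intros)
  have Wi': "integrable lborel (\<lambda>r. indicator {1..2} r * poly (wt N) r)" for N
    using Wi[of N] by (simp add: set_integrable_def)
  have "(LINT r|lborel. ?W r) = 1"
    using set_borel_integral_eq_integral(2)[OF Wi[of 0]] wt_integral
    by (simp add: set_lebesgue_integral_def integral_unique)
  then have "osc_int 0 m z = (LINT r|lborel. ?W r * osc_int 0 m z)" by simp
  also have "\<dots> = (LINT r|lborel. LINT \<xi>|lborel. ?F r \<xi>)"
  proof (rule Bochner_Integration.integral_cong[OF refl])
    fix r :: real
    show "?W r * osc_int 0 m z = (LINT \<xi>|lborel. ?F r \<xi>)"
    proof (cases "r \<in> {1..2}")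
      case True
      have "osc_int 0 m z = \<bar>r\<bar> ^ DIM(real^'n) * (LINT \<xi>|lborel. m (0 + r *\<^sub>R \<xi>) * cos (z \<bullet> (0 + r *\<^sub>R \<xi>)))"
        unfolding osc_int_zero by (rule lborel_integral_affine) (use True mm in \<open>auto intro!: borel_measurable_times cos_inner_measurable\<close>)
      also have "\<dots> = r ^ CARD('n) * (LINT \<xi>|lborel. m (r *\<^sub>R \<xi>) * cos (r * (z \<bullet> \<xi>)))"
        using True by simp
      finally have "osc_int 0 m z = r ^ CARD('n) * (LINT \<xi>|lborel. m (r *\<^sub>R \<xi>) * cos (r * (z \<bullet> \<xi>)))" .
      then show ?thesis using True by (simp add: wt_eq)
    qed simp
  qed
  also have "\<dots> = (LINT \<xi>|lborel. LINT r|lborel. ?F r \<xi>)"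
  proof (rule fubini_bound(1)[OF Wi'[of "CARD('n)"]])
    have "emeasure lborel (cball (0::real^'n) 2) < \<infinity>" by (intro emeasure_bounded_finite) auto
    then show "integrable lborel (\<lambda>\<xi>::real^'n. B0 * indicator (cball 0 2) \<xi>)"
      by (intro integrable_mult_right integrable_real_indicator) auto
    have A1: "(\<lambda>p. m (fst p *\<^sub>R snd p)) \<in> borel_measurable (borel :: (real \<times> (real^'n)) measure)"
      by (intro borel_measurable_continuous_onI continuous_on_compose2[OF test_fun_continuous[OF m]] continuous_intros) auto
    have A2: "(\<lambda>p. cos (fst p * (z \<bullet> snd p))) \<in> borel_measurable (borel :: (real \<times> (real^'n)) measure)"
      by (intro borel_measurable_continuous_onI continuous_intros)
    have A3: "(\<lambda>p. indicator {1..2} (fst p) * poly (wt CARD('n)) (fst p)) \<in> borel_measurable (borel :: (real \<times> (real^'n)) measure)"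
      by (rule borel_measurable_fst) (use Wi'[of "CARD('n)"] in auto)
    have "(\<lambda>p. (indicator {1..2} (fst p) * poly (wt CARD('n)) (fst p)) * (m (fst p *\<^sub>R snd p) * cos (fst p * (z \<bullet> snd p)))) \<in>
        borel_measurable (borel :: (real \<times> (real^'n)) measure)"
      by (rule borel_measurable_times[OF A3 borel_measurable_times[OF A1 A2]])
    then show "(\<lambda>p. ?F (fst p) (snd p)) \<in> borel_measurable borel"
      by (simp only: mult.assoc)
    fix r \<xi>
    show "norm (?F r \<xi>) \<le> \<bar>indicator {1..2} r * poly (wt CARD('n)) r * (B0 * indicator (cball 0 2) \<xi>)\<bar>"
    proof (cases "r \<in> {1..2}")
      case True
      have "\<bar>m (r *\<^sub>R \<xi>) * cos (r * (z \<bullet> \<xi>))\<bar> \<le> B0 * indicator (cball 0 2) \<xi>"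
      proof (cases "norm \<xi> \<le> 2")
        case True
        have "\<bar>m (r *\<^sub>R \<xi>) * cos (r * (z \<bullet> \<xi>))\<bar> \<le> B0 * 1" unfolding abs_mult by (intro mult_mono B0) auto
        then show ?thesis using True by simp
      next
        case False
        have "1 * norm \<xi> \<le> r * norm \<xi>" using \<open>r \<in> {1..2}\<close> by (intro mult_right_mono) auto
        then have "m (r *\<^sub>R \<xi>) = 0" using False \<open>r \<in> {1..2}\<close> by (intro m0) simp
        then show ?thesis using False by simp
      qed
      then have "\<bar>poly (wt CARD('n)) r\<bar> * \<bar>m (r *\<^sub>R \<xi>) * cos (r * (z \<bullet> \<xi>))\<bar> \<le> \<bar>poly (wt CARD('n)) r\<bar> * (B0 * indicator (cball 0 2) \<xi>)"
        by (intro mult_left_mono) auto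
      then show ?thesis using True B0(2) by (simp add: abs_mult)
    qed simp
  qed
  also have "\<dots> = (LINT \<xi>|lborel. indicator (cball 0 2) \<xi> * osc_profile m \<xi> 0 (z \<bullet> \<xi>))"
  proof (rule Bochner_Integration.integral_cong[OF refl])
    fix \<xi> :: "real^'n"
    let ?g = "\<lambda>r. poly (wt CARD('n)) r * (m (r *\<^sub>R \<xi>) * cos (r * (z \<bullet> \<xi>)))"
    have "set_integrable lborel {1..2} ?g"
      by (intro borel_integrable_atLeastAtMost' continuous_intros test_fun_continuous_ray m)
    from set_borel_integral_eq_integral(2)[OF this]
    have e: "(LINT r|lborel. ?F r \<xi>) = osc_profile m \<xi> 0 (z \<bullet> \<xi>)"
      by (simp add: set_lebesgue_integral_def osc_profile_def mult.assoc)
    show "(LINT r|lborel. ?F r \<xi>) = indicator (cball 0 2) \<xi> * osc_profile m \<xi> 0 (z \<bullet> \<xi>)"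
    proof (cases "norm \<xi> \<le> 2")
      case False
      have F0: "?F r \<xi> = 0" for r
      proof (cases "r \<in> {1..2}")
        case True
        have "1 * norm \<xi> \<le> r * norm \<xi>" using True by (intro mult_right_mono) auto
        then have "m (r *\<^sub>R \<xi>) = 0" using False True by (intro m0) simp
        then show ?thesis by simp
      qed simp
      have "(LINT r|lborel. ?F r \<xi>) = integral\<^sup>L lborel (\<lambda>r::real. 0::real)" by (simp only: F0)
      also have "\<dots> = indicator (cball 0 2) \<xi> * osc_profile m \<xi> 0 (z \<bullet> \<xi>)" using False by simp
      finally show ?thesis .
    qed (use e in simp)
  qed
  finally show ?thesis .
qed

text \<open>For fixed \<xi> the integrand is a ridge profile at frequency
  \<open>\<kappa> = R * norm \<xi>\<close>, at most \<open>2 * R\<close>. The translation by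
  \<open>y\<close> only changes the offset \<theta>, over which \<open>approx_hull_profile\<close>
  is uniform; hence the bound does not see \<open>y\<close>.\<close>

lemma kern_ridge_hull:
  fixes \<Omega> :: "(real^'n) set" and m :: "real^'n \<Rightarrow> real"
  assumes k: "1 \<le> k" and c: "c' < c" "0 < c"
    and \<Omega>: "\<And>x \<omega>. x \<in> \<Omega> \<Longrightarrow> norm \<omega> = 1 \<Longrightarrow> \<bar>\<omega> \<bullet> x\<bar> \<le> c'" and \<Omega>b: "bounded \<Omega>"
    and m: "test_fun m" and m0: "\<And>\<xi>. 2 < norm \<xi> \<Longrightarrow> m \<xi> = 0"
  shows "\<exists>C\<ge>0. \<forall>R\<ge>1. \<forall>y. approx_hull \<Omega> (dictionary k c) (C * R ^ k) (\<lambda>x. kern m (R *\<^sub>R (x - y)))"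
proof -
  have "\<exists>C\<ge>0. \<forall>D B \<kappa> \<theta> \<omega>. 0 \<le> \<kappa> \<longrightarrow> norm \<omega> = 1 \<longrightarrow>
    (\<forall>n t. n \<le> k \<longrightarrow> (D n has_real_derivative D (Suc n) t) (at t)) \<longrightarrow> continuous_on UNIV (D (Suc k)) \<longrightarrow>
    (\<forall>n t. n \<le> Suc k \<longrightarrow> \<bar>D n t\<bar> \<le> B / (1 + t\<^sup>2)) \<longrightarrow>
    approx_hull \<Omega> (dictionary k c) (C * B * (1 + \<kappa>) ^ k) (\<lambda>x. D 0 (\<kappa> * (\<omega> \<bullet> x) - \<theta>))"
    by (rule approx_hull_profile[OF k c]) (rule \<Omega>)
  then obtain C where C: "0 \<le> C" and prof_all: "\<forall>D B \<kappa> \<theta> \<omega>. 0 \<le> \<kappa> \<longrightarrow> norm \<omega> = 1 \<longrightarrow>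
    (\<forall>n t. n \<le> k \<longrightarrow> (D n has_real_derivative D (Suc n) t) (at t)) \<longrightarrow> continuous_on UNIV (D (Suc k)) \<longrightarrow>
    (\<forall>n t. n \<le> Suc k \<longrightarrow> \<bar>D n t\<bar> \<le> B / (1 + t\<^sup>2)) \<longrightarrow>
    approx_hull \<Omega> (dictionary k c) (C * B * (1 + \<kappa>) ^ k) (\<lambda>x. D 0 (\<kappa> * (\<omega> \<bullet> x) - \<theta>))"
    by (elim exE conjE) (rule that)
  note prof = prof_all[rule_format]
  obtain B where B: "\<And>\<xi> n t. norm \<xi> \<le> 2 \<Longrightarrow> n \<le> Suc k \<Longrightarrow> \<bar>osc_profile m \<xi> n t\<bar> \<le> B / (1 + t\<^sup>2)"
    using osc_profile_decay[OF m, of "Suc k"] by blast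
  have B0: "0 \<le> B" using B[of 0 0 0] by simp
  define v where "v = measure lborel (cball (0::real^'n) 2)"
  define C' where "C' = C * B * 3 ^ k * v / (2 * pi) ^ CARD('n)"
  have "C' \<ge> 0" using C B0 by (simp add: C'_def v_def)
  moreover have "approx_hull \<Omega> (dictionary k c) (C' * R ^ k) (\<lambda>x. kern m (R *\<^sub>R (x - y)))" if R: "R \<ge> 1" for R y
  proof -
    \<comment> \<open>\<open>1 + \<kappa> \<le> 1 + 2 * R \<le> 3 * R\<close>, as
      \<open>R \<ge> 1\<close>.\<close>
    define T where "T = C * B * (3 * R) ^ k"
    have T0: "0 \<le> T" using C B0 R by (simp add: T_def)
    let ?V = "\<lambda>\<xi> x. osc_profile m \<xi> 0 (R *\<^sub>R (x - y) \<bullet> \<xi>)"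
    have hV: "approx_hull \<Omega> (dictionary k c) T (?V \<xi>)" if x: "\<xi> \<in> cball 0 2" for \<xi>
    proof -
      \<comment> \<open>At \<open>\<xi> = 0\<close> the profile is constant in \<open>x\<close> and
        any unit direction serves.\<close>
      define \<omega> where "\<omega> = (if \<xi> = 0 then axis undefined 1 else (1 / norm \<xi>) *\<^sub>R \<xi>)"
      have w: "norm \<omega> = 1" by (simp add: \<omega>_def)
      have wx: "\<xi> = norm \<xi> *\<^sub>R \<omega>" by (simp add: \<omega>_def)
      have "approx_hull \<Omega> (dictionary k c) (C * B * (1 + R * norm \<xi>) ^ k) (\<lambda>x. osc_profile m \<xi> 0 ((R * norm \<xi>) * (\<omega> \<bullet> x) - R * (\<xi> \<bullet> y)))"
      proof (rule prof[OF _ w])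
        show "0 \<le> R * norm \<xi>" using R by simp
        show "continuous_on UNIV (osc_profile m \<xi> (Suc k))"
          using osc_profile_deriv[OF m] by (meson DERIV_isCont continuous_at_imp_continuous_on)
        show "(osc_profile m \<xi> n has_real_derivative osc_profile m \<xi> (Suc n) t) (at t)" for n t
          by (rule osc_profile_deriv[OF m])
        show "\<bar>osc_profile m \<xi> n t\<bar> \<le> B / (1 + t\<^sup>2)" if "n \<le> Suc k" for n t
          using B[of \<xi> n t] x that by simp
      qed
      moreover have "C * B * (1 + R * norm \<xi>) ^ k \<le> T"
      proof -
        have "R * norm \<xi> \<le> R * 2" using x R by (intro mult_left_mono) auto
        then have "1 + R * norm \<xi> \<le> 3 * R" using R by linarith
        then show ?thesis unfolding T_def using C B0 R by (intro mult_left_mono power_mono) auto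
      qed
      moreover have "(R * norm \<xi>) * (\<omega> \<bullet> x) - R * (\<xi> \<bullet> y) = R *\<^sub>R (x - y) \<bullet> \<xi>" for x
      proof -
        have "norm \<xi> * (\<omega> \<bullet> x) = \<xi> \<bullet> x" by (subst (2) wx) simp
        then show ?thesis by (simp add: inner_diff_left right_diff_distrib inner_commute[of \<xi>] mult.assoc)
      qed
      ultimately show ?thesis using approx_hull_mono by simp
    qed
    \<comment> \<open>Passing to the closure of \<Omega> gives a compact product, hence the
      boundedness and uniform continuity that the superposition lemma asks for.\<close>
    have comp: "compact (cball (0::real^'n) 2 \<times> closure \<Omega>)"
      using \<Omega>b by (intro compact_Times) (auto simp: compact_closure)
    have Vc: "continuous_on (cball (0::real^'n) 2 \<times> closure \<Omega>) (\<lambda>p. ?V (fst p) (snd p))"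
    proof -
      have "continuous_on ((cball (0::real^'n) 2 \<times> closure \<Omega>) \<times> cbox 1 2) (\<lambda>q. m (snd q *\<^sub>R fst (fst q)))"
        by (rule continuous_on_compose2[OF test_fun_continuous[OF m]]) (auto intro!: continuous_intros)
      then have "continuous_on ((cball (0::real^'n) 2 \<times> closure \<Omega>) \<times> cbox 1 2)
        (\<lambda>(p, r). poly (wt (CARD('n) + 0)) r * m (r *\<^sub>R fst p) * cos (r * (R *\<^sub>R (snd p - y) \<bullet> fst p) + real 0 * (pi / 2)))"
        unfolding case_prod_beta' by (intro continuous_intros)
      from integral_continuous_on_param[OF this] show ?thesis
        by (simp only: osc_profile_def cbox_interval)
    qed
    have uc: "uniformly_continuous_on (cball (0::real^'n) 2 \<times> closure \<Omega>) (\<lambda>p. ?V (fst p) (snd p))"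
      by (rule compact_uniformly_continuous[OF Vc comp])
    have "bounded ((\<lambda>p. ?V (fst p) (snd p)) ` (cball (0::real^'n) 2 \<times> closure \<Omega>))"
      by (intro compact_imp_bounded compact_continuous_image Vc comp)
    then obtain M where Mb: "\<forall>v\<in>(\<lambda>p. ?V (fst p) (snd p)) ` (cball (0::real^'n) 2 \<times> closure \<Omega>). norm v \<le> M"
      unfolding bounded_iff by (elim exE) (rule that)
    have M: "\<bar>?V \<xi> x\<bar> \<le> M" if "\<xi> \<in> cball 0 2" "x \<in> closure \<Omega>" for \<xi> x
    proof -
      have "norm (?V (fst (\<xi>, x)) (snd (\<xi>, x))) \<le> M"
        by (rule bspec[OF Mb], rule image_eqI[where x="(\<xi>, x)"], rule refl) (use that in simp)
      then show ?thesis by (simp only: fst_conv snd_conv real_norm_def)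
    qed
    have sub: "x \<in> closure \<Omega>" if "x \<in> \<Omega>" for x using that closure_subset by blast
    have "emeasure lborel (cball (0::real^'n) 2) < \<infinity>" by (intro emeasure_bounded_finite) auto
    then have hi: "integrable lborel (indicator (cball (0::real^'n) 2) :: _ \<Rightarrow> real)" by (intro integrable_real_indicator) auto
    have "approx_hull \<Omega> (dictionary k c) (T * (LINT \<xi>|lborel. \<bar>indicator (cball (0::real^'n) 2) \<xi> :: real\<bar>)) (\<lambda>x. LINT \<xi>|lborel. indicator (cball 0 2) \<xi> * ?V \<xi> x)"
    proof (rule approx_hull_integral[OF hi, where S="cball 0 2" and M=M])
      show "\<bar>?V \<xi> x\<bar> \<le> M" if "\<xi> \<in> cball 0 2" "x \<in> \<Omega>" for \<xi> x by (rule M[OF that(1) sub[OF that(2)]])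
      show "\<exists>\<delta>>0. \<forall>a\<in>cball 0 2. \<forall>b\<in>cball 0 2. dist a b < \<delta> \<longrightarrow> (\<forall>x\<in>\<Omega>. \<bar>?V a x - ?V b x\<bar> \<le> \<epsilon>)" if e: "\<epsilon> > 0" for \<epsilon>
      proof -
        obtain d where d: "d > 0" "\<And>p q. p \<in> cball (0::real^'n) 2 \<times> closure \<Omega> \<Longrightarrow> q \<in> cball (0::real^'n) 2 \<times> closure \<Omega> \<Longrightarrow>
            dist q p < d \<Longrightarrow> dist (?V (fst q) (snd q)) (?V (fst p) (snd p)) < \<epsilon>"
          using uc e unfolding uniformly_continuous_on_def by metis
        show ?thesis
        proof (intro exI[of _ d] conjI ballI impI d(1))
          fix a b :: "real^'n" and x assume ab: "a \<in> cball 0 2" "b \<in> cball 0 2" "dist a b < d" and x: "x \<in> \<Omega>"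
          have "dist (?V (fst (a, x)) (snd (a, x))) (?V (fst (b, x)) (snd (b, x))) < \<epsilon>"
            using ab sub[OF x] by (intro d(2)) (auto simp: dist_Pair_Pair)
          then show "\<bar>?V a x - ?V b x\<bar> \<le> \<epsilon>" by (simp add: dist_real_def)
        qed
      qed
      show "(\<lambda>a. indicator (cball 0 2) a * ?V a x) \<in> borel_measurable borel" if "x \<in> \<Omega>" for x
      proof -
        have "continuous_on (cball 0 2) (\<lambda>a. ?V (fst (a, x)) (snd (a, x)))"
          by (rule continuous_on_compose2[OF Vc, of _ "\<lambda>a. (a, x)"]) (use sub[OF that] in \<open>auto intro!: continuous_intros\<close>)
        then show ?thesis
          using borel_measurable_continuous_on_indicator[of "cball 0 2" "\<lambda>a. ?V a x"] by simp
      qed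
    qed (use hV T0 in auto)
    from approx_hull_scale[OF this, of "1 / (2 * pi) ^ CARD('n)"]
    have "approx_hull \<Omega> (dictionary k c) (1 / (2 * pi) ^ CARD('n) * (T * v)) (\<lambda>x. 1 / (2 * pi) ^ CARD('n) * (LINT \<xi>|lborel. indicator (cball 0 2) \<xi> * ?V \<xi> x))"
      by (simp add: v_def)
    moreover have "1 / (2 * pi) ^ CARD('n) * (T * v) = C' * R ^ k"
      by (simp add: T_def C'_def power_mult_distrib)
    moreover have "kern m z = 1 / (2 * pi) ^ CARD('n) * (LINT \<xi>|lborel. indicator (cball 0 2) \<xi> * osc_profile m \<xi> 0 (z \<bullet> \<xi>))" for z
      using kern_profile_integral[OF m m0, of z] by (simp add: kern_def)
    ultimately show ?thesis by (simp only:)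
  qed
  ultimately show ?thesis by blast
qed

section \<open>Embedding into the variation space\<close>

text \<open>The sequence embedding of l^q into l^1 for q \<le> 1: writing \<open>x j\<close> as the
  product of its powers \<open>1 - q\<close> and \<open>q\<close> and bounding the first by the
  supremum.\<close>

lemma lq_norm_sums:
  fixes x :: "nat \<Rightarrow> real"
  assumes x: "\<And>j. 0 \<le> x j" and q: "0 < q" and sm: "summable (\<lambda>j. x j powr q)"
  shows "x j \<le> (\<Sum>j. x j powr q) powr (1 / q)"
    and "q \<le> 1 \<Longrightarrow> summable x" "q \<le> 1 \<Longrightarrow> (\<Sum>j. x j) \<le> (\<Sum>j. x j powr q) powr (1 / q)"
proof -
  define X where "X = (\<Sum>j. x j powr q)"
  have X0: "0 \<le> X" unfolding X_def by (intro suminf_nonneg sm) simp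
  have le: "x j \<le> X powr (1 / q)" for j
  proof -
    have "x j powr q = (\<Sum>i\<in>{j}. x i powr q)" by simp
    also have "\<dots> \<le> X" unfolding X_def by (rule sum_le_suminf[OF sm]) auto
    finally have "(x j powr q) powr (1 / q) \<le> X powr (1 / q)" using q by (intro powr_mono2) auto
    then show ?thesis using q x[of j] by (simp add: powr_powr)
  qed
  then show "x j \<le> (\<Sum>j. x j powr q) powr (1 / q)" by (simp add: X_def)
  assume q1: "q \<le> 1"
  have b: "x j \<le> X powr ((1 - q) / q) * x j powr q" for j
  proof (cases "x j = 0")
    case False
    then have xp: "0 < x j" using x[of j] by simp
    have "x j = x j powr (1 - q) * x j powr q" using xp by (simp add: powr_add[symmetric])
    also have "\<dots> \<le> (X powr (1 / q)) powr (1 - q) * x j powr q"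
      using le[of j] q1 xp by (intro mult_right_mono powr_mono2) auto
    finally show ?thesis by (simp add: powr_powr)
  qed simp
  have sb: "summable (\<lambda>j. X powr ((1 - q) / q) * x j powr q)" by (rule summable_mult[OF sm])
  show sx: "summable x"
    by (rule summable_comparison_test'[OF sb, of 0]) (use b x in auto)
  have "(\<Sum>j. x j) \<le> (\<Sum>j. X powr ((1 - q) / q) * x j powr q)" by (rule suminf_le[OF b sx sb])
  also have "\<dots> = X powr ((1 - q) / q) * X" unfolding X_def by (rule suminf_mult[OF sm])
  also have "\<dots> = X powr (1 / q)"
  proof (cases "X = 0")
    case False
    then have "X powr ((1 - q) / q) * X = X powr ((1 - q) / q) * X powr 1" using X0 by simp
    also have "\<dots> = X powr ((1 - q) / q + 1)" by (rule powr_add[symmetric])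
    also have "(1 - q) / q + 1 = 1 / q" using q by (simp add: field_simps)
    finally show ?thesis .
  qed simp
  finally show "(\<Sum>j. x j) \<le> (\<Sum>j. x j powr q) powr (1 / q)" by (simp add: X_def)
qed

text \<open>The weights are positive, so a finite norm forces every block norm to be finite; from
  there the extended arithmetic of the definition can be left for real sequences.\<close>

lemma besov_norm_blocks:
  fixes f :: "(real^'n \<Rightarrow> real) \<Rightarrow> real"
  assumes fin: "besov_norm \<phi>0 s p q f < \<infinity>" and q: "0 < q"
  defines "a \<equiv> \<lambda>j. enn2real (dist_Lp_norm p (LP_block \<phi>0 j f))"
  shows "dist_Lp_norm p (LP_block \<phi>0 j f) = ennreal (a j)"
    and "2 powr (real j * s) * a j \<le> enn2real (besov_norm \<phi>0 s p q f)"
    and "q \<le> 1 \<Longrightarrow> summable (\<lambda>j. 2 powr (real j * s) * a j) \<and>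
      (\<Sum>j. 2 powr (real j * s) * a j) \<le> enn2real (besov_norm \<phi>0 s p q f)"
proof -
  let ?d = "\<lambda>j. dist_Lp_norm p (LP_block \<phi>0 j f)" and ?N = "besov_norm \<phi>0 s p q f"
  have pos: "0 < (2::real) powr t" for t by simp
  have "(\<forall>j. ?d j = ennreal (a j)) \<and> (\<forall>j. 2 powr (real j * s) * a j \<le> enn2real ?N) \<and>
    (q \<le> 1 \<longrightarrow> summable (\<lambda>j. 2 powr (real j * s) * a j) \<and> (\<Sum>j. 2 powr (real j * s) * a j) \<le> enn2real ?N)"
  proof (cases "q = \<infinity>")
    case True
    then have N: "?N = (SUP j. ennreal (2 powr (real j * s)) * ?d j)" by (simp add: besov_norm_def)
    have le: "ennreal (2 powr (real j * s)) * ?d j \<le> ?N" for j unfolding N by (rule SUP_upper) simp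
    have da: "?d j = ennreal (a j)" for j
    proof -
      have "ennreal (2 powr (real j * s)) * ?d j < \<infinity>" using le fin by (rule le_less_trans)
      then have "?d j < \<infinity>" using pos by (auto simp: ennreal_mult_less_top)
      then show ?thesis by (simp add: a_def)
    qed
    have "2 powr (real j * s) * a j \<le> enn2real ?N" for j
    proof -
      have "ennreal (2 powr (real j * s) * a j) = ennreal (2 powr (real j * s)) * ennreal (a j)"
        by (intro ennreal_mult) (simp_all add: a_def)
      also have "\<dots> \<le> ?N" using le[of j] by (simp only: da)
      finally have "enn2real (ennreal (2 powr (real j * s) * a j)) \<le> enn2real ?N" using fin by (intro enn2real_mono) auto
      then show ?thesis by (simp add: a_def)
    qed
    moreover have "\<not> q \<le> 1"
    proof
      assume "q \<le> 1"
      then have "q < top" using ennreal_one_less_top by (rule le_less_trans)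
      with True show False by simp
    qed
    ultimately show ?thesis using da by blast
  next
    case False
    define r where "r = enn2real q"
    have r: "0 < r" unfolding r_def using q False by (simp add: enn2real_positive_iff less_top)
    let ?t = "\<lambda>j. ennreal (2 powr (real j * s * r)) * ennreal_powr (?d j) r"
    have N: "?N = ennreal_powr (\<Sum>j. ?t j) (1 / r)" using False by (simp add: besov_norm_def r_def)
    have Tfin: "(\<Sum>j. ?t j) < \<infinity>" using fin unfolding N ennreal_powr_def by (auto split: if_splits simp: less_top)
    have tfin: "?t j < \<infinity>" for j
    proof -
      have "?t j = (\<Sum>i\<in>{j}. ?t i)" by simp
      also have "\<dots> \<le> (\<Sum>j. ?t j)" by (rule sum_le_suminf) auto
      finally show ?thesis using Tfin by (rule le_less_trans)
    qed
    have da: "?d j = ennreal (a j)" for j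
    proof -
      have "ennreal_powr (?d j) r < \<infinity>" using tfin[of j] pos by (auto simp: ennreal_mult_less_top)
      then have "?d j \<noteq> \<infinity>" by (auto simp: ennreal_powr_def)
      then show ?thesis by (simp add: a_def less_top)
    qed
    have a0: "0 \<le> a j" for j by (simp add: a_def)
    define x where "x j = 2 powr (real j * s) * a j" for j
    have x0: "0 \<le> x j" for j by (simp add: x_def a_def)
    have t: "?t j = ennreal (x j powr r)" for j
    proof -
      have "ennreal_powr (?d j) r = ennreal (a j powr r)" using a0 by (simp add: da ennreal_powr_def)
      then have "?t j = ennreal (2 powr (real j * s * r) * a j powr r)" by (simp add: ennreal_mult)
      also have "2 powr (real j * s * r) * a j powr r = x j powr r"
        by (simp add: x_def powr_mult powr_powr a_def)
      finally show ?thesis .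
    qed
    have sm: "summable (\<lambda>j. x j powr r)"
      by (rule summable_suminf_not_top) (use Tfin t in auto)
    have "?N = ennreal ((\<Sum>j. x j powr r) powr (1 / r))"
    proof -
      have "(\<Sum>j. ?t j) = ennreal (\<Sum>j. x j powr r)" unfolding t by (rule suminf_ennreal2[OF _ sm]) simp
      then show ?thesis unfolding N ennreal_powr_def using suminf_nonneg[OF sm] by simp
    qed
    then have Nr: "enn2real ?N = (\<Sum>j. x j powr r) powr (1 / r)" by simp
    have "r \<le> 1" if "q \<le> 1"
      unfolding r_def using enn2real_mono[OF that] by simp
    then show ?thesis using da lq_norm_sums[OF x0 r sm] unfolding Nr x_def[symmetric] by auto
  qed
  then show "?d j = ennreal (a j)" "2 powr (real j * s) * a j \<le> enn2real ?N"
    "q \<le> 1 \<Longrightarrow> summable (\<lambda>j. 2 powr (real j * s) * a j) \<and> (\<Sum>j. 2 powr (real j * s) * a j) \<le> enn2real ?N"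
    by auto
qed

text \<open>The two regimes of the theorem. Above the critical smoothness the supremum bound is
  enough, the excess \<open>s - \<sigma>\<close> providing a geometric series; at the critical
  smoothness summability comes from \<open>q \<le> 1\<close>.\<close>

lemma besov_weighted_blocks:
  assumes sq: "(\<sigma> < s \<and> 0 < q) \<or> (s = \<sigma> \<and> 0 < q \<and> q \<le> 1)"
  shows "\<exists>C\<ge>0. \<forall>f::(real^'n \<Rightarrow> real) \<Rightarrow> real. besov_norm \<phi>0 s p q f < \<infinity> \<longrightarrow>
    summable (\<lambda>j. 2 powr (real j * \<sigma>) * enn2real (dist_Lp_norm p (LP_block \<phi>0 j f))) \<and>
    (\<Sum>j. 2 powr (real j * \<sigma>) * enn2real (dist_Lp_norm p (LP_block \<phi>0 j f))) \<le> C * enn2real (besov_norm \<phi>0 s p q f)"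
  using sq
proof
  assume a: "s = \<sigma> \<and> 0 < q \<and> q \<le> 1"
  show ?thesis
    by (rule exI[of _ 1]) (use a besov_norm_blocks(3)[of \<phi>0 s p q] in auto)
next
  assume a: "\<sigma> < s \<and> 0 < q"
  define \<theta> where "\<theta> = 2 powr (\<sigma> - s)"
  have "2 powr (\<sigma> - s) < 2 powr (0::real)" using a by (intro powr_less_mono) auto
  then have th: "0 < \<theta>" "\<theta> < 1" by (simp_all add: \<theta>_def)
  have sg: "summable (\<lambda>j. \<theta> ^ j)" by (rule summable_geometric) (use th in simp)
  show ?thesis
  proof (intro exI[of _ "\<Sum>j. \<theta> ^ j"] conjI allI impI)
    show "0 \<le> (\<Sum>j. \<theta> ^ j)" by (intro suminf_nonneg sg) (use th in simp)
    fix f :: "(real^'n \<Rightarrow> real) \<Rightarrow> real" assume fin: "besov_norm \<phi>0 s p q f < \<infinity>"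
    let ?N = "enn2real (besov_norm \<phi>0 s p q f)" and ?a = "\<lambda>j. enn2real (dist_Lp_norm p (LP_block \<phi>0 j f))"
    have le: "2 powr (real j * \<sigma>) * ?a j \<le> \<theta> ^ j * ?N" for j
    proof -
      have "2 powr (real j * \<sigma>) = \<theta> ^ j * 2 powr (real j * s)"
      proof -
        have "\<theta> ^ j = 2 powr (real j * (\<sigma> - s))"
          using th by (simp add: \<theta>_def powr_realpow[symmetric] powr_powr mult.commute)
        then show ?thesis by (simp add: powr_add[symmetric] algebra_simps)
      qed
      then have "2 powr (real j * \<sigma>) * ?a j = \<theta> ^ j * (2 powr (real j * s) * ?a j)" by simp
      also have "\<dots> \<le> \<theta> ^ j * ?N"
        using besov_norm_blocks(2)[OF fin] a th by (intro mult_left_mono) auto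
      finally show ?thesis .
    qed
    have sN: "summable (\<lambda>j. \<theta> ^ j * ?N)" by (rule summable_mult2[OF sg])
    show sm: "summable (\<lambda>j. 2 powr (real j * \<sigma>) * ?a j)"
      by (rule summable_comparison_test'[OF sN, of 0]) (use le in auto)
    have "(\<Sum>j. 2 powr (real j * \<sigma>) * ?a j) \<le> (\<Sum>j. \<theta> ^ j * ?N)" by (rule suminf_le[OF le sm sN])
    also have "\<dots> = (\<Sum>j. \<theta> ^ j) * ?N" by (rule suminf_mult2[OF sg, symmetric])
    finally show "(\<Sum>j. 2 powr (real j * \<sigma>) * ?a j) \<le> (\<Sum>j. \<theta> ^ j) * ?N" .
  qed
qed

section \<open>Summation over the blocks\<close>

lemma Lp_norm_less:
  assumes p: "0 < p" and g: "g \<in> borel_measurable borel" and less: "Lp_norm (ennreal p) g < ennreal c"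
  shows "integrable lborel (\<lambda>x. norm (g x) powr p)"
    and "(LINT x|lborel. norm (g x) powr p) powr (1 / p) < c"
proof -
  let ?I = "\<integral>\<^sup>+x. ennreal (norm (g x) powr p) \<partial>lborel"
  have L: "Lp_norm (ennreal p) g = ennreal_powr ?I (1 / p)"
    using p by (simp add: Lp_norm_def)
  have "?I \<noteq> \<infinity>" using less unfolding L by (auto simp: ennreal_powr_def)
  then show i: "integrable lborel (\<lambda>x. norm (g x) powr p)"
    using g by (intro integrableI_nonneg) (auto simp: less_top)
  have "?I = ennreal (LINT x|lborel. norm (g x) powr p)"
    by (rule nn_integral_eq_integral[OF i]) simp
  then have "ennreal ((LINT x|lborel. norm (g x) powr p) powr (1 / p)) < ennreal c"
    using less unfolding L by (simp add: ennreal_powr_def)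
  then show "(LINT x|lborel. norm (g x) powr p) powr (1 / p) < c"
    by (simp add: ennreal_less_iff)
qed

lemma kern_lipschitz:
  fixes m :: "real^'n \<Rightarrow> real"
  assumes m: "test_fun m"
  shows "\<exists>L\<ge>0. \<forall>x y. \<bar>kern m x - kern m y\<bar> \<le> L * norm (x - y)"
proof -
  have "\<exists>B. \<forall>x. \<bar>partial_deriv i (kern m) x\<bar> \<le> B" for i
  proof -
    have "\<exists>C. \<forall>x. (1 + norm x) ^ 0 * \<bar>iter_partial [i] (kern m) x\<bar> \<le> C"
      using kern_schwartz[OF m] unfolding schwartz_iff by blast
    then show ?thesis by simp
  qed
  then have "\<forall>i. \<exists>B. \<forall>x. \<bar>partial_deriv i (kern m) x\<bar> \<le> B" by simp
  from choice[OF this] obtain B where "\<forall>i x. \<bar>partial_deriv i (kern m) x\<bar> \<le> B i" by (elim exE)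
  then have B: "\<bar>partial_deriv i (kern m) x\<bar> \<le> B i" for i x by simp
  have B0: "0 \<le> B i" for i using B[of i 0] by linarith
  have B': "\<bar>partial_deriv i (kern m) x\<bar> \<le> (\<Sum>i\<in>UNIV. B i)" for i x
    using B[of i x] member_le_sum[of i UNIV B] B0 by (auto intro: order_trans)
  have s: "smooth (kern m)" using kern_schwartz[OF m] by (simp add: schwartz_iff)
  show ?thesis
    by (intro exI[of _ "real CARD('n) * (\<Sum>i\<in>UNIV. B i)"] conjI allI smooth_lipschitz[OF s B'])
       (simp add: sum_nonneg B0)
qed

text \<open>The parameter \<open>y\<close> ranges over the whole space, so equicontinuity comes from
  a global Lipschitz bound of the kernel rather than from compactness.\<close>

lemma kern_conv_hull:
  fixes \<Omega> :: "(real^'n) set" and m :: "real^'n \<Rightarrow> real"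
  assumes m: "test_fun m" and T: "0 \<le> T"
    and hull: "\<And>y. approx_hull \<Omega> D T (\<lambda>x. kern m (R *\<^sub>R (x - y)))" and h: "integrable lborel h"
  shows "approx_hull \<Omega> D (T * (LINT y|lborel. \<bar>h y\<bar>)) (\<lambda>x. LINT y|lborel. h y * kern m (R *\<^sub>R (x - y)))"
proof -
  obtain B where B: "\<And>x. (1 + norm x) ^ 0 * \<bar>kern m x\<bar> \<le> B" using rapid_bound[OF kern_rapid[OF m], of 0] by blast
  obtain L where L: "0 \<le> L" "\<And>x y. \<bar>kern m x - kern m y\<bar> \<le> L * norm (x - y)" using kern_lipschitz[OF m] by blast
  show ?thesis
  proof (rule approx_hull_integral[OF h, where S=UNIV and M=B])
    show "\<bar>kern m (R *\<^sub>R (x - a))\<bar> \<le> B" for a x using B by simp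
    show "\<exists>\<delta>>0. \<forall>a\<in>UNIV. \<forall>b\<in>UNIV. dist a b < \<delta> \<longrightarrow> (\<forall>x\<in>\<Omega>. \<bar>kern m (R *\<^sub>R (x - a)) - kern m (R *\<^sub>R (x - b))\<bar> \<le> \<epsilon>)"
      if e: "\<epsilon> > 0" for \<epsilon>
    proof -
      define \<delta> where "\<delta> = \<epsilon> / (L * \<bar>R\<bar> + 1)"
      have d1: "0 < L * \<bar>R\<bar> + 1" using L(1) by (simp add: add_nonneg_pos)
      have d: "0 < \<delta>" "(L * \<bar>R\<bar> + 1) * \<delta> = \<epsilon>" using e d1 by (simp_all add: \<delta>_def)
      show ?thesis
      proof (intro exI[of _ \<delta>] conjI ballI impI d(1))
        fix a b x :: "real^'n" assume ab: "dist a b < \<delta>"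
        have "\<bar>kern m (R *\<^sub>R (x - a)) - kern m (R *\<^sub>R (x - b))\<bar> \<le> L * norm (R *\<^sub>R (x - a) - R *\<^sub>R (x - b))" by (rule L(2))
        also have "R *\<^sub>R (x - a) - R *\<^sub>R (x - b) = R *\<^sub>R (b - a)" by (simp add: scaleR_diff_right)
        also have "L * norm (R *\<^sub>R (b - a)) = (L * \<bar>R\<bar>) * dist a b" by (simp add: dist_norm norm_minus_commute)
        also have "\<dots> \<le> (L * \<bar>R\<bar> + 1) * \<delta>" using ab L(1) by (intro mult_mono) auto
        finally show "\<bar>kern m (R *\<^sub>R (x - a)) - kern m (R *\<^sub>R (x - b))\<bar> \<le> \<epsilon>" using d(2) by simp
      qed
    qed
    show "(\<lambda>a. h a * kern m (R *\<^sub>R (x - a))) \<in> borel_measurable borel" for x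
      using h by (intro borel_measurable_times measurable_compose[OF _ rapid_measurable[OF kern_rapid[OF m]]]) auto
  qed (use hull T in auto)
qed

text \<open>The slack \<open>e\<close> is present because the L^p norm of a functional is an infimum
  over representing functions, here only approached. In Nikolskii's bound the powers of the integral
  combine to \<open>1 / p\<close>, which is again the L^p quasi-norm.\<close>

lemma besov_density:
  fixes f :: "(real^'n \<Rightarrow> real) \<Rightarrow> real" and \<phi>0 :: "real^'n \<Rightarrow> real"
  assumes LP: "LP_generator \<phi>0" and p: "0 < p" "p \<le> 1" and b: "0 < b" "\<And>x. \<bar>kern \<phi>0 x\<bar> \<le> b"
    and f: "f \<in> tempered_distributions" and fin: "dist_Lp_norm (ennreal p) (LP_block \<phi>0 j f) = ennreal a"
    and e: "0 < e" and a: "0 \<le> a"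
  shows "\<exists>h. integrable lborel h \<and>
    (LINT x|lborel. \<bar>h x\<bar>) \<le> ((2 ^ Suc j) ^ CARD('n) * b) powr ((1 - p) / p) * (a + e) \<and>
    (\<forall>\<phi>. test_fun \<phi> \<longrightarrow> f (conv (kern (LP_function \<phi>0 j)) \<phi>) = (LINT x|lborel. h x * \<phi> x)) \<and>
    (AE x in lborel. h x = (LINT y|lborel. h y * kern (dil \<phi>0 (Suc j)) (x - y)))"
proof -
  have "dist_Lp_norm (ennreal p) (LP_block \<phi>0 j f) < ennreal (a + e)"
    unfolding fin using e a by (intro ennreal_lessI) auto
  then obtain g where rep: "represented_by (LP_block \<phi>0 j f) g" and gl: "Lp_norm (ennreal p) g < ennreal (a + e)"
    unfolding dist_Lp_norm_def by (auto simp: INF_less_iff)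
  have gm: "g \<in> borel_measurable borel" using rep by (simp add: represented_by_def)
  note gi = Lp_norm_less[OF p(1) gm gl]
  define S where "S = (LINT x|lborel. norm (g x) powr p)"
  have S0: "0 \<le> S" by (simp add: S_def)
  let ?B = "(2 ^ Suc j) ^ CARD('n) * b"
  have B0: "0 < ?B" using b by simp
  obtain h where h: "integrable lborel h" "(LINT x|lborel. \<bar>h x\<bar>) \<le> (?B * S) powr ((1 - p) / p) * S"
    "\<forall>\<phi>. test_fun \<phi> \<longrightarrow> f (conv (kern (LP_function \<phi>0 j)) \<phi>) = (LINT x|lborel. h x * \<phi> x)"
    "AE x in lborel. h x = (LINT y|lborel. h y * kern (dil \<phi>0 (Suc j)) (x - y))"
    using LP_block_density[OF LP f p rep gi(1) b(2)] unfolding S_def by blast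
  have "(?B * S) powr ((1 - p) / p) * S = ?B powr ((1 - p) / p) * S powr (1 / p)"
  proof (cases "S = 0")
    case False
    then have Sp: "0 < S" using S0 by simp
    have "S powr ((1 - p) / p) * S = S powr ((1 - p) / p) * S powr 1" using Sp by simp
    also have "\<dots> = S powr ((1 - p) / p + 1)" by (rule powr_add[symmetric])
    also have "(1 - p) / p + 1 = 1 / p" using p by (simp add: field_simps)
    finally have "S powr ((1 - p) / p) * S = S powr (1 / p)" .
    then show ?thesis using B0 Sp by (simp add: powr_mult mult.assoc)
  qed simp
  also have "\<dots> \<le> ?B powr ((1 - p) / p) * (a + e)"
    using gi(2) unfolding S_def by (intro mult_left_mono) auto
  finally show ?thesis using h by (intro exI[of _ h]) auto
qed

text \<open>A density \<open>h j\<close> is determined only almost everywhere. The function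
  \<open>g\<close> is therefore assembled from the convolutions \<open>F j\<close>, which are
  defined at every point and carry the pointwise ridge bounds, while pairings may be computed with
  either.\<close>

lemma besov_hull_representation:
  fixes \<Omega> :: "(real^'n) set" and \<phi>0 :: "real^'n \<Rightarrow> real"
  assumes LP: "LP_generator \<phi>0" and p: "0 < p" "p \<le> 1" and k: "1 \<le> k" and c: "c' < c" "0 < c"
    and \<Omega>: "\<And>x \<omega>. x \<in> \<Omega> \<Longrightarrow> norm \<omega> = 1 \<Longrightarrow> \<bar>\<omega> \<bullet> x\<bar> \<le> c'" and \<Omega>b: "bounded \<Omega>"
    and sq: "(real k + real CARD('n) / p < s \<and> 0 < q) \<or> (s = real k + real CARD('n) / p \<and> 0 < q \<and> q \<le> 1)"
  shows "\<exists>C>0. \<forall>f\<in>besov_space \<phi>0 s (ennreal p) q. \<forall>\<epsilon>>0. \<exists>g. g \<in> borel_measurable borel \<and>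
    approx_hull \<Omega> (dictionary k c) (C * (enn2real (besov_norm \<phi>0 s (ennreal p) q f) + \<epsilon>)) g \<and>
    (\<forall>\<phi>. test_fun \<phi> \<longrightarrow> f \<phi> = (LINT x|lborel. g x * \<phi> x))"
proof -
  let ?n = "CARD('n)"
  define \<sigma> where "\<sigma> = real k + real ?n / p"
  note t = LP_test_fun[OF LP]
  have tz: "\<phi>0 \<xi> = 0" if "2 < norm \<xi>" for \<xi> by (rule LP_zero[OF LP that])
  obtain C1 where C1: "0 \<le> C1" "\<And>f::(real^'n \<Rightarrow> real) \<Rightarrow> real. besov_norm \<phi>0 s (ennreal p) q f < \<infinity> \<Longrightarrow>
    summable (\<lambda>j. 2 powr (real j * \<sigma>) * enn2real (dist_Lp_norm (ennreal p) (LP_block \<phi>0 j f))) \<and>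
    (\<Sum>j. 2 powr (real j * \<sigma>) * enn2real (dist_Lp_norm (ennreal p) (LP_block \<phi>0 j f))) \<le> C1 * enn2real (besov_norm \<phi>0 s (ennreal p) q f)"
    using besov_weighted_blocks[of \<sigma> s q \<phi>0 "ennreal p"] sq unfolding \<sigma>_def by blast
  obtain C2 where C2: "0 \<le> C2" "\<And>R y. 1 \<le> R \<Longrightarrow> approx_hull \<Omega> (dictionary k c) (C2 * R ^ k) (\<lambda>x. kern \<phi>0 (R *\<^sub>R (x - y)))"
    using kern_ridge_hull[OF k c \<Omega> \<Omega>b t tz] by blast
  obtain b0 where b0: "\<And>x. (1 + norm x) ^ 0 * \<bar>kern \<phi>0 x\<bar> \<le> b0" "0 \<le> b0" using rapid_bound[OF kern_rapid[OF t], of 0] by blast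
  define b where "b = b0 + 1"
  have b: "0 < b" "\<bar>kern \<phi>0 x\<bar> \<le> b" for x using b0(1)[of x] b0(2) by (simp_all add: b_def)
  define E where "E = (1 - p) / p"
  have E0: "0 \<le> E" using p by (simp add: E_def)
  \<comment> \<open>Cost of block \<open>j\<close> per unit of its L^p norm: dilation factor of the
    kernel, ridge cost, Nikolskii loss. The exponents add up to \<sigma>, as d + k + d (1 - p) / p =
    k + d / p.\<close>
  define P where "P j = (2 ^ Suc j) ^ ?n * (2 ^ Suc j) ^ k * ((2 ^ Suc j) ^ ?n * b) powr E" for j :: nat
  define C3 where "C3 = 2 powr \<sigma> * b powr E"
  have P: "P j = C3 * 2 powr (real j * \<sigma>)" for j
  proof -
    have pw: "((2::real) ^ Suc j) ^ i = 2 powr (real (Suc j) * real i)" for i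
    proof -
      have "2 powr (real (Suc j) * real i) = 2 powr real (Suc j * i)" by (simp only: of_nat_mult)
      also have "\<dots> = 2 ^ (Suc j * i)" by (rule powr_realpow) simp
      also have "\<dots> = (2 ^ Suc j) ^ i" by (rule power_mult)
      finally show ?thesis by (rule sym)
    qed
    have "P j = 2 powr (real (Suc j) * real ?n) * 2 powr (real (Suc j) * real k) * (2 powr (real (Suc j) * real ?n) * b) powr E"
      unfolding P_def pw ..
    also have "(2 powr (real (Suc j) * real ?n) * b) powr E = 2 powr (real (Suc j) * real ?n * E) * b powr E"
      using b(1) by (simp add: powr_mult powr_powr)
    also have "2 powr (real (Suc j) * real ?n) * 2 powr (real (Suc j) * real k) * (2 powr (real (Suc j) * real ?n * E) * b powr E)
      = 2 powr (real (Suc j) * real ?n + real (Suc j) * real k + real (Suc j) * real ?n * E) * b powr E"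
      by (simp only: powr_add mult.assoc)
    also have "real (Suc j) * real ?n + real (Suc j) * real k + real (Suc j) * real ?n * E = \<sigma> + real j * \<sigma>"
    proof -
      have "1 + E = 1 / p" using p by (simp add: E_def field_simps)
      then have "real ?n + real k + real ?n * E = \<sigma>"
        unfolding \<sigma>_def by (metis (no_types, opaque_lifting) add.assoc add.commute distrib_left mult.right_neutral times_divide_eq_right)
      moreover have "real (Suc j) * real ?n + real (Suc j) * real k + real (Suc j) * real ?n * E = (1 + real j) * (real ?n + real k + real ?n * E)"
        by (simp add: algebra_simps)
      ultimately show ?thesis by (simp add: algebra_simps)
    qed
    finally show ?thesis by (simp add: C3_def powr_add mult_ac)
  qed
  have C3: "0 < C3" using b(1) by (simp add: C3_def)
  \<comment> \<open>\<open>C2 + 1\<close> ensures positivity; \<open>C1 + 2\<close> also absorbs the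
    error term \<open>2 * \<epsilon>\<close>.\<close>
  define C where "C = (C2 + 1) * C3 * (C1 + 2)"
  have Cpos: "0 < C" using C1(1) C2(1) C3 by (simp add: C_def)
  have main: "\<exists>g. g \<in> borel_measurable borel \<and>
      approx_hull \<Omega> (dictionary k c) (C * (enn2real (besov_norm \<phi>0 s (ennreal p) q f) + \<epsilon>)) g \<and>
      (\<forall>\<phi>. test_fun \<phi> \<longrightarrow> f \<phi> = (LINT x|lborel. g x * \<phi> x))"
    if fB: "f \<in> besov_space \<phi>0 s (ennreal p) q" and eps: "0 < \<epsilon>" for f \<epsilon>
  proof -
    let ?N = "enn2real (besov_norm \<phi>0 s (ennreal p) q f)"
    have f: "f \<in> tempered_distributions" and fin: "besov_norm \<phi>0 s (ennreal p) q f < \<infinity>"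
      using fB by (auto simp: besov_space_def)
    define a where "a j = enn2real (dist_Lp_norm (ennreal p) (LP_block \<phi>0 j f))" for j
    have a0: "0 \<le> a j" for j by (simp add: a_def)
    have q0: "0 < q" using sq by auto
    have da: "dist_Lp_norm (ennreal p) (LP_block \<phi>0 j f) = ennreal (a j)" for j
      unfolding a_def by (rule besov_norm_blocks(1)[OF fin q0])
    have sa: "summable (\<lambda>j. 2 powr (real j * \<sigma>) * a j)" "(\<Sum>j. 2 powr (real j * \<sigma>) * a j) \<le> C1 * ?N"
      using C1(2)[OF fin] by (simp_all add: a_def)
    \<comment> \<open>Chosen so that the slacks, weighted with
      \<open>2 powr (real j * \<sigma>)\<close>, form a geometric series with sum
      \<open>2 * \<epsilon>\<close>.\<close>
    define e where "e j = \<epsilon> * (1 / 2) ^ j / 2 powr (real j * \<sigma>)" for j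
    have e0: "0 < e j" for j using eps by (simp add: e_def)
    have "\<forall>j. \<exists>h. integrable lborel h \<and>
      (LINT x|lborel. \<bar>h x\<bar>) \<le> ((2 ^ Suc j) ^ ?n * b) powr E * (a j + e j) \<and>
      (\<forall>\<phi>. test_fun \<phi> \<longrightarrow> f (conv (kern (LP_function \<phi>0 j)) \<phi>) = (LINT x|lborel. h x * \<phi> x)) \<and>
      (AE x in lborel. h x = (LINT y|lborel. h y * kern (dil \<phi>0 (Suc j)) (x - y)))"
      unfolding E_def using besov_density[OF LP p b f da e0 a0] by blast
    from choice[OF this] obtain h where h: "\<forall>j. integrable lborel (h j) \<and>
      (LINT x|lborel. \<bar>h j x\<bar>) \<le> ((2 ^ Suc j) ^ ?n * b) powr E * (a j + e j) \<and>
      (\<forall>\<phi>. test_fun \<phi> \<longrightarrow> f (conv (kern (LP_function \<phi>0 j)) \<phi>) = (LINT x|lborel. h j x * \<phi> x)) \<and>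
      (AE x in lborel. h j x = (LINT y|lborel. h j y * kern (dil \<phi>0 (Suc j)) (x - y)))" by (elim exE)
    have hi: "integrable lborel (h j)" and hb: "(LINT x|lborel. \<bar>h j x\<bar>) \<le> ((2 ^ Suc j) ^ ?n * b) powr E * (a j + e j)"
      and hf: "test_fun \<phi> \<Longrightarrow> f (conv (kern (LP_function \<phi>0 j)) \<phi>) = (LINT x|lborel. h j x * \<phi> x)"
      and hF: "AE x in lborel. h j x = (LINT y|lborel. h j y * kern (dil \<phi>0 (Suc j)) (x - y))" for j \<phi>
      using h by auto
    define H where "H j = (LINT x|lborel. \<bar>h j x\<bar>)" for j
    have H0: "0 \<le> H j" for j by (simp add: H_def)
    define F where "F j x = (LINT y|lborel. h j y * kern (dil \<phi>0 (Suc j)) (x - y))" for j x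
    define \<tau> where "\<tau> j = C3 * (2 powr (real j * \<sigma>) * a j + \<epsilon> * (1 / 2) ^ j)" for j
    have Ht: "(2 ^ Suc j) ^ ?n * (2 ^ Suc j) ^ k * H j \<le> \<tau> j" for j
    proof -
      have "(2 ^ Suc j) ^ ?n * (2 ^ Suc j) ^ k * H j \<le> (2 ^ Suc j) ^ ?n * (2 ^ Suc j) ^ k * (((2 ^ Suc j) ^ ?n * b) powr E * (a j + e j))"
        unfolding H_def by (intro mult_left_mono hb) auto
      also have "\<dots> = P j * (a j + e j)" by (simp only: P_def mult.assoc)
      also have "\<dots> = C3 * (2 powr (real j * \<sigma>) * a j + 2 powr (real j * \<sigma>) * e j)"
        unfolding P by (simp only: mult.assoc distrib_left)
      also have "2 powr (real j * \<sigma>) * e j = \<epsilon> * (1 / 2) ^ j" by (simp add: e_def)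
      finally show ?thesis by (simp only: \<tau>_def)
    qed
    have sg: "summable (\<lambda>j. \<epsilon> * (1 / 2) ^ j)" by (intro summable_mult summable_geometric) simp
    have s\<tau>: "summable \<tau>" unfolding \<tau>_def by (intro summable_mult summable_add sa sg)
    have \<tau>0: "0 \<le> \<tau> j" for j using C3 a0 eps by (simp add: \<tau>_def)
    have sum\<tau>: "(\<Sum>j. \<tau> j) \<le> C3 * (C1 * ?N + 2 * \<epsilon>)"
    proof -
      have "(\<Sum>j. \<tau> j) = C3 * ((\<Sum>j. 2 powr (real j * \<sigma>) * a j) + (\<Sum>j. \<epsilon> * (1 / 2) ^ j))"
        unfolding \<tau>_def suminf_mult[OF summable_add[OF sa(1) sg]] suminf_add[OF sa(1) sg] ..
      also have "(\<Sum>j. \<epsilon> * (1 / 2) ^ j) = \<epsilon> * 2"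
        by (subst suminf_mult) (auto simp: suminf_geometric summable_geometric)
      finally show ?thesis using sa(2) C3 by (simp add: mult_left_mono)
    qed
    have Fe: "F j x = (2 ^ Suc j) ^ ?n * (LINT y|lborel. h j y * kern \<phi>0 (2 ^ Suc j *\<^sub>R (x - y)))" for j x
    proof -
      have "F j x = (LINT y|lborel. (2 ^ Suc j) ^ ?n * (h j y * kern \<phi>0 (2 ^ Suc j *\<^sub>R (x - y))))"
        unfolding F_def kern_dil[OF t] by (simp only: mult.left_commute)
      then show ?thesis by (simp only: integral_mult_right_zero)
    qed
    have hullF: "approx_hull \<Omega> (dictionary k c) (C2 * \<tau> j) (F j)" for j
    proof -
      have "approx_hull \<Omega> (dictionary k c) (C2 * (2 ^ Suc j) ^ k * H j) (\<lambda>x. LINT y|lborel. h j y * kern \<phi>0 (2 ^ Suc j *\<^sub>R (x - y)))"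
        unfolding H_def using C2(1) one_le_power[of "2::real" "Suc j"] by (intro kern_conv_hull[OF t _ _ hi] C2(2)) auto
      from approx_hull_scale[OF this, of "(2 ^ Suc j) ^ ?n"]
      have "approx_hull \<Omega> (dictionary k c) (\<bar>(2 ^ Suc j) ^ ?n\<bar> * (C2 * (2 ^ Suc j) ^ k * H j)) (F j)"
        unfolding Fe .
      moreover have "\<bar>(2 ^ Suc j) ^ ?n\<bar> * (C2 * (2 ^ Suc j) ^ k * H j) = C2 * ((2 ^ Suc j) ^ ?n * (2 ^ Suc j) ^ k * H j)"
        by (simp add: mult_ac)
      ultimately show ?thesis using mult_left_mono[OF Ht[of j] C2(1)] approx_hull_mono by metis
    qed
    \<comment> \<open>This bound holds on the whole space, not only on \<Omega>: the series for
      \<open>g\<close> converges uniformly, and \<open>g\<close> can be paired with every test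
      function.\<close>
    have Fb: "\<bar>F j x\<bar> \<le> b * \<tau> j" for j x
    proof -
      have hk: "integrable lborel (\<lambda>y. h j y * b)" by (intro integrable_mult_left hi)
      have "\<bar>LINT y|lborel. h j y * kern \<phi>0 (2 ^ Suc j *\<^sub>R (x - y))\<bar> \<le> (LINT y|lborel. \<bar>h j y\<bar> * b)"
      proof (rule order_trans[OF integral_abs_bound], rule integral_mono')
        show "integrable lborel (\<lambda>y. \<bar>h j y\<bar> * b)" by (intro integrable_mult_left integrable_abs hi)
        show "\<bar>h j y * kern \<phi>0 (2 ^ Suc j *\<^sub>R (x - y))\<bar> \<le> \<bar>h j y\<bar> * b" for y
          unfolding abs_mult by (intro mult_left_mono b) auto
      qed (use b(1) in simp)
      also have "\<dots> = b * H j" by (simp add: H_def)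
      finally have "\<bar>F j x\<bar> \<le> (2 ^ Suc j) ^ ?n * (b * H j)"
        unfolding Fe abs_mult by (intro mult_mono) (use b(1) H0 in auto)
      also have "\<dots> \<le> (2 ^ Suc j) ^ ?n * (2 ^ Suc j) ^ k * (b * H j)"
      proof -
        have "1 \<le> ((2::real) ^ Suc j) ^ k" by (intro one_le_power) simp
        then have "(2 ^ Suc j) ^ ?n * (b * H j) * 1 \<le> (2 ^ Suc j) ^ ?n * (b * H j) * (2 ^ Suc j) ^ k"
          using b(1) H0[of j] by (intro mult_left_mono) auto
        then show ?thesis by (simp only: mult_1_right mult_ac)
      qed
      also have "\<dots> = b * ((2 ^ Suc j) ^ ?n * (2 ^ Suc j) ^ k * H j)" by (simp only: mult_ac)
      also have "\<dots> \<le> b * \<tau> j" using b(1) by (intro mult_left_mono Ht) auto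
      finally show ?thesis .
    qed
    have sb: "summable (\<lambda>j. b * \<tau> j)" by (rule summable_mult[OF s\<tau>])
    have sF: "summable (\<lambda>j. \<bar>F j x\<bar>)" for x
      by (rule summable_comparison_test'[OF sb, of 0]) (use Fb in auto)
    have Fm: "F j \<in> borel_measurable borel" for j
      unfolding F_def using hi[of j] by (intro conv_measurable rapid_measurable[OF kern_rapid] dil_test_fun t) auto
    define g where "g x = (\<Sum>j. F j x)" for x
    have gm: "g \<in> borel_measurable borel" unfolding g_def using Fm by measurable
    have hullg: "approx_hull \<Omega> (dictionary k c) (C2 * (\<Sum>j. \<tau> j)) g"
    proof (rule approx_hull_limit)
      fix \<delta> :: real assume d: "\<delta> > 0"
      obtain M where M: "\<And>n. M \<le> n \<Longrightarrow> norm (\<Sum>i. b * \<tau> (i + n)) < \<delta>"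
        using suminf_exist_split[OF d sb] by blast
      show "\<exists>g'. approx_hull \<Omega> (dictionary k c) (C2 * (\<Sum>j. \<tau> j)) g' \<and> (\<forall>x\<in>\<Omega>. \<bar>g x - g' x\<bar> \<le> \<delta>)"
      proof (intro exI[of _ "\<lambda>x. \<Sum>j<M. F j x"] conjI ballI)
        have "approx_hull \<Omega> (dictionary k c) (\<Sum>j<M. C2 * \<tau> j) (\<lambda>x. \<Sum>j<M. F j x)"
          by (intro approx_hull_sum hullF) auto
        moreover have "(\<Sum>j<M. C2 * \<tau> j) \<le> C2 * (\<Sum>j. \<tau> j)"
          unfolding sum_distrib_left[symmetric] using C2(1) \<tau>0 by (intro mult_left_mono sum_le_suminf[OF s\<tau>]) auto
        ultimately show "approx_hull \<Omega> (dictionary k c) (C2 * (\<Sum>j. \<tau> j)) (\<lambda>x. \<Sum>j<M. F j x)" by (rule approx_hull_mono)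
        fix x assume "x \<in> \<Omega>"
        have "g x - (\<Sum>j<M. F j x) = (\<Sum>j. F (j + M) x)"
          unfolding g_def using suminf_minus_initial_segment[OF summable_rabs_cancel[OF sF[of x]], of M] by simp
        also have "\<bar>\<dots>\<bar> \<le> (\<Sum>j. \<bar>F (j + M) x\<bar>)"
          by (rule summable_rabs) (rule summable_ignore_initial_segment[OF sF])
        also have "\<dots> \<le> (\<Sum>j. b * \<tau> (j + M))"
          by (intro suminf_le Fb summable_ignore_initial_segment[OF sF] summable_ignore_initial_segment[OF sb])
        also have "\<dots> \<le> \<delta>" using M[OF order_refl] by simp
        finally show "\<bar>g x - (\<Sum>j<M. F j x)\<bar> \<le> \<delta>" .
      qed
    qed
    have "C2 * (\<Sum>j. \<tau> j) \<le> C * (?N + \<epsilon>)"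
    proof -
      have N0: "0 \<le> ?N" by simp
      have "C2 * (\<Sum>j. \<tau> j) \<le> (C2 + 1) * (C3 * (C1 * ?N + 2 * \<epsilon>))"
        using sum\<tau> C2(1) suminf_nonneg[OF s\<tau> \<tau>0] by (intro mult_mono) auto
      also have "\<dots> \<le> (C2 + 1) * (C3 * ((C1 + 2) * (?N + \<epsilon>)))"
      proof -
        have "C1 * ?N + 2 * \<epsilon> \<le> (C1 + 2) * (?N + \<epsilon>)"
          using N0 eps C1(1) by (simp add: algebra_simps)
        then show ?thesis using C2(1) C3 by (intro mult_left_mono) auto
      qed
      finally show ?thesis by (simp only: C_def mult.assoc)
    qed
    then have hull: "approx_hull \<Omega> (dictionary k c) (C * (?N + \<epsilon>)) g" using hullg approx_hull_mono by blast
    \<comment> \<open>Both sides are sums of the same series: the Littlewood--Paley series of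
      \<open>f\<close> tested on \<phi>, and the termwise integral of the series defining
      \<open>g\<close>.\<close>
    have pair: "f \<phi> = (LINT x|lborel. g x * \<phi> x)" if ph: "test_fun \<phi>" for \<phi>
    proof -
      obtain B where B: "\<And>x. \<bar>\<phi> x\<bar> \<le> B" "0 \<le> B" using test_fun_bounded[OF ph] by blast
      have pm: "\<phi> \<in> borel_measurable borel" by (rule test_fun_measurable[OF ph])
      have hp: "integrable lborel (\<lambda>x. h j x * \<phi> x)" for j
      proof (rule Bochner_Integration.integrable_bound[OF integrable_mult_left[OF hi, of j B]])
        show "AE x in lborel. norm (h j x * \<phi> x) \<le> norm (h j x * B)"
          using B by (intro AE_I2) (simp add: abs_mult mult_left_mono)
      qed (use hi[of j] pm in auto)
      have ae: "AE x in lborel. h j x * \<phi> x = F j x * \<phi> x" for j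
        using hF[of j] by (rule eventually_mono) (simp add: F_def)
      have Fp: "integrable lborel (\<lambda>x. F j x * \<phi> x)" for j
        by (rule integrable_cong_AE_imp[OF hp]) (use Fm pm ae[of j] in \<open>auto intro: eventually_mono\<close>)
      have Fi: "(LINT x|lborel. F j x * \<phi> x) = (LINT x|lborel. h j x * \<phi> x)" for j
        using ae[of j] Fm[of j] pm hi[of j] by (intro integral_cong_AE) (auto intro: eventually_mono)
      have Fn: "(LINT x|lborel. norm (F j x * \<phi> x)) \<le> B * \<tau> j" for j
      proof -
        have "(LINT x|lborel. norm (F j x * \<phi> x)) = (LINT x|lborel. norm (h j x * \<phi> x))"
          using ae[of j] Fm[of j] pm hi[of j] by (intro integral_cong_AE) (auto intro: eventually_mono)
        also have "\<dots> \<le> (LINT x|lborel. \<bar>h j x\<bar> * B)"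
          using B by (intro integral_mono integrable_norm hp integrable_mult_left integrable_abs hi)
            (simp add: abs_mult mult_left_mono)
        also have "\<dots> = B * H j" by (simp add: H_def)
        also have "\<dots> \<le> B * \<tau> j"
        proof (rule mult_left_mono[OF _ B(2)])
          have "1 * 1 \<le> ((2::real) ^ Suc j) ^ ?n * (2 ^ Suc j) ^ k" by (intro mult_mono one_le_power) auto
          then have "1 * H j \<le> ((2::real) ^ Suc j) ^ ?n * (2 ^ Suc j) ^ k * H j" by (intro mult_right_mono H0) simp
          then show "H j \<le> \<tau> j" using Ht[of j] by simp
        qed
        finally show ?thesis .
      qed
      have A: "(\<lambda>j. LINT x|lborel. F j x * \<phi> x) sums (LINT x|lborel. (\<Sum>j. F j x * \<phi> x))"
      proof (rule sums_integral[OF Fp])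
        show "AE x in lborel. summable (\<lambda>j. norm (F j x * \<phi> x))"
          using summable_mult2[OF sF] by (intro AE_I2) (simp add: abs_mult)
        show "summable (\<lambda>j. LINT x|lborel. norm (F j x * \<phi> x))"
          by (rule summable_comparison_test'[OF summable_mult[OF s\<tau>, of B], of 0]) (use Fn in auto)
      qed
      have B': "(\<Sum>j. F j x * \<phi> x) = g x * \<phi> x" for x
        unfolding g_def by (rule suminf_mult2[OF summable_rabs_cancel[OF sF], symmetric])
      have C': "(\<lambda>j. LINT x|lborel. F j x * \<phi> x) sums f \<phi>"
        using tempered_LP_sums[OF LP f ph] unfolding hf[OF ph] Fi .
      show ?thesis by (rule sums_unique2[OF C' A[unfolded B']])
    qed
    show ?thesis using gm hull pair by blast
  qed
  show ?thesis using Cpos main by blast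
qed

section \<open>Restriction to the domain\<close>

lemma test_functions_subset: "\<phi> \<in> test_functions \<Omega> \<Longrightarrow> test_fun \<phi>"
  by (simp add: test_functions_def)

lemma test_functions_zero_outside:
  assumes "\<phi> \<in> test_functions \<Omega>" "x \<notin> \<Omega>" shows "\<phi> x = 0"
proof (rule ccontr)
  assume "\<phi> x \<noteq> 0"
  then have "x \<in> fun_support \<phi>" unfolding fun_support_def by (intro closure_subset[THEN subsetD]) auto
  then show False using assms by (auto simp: test_functions_def)
qed

text \<open>The strict inequalities leave a gap between \<open>c'\<close> and \<open>c\<close>; it
  provides room for the breakpoints of the polynomial part of a profile.\<close>

lemma ridge_domain_bound:
  fixes \<Omega> :: "(real^'n) set"
  assumes \<Omega>b: "bounded \<Omega>"
    and cI: "- c < Inf {\<omega> \<bullet> x | x \<omega>. x \<in> \<Omega> \<and> norm \<omega> = 1}"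
    and cS: "Sup {\<omega> \<bullet> x | x \<omega>. x \<in> \<Omega> \<and> norm \<omega> = 1} < c"
  obtains c' where "c' < c" "\<And>x \<omega>. x \<in> \<Omega> \<Longrightarrow> norm \<omega> = 1 \<Longrightarrow> \<bar>\<omega> \<bullet> x\<bar> \<le> c'"
proof -
  let ?A = "{\<omega> \<bullet> x | x \<omega>. x \<in> \<Omega> \<and> norm \<omega> = 1}"
  obtain R where R: "\<And>x. x \<in> \<Omega> \<Longrightarrow> norm x \<le> R" using \<Omega>b unfolding bounded_iff by blast
  have AR: "\<bar>y\<bar> \<le> R" if y: "y \<in> ?A" for y
  proof -
    obtain x \<omega> where "y = \<omega> \<bullet> x" "x \<in> \<Omega>" "norm \<omega> = 1" using y by blast
    then show ?thesis using Cauchy_Schwarz_ineq2[of \<omega> x] R[of x] by simp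
  qed
  have ba: "bdd_above ?A" by (rule bdd_aboveI[of _ R]) (use AR in \<open>auto simp: abs_le_iff\<close>)
  have bb: "bdd_below ?A" by (rule bdd_belowI[of _ "- R"]) (use AR in \<open>force simp: abs_le_iff\<close>)
  show ?thesis
  proof (rule that[of "max (Sup ?A) (- Inf ?A)"])
    show "max (Sup ?A) (- Inf ?A) < c" using cI cS by simp
    fix x \<omega> :: "real^'n" assume "x \<in> \<Omega>" "norm \<omega> = 1"
    then have m: "\<omega> \<bullet> x \<in> ?A" by blast
    have "\<omega> \<bullet> x \<le> Sup ?A" by (rule cSup_upper[OF m ba])
    moreover have "Inf ?A \<le> \<omega> \<bullet> x" by (rule cInf_lower[OF m bb])
    ultimately show "\<bar>\<omega> \<bullet> x\<bar> \<le> max (Sup ?A) (- Inf ?A)" by linarith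
  qed
qed

theorem theorem1p1:
  fixes \<Omega> :: "(real^'n) set" and \<phi>0 :: "real^'n \<Rightarrow> real"
    and k :: nat and c s p :: real and q :: ennreal
  assumes k: "k \<ge> 1"
    and domain: "bounded_lipschitz_domain \<Omega>"
    and c_pos: "c > 0"
    and c_Inf: "- c < Inf {\<omega> \<bullet> x | x \<omega>. x \<in> \<Omega> \<and> norm \<omega> = 1}"
    and Inf_Sup: "Inf {\<omega> \<bullet> x | x \<omega>. x \<in> \<Omega> \<and> norm \<omega> = 1} < Sup {\<omega> \<bullet> x | x \<omega>. x \<in> \<Omega> \<and> norm \<omega> = 1}"
    and c_Sup: "Sup {\<omega> \<bullet> x | x \<omega>. x \<in> \<Omega> \<and> norm \<omega> = 1} < c"
    and LP: "LP_generator \<phi>0"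
    and p: "0 < p" "p \<le> 1"
    and sq: "(s > real k + real CARD('n) / p \<and> 0 < q) \<or>
             (s = real k + real CARD('n) / p \<and> 0 < q \<and> q \<le> 1)"
  shows "\<exists>C::real. C > 0 \<and>
    (\<forall>f\<in>besov_space_on \<phi>0 s (ennreal p) q \<Omega>.
       \<exists>g\<in>variation_space \<Omega> (dictionary k c).
         f = regular_distribution \<Omega> g \<and>
         variation_norm \<Omega> (dictionary k c) g \<le> ennreal C * besov_norm_on \<phi>0 s (ennreal p) q \<Omega> f)"
proof -
  have \<Omega>o: "open \<Omega>" and \<Omega>b: "bounded \<Omega>" using domain by (auto simp: bounded_lipschitz_domain_def)
  obtain c' where c': "c' < c" "\<And>x \<omega>. x \<in> \<Omega> \<Longrightarrow> norm \<omega> = 1 \<Longrightarrow> \<bar>\<omega> \<bullet> x\<bar> \<le> c'"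
    using ridge_domain_bound[OF \<Omega>b c_Inf c_Sup] by blast
  have sq': "(real k + real CARD('n) / p < s \<and> 0 < q) \<or> (s = real k + real CARD('n) / p \<and> 0 < q \<and> q \<le> 1)"
    using sq by simp
  let ?D = "dictionary k c :: (real^'n \<Rightarrow> real) set"
  obtain C where C: "0 < C" and rep: "\<And>f \<epsilon>. f \<in> besov_space \<phi>0 s (ennreal p) q \<Longrightarrow> 0 < \<epsilon> \<Longrightarrow> \<exists>g. g \<in> borel_measurable borel \<and>
    approx_hull \<Omega> ?D (C * (enn2real (besov_norm \<phi>0 s (ennreal p) q f) + \<epsilon>)) g \<and>
    (\<forall>\<phi>. test_fun \<phi> \<longrightarrow> f \<phi> = (LINT x|lborel. g x * \<phi> x))"
    using besov_hull_representation[OF LP p k c'(1) c_pos c'(2) \<Omega>b sq'] by blast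
  have "\<exists>g\<in>variation_space \<Omega> ?D. f = regular_distribution \<Omega> g \<and>
      variation_norm \<Omega> ?D g \<le> ennreal (2 * C) * besov_norm_on \<phi>0 s (ennreal p) q \<Omega> f"
    if fB: "f \<in> besov_space_on \<phi>0 s (ennreal p) q \<Omega>" for f
  proof -
    let ?E = "{fe \<in> besov_space \<phi>0 s (ennreal p) q. restrict_distribution \<Omega> fe = f}"
    define B where "B = enn2real (besov_norm_on \<phi>0 s (ennreal p) q \<Omega> f)"
    have B0: "0 \<le> B" by (simp add: B_def)
    obtain f0 where f0: "f0 \<in> ?E" using fB by (auto simp: besov_space_on_def)
    have "besov_norm_on \<phi>0 s (ennreal p) q \<Omega> f \<le> besov_norm \<phi>0 s (ennreal p) q f0"
      unfolding besov_norm_on_def by (rule INF_lower[OF f0])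
    also have "\<dots> < \<infinity>" using f0 by (simp add: besov_space_def)
    finally have BN: "besov_norm_on \<phi>0 s (ennreal p) q \<Omega> f = ennreal B" by (simp add: B_def)
    \<comment> \<open>Half of \<epsilon> pays for choosing a nearly optimal extension, half for the
      slack in the representation.\<close>
    have approx: "\<exists>g. g \<in> borel_measurable borel \<and> approx_hull \<Omega> ?D (C * (B + \<epsilon>)) g \<and> f = regular_distribution \<Omega> g"
      if e: "0 < \<epsilon>" for \<epsilon>
    proof -
      have "besov_norm_on \<phi>0 s (ennreal p) q \<Omega> f < ennreal (B + \<epsilon> / 2)"
        unfolding BN using e B0 by (intro ennreal_lessI) auto
      then obtain fe where fe: "fe \<in> ?E" "besov_norm \<phi>0 s (ennreal p) q fe < ennreal (B + \<epsilon> / 2)"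
        unfolding besov_norm_on_def by (auto simp: INF_less_iff)
      have "enn2real (besov_norm \<phi>0 s (ennreal p) q fe) \<le> enn2real (ennreal (B + \<epsilon> / 2))"
        using fe(2) by (intro enn2real_mono less_imp_le) auto
      also have "\<dots> = B + \<epsilon> / 2" using B0 e by (intro enn2real_ennreal) simp
      finally have N: "enn2real (besov_norm \<phi>0 s (ennreal p) q fe) \<le> B + \<epsilon> / 2" .
      have "0 < \<epsilon> / 2" using e by simp
      with rep fe(1) obtain g where g: "g \<in> borel_measurable borel"
        "approx_hull \<Omega> ?D (C * (enn2real (besov_norm \<phi>0 s (ennreal p) q fe) + \<epsilon> / 2)) g"
        "\<And>\<phi>. test_fun \<phi> \<Longrightarrow> fe \<phi> = (LINT x|lborel. g x * \<phi> x)" by blast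
      have "C * (enn2real (besov_norm \<phi>0 s (ennreal p) q fe) + \<epsilon> / 2) \<le> C * (B + \<epsilon>)"
        using N C by (intro mult_left_mono) auto
      with g(2) have hull: "approx_hull \<Omega> ?D (C * (B + \<epsilon>)) g" by (rule approx_hull_mono)
      have "f = regular_distribution \<Omega> g"
      proof
        fix \<phi>
        have fr: "f = restrict_distribution \<Omega> fe" using fe(1) by simp
        show "f \<phi> = regular_distribution \<Omega> g \<phi>"
        proof (cases "\<phi> \<in> test_functions \<Omega>")
          case True
          have "indicator \<Omega> x *\<^sub>R (g x * \<phi> x) = g x * \<phi> x" for x
            using test_functions_zero_outside[OF True, of x] by (auto simp: indicator_def)
          then have "(LINT x:\<Omega>|lborel. g x * \<phi> x) = (LINT x|lborel. g x * \<phi> x)"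
            by (simp only: set_lebesgue_integral_def)
          then show ?thesis using True g(3)[OF test_functions_subset[OF True]]
            by (simp add: fr restrict_distribution_def regular_distribution_def)
        qed (simp add: fr restrict_distribution_def regular_distribution_def)
      qed
      then show ?thesis using g(1) hull by blast
    qed
    have ind_m: "(\<lambda>x. indicator \<Omega> x * g x) \<in> borel_measurable borel" if "g \<in> borel_measurable borel" for g :: "real^'n \<Rightarrow> real"
      using that \<Omega>o by simp
    show ?thesis
    proof (cases "B = 0")
      case False
      then have Bp: "0 < B" using B0 by simp
      \<comment> \<open>With slack equal to the norm itself the constant merely doubles.\<close>
      from approx[OF Bp] obtain g where g: "g \<in> borel_measurable borel" "approx_hull \<Omega> ?D (C * (B + B)) g" "f = regular_distribution \<Omega> g"
        by blast
      have t: "0 < C * (B + B)" using C Bp by simp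
      have "variation_norm \<Omega> ?D g \<le> ennreal (C * (B + B))" "g \<in> variation_space \<Omega> ?D"
        using approx_hull_variation[OF \<Omega>o \<Omega>b less_imp_le[OF c_pos] t ind_m[OF g(1)] g(2)] by auto
      moreover have "ennreal (C * (B + B)) = ennreal (2 * C) * ennreal B"
        using C B0 by (simp add: ennreal_mult[symmetric] mult_ac)
      ultimately show ?thesis using g(3) BN by (intro bexI[of _ g]) auto
    next
      \<comment> \<open>No slack can be absorbed when the norm is 0. Instead the representatives for
        every \<epsilon> are uniformly of size \<epsilon> on \<Omega>, so \<open>f\<close> vanishes
        on each test function and the zero function represents it.\<close>
      case True
      let ?z = "\<lambda>x::real^'n. 0::real"
      obtain R where R: "\<And>x. x \<in> \<Omega> \<Longrightarrow> norm x \<le> R" "0 < R" using \<Omega>b by (meson bounded_pos)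
      define M where "M = (R + c) ^ k"
      have M0: "0 \<le> M" using R c_pos by (simp add: M_def)
      have DM: "\<bar>v x\<bar> \<le> M" if "v \<in> ?D" "x \<in> \<Omega>" for v x
        unfolding M_def by (rule dictionary_bound[OF that(1) R(1)[OF that(2)]]) (use R c_pos in auto)
      have "f = regular_distribution \<Omega> ?z"
      proof
        fix \<phi>
        show "f \<phi> = regular_distribution \<Omega> ?z \<phi>"
        proof (cases "\<phi> \<in> test_functions \<Omega>")
          case True2: True
          define Q where "Q = (LINT x|lborel. \<bar>\<phi> x\<bar>)"
          have pi: "integrable lborel \<phi>" by (rule test_fun_integrable[OF test_functions_subset[OF True2]])
          have le: "\<bar>f \<phi>\<bar> \<le> \<epsilon> * (C * M * Q)" if e: "0 < \<epsilon>" for \<epsilon>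
          proof -
            from approx[OF e] obtain g where g: "approx_hull \<Omega> ?D (C * (B + \<epsilon>)) g" "f = regular_distribution \<Omega> g" by blast
            have gb: "\<bar>g x\<bar> \<le> C * \<epsilon> * M" if "x \<in> \<Omega>" for x
            proof -
              have "\<bar>g x\<bar> \<le> C * (B + \<epsilon>) * M" by (rule approx_hull_bound[OF g(1) _ that M0]) (rule DM)
              then show ?thesis using True by simp
            qed
            have "\<bar>f \<phi>\<bar> = \<bar>LINT x|lborel. indicator \<Omega> x * (g x * \<phi> x)\<bar>"
              using True2 by (simp add: g(2) regular_distribution_def set_lebesgue_integral_def)
            also have "\<dots> \<le> (LINT x|lborel. \<bar>indicator \<Omega> x * (g x * \<phi> x)\<bar>)" by (rule integral_abs_bound)
            also have "\<dots> \<le> (LINT x|lborel. (C * \<epsilon> * M) * \<bar>\<phi> x\<bar>)"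
            proof (rule integral_mono')
              show "integrable lborel (\<lambda>x. (C * \<epsilon> * M) * \<bar>\<phi> x\<bar>)" by (intro integrable_mult_right integrable_abs pi)
              show "\<bar>indicator \<Omega> x * (g x * \<phi> x)\<bar> \<le> (C * \<epsilon> * M) * \<bar>\<phi> x\<bar>" for x
                using gb[of x] C e M0 by (cases "x \<in> \<Omega>") (auto simp: abs_mult intro!: mult_right_mono)
              show "0 \<le> (C * \<epsilon> * M) * \<bar>\<phi> x\<bar>" for x using C e M0 by simp
            qed
            also have "\<dots> = (C * \<epsilon> * M) * Q" unfolding Q_def by (rule integral_mult_right_zero)
            finally show ?thesis by (simp only: mult_ac)
          qed
          have "\<bar>f \<phi>\<bar> \<le> 0 + e" if e: "0 < e" for e
          proof -
            \<comment> \<open>The summand 1 makes the divisor positive even when the bound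
              \<open>C * M * Q\<close> is 0.\<close>
            define K where "K = C * M * Q + 1"
            have "0 \<le> C * M * Q" using C M0 by (simp add: Q_def)
            then have K: "0 < K" "C * M * Q \<le> K" by (simp_all add: K_def)
            have "\<bar>f \<phi>\<bar> \<le> e / K * (C * M * Q)" using e K by (intro le) simp
            also have "\<dots> \<le> e / K * K" using e K by (intro mult_left_mono) auto
            finally show ?thesis using K by simp
          qed
          then have "\<bar>f \<phi>\<bar> \<le> 0" by (rule field_le_epsilon)
          then show ?thesis using True2 by (simp add: regular_distribution_def set_lebesgue_integral_def)
        next
          case False
          obtain g where "f = regular_distribution \<Omega> g" using approx[of 1] by auto
          then show ?thesis using False by (simp add: regular_distribution_def)
        qed
      qed
      moreover have vz: "?z \<in> variation_space \<Omega> ?D" "variation_norm \<Omega> ?D ?z \<le> ennreal t" if t: "0 < t" for t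
      proof -
        have "approx_hull \<Omega> ?D t ?z" by (rule approx_hull_mono[OF approx_hull_zero]) (use t in simp)
        then show "?z \<in> variation_space \<Omega> ?D" "variation_norm \<Omega> ?D ?z \<le> ennreal t"
          using approx_hull_variation[OF \<Omega>o \<Omega>b less_imp_le[OF c_pos] t ind_m[of ?z]] by auto
      qed
      moreover have "variation_norm \<Omega> ?D ?z \<le> 0"
        by (rule ennreal_le_epsilon) (use vz(2) in auto)
      ultimately show ?thesis by (intro bexI[of _ ?z]) (auto intro: vz(1)[OF zero_less_one] order_trans)
    qed
  qed
  then show ?thesis using C by (intro exI[of _ "2 * C"]) auto
qed

end
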